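(* Let $\mathcal{O}_F$ be the ring of integers of a (non-archimedean) local field $F$ with maximal ideal $\mathfrak{m}$, residue characteristic $\mathrm{char}\,\mathcal{O}_F/\mathfrak{m}>3$ and surjective discrete valuation $v\colon F^\times\to\mathbb{Z}$, and let $d\in\mathcal{O}_F$ be non-zero. (a) If $v(d)=0$, then $H^1_{\mathrm{int}}(F,C_d)=H^1_{\mathrm{un}}(F,C_d)$. (b) If $v(d)$ is odd, then $H^1_{\mathrm{int}}(F,C_d)=H^1(F,C_d)=0$. (c) If $v(d)=2$, then the only non-integral classes in $H^1(F,C_d)$ are the non-trivial unramified classes. (d) If $v(d)>2$, then all classes in $H^1(F,C_d)$ are integral.
   Context: $V(R)$ is the space of binary cubic forms $f(x,y)$ with coefficients in $R$; $\mathrm{SL}_2$ acts by linear change of variables, $(\gamma\cdot f)(x,y)=f(ax+cy,bx+dy)$ for $\gamma=\begin{pmatrix}a&b\\c&d\end{pmatrix}$, preserving the usual polynomial discriminant $\mathrm{Disc}$. For $0\ne d\in F$, $V(F)_d=\{f\in V(F):\mathrm{Disc}(f)=d\}$. There is a unique $\mathrm{SL}_2(F)$-orbit of reducible forms in $V(F)_d$; the stabilizer in $\mathrm{SL}_2$ of such a form $f_0$ is a commutative $F$-group scheme $C_d$ of order $3$, on whose $\overline F$-points $G_F=\mathrm{Gal}(\overline F/F)$ acts through the quadratic character $\chi_d\colon\mathrm{Gal}(F(\sqrt d)/F)\to\{\pm1\}$. The set of $\mathrm{SL}_2(F)$-orbits on $V(F)_d$ is in bijection with $H^1(F,C_d)$: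 the orbit of $f=g\cdot f_0$ with $g\in\mathrm{SL}_2(\overline F)$ ($\overline F$ a separable closure) corresponds to the class of $\sigma\mapsto g^{-1}\sigma(g)$. A class in $H^1(F,C_d)$ is integral if the corresponding $\mathrm{SL}_2(F)$-orbit contains an element of $V(\mathcal{O}_F)$ (a form with coefficients in $\mathcal{O}_F$, of discriminant $d$); $H^1_{\mathrm{int}}(F,C_d)$ is the set of integral classes. $H^1_{\mathrm{un}}(F,C_d)$ is the subgroup of unramified classes, i.e. those with trivial restriction to the inertia subgroup of $G_F$. *)

theory Defs
  imports
    "HOL-Analysis.Analysis"
    "HOL-Computational_Algebra.Computational_Algebra"
    "HOL-Algebra.QuotRing"
begin

section \<open>Non-archimedean local fields\<close>

text \<open>
  The value of a valuation at \<open>0\<close> is irrelevant; \<open>val_ge v n x\<close> reads \<open>v(x) \<ge> n\<close> with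
  the convention \<open>v(0) = \<infinity>\<close>.
\<close>

definition val_ge :: "('f::field \<Rightarrow> int) \<Rightarrow> int \<Rightarrow> 'f \<Rightarrow> bool"
  where "val_ge v n x \<longleftrightarrow> x = 0 \<or> n \<le> v x"

definition valuation_ring :: "('f::field \<Rightarrow> int) \<Rightarrow> 'f ring"
  where "valuation_ring v =
    \<lparr>carrier = {x. val_ge v 0 x}, mult = (*), one = 1, zero = 0, add = (+)\<rparr>"

definition max_ideal :: "('f::field \<Rightarrow> int) \<Rightarrow> 'f set"
  where "max_ideal v = {x. val_ge v 1 x}"

definition residue_field :: "('f::field \<Rightarrow> int) \<Rightarrow> 'f set ring"
  where "residue_field v = valuation_ring v Quot max_ideal v"

text \<open>Same definition as the library's \<^const>\<open>semiring_char\<close>, for a ring given as a record.\<close>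

definition residue_char :: "('f::field \<Rightarrow> int) \<Rightarrow> nat"
  where "residue_char v =
    Gcd {n::nat. [n] \<cdot>\<^bsub>residue_field v\<^esub> \<one>\<^bsub>residue_field v\<^esub> = \<zero>\<^bsub>residue_field v\<^esub>}"

locale local_field =
  fixes v :: "'f::field \<Rightarrow> int"
  assumes val_mult: "x \<noteq> 0 \<Longrightarrow> y \<noteq> 0 \<Longrightarrow> v (x * y) = v x + v y"
    and val_add: "x \<noteq> 0 \<Longrightarrow> y \<noteq> 0 \<Longrightarrow> x + y \<noteq> 0 \<Longrightarrow> min (v x) (v y) \<le> v (x + y)"
    and val_surj: "\<exists>x. x \<noteq> 0 \<and> v x = n"
    and complete: "(\<forall>N. \<exists>M. \<forall>m\<ge>M. \<forall>n\<ge>M. val_ge v N (s m - s n)) \<Longrightarrow>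
      \<exists>l. \<forall>N. \<exists>M. \<forall>n\<ge>M. val_ge v N (s (n::nat) - l)"
    and finite_residue_field: "finite (carrier (residue_field v))"


section \<open>Separable closure and absolute Galois group\<close>

text \<open>
  An embedding \<open>\<iota>\<close> of \<open>'f\<close> into \<open>'s\<close> that makes \<open>'s\<close> a separable closure of \<open>'f\<close>:
  every element of \<open>'s\<close> is separable algebraic over \<open>'f\<close>, and \<open>'s\<close> is separably closed.
  A polynomial is separable if it is coprime to its derivative.
\<close>

locale separable_closure =
  fixes \<iota> :: "'f::field \<Rightarrow> 's::field"
  assumes emb_one: "\<iota> 1 = 1"
    and emb_add: "\<iota> (x + y) = \<iota> x + \<iota> y"
    and emb_mult: "\<iota> (x * y) = \<iota> x * \<iota> y"
    and separable: "\<exists>p. p \<noteq> 0 \<and> coprime p (pderiv p) \<and> poly (map_poly \<iota> p) z = 0"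
    and separably_closed: "0 < degree (q :: 's poly) \<Longrightarrow>
      coprime q (pderiv q) \<Longrightarrow> \<exists>z. poly q z = 0"

definition galois_group :: "('f::field \<Rightarrow> 's::field) \<Rightarrow> ('s \<Rightarrow> 's) set"
  where "galois_group \<iota> = {\<sigma>. bij \<sigma> \<and> (\<forall>x y. \<sigma> (x + y) = \<sigma> x + \<sigma> y)
    \<and> (\<forall>x y. \<sigma> (x * y) = \<sigma> x * \<sigma> y) \<and> (\<forall>a. \<sigma> (\<iota> a) = \<iota> a)}"

text \<open>
  \<open>fixing_group \<iota> S\<close> is the Galois group over the subextension generated by \<open>S\<close>; for finite
  \<open>S\<close> these subextensions are exactly the finite ones.
\<close>

definition fixing_group :: "('f::field \<Rightarrow> 's::field) \<Rightarrow> 's set \<Rightarrow> ('s \<Rightarrow> 's) set"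
  where "fixing_group \<iota> S = {\<sigma> \<in> galois_group \<iota>. \<forall>x\<in>S. \<sigma> x = x}"

definition krull_open :: "('f::field \<Rightarrow> 's::field) \<Rightarrow> ('s \<Rightarrow> 's) set \<Rightarrow> bool"
  where "krull_open \<iota> U \<longleftrightarrow> U \<subseteq> galois_group \<iota> \<and>
    (\<forall>\<sigma>\<in>U. \<exists>S. finite S \<and> (\<lambda>\<tau>. \<sigma> \<circ> \<tau>) ` fixing_group \<iota> S \<subseteq> U)"

definition krull_topology :: "('f::field \<Rightarrow> 's::field) \<Rightarrow> ('s \<Rightarrow> 's) topology"
  where "krull_topology \<iota> = topology (krull_open \<iota>)"

lemma istopology_krull_open: "istopology (krull_open \<iota>)"
  unfolding istopology_def
proof (intro conjI allI impI)
  fix U V assume U: "krull_open \<iota> U" and V: "krull_open \<iota> V"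
  show "krull_open \<iota> (U \<inter> V)"
    unfolding krull_open_def
  proof (intro conjI ballI)
    show "U \<inter> V \<subseteq> galois_group \<iota>" using U by (auto simp: krull_open_def)
    fix \<sigma> assume \<sigma>: "\<sigma> \<in> U \<inter> V"
    obtain S where S: "finite S" "(\<lambda>\<tau>. \<sigma> \<circ> \<tau>) ` fixing_group \<iota> S \<subseteq> U"
      using U \<sigma> by (auto simp: krull_open_def)
    obtain T where T: "finite T" "(\<lambda>\<tau>. \<sigma> \<circ> \<tau>) ` fixing_group \<iota> T \<subseteq> V"
      using V \<sigma> by (auto simp: krull_open_def)
    have "fixing_group \<iota> (S \<union> T) \<subseteq> fixing_group \<iota> S \<inter> fixing_group \<iota> T"
      by (auto simp: fixing_group_def)
    then show "\<exists>R. finite R \<and> (\<lambda>\<tau>. \<sigma> \<circ> \<tau>) ` fixing_group \<iota> R \<subseteq> U \<inter> V"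
      using S T by (intro exI[of _ "S \<union> T"]) blast
  qed
next
  fix \<K> assume K: "\<forall>U\<in>\<K>. krull_open \<iota> U"
  show "krull_open \<iota> (\<Union>\<K>)"
    unfolding krull_open_def
  proof (intro conjI ballI)
    show "\<Union>\<K> \<subseteq> galois_group \<iota>" using K by (auto simp: krull_open_def)
    fix \<sigma> assume "\<sigma> \<in> \<Union>\<K>"
    then obtain U where "U \<in> \<K>" "\<sigma> \<in> U" by blast
    then show "\<exists>S. finite S \<and> (\<lambda>\<tau>. \<sigma> \<circ> \<tau>) ` fixing_group \<iota> S \<subseteq> \<Union>\<K>"
      using K unfolding krull_open_def by (meson Union_upper subset_trans)
  qed
qed

lemma openin_krull_topology: "openin (krull_topology \<iota>) = krull_open \<iota>"
  by (simp add: krull_topology_def istopology_krull_open)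

lemma galois_group_comp:
  "\<sigma> \<in> galois_group \<iota> \<Longrightarrow> \<tau> \<in> galois_group \<iota> \<Longrightarrow> \<sigma> \<circ> \<tau> \<in> galois_group \<iota>"
  by (auto simp: galois_group_def bij_comp)

lemma topspace_krull_topology: "topspace (krull_topology \<iota>) = galois_group \<iota>"
proof -
  have "krull_open \<iota> (galois_group \<iota>)"
    by (auto simp: krull_open_def fixing_group_def galois_group_comp intro!: exI[of _ "{}"])
  then show ?thesis
    unfolding topspace_def openin_krull_topology by (auto simp: krull_open_def)
qed

text \<open>
  The inertia subgroup consists of the automorphisms acting trivially on the residue field of the
  separable closure, i.e. on the integral closure of the valuation ring modulo its non-units.
\<close>

definition integral_closure :: "('f::field \<Rightarrow> int) \<Rightarrow> ('f \<Rightarrow> 's::field) \<Rightarrow> 's set"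
  where "integral_closure v \<iota> = {z. \<exists>p. lead_coeff p = 1
    \<and> (\<forall>i. coeff p i \<in> carrier (valuation_ring v)) \<and> poly (map_poly \<iota> p) z = 0}"

definition integral_closure_max_ideal ::
    "('f::field \<Rightarrow> int) \<Rightarrow> ('f \<Rightarrow> 's::field) \<Rightarrow> 's set"
  where "integral_closure_max_ideal v \<iota> =
    {z \<in> integral_closure v \<iota>. z = 0 \<or> inverse z \<notin> integral_closure v \<iota>}"

definition inertia_group :: "('f::field \<Rightarrow> int) \<Rightarrow> ('f \<Rightarrow> 's::field) \<Rightarrow> ('s \<Rightarrow> 's) set"
  where "inertia_group v \<iota> = {\<sigma> \<in> galois_group \<iota>.
    \<forall>z \<in> integral_closure v \<iota>. \<sigma> z - z \<in> integral_closure_max_ideal v \<iota>}"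


section \<open>Continuous first cohomology\<close>

text \<open>
  Cohomology of a topological group \<open>T\<close> of transformations (with composition as group law) with
  coefficients in a discrete commutative group \<open>A\<close>, written multiplicatively, on which \<open>\<sigma>\<close> in
  the group acts by \<open>act \<sigma>\<close>.  Cochains are extensional functions, so that equality of cochains
  is equality on the group.
\<close>

definition Z1 :: "('s \<Rightarrow> 's) topology \<Rightarrow> 'a monoid \<Rightarrow> (('s \<Rightarrow> 's) \<Rightarrow> 'a \<Rightarrow> 'a)
    \<Rightarrow> (('s \<Rightarrow> 's) \<Rightarrow> 'a) monoid"
  where "Z1 T A act =
    \<lparr>carrier = {c \<in> topspace T \<rightarrow>\<^sub>E carrier A. continuous_map T (discrete_topology (carrier A)) c
        \<and> (\<forall>\<sigma>\<in>topspace T. \<forall>\<tau>\<in>topspace T. c (\<sigma> \<circ> \<tau>) = c \<sigma> \<otimes>\<^bsub>A\<^esub> act \<sigma> (c \<tau>))},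
     mult = (\<lambda>c c'. \<lambda>\<sigma>\<in>topspace T. c \<sigma> \<otimes>\<^bsub>A\<^esub> c' \<sigma>),
     one = (\<lambda>\<sigma>\<in>topspace T. \<one>\<^bsub>A\<^esub>)\<rparr>"

definition B1 :: "('s \<Rightarrow> 's) topology \<Rightarrow> 'a monoid \<Rightarrow> (('s \<Rightarrow> 's) \<Rightarrow> 'a \<Rightarrow> 'a)
    \<Rightarrow> (('s \<Rightarrow> 's) \<Rightarrow> 'a) set"
  where "B1 T A act = {\<lambda>\<sigma>\<in>topspace T. inv\<^bsub>A\<^esub> a \<otimes>\<^bsub>A\<^esub> act \<sigma> a | a. a \<in> carrier A}"

definition H1 :: "('s \<Rightarrow> 's) topology \<Rightarrow> 'a monoid \<Rightarrow> (('s \<Rightarrow> 's) \<Rightarrow> 'a \<Rightarrow> 'a)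
    \<Rightarrow> (('s \<Rightarrow> 's) \<Rightarrow> 'a) set monoid"
  where "H1 T A act = Z1 T A act Mod B1 T A act"

definition cohomology_class :: "('s \<Rightarrow> 's) topology \<Rightarrow> 'a monoid \<Rightarrow> (('s \<Rightarrow> 's) \<Rightarrow> 'a \<Rightarrow> 'a)
    \<Rightarrow> (('s \<Rightarrow> 's) \<Rightarrow> 'a) \<Rightarrow> (('s \<Rightarrow> 's) \<Rightarrow> 'a) set"
  where "cohomology_class T A act c = B1 T A act #>\<^bsub>Z1 T A act\<^esub> c"

text \<open>
  Restriction of classes to a subgroup \<open>I\<close>; the union is over classes that all coincide.
\<close>

definition res :: "('s \<Rightarrow> 's) topology \<Rightarrow> ('s \<Rightarrow> 's) set \<Rightarrow> 'a monoid
    \<Rightarrow> (('s \<Rightarrow> 's) \<Rightarrow> 'a \<Rightarrow> 'a) \<Rightarrow> (('s \<Rightarrow> 's) \<Rightarrow> 'a) set \<Rightarrow> (('s \<Rightarrow> 's) \<Rightarrow> 'a) set"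
  where "res T I A act X =
    (\<Union>c\<in>X. cohomology_class (subtopology T I) A act (restrict c I))"


section \<open>Binary cubic forms\<close>

text \<open>\<open>Cubic a b c e\<close> is the form \<open>a x\<^sup>3 + b x\<^sup>2 y + c x y\<^sup>2 + e y\<^sup>3\<close>.\<close>

datatype 'a cubic_form = Cubic 'a 'a 'a 'a

fun eval_form :: "'a::comm_ring_1 cubic_form \<Rightarrow> 'a \<Rightarrow> 'a \<Rightarrow> 'a"
  where "eval_form (Cubic a b c e) x y = a * x^3 + b * x^2 * y + c * x * y^2 + e * y^3"

fun disc :: "'a::comm_ring_1 cubic_form \<Rightarrow> 'a"
  where "disc (Cubic a b c e) =
    b^2 * c^2 - 4 * a * c^3 - 4 * b^3 * e - 27 * a^2 * e^2 + 18 * a * b * c * e"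

text \<open>
  The coefficients of \<open>f(p x + r y, q x + s y)\<close> for the matrix with rows \<open>(p, q)\<close> and
  \<open>(r, s)\<close>; see \<open>eval_act_form\<close> below.
\<close>

fun act_coeffs :: "'a::comm_ring_1 \<Rightarrow> 'a \<Rightarrow> 'a \<Rightarrow> 'a \<Rightarrow> 'a cubic_form \<Rightarrow> 'a cubic_form"
  where "act_coeffs p q r s (Cubic a b c e) = Cubic
    (a * p^3 + b * p^2 * q + c * p * q^2 + e * q^3)
    (3 * a * p^2 * r + b * (p^2 * s + 2 * p * q * r) + c * (2 * p * q * s + q^2 * r)
      + 3 * e * q^2 * s)
    (3 * a * p * r^2 + b * (2 * p * r * s + q * r^2) + c * (p * s^2 + 2 * q * r * s)
      + 3 * e * q * s^2)
    (a * r^3 + b * r^2 * s + c * r * s^2 + e * s^3)"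

definition act_form :: "'a::comm_ring_1^2^2 \<Rightarrow> 'a cubic_form \<Rightarrow> 'a cubic_form"
  where "act_form \<gamma> f = act_coeffs (\<gamma>$1$1) (\<gamma>$1$2) (\<gamma>$2$1) (\<gamma>$2$2) f"

lemma eval_act_form:
  "eval_form (act_form \<gamma> f) x y =
    eval_form f (\<gamma>$1$1 * x + \<gamma>$2$1 * y) (\<gamma>$1$2 * x + \<gamma>$2$2 * y)"
proof -
  have "eval_form (act_coeffs p q r s (Cubic a b c e)) x y =
      eval_form (Cubic a b c e) (p * x + r * y) (q * x + s * y)"
    for p q r s a b c e :: 'a
    by (simp add: algebra_simps power2_eq_square power3_eq_cube)
  then show ?thesis
    by (cases f) (simp only: act_form_def)
qed

lemma act_form_mult: "act_form (\<gamma> ** \<delta>) f = act_form \<gamma> (act_form \<delta> f)"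
proof -
  have "act_coeffs (p * p' + q * r') (p * q' + q * s') (r * p' + s * r') (r * q' + s * s')
      (Cubic a b c e) = act_coeffs p q r s (act_coeffs p' q' r' s' (Cubic a b c e))"
    for p q r s p' q' r' s' a b c e :: 'a
    by (simp add: algebra_simps power2_eq_square power3_eq_cube)
  then show ?thesis
    by (cases f) (simp only: act_form_def matrix_matrix_mult_def sum_2 vec_lambda_beta)
qed

definition SL2 :: "('a::field^2^2) set"
  where "SL2 = {\<gamma>. det \<gamma> = 1}"

definition forms_disc :: "'a::field \<Rightarrow> 'a cubic_form set"
  where "forms_disc d = {f. disc f = d}"

definition SL2_orbits :: "'a::field \<Rightarrow> 'a cubic_form set set"
  where "SL2_orbits d = {(\<lambda>\<gamma>. act_form \<gamma> f) ` SL2 | f. f \<in> forms_disc d}"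

text \<open>
  A non-zero cubic form is reducible if it is the product of a linear form
  \<open>l\<^sub>0 x + l\<^sub>1 y\<close> and a quadratic form \<open>q\<^sub>0 x\<^sup>2 + q\<^sub>1 x y + q\<^sub>2 y\<^sup>2\<close> over the base field.
\<close>

definition reducible_form :: "'a::field cubic_form \<Rightarrow> bool"
  where "reducible_form f \<longleftrightarrow> f \<noteq> Cubic 0 0 0 0 \<and> (\<exists>l0 l1 q0 q1 q2.
    f = Cubic (l0 * q0) (l0 * q1 + l1 * q0) (l0 * q2 + l1 * q1) (l1 * q2))"


section \<open>The stabilizer and its cohomology\<close>

text \<open>
  The points over the separable closure of the stabilizer of \<open>f0\<close>; the Galois group acts on it
  entrywise.
\<close>

definition stab :: "('f::field \<Rightarrow> 's::field) \<Rightarrow> 'f cubic_form \<Rightarrow> ('s^2^2) monoid"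
  where "stab \<iota> f0 =
    \<lparr>carrier = {\<gamma> \<in> SL2. act_form \<gamma> (map_cubic_form \<iota> f0) = map_cubic_form \<iota> f0},
     mult = (**), one = mat 1\<rparr>"

definition H1_stab :: "('f::field \<Rightarrow> 's::field) \<Rightarrow> 'f cubic_form
    \<Rightarrow> (('s \<Rightarrow> 's) \<Rightarrow> 's^2^2) set monoid"
  where "H1_stab \<iota> f0 = H1 (krull_topology \<iota>) (stab \<iota> f0) map_matrix"

text \<open>
  The orbit of \<open>f = g \<cdot> f0\<close>, with \<open>g\<close> over the separable closure, corresponds to the class of
  \<open>\<sigma> \<mapsto> g\<^sup>-\<^sup>1 \<sigma>(g)\<close>.
\<close>

definition orbit_corresponds :: "('f::field \<Rightarrow> 's::field) \<Rightarrow> 'f cubic_form \<Rightarrow> 'f cubic_form set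
    \<Rightarrow> (('s \<Rightarrow> 's) \<Rightarrow> 's^2^2) set \<Rightarrow> bool"
  where "orbit_corresponds \<iota> f0 \<Omega> X \<longleftrightarrow> (\<exists>f\<in>\<Omega>. \<exists>g\<in>SL2.
    map_cubic_form \<iota> f = act_form g (map_cubic_form \<iota> f0) \<and>
    X = cohomology_class (krull_topology \<iota>) (stab \<iota> f0) map_matrix
      (\<lambda>\<sigma>\<in>galois_group \<iota>. matrix_inv g ** map_matrix \<sigma> g))"

definition H1_int :: "('f::field \<Rightarrow> int) \<Rightarrow> ('f \<Rightarrow> 's::field) \<Rightarrow> 'f \<Rightarrow> 'f cubic_form
    \<Rightarrow> (('s \<Rightarrow> 's) \<Rightarrow> 's^2^2) set set"
  where "H1_int v \<iota> d f0 = {X \<in> carrier (H1_stab \<iota> f0). \<exists>\<Omega>\<in>SL2_orbits d.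
    orbit_corresponds \<iota> f0 \<Omega> X \<and> (\<exists>f\<in>\<Omega>. set_cubic_form f \<subseteq> carrier (valuation_ring v))}"

definition H1_un :: "('f::field \<Rightarrow> int) \<Rightarrow> ('f \<Rightarrow> 's::field) \<Rightarrow> 'f cubic_form
    \<Rightarrow> (('s \<Rightarrow> 's) \<Rightarrow> 's^2^2) set set"
  where "H1_un v \<iota> f0 = kernel (H1_stab \<iota> f0)
    (H1 (subtopology (krull_topology \<iota>) (inertia_group v \<iota>)) (stab \<iota> f0) map_matrix)
    (res (krull_topology \<iota>) (inertia_group v \<iota>) (stab \<iota> f0) map_matrix)"

end

theory Submission
  imports Defs "HOL-Number_Theory.Cong"
begin

text \<open>
  The theorem is proved by describing all classes through points of a norm one torus.  Put
  \<open>D = d / 4\<close>.  A reducible form of discriminant \<open>d\<close> is equivalent to the normal form \<open>y (x\<^sup>2 - D y\<^sup>2)\<close>, whose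
  Hessian is \<open>x\<^sup>2 + 3 D y\<^sup>2\<close>.  The special orthogonal group of the Hessian is the torus of the pairs \<open>(p, q)\<close>
  with \<open>p\<^sup>2 + 3 D q\<^sup>2 = 1\<close>, that is, of the elements \<open>p + q \<surd>(-3 D)\<close> of norm \<open>1\<close>, and the stabilizer of the normal
  form is the group of its elements of order dividing \<open>3\<close> (\<open>stabilizer_nform\<close>).  The element \<open>(p, q)\<close>
  carries the normal form to a form that depends only on the cube \<open>(P, Q)\<close> of \<open>(p, q)\<close>.  A cocycle of the
  stabilizer becomes trivial in the torus: by Hilbert's Theorem 90 it is trivialized by some \<open>w\<close> in the
  quadratic algebra, and then, being of order \<open>3\<close>, by the conjugate of \<open>w\<close> divided by \<open>w\<close>, which has norm
  one.  So every class belongs to a form \<open>tform D P Q\<close> with \<open>(P, Q)\<close> on the torus over the base field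
  (\<open>class_from_torus\<close>), and it is trivial if \<open>(P, Q)\<close> is a cube there.
  
  It remains to read off integrality and ramification from \<open>(P, Q)\<close>.  If \<open>P\<close> is not integral, Hensel's
  lemma shows that the torus splits, \<open>s\<^sup>2 = - 3 D\<close>, so that \<open>v d\<close> is even; the form is then equivalent to a diagonal form
  \<open>\<alpha> x\<^sup>3 + \<beta> y\<^sup>3\<close> with \<open>v \<alpha> + v \<beta> = v s\<close>, in which the valuations may be shifted by opposite multiples of \<open>3\<close>,
  and the class is unramified iff \<open>3\<close> divides \<open>v (P + Q s)\<close>.  If \<open>P\<close> is integral, the class is
  unramified for even \<open>v d\<close>, and trivial for odd \<open>v d\<close> because then \<open>P\<close> is congruent to \<open>1\<close> or \<open>- 1\<close> and Hensel's lemma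
  makes \<open>(P, Q)\<close> a cube.  Scaling the variables by powers of the uniformizer exhibits integral forms:
  for \<open>v d = 0\<close> when the class is unramified, for \<open>v d = 2\<close> when it is ramified, and always for \<open>v d > 2\<close>.
  
  Two obstructions to integral forms remain.  If \<open>v d = 0\<close>, a matrix carrying the normal form to an
  integral form has integral entries, so inertia moves it only modulo the maximal ideal; since no other
  element of the stabilizer is congruent to \<open>1\<close> when the residue characteristic is not \<open>3\<close>, inertia
  fixes it (\<open>fixed_if_cong\<close>).  If \<open>v d = 2\<close>, an integral form is either reducible by Hensel's lemma, or an
  Eisenstein form, whose roots have valuation \<open>1/3\<close> and are moved by inertia.
  
  The last step and its analogue for cube roots need that inertia fixes nothing of valuation
  strictly between \<open>0\<close> and \<open>1\<close> (\<open>inertia_moves\<close>).  The inertia group is defined through the integral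
  closure of the valuation ring, so the structure of the latter is developed first.  The key fact is
  that every integral element has a power congruent to \<open>0\<close> or \<open>1\<close> modulo the uniformizer
  (\<open>power_dichotomy\<close>), which follows from the pigeonhole principle in the finite residue field and from lifting
  idempotents in the complete ring generated by one integral element.  Hence the non-units form a
  prime ideal, and modulo that ideal every integral element is \<open>0\<close> or a root of unity of order prime to the
  residue characteristic; so automorphisms fixing these roots of unity lie in inertia, and a trace
  formula describes the integers they fix.
\<close>

section \<open>Elements integral over a subring of a field\<close>

definition ring_set :: "'a::comm_ring_1 set \<Rightarrow> bool"
  where "ring_set R \<longleftrightarrow> 1 \<in> R \<and> (\<forall>x\<in>R. \<forall>y\<in>R. x - y \<in> R \<and> x * y \<in> R)"

lemma ring_setI:
  assumes "1 \<in> R" "\<And>x y. x \<in> R \<Longrightarrow> y \<in> R \<Longrightarrow> x - y \<in> R" "\<And>x y. x \<in> R \<Longrightarrow> y \<in> R \<Longrightarrow> x * y \<in> R"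
  shows "ring_set R"
  using assms by (auto simp: ring_set_def)

context
  fixes R :: "'a::comm_ring_1 set"
  assumes R: "ring_set R"
begin

lemma rs_1: "1 \<in> R" and rs_diff: "x \<in> R \<Longrightarrow> y \<in> R \<Longrightarrow> x - y \<in> R"
  and rs_mult: "x \<in> R \<Longrightarrow> y \<in> R \<Longrightarrow> x * y \<in> R"
  using R by (auto simp: ring_set_def)

lemma rs_0: "0 \<in> R" using rs_diff[OF rs_1 rs_1] by simp

lemma rs_minus: "x \<in> R \<Longrightarrow> - x \<in> R" using rs_diff[OF rs_0] by force

lemma rs_add: "x \<in> R \<Longrightarrow> y \<in> R \<Longrightarrow> x + y \<in> R"
  using rs_diff[of x "- y"] rs_minus[of y] by simp

lemma rs_sum: "(\<And>i. i \<in> A \<Longrightarrow> f i \<in> R) \<Longrightarrow> sum f A \<in> R"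
  by (induction A rule: infinite_finite_induct) (auto simp: rs_0 rs_add)

lemma rs_prod: "(\<And>i. i \<in> A \<Longrightarrow> f i \<in> R) \<Longrightarrow> prod f A \<in> R"
  by (induction A rule: infinite_finite_induct) (auto simp: rs_1 rs_mult)

lemma rs_power: "x \<in> R \<Longrightarrow> x ^ n \<in> R"
  by (induction n) (auto simp: rs_1 rs_mult)

lemma rs_of_nat: "of_nat n \<in> R"
  by (induction n) (auto simp: rs_0 rs_1 rs_add)

lemma rs_numeral: "numeral n \<in> R"
  using rs_of_nat[of "numeral n"] by simp

end

definition polys_over :: "'a::comm_ring_1 set \<Rightarrow> 'a poly set"
  where "polys_over R = {p. \<forall>i. coeff p i \<in> R}"

lemma polys_overD: "p \<in> polys_over R \<Longrightarrow> coeff p i \<in> R"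
  by (simp add: polys_over_def)

lemma ring_set_polys_over:
  assumes "ring_set R" shows "ring_set (polys_over R)"
  unfolding ring_set_def polys_over_def
  by (auto simp: coeff_mult rs_diff[OF assms] rs_mult[OF assms] coeff_1 rs_0[OF assms] rs_1[OF assms]
      intro!: rs_sum[OF assms])

lemma polys_over_monom: "ring_set R \<Longrightarrow> c \<in> R \<Longrightarrow> monom c n \<in> polys_over R"
  by (simp add: polys_over_def rs_0)

lemma polys_over_const: "ring_set R \<Longrightarrow> c \<in> R \<Longrightarrow> [:c:] \<in> polys_over R"
  by (simp add: polys_over_def coeff_pCons rs_0 split: nat.split)

lemma poly_in: "ring_set R \<Longrightarrow> p \<in> polys_over R \<Longrightarrow> x \<in> R \<Longrightarrow> poly p x \<in> R"
  unfolding poly_altdef by (intro rs_sum rs_mult rs_power) (auto simp: polys_over_def)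

text \<open>
  The leading coefficient of the divisor is \<open>1\<close>, so no step of the division leaves the ring \<open>R\<close>.
\<close>

lemma monic_division:
  fixes R :: "'a::comm_ring_1 set"
  assumes R: "ring_set R" and m: "m \<in> polys_over R" "lead_coeff m = 1"
    and p: "p \<in> polys_over R"
  shows "\<exists>k\<in>polys_over R. \<exists>r\<in>polys_over R. p = m * k + r \<and> (\<forall>i\<ge>degree m. coeff r i = 0)"
  using p
proof (induction "degree p" arbitrary: p rule: less_induct)
  case less
  note RP = ring_set_polys_over[OF R]
  show ?case
  proof (cases "degree p < degree m")
    case True
    then show ?thesis using less.prems rs_0[OF RP]
      by (intro bexI[of _ 0] bexI[of _ p]) (auto simp: coeff_eq_0)
  next
    case False
    define t where "t = monom (lead_coeff p) (degree p - degree m)"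
    have t: "t \<in> polys_over R"
      unfolding t_def using less.prems by (intro polys_over_monom R) (auto simp: polys_over_def)
    define q where "q = p - m * t"
    have q: "q \<in> polys_over R"
      unfolding q_def using less.prems m t by (intro rs_diff[OF RP] rs_mult[OF RP])
    have cq: "coeff q i = 0" if "i \<ge> degree p" for i
    proof -
      have "coeff (m * t) i = (if i = degree p then lead_coeff p else 0)"
      proof (cases "i = degree p")
        case True
        then show ?thesis using False m unfolding t_def
          by (simp add: mult.commute[of m] coeff_monom_mult)
      next
        case False
        then have "degree m < i - (degree p - degree m)" using that \<open>\<not> degree p < degree m\<close> by simp
        then show ?thesis using False that unfolding t_def
          by (auto simp: mult.commute[of m] coeff_monom_mult coeff_eq_0)
      qed
      then show ?thesis using that by (auto simp: q_def coeff_eq_0)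
    qed
    show ?thesis
    proof (cases "degree p = 0")
      case True
      then have "q = 0" using cq by (intro poly_eqI) auto
      then show ?thesis using t rs_0[OF RP] by (intro bexI[of _ t] bexI[of _ 0]) (auto simp: q_def)
    next
      case False
      then have "degree q < degree p"
        using cq by (intro degree_lessI) auto
      from less.hyps[OF this q] obtain k r where k: "k \<in> polys_over R" "r \<in> polys_over R"
        "q = m * k + r" "\<forall>i\<ge>degree m. coeff r i = 0" by blast
      then have "p = m * (t + k) + r" by (simp add: q_def algebra_simps)
      then show ?thesis using k t rs_add[OF RP] by blast
    qed
  qed
qed

definition integral_over :: "'a::comm_ring_1 set \<Rightarrow> 'a \<Rightarrow> bool"
  where "integral_over R z \<longleftrightarrow> (\<exists>p\<in>polys_over R. lead_coeff p = 1 \<and> poly p z = 0)"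

text \<open>
  The determinant trick without determinants.  Multiplying every other equation by the diagonal
  entry of one of them and eliminating the corresponding unknown preserves the shape of the system:
  in each row the diagonal entry is monic and its degree exceeds those of the other entries.
\<close>

lemma eliminate_monic_system:
  fixes R :: "'a::idom set" and B :: "'i \<Rightarrow> 'i \<Rightarrow> 'a poly" and deg :: "'i \<Rightarrow> nat"
  assumes R: "ring_set R" and "finite I" "i0 \<notin> I"
    and "\<And>i j. i \<in> insert i0 I \<Longrightarrow> j \<in> insert i0 I \<Longrightarrow> B i j \<in> polys_over R"
    and "\<And>i. i \<in> insert i0 I \<Longrightarrow> coeff (B i i) (deg i) = 1 \<and> degree (B i i) = deg i"
    and "\<And>i j k. i \<in> insert i0 I \<Longrightarrow> j \<in> insert i0 I \<Longrightarrow> i \<noteq> j \<Longrightarrow> k \<ge> deg i \<Longrightarrow> coeff (B i j) k = 0"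
    and "\<And>i. i \<in> insert i0 I \<Longrightarrow> (\<Sum>j\<in>insert i0 I. poly (B i j) x * e j) = 0"
  shows "\<exists>p\<in>polys_over R. lead_coeff p = 1 \<and> poly p x * e i0 = 0"
  using assms(2-)
proof (induction I arbitrary: B deg rule: finite_induct)
  case empty
  show ?case
    using empty.prems(2)[of i0] empty.prems(3)[of i0] empty.prems(5)[of i0]
    by (intro bexI[of _ "B i0 i0"]) auto
next
  case (insert n I)
  note RP = ring_set_polys_over[OF R]
  let ?J = "insert i0 I"
  have nJ: "n \<notin> ?J" using insert by auto
  have JJ: "insert i0 (insert n I) = insert n ?J" by auto
  note B = insert.prems(2)[unfolded JJ] and diag = insert.prems(3)[unfolded JJ]
    and off = insert.prems(4)[unfolded JJ] and eqs = insert.prems(5)[unfolded JJ]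
  define C where "C i j = B n n * B i j - B i n * B n j" for i j
  define D where "D i = deg n + deg i" for i
  have small: "coeff (B i n * B n j) k = 0" if "i \<in> ?J" "j \<in> ?J" "k \<ge> D i" for i j k
  proof -
    have "coeff (B i n) l * coeff (B n j) (k - l) = 0" if "l \<le> k" for l
    proof (cases "l < deg i")
      case True
      then have "k - l \<ge> deg n" using \<open>k \<ge> D i\<close> by (simp add: D_def)
      then show ?thesis using off[of n j "k - l"] nJ \<open>j \<in> ?J\<close> by auto
    next
      case False
      then show ?thesis using off[of i n l] nJ \<open>i \<in> ?J\<close> by auto
    qed
    then show ?thesis unfolding coeff_mult by (intro sum.neutral) auto
  qed
  have deg_n: "degree (B n n) = deg n" "coeff (B n n) (deg n) = 1" using diag[of n] by auto
  show ?case
  proof (rule insert.IH[of C D])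
    show "i0 \<notin> I" using insert by auto
    show "C i j \<in> polys_over R" if "i \<in> ?J" "j \<in> ?J" for i j
      unfolding C_def using that B by (intro rs_diff[OF RP] rs_mult[OF RP]) auto
    show "coeff (C i i) (D i) = 1 \<and> degree (C i i) = D i" if i: "i \<in> ?J" for i
    proof -
      have di: "degree (B i i) = deg i" "coeff (B i i) (deg i) = 1" using diag[of i] i by auto
      have "coeff (B n n * B i i) (D i) = 1"
        using coeff_mult_degree_sum[of "B n n" "B i i"] deg_n di by (simp add: D_def)
      then have c: "coeff (C i i) (D i) = 1" using small[OF i i] by (simp add: C_def)
      have "coeff (C i i) k = 0" if "k > D i" for k
      proof -
        have "coeff (B n n * B i i) k = 0"
          using that degree_mult_le[of "B n n" "B i i"] deg_n di by (intro coeff_eq_0) (simp add: D_def)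
        then show ?thesis using small[OF i i, of k] that by (simp add: C_def)
      qed
      then have "degree (C i i) \<le> D i" by (intro degree_le) auto
      moreover have "D i \<le> degree (C i i)" using c by (intro le_degree) auto
      ultimately show ?thesis using c by simp
    qed
    show "coeff (C i j) k = 0" if i: "i \<in> ?J" and j: "j \<in> ?J" and "i \<noteq> j" "k \<ge> D i" for i j k
    proof -
      have "coeff (B n n) l * coeff (B i j) (k - l) = 0" if "l \<le> k" for l
      proof (cases "l \<le> deg n")
        case True
        then have "k - l \<ge> deg i" using \<open>k \<ge> D i\<close> by (simp add: D_def)
        then show ?thesis using off[of i j "k - l"] i j \<open>i \<noteq> j\<close> by auto
      next
        case False
        then show ?thesis using deg_n by (simp add: coeff_eq_0)
      qed
      then have "coeff (B n n * B i j) k = 0" unfolding coeff_mult by (intro sum.neutral) auto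
      then show ?thesis using small[OF i j \<open>k \<ge> D i\<close>] by (simp add: C_def)
    qed
    show "(\<Sum>j\<in>?J. poly (C i j) x * e j) = 0" if i: "i \<in> ?J" for i
    proof -
      have sI: "(\<Sum>j\<in>?J. poly (B k j) x * e j) = - poly (B k n) x * e n"
        if "k \<in> insert n ?J" for k
        using eqs[OF that] nJ insert.hyps(1) by (simp add: eq_neg_iff_add_eq_0 add.commute)
      have "(\<Sum>j\<in>?J. poly (C i j) x * e j)
          = poly (B n n) x * (\<Sum>j\<in>?J. poly (B i j) x * e j)
            - poly (B i n) x * (\<Sum>j\<in>?J. poly (B n j) x * e j)"
        unfolding C_def sum_distrib_left sum_subtractf[symmetric]
        by (intro sum.cong) (auto simp: algebra_simps)
      also have "\<dots> = 0"
        using sI[of i] sI[of n] i by (simp add: algebra_simps)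
      finally show ?thesis .
    qed
  qed
qed

text \<open>
  The relations \<open>x e\<^sub>i = \<Sum> a\<^sub>i\<^sub>j e\<^sub>j\<close> form a linear system with diagonal entries \<open>x - a\<^sub>i\<^sub>i\<close> and
  constants elsewhere; eliminating all unknowns but one leaves a monic polynomial in \<open>x\<close> which kills
  a nonzero element.
\<close>

lemma integral_if_stabilizes:
  fixes R :: "'a::idom set"
  assumes R: "ring_set R" and "finite I" "i0 \<in> I" "e i0 \<noteq> 0"
    and x: "\<And>i. i \<in> I \<Longrightarrow> \<exists>a. (\<forall>j\<in>I. a j \<in> R) \<and> x * e i = (\<Sum>j\<in>I. a j * e j)"
  shows "integral_over R x"
proof -
  note RP = ring_set_polys_over[OF R]
  obtain A where A: "\<And>i j. i \<in> I \<Longrightarrow> j \<in> I \<Longrightarrow> A i j \<in> R"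
    "\<And>i. i \<in> I \<Longrightarrow> x * e i = (\<Sum>j\<in>I. A i j * e j)"
    using x by metis
  define B where "B i j = (if i = j then [:0, 1:] else 0) - [:A i j:]" for i j
  have I: "insert i0 (I - {i0}) = I" using assms by auto
  have X: "[:0, 1:] \<in> polys_over R"
    using R by (auto simp: polys_over_def coeff_pCons rs_0 rs_1 split: nat.split)
  have "\<exists>p\<in>polys_over R. lead_coeff p = 1 \<and> poly p x * e i0 = 0"
  proof (rule eliminate_monic_system[where I = "I - {i0}" and ?i0.0 = i0 and B = B and deg = "\<lambda>_. 1", OF R, unfolded I])
    show "B i j \<in> polys_over R" if "i \<in> I" "j \<in> I" for i j
      unfolding B_def using that A X rs_0[OF RP] by (intro rs_diff[OF RP] polys_over_const[OF R]) simp_all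
    show "coeff (B i i) 1 = 1 \<and> degree (B i i) = 1" for i by (simp add: B_def)
    show "coeff (B i j) k = 0" if "i \<noteq> j" "1 \<le> k" for i j k
      using that by (simp add: B_def coeff_pCons split: nat.split)
    show "(\<Sum>j\<in>I. poly (B i j) x * e j) = 0" if i: "i \<in> I" for i
    proof -
      have "(\<Sum>j\<in>I. poly (B i j) x * e j)
          = (\<Sum>j\<in>I. (if i = j then x * e j else 0) - A i j * e j)"
        by (intro sum.cong) (auto simp: B_def algebra_simps)
      also have "\<dots> = x * e i - (\<Sum>j\<in>I. A i j * e j)"
        using i \<open>finite I\<close> by (simp add: sum_subtractf)
      finally show ?thesis using A(2)[OF i] by simp
    qed
  qed (use assms in auto)
  then show ?thesis using \<open>e i0 \<noteq> 0\<close> by (auto simp: integral_over_def)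
qed

lemma integral_power_reduction:
  assumes R: "ring_set R" and "integral_over R z"
  shows "\<exists>n>0. \<exists>a. (\<forall>i<n. a i \<in> R) \<and> z ^ n = (\<Sum>i<n. a i * z ^ i)"
proof -
  obtain p where p: "p \<in> polys_over R" "lead_coeff p = 1" "poly p z = 0"
    using assms by (auto simp: integral_over_def)
  have "degree p > 0"
  proof (rule ccontr)
    assume "\<not> ?thesis"
    then obtain c where "p = [:c:]" by (auto elim: degree_eq_zeroE)
    then show False using p by simp
  qed
  moreover have "z ^ degree p = (\<Sum>i<degree p. - coeff p i * z ^ i)"
  proof -
    have "0 = (\<Sum>i\<le>degree p. coeff p i * z ^ i)" using p by (simp add: poly_altdef)
    also have "\<dots> = (\<Sum>i<degree p. coeff p i * z ^ i) + z ^ degree p"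
      using p by (simp flip: lessThan_Suc_atMost)
    finally show ?thesis by (simp add: sum_negf eq_neg_iff_add_eq_0 add.commute)
  qed
  ultimately show ?thesis using p rs_minus[OF R]
    by (intro exI[of _ "degree p"] conjI exI[of _ "\<lambda>i. - coeff p i"]) (auto simp: polys_over_def)
qed

text \<open>
  Both \<open>z\<close> and \<open>w\<close> stabilize the module generated by the monomials \<open>z\<^sup>i w\<^sup>j\<close> below their
  degrees, hence so do \<open>z - w\<close> and \<open>z w\<close>.
\<close>

lemma ring_set_integral_over:
  fixes R :: "'a::idom set"
  assumes R: "ring_set R"
  shows "ring_set {z. integral_over R z}"
proof -
  have main: "integral_over R (z - w) \<and> integral_over R (z * w)"
    if z: "integral_over R z" and w: "integral_over R w" for z w
  proof -
    obtain m a where m: "m > 0" "\<And>i. i < m \<Longrightarrow> a i \<in> R" "z ^ m = (\<Sum>i<m. a i * z ^ i)"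
      using integral_power_reduction[OF R z] by blast
    obtain n b where n: "n > 0" "\<And>i. i < n \<Longrightarrow> b i \<in> R" "w ^ n = (\<Sum>i<n. b i * w ^ i)"
      using integral_power_reduction[OF R w] by blast
    define I where "I = {..<m} \<times> {..<n}"
    define e where "e k = z ^ fst k * w ^ snd k" for k
    have fin: "finite I" by (simp add: I_def)
    define M where "M = {y. \<exists>c. (\<forall>j\<in>I. c j \<in> R) \<and> y = (\<Sum>j\<in>I. c j * e j)}"
    have M_diff: "x - y \<in> M" if xy: "x \<in> M" "y \<in> M" for x y
    proof -
      obtain c c' where c: "\<forall>j\<in>I. c j \<in> R" "x = (\<Sum>j\<in>I. c j * e j)" 
        and c': "\<forall>j\<in>I. c' j \<in> R" "y = (\<Sum>j\<in>I. c' j * e j)" using xy by (auto simp: M_def)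
      show ?thesis unfolding M_def using c c' rs_diff[OF R]
        by (auto intro!: exI[of _ "\<lambda>j. c j - c' j"] simp: sum_subtractf left_diff_distrib)
    qed
    have M_0: "0 \<in> M" unfolding M_def using rs_0[OF R] by (auto intro!: exI[of _ "\<lambda>_. 0"])
    have M_add: "x + y \<in> M" if "x \<in> M" "y \<in> M" for x y
      using M_diff[OF that(1) M_diff[OF M_0 that(2)]] by simp
    have M_sum: "sum f A \<in> M" if "\<And>i. i \<in> A \<Longrightarrow> f i \<in> M" for f and A :: "'b set"
      using that by (induction A rule: infinite_finite_induct) (auto simp: M_0 M_add)
    have M_scale: "r * x \<in> M" if r: "r \<in> R" and x: "x \<in> M" for r x
    proof -
      obtain c where c: "\<forall>j\<in>I. c j \<in> R" "x = (\<Sum>j\<in>I. c j * e j)" using x by (auto simp: M_def)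
      show ?thesis unfolding M_def using c r rs_mult[OF R]
        by (auto intro!: exI[of _ "\<lambda>j. r * c j"] simp: sum_distrib_left mult.assoc)
    qed
    have M_e: "e j \<in> M" if "j \<in> I" for j
      unfolding M_def using that fin rs_0[OF R] rs_1[OF R]
      by (auto intro!: exI[of _ "\<lambda>k. if k = j then 1 else 0"] simp: if_distrib[of "\<lambda>t. t * _"] cong: if_cong)
    have M_mono: "z ^ i * w ^ j \<in> M" if "i < m" "j < n" for i j
      using M_e[of "(i, j)"] that by (simp add: I_def e_def)
    have ze: "z * e k \<in> M" if "k \<in> I" for k
    proof -
      obtain i j where k: "k = (i, j)" "i < m" "j < n" using \<open>k \<in> I\<close> by (auto simp: I_def)
      show ?thesis
      proof (cases "Suc i < m")
        case True
        then show ?thesis using M_mono[of "Suc i" j] k by (simp add: e_def mult.assoc)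
      next
        case False
        then have "Suc i = m" using k by simp
        then have "z * e k = z ^ m * w ^ j" using k by (simp add: e_def mult.assoc[symmetric] flip: power_Suc)
        also have "\<dots> = (\<Sum>i<m. a i * (z ^ i * w ^ j))" by (simp add: m(3) sum_distrib_right mult.assoc)
        also have "\<dots> \<in> M" using k m by (intro M_sum M_scale M_mono) auto
        finally show ?thesis .
      qed
    qed
    have we: "w * e k \<in> M" if "k \<in> I" for k
    proof -
      obtain i j where k: "k = (i, j)" "i < m" "j < n" using \<open>k \<in> I\<close> by (auto simp: I_def)
      show ?thesis
      proof (cases "Suc j < n")
        case True
        then show ?thesis using M_mono[of i "Suc j"] k by (simp add: e_def ac_simps)
      next
        case False
        then have "Suc j = n" using k by simp
        then have "w * e k = z ^ i * w ^ n" using k by (auto simp: e_def ac_simps)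
        also have "\<dots> = (\<Sum>j<n. b j * (z ^ i * w ^ j))" by (simp add: n(3) sum_distrib_left ac_simps)
        also have "\<dots> \<in> M" using k n by (intro M_sum M_scale M_mono) auto
        finally show ?thesis .
      qed
    qed
    have stab: "y * x \<in> M" if y: "\<And>k. k \<in> I \<Longrightarrow> y * e k \<in> M" and "x \<in> M" for x y
    proof -
      obtain c where c: "\<forall>j\<in>I. c j \<in> R" "x = (\<Sum>j\<in>I. c j * e j)" using \<open>x \<in> M\<close> by (auto simp: M_def)
      have "y * x = (\<Sum>j\<in>I. c j * (y * e j))" by (simp add: c sum_distrib_left ac_simps)
      also have "\<dots> \<in> M" by (rule M_sum, rule M_scale) (use c y in auto)
      finally show ?thesis .
    qed
    have int: "integral_over R y" if y: "\<And>k. k \<in> I \<Longrightarrow> y * e k \<in> M" for y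
    proof (rule integral_if_stabilizes[OF R fin, where e = e])
      show "(0, 0) \<in> I" using m n by (simp add: I_def)
      show "e (0, 0) \<noteq> 0" by (simp add: e_def)
      show "\<exists>a. (\<forall>j\<in>I. a j \<in> R) \<and> y * e i = (\<Sum>j\<in>I. a j * e j)" if "i \<in> I" for i
        using y[OF that] by (simp add: M_def)
    qed
    have "(z - w) * e k \<in> M" "(z * w) * e k \<in> M" if "k \<in> I" for k
      using M_diff[OF ze[OF that] we[OF that]] stab[OF ze we[OF that]] by (simp_all add: algebra_simps)
    then show ?thesis using int by blast
  qed
  have "integral_over R 1"
    unfolding integral_over_def using R
    by (intro bexI[of _ "[:-1, 1:]"]) (auto simp: polys_over_def coeff_pCons rs_0 rs_1 rs_minus split: nat.split)
  then show ?thesis using main by (auto simp: ring_set_def)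
qed

lemma integral_over_base: "ring_set R \<Longrightarrow> c \<in> R \<Longrightarrow> integral_over R c"
  unfolding integral_over_def
  by (intro bexI[of _ "[:-c, 1:]"]) (auto simp: polys_over_def coeff_pCons rs_0 rs_1 rs_minus split: nat.split)

lemma integral_over_root:
  fixes R :: "'a::idom set"
  assumes R: "ring_set R" and "n > 0" and z: "integral_over R (z ^ n)"
  shows "integral_over R z"
proof -
  obtain p where p: "p \<in> polys_over R" "lead_coeff p = 1" "poly p (z ^ n) = 0"
    using z by (auto simp: integral_over_def)
  note RP = ring_set_polys_over[OF R]
  have "pcompose p (monom 1 n) = (\<Sum>i\<le>degree p. [:coeff p i:] * monom 1 n ^ i)"
    unfolding pcompose_altdef by (simp add: poly_altdef degree_map_poly coeff_map_poly)
  also have "\<dots> \<in> polys_over R"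
    using p by (intro rs_sum[OF RP] rs_mult[OF RP] rs_power[OF RP] polys_over_const polys_over_monom R rs_1)
      (auto simp: polys_over_def)
  finally have "pcompose p (monom 1 n) \<in> polys_over R" .
  moreover have "lead_coeff (pcompose p (monom 1 n)) = 1"
    using \<open>n > 0\<close> p by (subst lead_coeff_comp) (auto simp: degree_monom_eq)
  moreover have "poly (pcompose p (monom 1 n)) z = 0" using p by (simp add: poly_pcompose poly_monom)
  ultimately show ?thesis by (auto simp: integral_over_def)
qed

section \<open>Extending automorphisms to the separable closure\<close>

definition hom_on :: "'a::idom set \<Rightarrow> ('a \<Rightarrow> 'b::idom) \<Rightarrow> bool"
  where "hom_on L h \<longleftrightarrow> ring_set L \<and> h 1 = 1
    \<and> (\<forall>x\<in>L. \<forall>y\<in>L. h (x - y) = h x - h y \<and> h (x * y) = h x * h y)"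

context
  fixes L :: "'a::idom set" and h :: "'a \<Rightarrow> 'b::idom"
  assumes h: "hom_on L h"
begin

lemma hom_ring_set: "ring_set L" and hom_1: "h 1 = 1"
  and hom_diff: "x \<in> L \<Longrightarrow> y \<in> L \<Longrightarrow> h (x - y) = h x - h y"
  and hom_mult: "x \<in> L \<Longrightarrow> y \<in> L \<Longrightarrow> h (x * y) = h x * h y"
  using h by (auto simp: hom_on_def)

lemma hom_0: "h 0 = 0"
  using hom_diff[of 1 1] rs_1[OF hom_ring_set] by simp

lemma hom_minus: "x \<in> L \<Longrightarrow> h (- x) = - h x"
  using hom_diff[of 0 x] rs_0[OF hom_ring_set] by (simp add: hom_0)

lemma hom_add: "x \<in> L \<Longrightarrow> y \<in> L \<Longrightarrow> h (x + y) = h x + h y"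
  using hom_diff[of x "- y"] hom_minus[of y] rs_minus[OF hom_ring_set, of y] by simp

lemma hom_sum: "(\<And>i. i \<in> A \<Longrightarrow> f i \<in> L) \<Longrightarrow> h (sum f A) = (\<Sum>i\<in>A. h (f i))"
  by (induction A rule: infinite_finite_induct) (auto simp: hom_0 hom_add rs_sum[OF hom_ring_set])

lemma hom_prod: "(\<And>i. i \<in> A \<Longrightarrow> f i \<in> L) \<Longrightarrow> h (prod f A) = (\<Prod>i\<in>A. h (f i))"
  by (induction A rule: infinite_finite_induct) (auto simp: hom_1 hom_mult rs_prod[OF hom_ring_set])

lemma hom_power: "x \<in> L \<Longrightarrow> h (x ^ n) = h x ^ n"
  by (induction n) (auto simp: hom_1 hom_mult rs_power[OF hom_ring_set])

lemma hom_of_nat: "h (of_nat n) = of_nat n"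
  by (induction n) (auto simp: hom_0 hom_1 hom_add rs_1[OF hom_ring_set] rs_of_nat[OF hom_ring_set])

lemma hom_numeral: "h (numeral n) = numeral n"
  using hom_of_nat[of "numeral n"] by simp

lemma coeff_hom: "coeff (map_poly h p) i = h (coeff p i)"
  by (simp add: coeff_map_poly hom_0)

lemma hom_degree_le: "degree (map_poly h p) \<le> degree p"
  by (rule degree_le) (simp add: coeff_hom coeff_eq_0 hom_0)

lemma hom_poly_1: "map_poly h 1 = 1"
  by (intro poly_eqI) (auto simp: coeff_hom coeff_1 hom_0 hom_1)

lemma hom_poly_diff: "p \<in> polys_over L \<Longrightarrow> q \<in> polys_over L \<Longrightarrow> map_poly h (p - q) = map_poly h p - map_poly h q"
  by (intro poly_eqI) (auto simp: coeff_hom polys_over_def hom_diff)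

lemma hom_poly_add: "p \<in> polys_over L \<Longrightarrow> q \<in> polys_over L \<Longrightarrow> map_poly h (p + q) = map_poly h p + map_poly h q"
  by (intro poly_eqI) (auto simp: coeff_hom polys_over_def hom_add)

lemma hom_poly_mult: "p \<in> polys_over L \<Longrightarrow> q \<in> polys_over L \<Longrightarrow> map_poly h (p * q) = map_poly h p * map_poly h q"
  by (intro poly_eqI) (auto simp: coeff_hom coeff_mult polys_over_def hom_mult hom_sum rs_mult[OF hom_ring_set])

lemma hom_pderiv: "p \<in> polys_over L \<Longrightarrow> map_poly h (pderiv p) = pderiv (map_poly h p)"
proof (intro poly_eqI)
  fix n assume "p \<in> polys_over L"
  then have "coeff p (Suc n) \<in> L" by (simp add: polys_over_def)
  then show "coeff (map_poly h (pderiv p)) n = coeff (pderiv (map_poly h p)) n"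
    unfolding coeff_hom coeff_pderiv
    using hom_mult[OF rs_of_nat[OF hom_ring_set, of "Suc n"]] hom_of_nat[of "Suc n"] by simp
qed

lemma hom_poly: "p \<in> polys_over L \<Longrightarrow> x \<in> L \<Longrightarrow> h (poly p x) = poly (map_poly h p) (h x)"
proof -
  assume p: "p \<in> polys_over L" and x: "x \<in> L"
  have "poly (map_poly h p) (h x) = (\<Sum>i\<le>degree p. coeff (map_poly h p) i * h x ^ i)"
    unfolding poly_altdef using hom_degree_le[of p]
    by (intro sum.mono_neutral_left) (auto simp: coeff_eq_0)
  also have "\<dots> = (\<Sum>i\<le>degree p. h (coeff p i * x ^ i))"
    using p x by (simp add: coeff_hom hom_mult hom_power rs_power[OF hom_ring_set] polys_over_def)
  also have "\<dots> = h (poly p x)"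
    unfolding poly_altdef
    using p x by (intro hom_sum[symmetric]) (auto simp: polys_over_def intro!: rs_mult[OF hom_ring_set] rs_power[OF hom_ring_set])
  finally show ?thesis by simp
qed

lemma hom_monic:
  assumes "lead_coeff p = 1"
  shows "degree (map_poly h p) = degree p" "lead_coeff (map_poly h p) = 1"
proof -
  have c: "coeff (map_poly h p) (degree p) = 1"
    using assms by (simp add: coeff_hom hom_1)
  show d: "degree (map_poly h p) = degree p"
    using c le_degree[of "map_poly h p" "degree p"] hom_degree_le[of p] by simp
  show "lead_coeff (map_poly h p) = 1" using c d by simp
qed

end

lemma polys_over_UNIV: "p \<in> polys_over UNIV"
  by (simp add: polys_over_def)

lemma bezout_field_poly:
  fixes a b :: "'a::field poly"
  assumes "coprime a b"
  shows "\<exists>u w. u * a + w * b = 1"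
proof -
  define J where "J = {u * a + w * b | u w. True}"
  have J: "x - y \<in> J" "z * x \<in> J" if x: "x \<in> J" and y: "y \<in> J" for x y z
  proof -
    obtain u w u' w' where e: "x = u * a + w * b" "y = u' * a + w' * b"
      using x y unfolding J_def by blast
    have "x - y = (u - u') * a + (w - w') * b" "z * x = (z * u) * a + (z * w) * b"
      by (simp_all add: e algebra_simps)
    then show "x - y \<in> J" "z * x \<in> J" unfolding J_def by blast+
  qed
  have JI: "u * a + w * b \<in> J" for u w unfolding J_def by blast
  have ab: "a \<in> J" "b \<in> J" using JI[of 1 0] JI[of 0 1] by simp_all
  have "a \<noteq> 0 \<or> b \<noteq> 0" using assms by auto
  then have "\<exists>n. \<exists>x\<in>J. x \<noteq> 0 \<and> degree x = n" using ab by auto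
  from LeastI_ex[OF this] obtain g where g: "g \<in> J" "g \<noteq> 0" 
    "degree g = (LEAST n. \<exists>x\<in>J. x \<noteq> 0 \<and> degree x = n)" by blast
  have "g dvd x" if "x \<in> J" for x
  proof (rule ccontr)
    assume "\<not> g dvd x"
    then have "x mod g \<noteq> 0" by (simp add: dvd_eq_mod_eq_0)
    moreover have "x mod g \<in> J"
      using J(1)[OF that J(2)[OF g(1) g(1)], of "x div g"] by (simp add: minus_div_mult_eq_mod)
    moreover from \<open>x mod g \<noteq> 0\<close> have "degree (x mod g) < degree g"
      using degree_mod_less[OF g(2)] by auto
    moreover have "degree g \<le> degree (x mod g)"
      unfolding g(3) by (rule Least_le, intro bexI conjI) (use calculation in auto)
    ultimately show False by simp
  qed
  then have "g dvd a" "g dvd b" using ab by blast+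
  then have "is_unit g" by (rule coprime_common_divisor[OF assms])
  then obtain k where k: "1 = g * k" by (rule dvdE)
  have "k * g \<in> J" by (rule J(2)[OF g(1) g(1)])
  then obtain u w where "k * g = u * a + w * b" unfolding J_def by blast
  then have "u * a + w * b = 1" using k by (metis mult.commute)
  then show ?thesis by blast
qed

lemma coprime_if_bezout: "u * a + w * b = (1::'a::idom) \<Longrightarrow> \<forall>c. c dvd a \<longrightarrow> c dvd b \<longrightarrow> c dvd 1"
  by (metis dvd_add dvd_mult)

text \<open>
  Separability of a polynomial survives the embedding because coprimality over a field is witnessed
  by a Bezout identity.
\<close>

lemma coprime_map_poly:
  fixes h :: "'a::field \<Rightarrow> 'b::field"
  assumes h: "hom_on UNIV h" and "coprime a b"
  shows "coprime (map_poly h a) (map_poly h b)"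
proof -
  obtain u w where "u * a + w * b = 1" using bezout_field_poly assms by blast
  then have "map_poly h (u * a + w * b) = 1" by (simp add: hom_poly_1[OF h])
  then have "map_poly h u * map_poly h a + map_poly h w * map_poly h b = 1"
    by (simp add: hom_poly_add[OF h] hom_poly_mult[OF h] polys_over_UNIV)
  then show ?thesis by (intro coprimeI) (use coprime_if_bezout in blast)
qed

lemma separable_factor:
  fixes A B :: "'a::field poly"
  assumes "coprime (A * B) (pderiv (A * B))"
  shows "coprime A (pderiv A)"
proof (rule coprimeI)
  fix c assume "c dvd A" "c dvd pderiv A"
  then have "c dvd A * B" "c dvd pderiv (A * B)" by (auto simp: pderiv_mult)
  then show "is_unit c" using assms by (meson coprime_common_divisor)
qed

lemma separable_simple_root:
  fixes p :: "'a::field poly"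
  assumes "coprime p (pderiv p)" "poly p x = 0"
  shows "poly (pderiv p) x \<noteq> 0"
proof
  assume "poly (pderiv p) x = 0"
  then have "is_unit [:-x, 1:]" using assms by (meson coprime_common_divisor poly_eq_0_iff_dvd)
  then show False by (simp add: is_unit_poly_iff)
qed

text \<open>
  A homomorphism from a subring of the separable closure is represented by its graph, so that
  unions of chains of extensions are again homomorphisms.
\<close>

definition ring_graph :: "('a::idom \<times> 'a) set \<Rightarrow> bool"
  where "ring_graph \<Phi> \<longleftrightarrow> (1, 1) \<in> \<Phi>
    \<and> (\<forall>(a, b)\<in>\<Phi>. \<forall>(a', b')\<in>\<Phi>. (a - a', b - b') \<in> \<Phi> \<and> (a * a', b * b') \<in> \<Phi>)
    \<and> (\<forall>b. (0, b) \<in> \<Phi> \<longrightarrow> b = 0)"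

lemma ring_graph_closed:
  assumes "ring_graph \<Phi>" "(a, b) \<in> \<Phi>" "(a', b') \<in> \<Phi>"
  shows "(a - a', b - b') \<in> \<Phi>" "(a * a', b * b') \<in> \<Phi>"
  using assms unfolding ring_graph_def by blast+

lemma hom_of_ring_graph:
  assumes "ring_graph \<Phi>"
  obtains h where "hom_on (Domain \<Phi>) h" "\<And>a b. (a, b) \<in> \<Phi> \<longleftrightarrow> a \<in> Domain \<Phi> \<and> b = h a"
proof -
  have diff: "(a - a', b - b') \<in> \<Phi>" and mult: "(a * a', b * b') \<in> \<Phi>"
    if "(a, b) \<in> \<Phi>" "(a', b') \<in> \<Phi>" for a b a' b'
    using ring_graph_closed[OF assms that] .
  have single: "b = b'" if "(a, b) \<in> \<Phi>" "(a, b') \<in> \<Phi>" for a b b'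
    using diff[OF that] assms by (auto simp: ring_graph_def)
  define h where "h a = (SOME b. (a, b) \<in> \<Phi>)" for a
  have h: "(a, h a) \<in> \<Phi>" if "a \<in> Domain \<Phi>" for a
    unfolding h_def using that by (metis Domain_iff someI_ex)
  have 1: "(1, 1) \<in> \<Phi>" using assms by (simp add: ring_graph_def)
  have "hom_on (Domain \<Phi>) h"
    unfolding hom_on_def ring_set_def
  proof (intro conjI ballI)
    show "1 \<in> Domain \<Phi>" using 1 by auto
    then show "h 1 = 1" using h single 1 by blast
    fix x y assume xy: "x \<in> Domain \<Phi>" "y \<in> Domain \<Phi>"
    show d: "x - y \<in> Domain \<Phi>" "x * y \<in> Domain \<Phi>" using diff mult h xy by blast+
    show "h (x - y) = h x - h y" using single[OF h[OF d(1)] diff[OF h[OF xy(1)] h[OF xy(2)]]] .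
    show "h (x * y) = h x * h y" using single[OF h[OF d(2)] mult[OF h[OF xy(1)] h[OF xy(2)]]] .
  qed
  moreover have "(a, b) \<in> \<Phi> \<longleftrightarrow> a \<in> Domain \<Phi> \<and> b = h a" for a b
    using h single by blast
  ultimately show ?thesis using that by blast
qed

text \<open>
  A homomorphism extends to \<open>L[x]\<close> by sending \<open>x\<close> to \<open>y\<close> as soon as \<open>y\<close> satisfies the images of all
  relations of \<open>x\<close>, because then the assignment \<open>p(x) \<mapsto> p(y)\<close> is well defined.
\<close>

lemma extend_hom:
  fixes L :: "'a::idom set" and h :: "'a \<Rightarrow> 'a"
  assumes h: "hom_on L h"
    and xy: "\<And>p. p \<in> polys_over L \<Longrightarrow> poly p x = 0 \<Longrightarrow> poly (map_poly h p) y = 0"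
  shows "\<exists>\<Phi>. ring_graph \<Phi> \<and> (x, y) \<in> \<Phi> \<and> (\<forall>a\<in>L. (a, h a) \<in> \<Phi>)"
proof -
  note L = hom_ring_set[OF h]
  note LP = ring_set_polys_over[OF L]
  define \<Phi> where "\<Phi> = {(poly p x, poly (map_poly h p) y) | p. p \<in> polys_over L}"
  have I: "(poly p x, poly (map_poly h p) y) \<in> \<Phi>" if "p \<in> polys_over L" for p
    using that by (auto simp: \<Phi>_def)
  have "ring_graph \<Phi>"
    unfolding ring_graph_def
  proof (intro conjI)
    show "(1, 1) \<in> \<Phi>" using I[OF rs_1[OF LP]] by (simp add: hom_poly_1[OF h])
    show "\<forall>(a, b)\<in>\<Phi>. \<forall>(a', b')\<in>\<Phi>. (a - a', b - b') \<in> \<Phi> \<and> (a * a', b * b') \<in> \<Phi>"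
    proof (clarify, intro conjI)
      fix a b a' b' assume "(a, b) \<in> \<Phi>" "(a', b') \<in> \<Phi>"
      then obtain p q where s: "p \<in> polys_over L" "q \<in> polys_over L"
        "a = poly p x" "b = poly (map_poly h p) y" "a' = poly q x" "b' = poly (map_poly h q) y"
        unfolding \<Phi>_def by blast
      show "(a - a', b - b') \<in> \<Phi>" "(a * a', b * b') \<in> \<Phi>"
        using I[OF rs_diff[OF LP s(1,2)]] I[OF rs_mult[OF LP s(1,2)]] s
        by (simp_all add: hom_poly_diff[OF h] hom_poly_mult[OF h])
    qed
    show "\<forall>b. (0, b) \<in> \<Phi> \<longrightarrow> b = 0" using xy by (auto simp: \<Phi>_def)
  qed
  moreover have "(x, y) \<in> \<Phi>"
  proof -
    have "monom 1 1 \<in> polys_over L" by (intro polys_over_monom L rs_1)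
    moreover have "map_poly h (monom 1 1) = monom 1 1"
      by (intro poly_eqI) (auto simp: coeff_hom[OF h] hom_0[OF h] hom_1[OF h])
    ultimately show ?thesis using I[of "monom 1 1"] by (simp add: poly_monom)
  qed
  moreover have "(a, h a) \<in> \<Phi>" if "a \<in> L" for a
    using I[OF polys_over_const[OF L that]] by (simp add: map_poly_pCons hom_0[OF h])
  ultimately show ?thesis by blast
qed

context separable_closure
begin

lemma hom_emb: "hom_on UNIV \<iota>"
proof -
  have "\<iota> (x - y) = \<iota> x - \<iota> y" for x y
    using emb_add[of "x - y" y] by simp
  then show ?thesis by (simp add: hom_on_def ring_set_def emb_one emb_mult)
qed

lemmas emb_0 = hom_0[OF hom_emb]
lemmas emb_diff = hom_diff[OF hom_emb UNIV_I UNIV_I]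
lemmas emb_minus = hom_minus[OF hom_emb UNIV_I]
lemmas emb_power = hom_power[OF hom_emb UNIV_I]
lemmas emb_of_nat = hom_of_nat[OF hom_emb]
lemmas emb_numeral = hom_numeral[OF hom_emb]

lemma emb_eq_0: "\<iota> x = 0 \<longleftrightarrow> x = 0"
proof
  assume "\<iota> x = 0"
  then have "x \<noteq> 0 \<Longrightarrow> \<iota> 1 = 0" using emb_mult[of x "inverse x"] by simp
  then show "x = 0" by (auto simp: emb_one)
qed (simp add: emb_0)

lemma emb_eq: "\<iota> x = \<iota> y \<longleftrightarrow> x = y"
  using emb_eq_0[of "x - y"] by (simp add: emb_diff)

lemma emb_inverse: "\<iota> (inverse x) = inverse (\<iota> x)"
proof (cases "x = 0")
  case False
  then have "\<iota> x * \<iota> (inverse x) = 1" by (simp flip: emb_mult add: emb_one)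
  then show ?thesis by (metis inverse_unique)
qed (simp add: emb_0)

lemma emb_divide: "\<iota> (x / y) = \<iota> x / \<iota> y"
  by (simp add: divide_inverse emb_mult emb_inverse)

lemmas emb_simps = emb_0 emb_one emb_add emb_diff emb_minus emb_mult emb_power emb_numeral emb_divide
  emb_inverse

lemma emb_polys_over: "range \<iota> \<subseteq> L \<Longrightarrow> map_poly \<iota> p \<in> polys_over L"
  by (auto simp: polys_over_def coeff_hom[OF hom_emb])

lemma annihilator:
  obtains P where "P \<noteq> 0" "coprime (map_poly \<iota> P) (pderiv (map_poly \<iota> P))" "poly (map_poly \<iota> P) z = 0"
    "map_poly \<iota> P \<noteq> 0"
proof -
  obtain P where P: "P \<noteq> 0" "coprime P (pderiv P)" "poly (map_poly \<iota> P) z = 0"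
    using separable by blast
  have "coprime (map_poly \<iota> P) (map_poly \<iota> (pderiv P))" by (rule coprime_map_poly[OF hom_emb P(2)])
  moreover have "map_poly \<iota> P \<noteq> 0"
    using P(1) coeff_hom[OF hom_emb, of P "degree P"] by (auto simp: emb_eq_0)
  ultimately show ?thesis using that[of P] P hom_pderiv[OF hom_emb, of P] by (simp add: polys_over_UNIV)
qed

text \<open>
  An algebraic relation of \<open>z\<close> with nonzero constant coefficient \<open>c\<close> reads \<open>z P(z) = - c\<close>, and a zero
  constant coefficient can be removed by dividing by \<open>z\<close>.  It follows that every ring between the base
  field and its separable closure is a field.
\<close>

lemma inverse_as_polynomial:
  assumes "z \<noteq> 0" shows "\<exists>h. poly (map_poly \<iota> h) z = inverse z"
proof -
  have "\<exists>h. poly (map_poly \<iota> h) z = inverse z" if "P \<noteq> 0" "poly (map_poly \<iota> P) z = 0" for P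
    using that
  proof (induction P)
    case 0
    then show ?case by simp
  next
    case (pCons c P)
    have e: "\<iota> c + z * poly (map_poly \<iota> P) z = 0"
      using pCons.prems by (simp add: map_poly_pCons emb_0)
    show ?case
    proof (cases "c = 0")
      case True
      then show ?thesis using e pCons assms by (auto simp: emb_0)
    next
      case False
      have "map_poly \<iota> ([:- inverse c:] * P) = [:- inverse (\<iota> c):] * map_poly \<iota> P"
        using hom_poly_mult[OF hom_emb, of "[:- inverse c:]" P]
        by (simp add: polys_over_UNIV map_poly_pCons emb_0 emb_minus emb_inverse)
      then have "poly (map_poly \<iota> ([:- inverse c:] * P)) z = - inverse (\<iota> c) * poly (map_poly \<iota> P) z"
        by simp
      also have "\<dots> = inverse z"
      proof -
        have "\<iota> c \<noteq> 0" using False by (simp add: emb_eq_0)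
        moreover have "z * poly (map_poly \<iota> P) z = - \<iota> c" using e by (simp add: eq_neg_iff_add_eq_0 add.commute)
        ultimately show ?thesis using assms by (simp add: field_simps)
      qed
      finally show ?thesis by blast
    qed
  qed
  then show ?thesis using annihilator by metis
qed

lemma subring_inverse:
  assumes "ring_set L" "range \<iota> \<subseteq> L" "z \<in> L" shows "inverse z \<in> L"
proof (cases "z = 0")
  case False
  then obtain h where "poly (map_poly \<iota> h) z = inverse z" using inverse_as_polynomial by blast
  then show ?thesis using poly_in[OF assms(1) emb_polys_over[OF assms(2)] assms(3)] by metis
qed (use rs_0[OF assms(1)] in simp)

lemma minimal_polynomial:
  assumes L: "ring_set L" "range \<iota> \<subseteq> L"
  obtains m where "m \<in> polys_over L" "lead_coeff m = 1" "degree m > 0" "poly m x = 0"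
    "\<And>p. p \<in> polys_over L \<Longrightarrow> poly p x = 0 \<Longrightarrow> \<exists>k\<in>polys_over L. p = m * k"
proof -
  note LP = ring_set_polys_over[OF L(1)]
  define good where "good p \<longleftrightarrow> p \<in> polys_over L \<and> p \<noteq> 0 \<and> poly p x = 0" for p
  obtain P where P: "poly (map_poly \<iota> P) x = 0" "map_poly \<iota> P \<noteq> 0" using annihilator by metis
  then have "\<exists>n. \<exists>p. good p \<and> degree p = n" using emb_polys_over[OF L(2)] by (auto simp: good_def)
  from LeastI_ex[OF this] obtain q where q: "good q" "degree q = (LEAST n. \<exists>p. good p \<and> degree p = n)"
    by blast
  define m where "m = smult (inverse (lead_coeff q)) q"
  have m: "m \<in> polys_over L" "lead_coeff m = 1" "poly m x = 0" "degree m = degree q"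
    using q(1) subring_inverse[OF L] rs_mult[OF L(1)] by (auto simp: m_def good_def polys_over_def)
  have "degree m > 0"
  proof (rule ccontr)
    assume "\<not> ?thesis"
    then obtain c where "m = [:c:]" by (auto elim: degree_eq_zeroE)
    then show False using m by simp
  qed
  moreover have "\<exists>k\<in>polys_over L. p = m * k" if p: "p \<in> polys_over L" "poly p x = 0" for p
  proof -
    obtain k r where k: "k \<in> polys_over L" "r \<in> polys_over L" "p = m * k + r"
      "\<forall>i\<ge>degree m. coeff r i = 0" using monic_division[OF L(1) m(1,2) p(1)] by blast
    have "r = 0"
    proof (rule ccontr)
      assume "r \<noteq> 0"
      then have "good r" using k p m by (simp add: good_def)
      moreover have "degree r < degree q"
        using k(4) \<open>r \<noteq> 0\<close> m(4) by (metis leading_coeff_0_iff not_less)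
      moreover have "degree q \<le> degree r"
        unfolding q(2) by (rule Least_le) (use \<open>good r\<close> in blast)
      ultimately show False by simp
    qed
    then show ?thesis using k by auto
  qed
  ultimately show ?thesis using that m by blast
qed

lemma separable_root:
  assumes "A * B = map_poly \<iota> P" "coprime (map_poly \<iota> P) (pderiv (map_poly \<iota> P))" "degree A > 0"
  shows "\<exists>y. poly A y = 0"
  using assms separably_closed separable_factor[of A B] by simp

text \<open>
  The image of the minimal polynomial of \<open>x\<close> divides a separable polynomial over the base field,
  so it has a root in the separable closure, to which \<open>x\<close> can be sent.
\<close>

lemma extend_emb_hom:
  assumes h: "hom_on L h" and L: "range \<iota> \<subseteq> L" and fixF: "\<And>a. h (\<iota> a) = \<iota> a"
  shows "\<exists>y \<Phi>. ring_graph \<Phi> \<and> (x, y) \<in> \<Phi> \<and> (\<forall>a\<in>L. (a, h a) \<in> \<Phi>)"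
proof -
  note rs = hom_ring_set[OF h]
  obtain m where m: "m \<in> polys_over L" "lead_coeff m = 1" "degree m > 0" 
    "\<And>p. p \<in> polys_over L \<Longrightarrow> poly p x = 0 \<Longrightarrow> \<exists>k\<in>polys_over L. p = m * k"
    using minimal_polynomial[OF rs L, of x] by blast
  obtain P where P: "coprime (map_poly \<iota> P) (pderiv (map_poly \<iota> P))" "poly (map_poly \<iota> P) x = 0"
    using annihilator by metis
  obtain k where k: "k \<in> polys_over L" "map_poly \<iota> P = m * k"
    using m(4)[OF emb_polys_over[OF L] P(2)] by blast
  have "map_poly h (map_poly \<iota> P) = map_poly \<iota> P"
    by (intro poly_eqI) (simp add: coeff_hom[OF h] coeff_hom[OF hom_emb] fixF)
  then have "map_poly h m * map_poly h k = map_poly \<iota> P"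
    using k hom_poly_mult[OF h m(1) k(1)] by simp
  then obtain y where y: "poly (map_poly h m) y = 0"
    using separable_root[of "map_poly h m" "map_poly h k" P] P hom_monic[OF h m(2)] m(3) by auto
  have "poly (map_poly h p) y = 0" if "p \<in> polys_over L" "poly p x = 0" for p
    using m(4)[OF that] hom_poly_mult[OF h m(1)] y by auto
  then show ?thesis using extend_hom[OF h] by blast
qed

text \<open>
  The minimal polynomial of \<open>u\<close> over \<open>K\<close> has degree at least two and is separable, so it has a second
  root \<open>y\<close>.  A maximal extension of the homomorphism fixing \<open>K\<close> and sending \<open>u\<close> to \<open>y\<close>, which exists by
  Zorn's lemma, is defined everywhere; it is surjective because it permutes the finitely many roots
  of each polynomial over the base field.
\<close>

theorem fixed_field:
  assumes K: "ring_set K" "range \<iota> \<subseteq> K" and u: "u \<notin> K"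
  obtains \<sigma> where "\<sigma> \<in> galois_group \<iota>" "\<And>a. a \<in> K \<Longrightarrow> \<sigma> a = a" "\<sigma> u \<noteq> u"
proof -
  have id: "hom_on K id" using K by (simp add: hom_on_def)
  obtain m where m: "m \<in> polys_over K" "lead_coeff m = 1" "degree m > 0" "poly m u = 0"
    "\<And>p. p \<in> polys_over K \<Longrightarrow> poly p u = 0 \<Longrightarrow> \<exists>k\<in>polys_over K. p = m * k"
    using minimal_polynomial[OF K, of u] by blast
  obtain P where P: "coprime (map_poly \<iota> P) (pderiv (map_poly \<iota> P))" "poly (map_poly \<iota> P) u = 0"
    using annihilator by metis
  obtain k where k: "map_poly \<iota> P = m * k"
    using m(5)[OF emb_polys_over[OF K(2)] P(2)] by blast
  obtain m1 where m1: "m = [:-u, 1:] * m1" using m(4) by (auto simp: poly_eq_0_iff_dvd elim: dvdE)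
  have "degree m1 > 0"
  proof (rule ccontr)
    assume "\<not> ?thesis"
    then obtain c where c: "m1 = [:c:]" by (auto elim: degree_eq_zeroE)
    then have "m = [:-u, 1:]" using m(2) m1 by (cases "c = 0") auto
    then have "coeff m 0 = - u" by simp
    then show False using polys_overD[OF m(1), of 0] u rs_minus[OF K(1), of "- u"] by simp
  qed
  then obtain y where y: "poly m1 y = 0"
    using separable_root[of m1 "[:-u, 1:] * k" P] P k unfolding m1 by (metis mult.assoc mult.commute)
  have "y \<noteq> u"
  proof
    assume "y = u"
    then have "poly (pderiv m) u = 0" using y unfolding m1 pderiv_mult by simp
    then show False using separable_simple_root[of m u] m(4) P(1) k separable_factor[of m k] by simp
  qed
  have my: "poly m y = 0" using y m1 by simp
  have "poly (map_poly id p) y = 0" if "p \<in> polys_over K" "poly p u = 0" for p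
    using m(5)[OF that] my by auto
  then obtain \<Phi>1 where \<Phi>1: "ring_graph \<Phi>1" "(u, y) \<in> \<Phi>1" "\<forall>a\<in>K. (a, a) \<in> \<Phi>1"
    using extend_hom[OF id, of u y] by auto
  define \<A> where "\<A> = {\<Phi>. ring_graph \<Phi> \<and> \<Phi>1 \<subseteq> \<Phi>}"
  have "\<exists>M\<in>\<A>. \<forall>X\<in>\<A>. M \<subseteq> X \<longrightarrow> X = M"
  proof (rule subset_Zorn_nonempty)
    show "\<A> \<noteq> {}" using \<Phi>1 by (auto simp: \<A>_def)
    fix \<C> assume C: "\<C> \<noteq> {}" "subset.chain \<A> \<C>"
    have common: "\<exists>X\<in>\<C>. s \<in> X \<and> t \<in> X" if "s \<in> \<Union>\<C>" "t \<in> \<Union>\<C>" for s t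
    proof -
      obtain X Y where "X \<in> \<C>" "s \<in> X" "Y \<in> \<C>" "t \<in> Y" using \<open>s \<in> \<Union>\<C>\<close> \<open>t \<in> \<Union>\<C>\<close> by blast
      moreover from this have "X \<subseteq> Y \<or> Y \<subseteq> X" using C(2) by (simp add: subset_chain_def)
      ultimately show ?thesis by blast
    qed
    have CA: "X \<in> \<A>" if "X \<in> \<C>" for X using C(2) that by (auto simp: subset_chain_def)
    have "ring_graph (\<Union>\<C>)"
      unfolding ring_graph_def
    proof (intro conjI)
      show "(1, 1) \<in> \<Union>\<C>" using C(1) CA by (auto simp: \<A>_def ring_graph_def)
      show "\<forall>(a, b)\<in>\<Union>\<C>. \<forall>(a', b')\<in>\<Union>\<C>.
        (a - a', b - b') \<in> \<Union>\<C> \<and> (a * a', b * b') \<in> \<Union>\<C>"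
      proof (clarify, intro conjI)
        fix a b a' b' X X' assume "X \<in> \<C>" "(a, b) \<in> X" "X' \<in> \<C>" "(a', b') \<in> X'"
        then obtain Y where Y: "Y \<in> \<C>" "(a, b) \<in> Y" "(a', b') \<in> Y" using common by blast
        then have "ring_graph Y" using CA by (auto simp: \<A>_def)
        then have "(a - a', b - b') \<in> Y" "(a * a', b * b') \<in> Y"
          using ring_graph_closed Y by blast+
        then show "(a - a', b - b') \<in> \<Union>\<C>" "(a * a', b * b') \<in> \<Union>\<C>" using Y by blast+
      qed
      show "\<forall>b. (0, b) \<in> \<Union>\<C> \<longrightarrow> b = 0" using CA by (auto simp: \<A>_def ring_graph_def)
    qed
    then show "\<Union>\<C> \<in> \<A>" using C(1) CA by (auto simp: \<A>_def)
  qed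
  then obtain M where M: "ring_graph M" "\<Phi>1 \<subseteq> M" "\<And>X. ring_graph X \<Longrightarrow> M \<subseteq> X \<Longrightarrow> X = M"
    by (auto simp: \<A>_def)
  obtain \<sigma> where \<sigma>: "hom_on (Domain M) \<sigma>" "\<And>a b. (a, b) \<in> M \<longleftrightarrow> a \<in> Domain M \<and> b = \<sigma> a"
    using hom_of_ring_graph[OF M(1)] by blast
  have inM: "\<sigma> a = b" if "(a, b) \<in> M" for a b using that \<sigma>(2)[of a b] by simp
  have fixK: "\<sigma> a = a" if "a \<in> K" for a using inM[of a a] \<Phi>1(3) M(2) that by auto
  have KM: "range \<iota> \<subseteq> Domain M"
  proof
    fix x assume "x \<in> range \<iota>"
    then have "(x, x) \<in> M" using \<Phi>1(3) M(2) K(2) by auto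
    then show "x \<in> Domain M" by auto
  qed
  have fixF: "\<sigma> (\<iota> a) = \<iota> a" for a using fixK K(2) by auto
  have total: "Domain M = UNIV"
  proof (intro equalityI subsetI UNIV_I)
    fix x :: 's
    obtain y \<Phi> where \<Phi>: "ring_graph \<Phi>" "(x, y) \<in> \<Phi>" "\<forall>a\<in>Domain M. (a, \<sigma> a) \<in> \<Phi>"
      using extend_emb_hom[OF \<sigma>(1) KM fixF, of x] by blast
    have "M \<subseteq> \<Phi>"
    proof (rule subrelI)
      fix a b assume "(a, b) \<in> M"
      then have "a \<in> Domain M" "b = \<sigma> a" using \<sigma>(2)[of a b] by simp_all
      then show "(a, b) \<in> \<Phi>" using \<Phi>(3) by auto
    qed
    then have "\<Phi> = M" using M(3) \<Phi>(1) by simp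
    then show "x \<in> Domain M" using \<Phi>(2) by auto
  qed
  have hom: "hom_on UNIV \<sigma>" using \<sigma>(1) total by simp
  have inj: "inj \<sigma>"
  proof (rule injI)
    fix a b assume "\<sigma> a = \<sigma> b"
    then have "\<sigma> (a - b) = 0" by (simp add: hom_diff[OF hom])
    moreover have "x = 0" if "\<sigma> x = 0" for x
    proof (rule ccontr)
      assume "x \<noteq> 0"
      then have "\<sigma> 1 = 0" using hom_mult[OF hom, of x "inverse x"] that by simp
      then show False using hom_1[OF hom] by simp
    qed
    ultimately show "a = b" by fastforce
  qed
  have "surj \<sigma>"
  proof -
    have "y \<in> range \<sigma>" for y
    proof -
      obtain P where P: "poly (map_poly \<iota> P) y = 0" "map_poly \<iota> P \<noteq> 0" using annihilator by metis
      define Z where "Z = {z. poly (map_poly \<iota> P) z = 0}"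
      have "finite Z" unfolding Z_def by (rule poly_roots_finite[OF P(2)])
      moreover have "\<sigma> ` Z \<subseteq> Z"
      proof
        fix w assume "w \<in> \<sigma> ` Z"
        then obtain z where z: "w = \<sigma> z" "poly (map_poly \<iota> P) z = 0" by (auto simp: Z_def)
        have "map_poly \<sigma> (map_poly \<iota> P) = map_poly \<iota> P"
          by (intro poly_eqI) (simp add: coeff_hom[OF hom] coeff_hom[OF hom_emb] fixF)
        then show "w \<in> Z" using z hom_poly[OF hom polys_over_UNIV UNIV_I, of "map_poly \<iota> P" z] hom_0[OF hom]
          by (simp add: Z_def)
      qed
      ultimately have "\<sigma> ` Z = Z"
        by (rule endo_inj_surj) (rule inj_on_subset[OF inj subset_UNIV])
      moreover have "y \<in> Z" using P by (simp add: Z_def)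
      ultimately show ?thesis by blast
    qed
    then show ?thesis by blast
  qed
  then have "\<sigma> \<in> galois_group \<iota>"
    using inj hom fixF by (simp add: galois_group_def bij_def hom_mult hom_add)
  moreover have "\<sigma> u = y" using inM[of u y] \<Phi>1(2) M(2) by auto
  ultimately show ?thesis using that[of \<sigma>] fixK \<open>y \<noteq> u\<close> by simp
qed

lemma galois_hom: "\<sigma> \<in> galois_group \<iota> \<Longrightarrow> hom_on UNIV \<sigma>"
proof -
  assume s: "\<sigma> \<in> galois_group \<iota>"
  then have add: "\<sigma> (x + y) = \<sigma> x + \<sigma> y" and mult: "\<sigma> (x * y) = \<sigma> x * \<sigma> y"
    and "\<sigma> (\<iota> 1) = \<iota> 1" for x y unfolding galois_group_def by blast+
  moreover have "\<sigma> (x - y) = \<sigma> x - \<sigma> y" for x y using add[of "x - y" y] by simp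
  ultimately show ?thesis by (simp add: hom_on_def ring_set_def emb_one)
qed

lemma galois_emb: "\<sigma> \<in> galois_group \<iota> \<Longrightarrow> \<sigma> (\<iota> a) = \<iota> a"
  by (simp add: galois_group_def)

lemma galois_id: "id \<in> galois_group \<iota>"
  by (simp add: galois_group_def)

lemma galois_fixed:
  assumes "\<And>\<sigma>. \<sigma> \<in> galois_group \<iota> \<Longrightarrow> \<sigma> x = x"
  obtains a where "x = \<iota> a"
proof -
  have "ring_set (range \<iota>)"
    by (intro ring_setI) (auto simp flip: emb_diff emb_mult intro: range_eqI[of _ _ 1] simp: emb_one)
  then have "x \<in> range \<iota>" using fixed_field[of "range \<iota>" x] assms by (metis order_refl)
  then show ?thesis using that by auto
qed

end

section \<open>Arithmetic of the local field\<close>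

context local_field
begin

lemma v_one: "v 1 = 0"
  using val_mult[of 1 1] by simp

lemma v_minus: "v (- x) = v x"
proof (cases "x = 0")
  case False
  have "v (- 1) = 0" using val_mult[of "-1" "-1"] v_one by simp
  then show ?thesis using False val_mult[of "-1" x] by simp
qed simp

lemma v_inverse: "x \<noteq> 0 \<Longrightarrow> v (inverse x) = - v x"
  using val_mult[of x "inverse x"] v_one by simp

lemma v_divide: "x \<noteq> 0 \<Longrightarrow> y \<noteq> 0 \<Longrightarrow> v (x / y) = v x - v y"
  by (simp add: divide_inverse val_mult v_inverse)

lemma v_power: "x \<noteq> 0 \<Longrightarrow> v (x ^ n) = int n * v x"
  by (induction n) (auto simp: v_one val_mult algebra_simps)

lemma val_ge_0 [simp]: "val_ge v n 0"
  by (simp add: val_ge_def)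

lemma val_geD: "val_ge v n x \<Longrightarrow> x \<noteq> 0 \<Longrightarrow> n \<le> v x"
  by (simp add: val_ge_def)

lemma val_ge_mono: "val_ge v n x \<Longrightarrow> m \<le> n \<Longrightarrow> val_ge v m x"
  by (auto simp: val_ge_def)

lemma val_ge_minus: "val_ge v n (- x) \<longleftrightarrow> val_ge v n x"
  by (simp add: val_ge_def v_minus)

lemma val_ge_add: "val_ge v n x \<Longrightarrow> val_ge v n y \<Longrightarrow> val_ge v n (x + y)"
  using val_add[of x y] by (cases "x = 0"; cases "y = 0"; cases "x + y = 0") (auto simp: val_ge_def)

lemma val_ge_diff: "val_ge v n x \<Longrightarrow> val_ge v n y \<Longrightarrow> val_ge v n (x - y)"
  using val_ge_add[of n x "- y"] by (simp add: val_ge_minus)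

lemma val_ge_diff_swap: "val_ge v n (x - y) \<longleftrightarrow> val_ge v n (y - x)"
  using val_ge_minus[of n "x - y"] by simp

lemma val_ge_mult: "val_ge v m x \<Longrightarrow> val_ge v n y \<Longrightarrow> val_ge v (m + n) (x * y)"
  by (cases "x = 0"; cases "y = 0") (auto simp: val_ge_def val_mult)

lemma val_ge_mult_left: "val_ge v n x \<Longrightarrow> val_ge v 0 y \<Longrightarrow> val_ge v n (x * y)"
  using val_ge_mult[of n x 0 y] by simp

lemma val_ge_mult_right: "val_ge v 0 x \<Longrightarrow> val_ge v n y \<Longrightarrow> val_ge v n (x * y)"
  using val_ge_mult[of 0 x n y] by simp

lemma val_ge_sum: "(\<And>i. i \<in> A \<Longrightarrow> val_ge v n (f i)) \<Longrightarrow> val_ge v n (sum f A)"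
  by (induction A rule: infinite_finite_induct) (auto simp: val_ge_add)

lemma val_ge_all: "(\<And>n. val_ge v n x) \<Longrightarrow> x = 0"
  using val_geD[of "v x + 1" x] by force

lemma val_ge_mult_cancel: "c \<noteq> 0 \<Longrightarrow> val_ge v n (c * x) \<longleftrightarrow> val_ge v (n - v c) x"
  by (cases "x = 0") (auto simp: val_ge_def val_mult)

lemma val_ge_one: "val_ge v n 1 \<longleftrightarrow> n \<le> 0"
  by (simp add: val_ge_def v_one)

lemma ring_set_int: "ring_set {x. val_ge v 0 x}"
  by (intro ring_setI) (auto simp: val_ge_one val_ge_diff val_ge_mult_left)

lemma val_ge_of_nat: "val_ge v 0 (of_nat n)"
  using rs_of_nat[OF ring_set_int] by simp

lemma val_ge_numeral: "val_ge v 0 (numeral n)"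
  using rs_numeral[OF ring_set_int] by simp

lemma val_ge_power: "val_ge v 0 x \<Longrightarrow> val_ge v 0 (x ^ n)"
  using rs_power[OF ring_set_int] by simp

lemma val_ge_power_pos: "val_ge v k x \<Longrightarrow> k \<ge> 0 \<Longrightarrow> n > 0 \<Longrightarrow> val_ge v k (x ^ n)"
  by (cases n) (auto intro!: val_ge_mult_left val_ge_power intro: val_ge_mono)

lemma not_val_ge: "\<not> val_ge v n x \<longleftrightarrow> x \<noteq> 0 \<and> v x < n"
  by (auto simp: val_ge_def)

text \<open>
  The summand of strictly smaller valuation determines the valuation of a sum.
\<close>

lemma v_add_dominant:
  assumes "x \<noteq> 0" "val_ge v (v x + 1) y" shows "x + y \<noteq> 0" "v (x + y) = v x"
proof -
  show nz: "x + y \<noteq> 0"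
  proof
    assume "x + y = 0"
    then have "x = - y" by (simp add: eq_neg_iff_add_eq_0)
    then show False using assms val_geD[of "v x + 1" y] v_minus[of y] by auto
  qed
  have "val_ge v (v x) (x + y)"
    using assms by (intro val_ge_add) (auto simp: val_ge_def)
  moreover have "\<not> val_ge v (v x + 1) (x + y)"
    using val_ge_diff[of "v x + 1" "x + y" y] assms by (auto simp: val_ge_def)
  ultimately show "v (x + y) = v x" using nz by (auto simp: val_ge_def)
qed

definition unif :: 'f where "unif = (SOME x. x \<noteq> 0 \<and> v x = 1)"

lemma unif: "unif \<noteq> 0" "v unif = 1"
  using someI_ex[OF val_surj[of 1]] by (auto simp: unif_def)

lemma v_unif_powi: "v (unif powi n) = n"
  using unif by (cases "n \<ge> 0") (auto simp: power_int_def v_power v_inverse)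

lemma val_ge_unif: "val_ge v n (unif * x) \<longleftrightarrow> val_ge v (n - 1) x"
  using val_ge_mult_cancel[OF unif(1)] unif(2) by simp

lemma val_ge_unif_power: "val_ge v n (unif ^ k * x) \<longleftrightarrow> val_ge v (n - int k) x"
  using val_ge_mult_cancel[of "unif ^ k"] unif v_power[of unif k] by simp

lemma val_ge_iff_unif_mult: "val_ge v 1 x \<longleftrightarrow> (\<exists>y. val_ge v 0 y \<and> x = unif * y)"
proof
  assume "val_ge v 1 x"
  then have "val_ge v 0 (x / unif)" using val_ge_unif[of 1 "x / unif"] unif by simp
  then show "\<exists>y. val_ge v 0 y \<and> x = unif * y" using unif by (intro exI[of _ "x / unif"]) simp
qed (auto simp: val_ge_unif)

subsection \<open>The residue field\<close>

lemma max_ideal_coset: "max_ideal v +>\<^bsub>valuation_ring v\<^esub> x = {y. val_ge v 1 (y - x)}"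
proof -
  have "y \<in> max_ideal v +>\<^bsub>valuation_ring v\<^esub> x" if "val_ge v 1 (y - x)" for y
    using that unfolding a_r_coset_def' valuation_ring_def max_ideal_def
    by (auto intro!: exI[of _ "y - x"])
  then show ?thesis
    by (auto simp: a_r_coset_def' valuation_ring_def max_ideal_def)
qed

text \<open>
  Finiteness of the residue field enters only through this pigeonhole principle: among infinitely
  many tuples of integers two are congruent.
\<close>

lemma residue_pigeonhole:
  fixes g :: "nat \<Rightarrow> nat \<Rightarrow> 'f"
  assumes "\<And>k i. i < n \<Longrightarrow> val_ge v 0 (g k i)"
  obtains a b where "a < b" "\<And>i. i < n \<Longrightarrow> val_ge v 1 (g a i - g b i)"
proof -
  define c where "c k = (\<lambda>i\<in>{..<n}. max_ideal v +>\<^bsub>valuation_ring v\<^esub> g k i)" for k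
  have "c k \<in> {..<n} \<rightarrow>\<^sub>E carrier (residue_field v)" for k
    using assms by (auto simp: c_def residue_field_def FactRing_def A_RCOSETS_def' valuation_ring_def)
  then have "range c \<subseteq> {..<n} \<rightarrow>\<^sub>E carrier (residue_field v)" by auto
  then have "finite (range c)"
    using finite_residue_field by (meson finite_PiE finite_lessThan finite_subset)
  then have "\<not> inj c" using finite_imageD infinite_UNIV_nat by blast
  then obtain a b where ab: "a < b" "c a = c b"
    by (metis injI linorder_neqE_nat)
  have "val_ge v 1 (g a i - g b i)" if "i < n" for i
  proof -
    have "c a i = c b i" using ab by simp
    then have "{y. val_ge v 1 (y - g a i)} = {y. val_ge v 1 (y - g b i)}"
      using that by (simp add: c_def max_ideal_coset)
    moreover have "g a i \<in> {y. val_ge v 1 (y - g a i)}" by simp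
    ultimately show ?thesis by blast
  qed
  then show ?thesis using that ab by blast
qed

text \<open>
  Translates the ring structure of the quotient, whose elements are cosets, into congruences in
  the field.
\<close>

lemma residue_char_eq: "residue_char v = Gcd {n. val_ge v 1 (of_nat n)}"
proof -
  have one: "\<one>\<^bsub>residue_field v\<^esub> = {y. val_ge v 1 (y - 1)}"
    unfolding residue_field_def FactRing_def
    by (simp add: max_ideal_coset) (simp add: valuation_ring_def)
  have zero: "\<zero>\<^bsub>residue_field v\<^esub> = {y. val_ge v 1 y}"
    by (simp add: residue_field_def FactRing_def max_ideal_def)
  have add: "{y. val_ge v 1 (y - x)} \<oplus>\<^bsub>residue_field v\<^esub> {y. val_ge v 1 (y - z)}
      = {y. val_ge v 1 (y - (x + z))}" for x z
  proof -
    have "\<exists>a b. val_ge v 1 (a - x) \<and> val_ge v 1 (b - z) \<and> y = a + b" if "val_ge v 1 (y - (x + z))" for y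
      using that by (intro exI[of _ x] exI[of _ "y - x"]) (simp add: algebra_simps)
    moreover have "val_ge v 1 (a + b - (x + z))" if "val_ge v 1 (a - x)" "val_ge v 1 (b - z)" for a b
      using val_ge_add[OF that] by (simp add: algebra_simps)
    ultimately show ?thesis
      by (auto simp: residue_field_def FactRing_def set_add_def set_mult_def valuation_ring_def)
  qed
  have "[n] \<cdot>\<^bsub>residue_field v\<^esub> \<one>\<^bsub>residue_field v\<^esub> = {y. val_ge v 1 (y - of_nat n)}" for n :: nat
  proof (induction n)
    case 0
    then show ?case by (simp add: add_pow_def nat_pow_def zero)
  next
    case (Suc n)
    then show ?case using add[of "of_nat n" 1] by (simp add: add_pow_def nat_pow_def one add.commute)
  qed
  moreover have "{y. val_ge v 1 (y - of_nat n)} = {y. val_ge v 1 y} \<longleftrightarrow> val_ge v 1 (of_nat n)" for n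
  proof
    assume e: "{y. val_ge v 1 (y - of_nat n)} = {y. val_ge v 1 y}"
    have "of_nat n \<in> {y. val_ge v 1 (y - of_nat n)}" by simp
    then show "val_ge v 1 (of_nat n)" unfolding e by simp
  next
    assume "val_ge v 1 (of_nat n)"
    then show "{y. val_ge v 1 (y - of_nat n)} = {y. val_ge v 1 y}"
      using val_ge_diff[of 1 _ "of_nat n"] val_ge_add[of 1 "_ - of_nat n" "of_nat n"] by force
  qed
  ultimately show ?thesis by (simp add: residue_char_def zero)
qed

subsection \<open>Completeness\<close>

lemma limit_of_series:
  assumes "\<And>k. val_ge v (int k) (c k)"
  obtains l where "\<And>K. val_ge v (int K) (l - (\<Sum>k<K. c k))"
proof -
  define s where "s n = (\<Sum>k<n. c k)" for n
  have tail: "val_ge v (int K) (s n - s K)" if "K \<le> n" for K n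
    using that
  proof (induction n rule: dec_induct)
    case (step n)
    have "val_ge v (int K) (c n)" using assms[of n] step(1) by (auto intro: val_ge_mono)
    then show ?case using val_ge_add[OF step(3)] by (simp add: s_def algebra_simps)
  qed simp
  have "\<forall>N. \<exists>M. \<forall>m\<ge>M. \<forall>n\<ge>M. val_ge v N (s m - s n)"
  proof
    fix N
    have "val_ge v N (s m - s n)" if "m \<ge> nat N" "n \<ge> nat N" for m n
      using val_ge_diff[OF tail[OF that(1)] tail[OF that(2)]] by (auto intro: val_ge_mono)
    then show "\<exists>M. \<forall>m\<ge>M. \<forall>n\<ge>M. val_ge v N (s m - s n)" by blast
  qed
  from complete[OF this] obtain l where l: "\<forall>N. \<exists>M. \<forall>n\<ge>M. val_ge v N (s n - l)" by blast
  have "val_ge v (int K) (l - s K)" for K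
  proof -
    obtain M where "\<forall>n\<ge>M. val_ge v (int K) (s n - l)" using l by blast
    then have "val_ge v (int K) (s (max M K) - l)" by simp
    then show ?thesis using val_ge_diff[OF tail[of K "max M K"]] by fastforce
  qed
  then show ?thesis using that unfolding s_def by blast
qed

text \<open>
  Banach's fixed point theorem on the ball of radius \<open>r\<close> around \<open>a\<close>.  A factor \<open>c\<close> in the maximal
  ideal makes the map contracting.  Every form of Hensel's lemma below is an instance.
\<close>

lemma contraction_fixed_point:
  assumes stable: "\<And>x. val_ge v r (x - a) \<Longrightarrow> val_ge v r (\<phi> x - a)"
    and contr: "\<And>x y. val_ge v r (x - a) \<Longrightarrow> val_ge v r (y - a) \<Longrightarrow>
      \<exists>c. val_ge v 1 c \<and> \<phi> x - \<phi> y = (x - y) * c"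
    and r: "r \<ge> 0"
  obtains x where "val_ge v r (x - a)" "\<phi> x = x"
proof -
  define x where "x n = (\<phi> ^^ n) a" for n
  have ball: "val_ge v r (x n - a)" for n
    by (induction n) (auto simp: x_def stable)
  have step: "val_ge v (r + int n) (x (Suc n) - x n)" for n
  proof (induction n)
    case 0
    then show ?case using ball[of 1] by (simp add: x_def)
  next
    case (Suc n)
    obtain c where "val_ge v 1 c" "\<phi> (x (Suc n)) - \<phi> (x n) = (x (Suc n) - x n) * c"
      using contr ball by blast
    then have "\<phi> (x (Suc n)) - \<phi> (x n) = (x (Suc n) - x n) * c" "val_ge v (r + int n + 1) ((x (Suc n) - x n) * c)"
      using val_ge_mult[OF Suc] by auto
    then show ?case by (simp add: x_def add.assoc add.commute[of 1])
  qed
  obtain l where "\<And>K. val_ge v (int K) (l - (\<Sum>k<K. x (Suc k) - x k))"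
    using limit_of_series[of "\<lambda>k. x (Suc k) - x k"] step r by (metis val_ge_mono le_add_same_cancel2)
  then have "val_ge v (int K) (l - (x K - x 0))" for K
    by (simp add: sum_lessThan_telescope)
  then have lim: "val_ge v (int K) (l + a - x K)" for K by (simp add: x_def algebra_simps)
  have lball: "val_ge v r (l + a - a)"
    using val_ge_add[OF val_ge_mono[OF lim[of "nat r"]] ball[of "nat r"]] r by (simp add: algebra_simps)
  have "val_ge v N (\<phi> (l + a) - (l + a))" for N
  proof -
    let ?K = "nat N"
    obtain c where c: "val_ge v 1 c" "\<phi> (l + a) - \<phi> (x ?K) = (l + a - x ?K) * c"
      using contr lball ball by blast
    have "val_ge v (int ?K + 1) (\<phi> (l + a) - \<phi> (x ?K))"
      unfolding c(2) by (rule val_ge_mult[OF lim c(1)])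
    then have "val_ge v (int ?K) (\<phi> (l + a) - x (Suc ?K))"
      by (auto simp: x_def intro: val_ge_mono)
    moreover have "val_ge v (int ?K) (l + a - x (Suc ?K))"
      using lim[of "Suc ?K"] by (auto intro: val_ge_mono)
    ultimately have "val_ge v (int ?K) ((\<phi> (l + a) - x (Suc ?K)) - (l + a - x (Suc ?K)))"
      by (rule val_ge_diff)
    moreover have "p - q - (r - q) = p - r" for p q r :: 'f by simp
    ultimately have "val_ge v (int ?K) (\<phi> (l + a) - (l + a))" by metis
    then show ?thesis by (rule val_ge_mono) simp
  qed
  then have "\<phi> (l + a) - (l + a) = 0" by (rule val_ge_all)
  then have "\<phi> (l + a) = l + a" by simp
  then show ?thesis by (rule that[OF lball])
qed

end

locale local_field_char_gt3 = local_field v for v :: "'f::field \<Rightarrow> int" +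
  assumes residue_char_gt3: "residue_char v > 3"
begin

lemma small_units: "(2::'f) \<noteq> 0" "v 2 = 0" "(3::'f) \<noteq> 0" "v 3 = 0"
proof -
  have "\<not> val_ge v 1 (of_nat n)" if "n \<in> {2, 3}" for n
  proof
    assume "val_ge v 1 (of_nat n)"
    then have "residue_char v dvd n" by (auto simp: residue_char_eq)
    then show False using residue_char_gt3 that by (auto dest: dvd_imp_le)
  qed
  from this[of 2] this[of 3] have "\<not> val_ge v 1 2" "\<not> val_ge v 1 3" by auto
  moreover have "val_ge v 0 2" "val_ge v 0 3" by (rule val_ge_numeral)+
  ultimately show "(2::'f) \<noteq> 0" "v 2 = 0" "(3::'f) \<noteq> 0" "v 3 = 0"
    by (auto simp: val_ge_def)
qed

lemma four_nonzero: "(4::'f) \<noteq> 0" "v 4 = 0"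
proof -
  have 4: "(4::'f) = 2 * 2" by simp
  show "(4::'f) \<noteq> 0" unfolding 4 by (intro no_zero_divisors small_units)
  show "v 4 = 0" using val_mult[of 2 2] small_units by simp
qed

lemma nine_nonzero: "(9::'f) \<noteq> 0" "v 9 = 0"
proof -
  have 9: "(9::'f) = 3 * 3" by simp
  show "(9::'f) \<noteq> 0" unfolding 9 by (intro no_zero_divisors small_units)
  show "v 9 = 0" using val_mult[of 3 3] small_units by simp
qed

lemma eighty_one_nonzero: "(81::'f) \<noteq> 0"
proof -
  have 81: "(81::'f) = 9 * 9" by simp
  show ?thesis unfolding 81 by (intro no_zero_divisors nine_nonzero)
qed

text \<open>
  A positive integer in the maximal ideal exists because the residue characteristic is not \<open>0\<close>; one
  of its prime factors lies in the maximal ideal too.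
\<close>

lemma residue_prime:
  obtains p :: nat where "prime p" "val_ge v 1 (of_nat p)"
proof -
  have "\<exists>n>0. val_ge v 1 (of_nat n)"
  proof (rule ccontr)
    assume "\<not> ?thesis"
    then have "{n. val_ge v 1 (of_nat n)} \<subseteq> {0}" by auto
    then have "residue_char v = 0" unfolding residue_char_eq Gcd_0_iff .
    then show False using residue_char_gt3 by simp
  qed
  then obtain n where n: "n > 0" "val_ge v 1 (of_nat n)" by blast
  then have "\<exists>p. prime p \<and> val_ge v 1 (of_nat p)"
  proof (induction n rule: less_induct)
    case (less n)
    have "n \<noteq> 1" using less.prems by (auto simp: val_ge_one)
    then obtain p where p: "prime p" "p dvd n" using prime_factor_nat by blast
    then obtain m where m: "n = p * m" by auto
    show ?case
    proof (cases "val_ge v 1 (of_nat p)")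
      case False
      then have "of_nat p \<noteq> (0::'f)" "v (of_nat p) = 0"
        using val_ge_of_nat[of p] by (auto simp: val_ge_def)
      then have "val_ge v 1 (of_nat m)"
        using less.prems val_ge_mult_cancel[of "of_nat p" 1 "of_nat m"] by (simp add: m)
      moreover have "m < n" "m > 0" using m less.prems prime_gt_1_nat[OF p(1)] by auto
      ultimately show ?thesis using less.IH by blast
    qed (use p in blast)
  qed
  then show ?thesis using that by blast
qed

lemma unit_of_nat:
  assumes "prime p" "val_ge v 1 (of_nat p)" "coprime n p"
  shows "of_nat n \<noteq> (0::'f)" "v (of_nat n) = 0"
proof -
  have "\<not> val_ge v 1 (of_nat n)"
  proof
    assume n: "val_ge v 1 (of_nat n)"
    obtain x where "[n * x = Suc 0] (mod p)" using cong_solve_coprime_nat[OF assms(3)] by blast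
    then have "[int (n * x) = 1] (mod int p)" by (metis cong_int_iff of_nat_1 One_nat_def)
    then obtain k where k: "int n * int x = 1 + int p * k"
      by (metis cong_iff_lin cong_sym mult.commute of_nat_mult)
    have "of_int (int n * int x) = (of_int (1 + int p * k) :: 'f)" using k by simp
    then have e: "1 = of_nat n * of_nat x - of_nat p * (of_int k :: 'f)" by simp
    have "val_ge v 0 (of_int k)"
      by (cases k) (auto simp: val_ge_of_nat val_ge_minus simp del: of_nat_Suc)
    then have "val_ge v 1 (of_nat n * of_nat x - of_nat p * (of_int k :: 'f))"
      using n assms(2) val_ge_of_nat by (intro val_ge_diff val_ge_mult_left)
    then show False using e by (simp add: val_ge_one)
  qed
  then show "of_nat n \<noteq> (0::'f)" "v (of_nat n) = 0"
    using val_ge_of_nat[of n] by (auto simp: val_ge_def)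
qed

lemma val_ge_div2: "val_ge v n (x / 2) \<longleftrightarrow> val_ge v n x"
  using val_ge_mult_cancel[of 2 n "x / 2"] small_units by simp

lemma val_ge_div3: "val_ge v n (x / 3) \<longleftrightarrow> val_ge v n x"
  using val_ge_mult_cancel[of 3 n "x / 3"] small_units by simp

lemma val_ge_times3: "val_ge v n (3 * x) \<longleftrightarrow> val_ge v n x"
  using val_ge_mult_cancel[of 3 n x] small_units by simp

text \<open>
  Newton's iteration for \<open>y\<^sup>2 - u\<close>, with the derivative evaluated at \<open>1\<close> throughout.
\<close>

lemma hensel_square_root:
  assumes u: "val_ge v 1 (u - 1)"
  obtains y where "y ^ 2 = u"
proof -
  define \<phi> where "\<phi> x = x - (x ^ 2 - u) / 2" for x
  obtain y where "\<phi> y = y"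
  proof (rule contraction_fixed_point[of 1 1 \<phi>])
    fix x assume x: "val_ge v 1 (x - 1)"
    have "\<phi> x - 1 = (u - 1) / 2 - (x - 1) * (x - 1) / 2"
      using small_units four_nonzero by (simp add: \<phi>_def field_simps power2_eq_square)
    moreover have "val_ge v 1 \<dots>"
      using u x by (intro val_ge_diff) (auto simp: val_ge_div2 intro!: val_ge_mult_left intro: val_ge_mono)
    ultimately show "val_ge v 1 (\<phi> x - 1)" by simp
    fix y assume y: "val_ge v 1 (y - 1)"
    have "val_ge v 1 ((- (x - 1) - (y - 1)) / 2)"
      unfolding val_ge_div2 by (rule val_ge_diff[OF iffD2[OF val_ge_minus x] y])
    moreover have "\<phi> x - \<phi> y = (x - y) * ((- (x - 1) - (y - 1)) / 2)"
      using small_units four_nonzero by (simp add: \<phi>_def field_simps power2_eq_square)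
    ultimately show "\<exists>c. val_ge v 1 c \<and> \<phi> x - \<phi> y = (x - y) * c" by blast
  qed auto
  then have "y ^ 2 = u" using small_units by (simp add: \<phi>_def)
  then show ?thesis using that by blast
qed

text \<open>
  \<open>4 p\<^sup>3 - 3 p\<close> is the first coordinate of the cube of a point \<open>(p, q)\<close> of a norm one torus.  It has
  derivative \<open>9\<close> at \<open>p = 1\<close>, which is a unit, so Newton's iteration converges.
\<close>

lemma hensel_cube_root:
  assumes P: "val_ge v 1 (P - 1)"
  obtains p where "4 * p ^ 3 - 3 * p = P" "val_ge v 1 (p - 1)"
proof -
  define \<phi> where "\<phi> x = x - (4 * x ^ 3 - 3 * x - P) / 9" for x
  note nz = nine_nonzero(1)
  have div9: "val_ge v n (x / 9) \<longleftrightarrow> val_ge v n x" for n x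
    using val_ge_div3[of n "x / 3"] val_ge_div3[of n x] by simp
  have int: "val_ge v 0 x" if "val_ge v 1 (x - 1)" for x
    using val_ge_add[of 0 "x - 1" 1] that val_ge_mono[of 1 "x - 1" 0] by (simp add: val_ge_one)
  obtain p where "val_ge v 1 (p - 1)" "\<phi> p = p"
  proof (rule contraction_fixed_point[of 1 1 \<phi>])
    fix x assume x: "val_ge v 1 (x - 1)"
    have e: "\<phi> x - 1 = (x - 1) - (x - 1) * ((2 * x + 1) ^ 2) / 9 + (P - 1) / 9"
      using nz eighty_one_nonzero by (simp add: \<phi>_def field_simps power2_eq_square power3_eq_cube)
    have "val_ge v 1 ((x - 1) * (2 * x + 1) ^ 2 / 9)"
      unfolding div9 using int[OF x]
      by (intro val_ge_mult_left[OF x] val_ge_power val_ge_add val_ge_mult_left val_ge_numeral) (simp_all add: val_ge_one)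
    then show "val_ge v 1 (\<phi> x - 1)" unfolding e
      by (intro val_ge_add val_ge_diff x) (simp_all add: div9 P)
    fix y assume y: "val_ge v 1 (y - 1)"
    define a b where "a = x - 1" and "b = y - 1"
    have ab: "val_ge v 1 a" "val_ge v 1 b" "val_ge v 0 a" "val_ge v 0 b"
      using x y by (auto simp: a_def b_def intro: val_ge_mono)
    have "val_ge v 1 (- 4 * (a * (3 + a) + b * (3 + a + b)) / 9)"
      using ab unfolding div9
      by (intro val_ge_mult_right val_ge_add val_ge_mult_left) (auto simp: val_ge_minus val_ge_numeral)
    moreover have "\<phi> x - \<phi> y = (x - y) * (- 4 * (a * (3 + a) + b * (3 + a + b)) / 9)"
      using nz eighty_one_nonzero by (simp add: \<phi>_def a_def b_def field_simps power2_eq_square power3_eq_cube)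
    ultimately show "\<exists>c. val_ge v 1 c \<and> \<phi> x - \<phi> y = (x - y) * c" by blast
  qed auto
  moreover from this have "4 * p ^ 3 - 3 * p = P" using nz by (simp add: \<phi>_def)
  ultimately show ?thesis using that by blast
qed

text \<open>
  Modulo the maximal ideal the equation is \<open>a + b y = 0\<close>; solving it for the linear term gives a
  contraction.  The coefficients are those of a cubic form whose Hessian is diagonal.
\<close>

lemma hensel_cubic_root:
  assumes a: "val_ge v 0 a" and b: "b \<noteq> 0" "v b = 0" and \<epsilon>: "val_ge v 1 \<epsilon>"
  obtains y where "a + b * y - 3 * a * \<epsilon> * y ^ 2 - b * \<epsilon> / 3 * y ^ 3 = 0"
proof -
  define \<phi> where "\<phi> y = (3 * a * \<epsilon> * y ^ 2 - a) / b + \<epsilon> / 3 * y ^ 3" for y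
  have divb: "val_ge v n (x / b) \<longleftrightarrow> val_ge v n x" for n x
    using val_ge_mult_cancel[of b n "x / b"] b by simp
  have \<epsilon>0: "val_ge v 0 \<epsilon>" using \<epsilon> by (rule val_ge_mono) simp
  have \<epsilon>3: "val_ge v 1 (\<epsilon> / 3)" using \<epsilon> by (simp add: val_ge_div3)
  obtain y where "\<phi> y = y"
  proof (rule contraction_fixed_point[of 0 0 \<phi>])
    fix x assume "val_ge v 0 (x - 0)"
    then have x: "val_ge v 0 x" by simp
    have "val_ge v 0 ((3 * a * \<epsilon> * x ^ 2 - a) / b)"
      unfolding divb using a \<epsilon>0 x by (intro val_ge_diff val_ge_mult_left val_ge_power val_ge_numeral)
    moreover have "val_ge v 0 (\<epsilon> / 3 * x ^ 3)"
      using \<epsilon>0 x by (intro val_ge_mult_left val_ge_power) (simp_all add: val_ge_div3)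
    ultimately show "val_ge v 0 (\<phi> x - 0)" unfolding \<phi>_def diff_zero by (rule val_ge_add)
    fix y assume "val_ge v 0 (y - 0)"
    then have y: "val_ge v 0 y" by simp
    define c where "c = (3 * a * (x + y)) / b * \<epsilon> + (x * x + x * y + y * y) * (\<epsilon> / 3)"
    have "val_ge v 1 c" unfolding c_def
      using a \<epsilon> \<epsilon>3 x y by (intro val_ge_add val_ge_mult_right)
        (auto simp: divb intro!: val_ge_mult_left val_ge_add val_ge_numeral)
    moreover have "\<phi> x - \<phi> y = (x - y) * c"
      using b by (simp add: \<phi>_def c_def field_simps power2_eq_square power3_eq_cube)
    ultimately show "\<exists>c. val_ge v 1 c \<and> \<phi> x - \<phi> y = (x - y) * c" by blast
  qed auto
  then have "b * \<phi> y = b * y" by simp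
  moreover have "b * \<phi> y = 3 * a * \<epsilon> * y ^ 2 - a + b * \<epsilon> / 3 * y ^ 3"
    using b by (simp add: \<phi>_def field_simps)
  moreover have "s - a + t = c \<Longrightarrow> a + c - s - t = 0" for s t c :: 'f
    by (auto simp: algebra_simps)
  ultimately have "a + b * y - 3 * a * \<epsilon> * y ^ 2 - b * \<epsilon> / 3 * y ^ 3 = 0"
    by metis
  then show ?thesis using that by blast
qed

end

section \<open>The integral closure of the valuation ring\<close>

locale local_closure = local_field_char_gt3 v + separable_closure \<iota>
  for v :: "'f::field \<Rightarrow> int" and \<iota> :: "'f \<Rightarrow> 's::field"
begin

abbreviation OF :: "'s set" where "OF \<equiv> \<iota> ` {x. val_ge v 0 x}"
abbreviation OS :: "'s set" where "OS \<equiv> integral_closure v \<iota>"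
abbreviation mS :: "'s set" where "mS \<equiv> integral_closure_max_ideal v \<iota>"
abbreviation "\<pi> \<equiv> \<iota> unif"

lemma ring_set_OF: "ring_set OF"
proof (rule ring_setI)
  show "1 \<in> OF" using emb_one val_ge_one[of 0] by (intro image_eqI[of _ _ 1]) auto
qed (auto simp: val_ge_diff val_ge_mult_left simp flip: emb_diff emb_mult)

lemma OS_eq: "OS = {z. integral_over OF z}"
proof (intro equalityI subsetI; clarify)
  fix z assume "z \<in> OS"
  then obtain p where p: "lead_coeff p = 1" "\<forall>i. coeff p i \<in> carrier (valuation_ring v)"
    "poly (map_poly \<iota> p) z = 0" by (auto simp: integral_closure_def)
  then have "map_poly \<iota> p \<in> polys_over OF"
    by (auto simp: polys_over_def coeff_hom[OF hom_emb] valuation_ring_def)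
  then show "integral_over OF z"
    unfolding integral_over_def using p hom_monic[OF hom_emb p(1)]
    by (intro bexI[of _ "map_poly \<iota> p"] conjI)
next
  fix z assume "integral_over OF z"
  then obtain q where q: "q \<in> polys_over OF" "lead_coeff q = 1" "poly q z = 0"
    by (auto simp: integral_over_def)
  (* A section of the embedding, to pull the coefficients back. *)
  define g where "g y = (SOME x. val_ge v 0 x \<and> \<iota> x = y)" for y
  have g: "val_ge v 0 (g y)" "\<iota> (g y) = y" if "y \<in> OF" for y
  proof -
    have "\<exists>x. val_ge v 0 x \<and> \<iota> x = y" using that by auto
    from someI_ex[OF this] show "val_ge v 0 (g y)" "\<iota> (g y) = y" by (auto simp: g_def)
  qed
  have g0: "g 0 = 0" using g(2)[OF rs_0[OF ring_set_OF]] by (simp add: emb_eq_0)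
  have g1: "g 1 = 1" using g(2)[OF rs_1[OF ring_set_OF]] emb_eq[of "g 1" 1] by (simp add: emb_one)
  have c: "coeff (map_poly g q) i = g (coeff q i)" for i by (simp add: coeff_map_poly g0)
  have inj: "map_poly \<iota> (map_poly g q) = q"
    using q(1) by (intro poly_eqI) (simp add: coeff_hom[OF hom_emb] c g(2) polys_over_def)
  have "degree (map_poly g q) = degree q"
  proof (rule antisym)
    show "degree (map_poly g q) \<le> degree q" by (rule degree_le) (simp add: c coeff_eq_0 g0)
    show "degree q \<le> degree (map_poly g q)" using q(2) by (intro le_degree) (simp add: c g1)
  qed
  then have "lead_coeff (map_poly g q) = 1" using q(2) by (simp add: c g1)
  then show "z \<in> OS"
    unfolding integral_closure_def using q g(1) inj
    by (intro CollectI exI[of _ "map_poly g q"]) (auto simp: c polys_over_def valuation_ring_def)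
qed

lemma ring_set_OS: "ring_set OS"
  unfolding OS_eq by (rule ring_set_integral_over[OF ring_set_OF])

lemmas OS_1 = rs_1[OF ring_set_OS] and OS_0 = rs_0[OF ring_set_OS] and OS_add = rs_add[OF ring_set_OS]
  and OS_diff = rs_diff[OF ring_set_OS] and OS_mult = rs_mult[OF ring_set_OS]
  and OS_minus = rs_minus[OF ring_set_OS] and OS_power = rs_power[OF ring_set_OS]
  and OS_sum = rs_sum[OF ring_set_OS] and OS_prod = rs_prod[OF ring_set_OS]
  and OS_of_nat = rs_of_nat[OF ring_set_OS] and OS_numeral = rs_numeral[OF ring_set_OS]

lemma OS_emb: "val_ge v 0 x \<Longrightarrow> \<iota> x \<in> OS"
  unfolding OS_eq using integral_over_base[OF ring_set_OF] by auto

lemma OS_root: "n > 0 \<Longrightarrow> z ^ n \<in> OS \<Longrightarrow> z \<in> OS"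
  unfolding OS_eq using integral_over_root[OF ring_set_OF] by auto

lemma OS_poly_root:
  assumes "lead_coeff p = 1" "\<And>i. val_ge v 0 (coeff p i)" "poly (map_poly \<iota> p) z = 0"
  shows "z \<in> OS"
  using assms by (auto simp: integral_closure_def valuation_ring_def)

text \<open>
  Valuation rings are integrally closed: if \<open>x\<close> is not integral then \<open>1 / x\<close> is, and dividing a monic
  relation of degree \<open>n\<close> by \<open>x\<^sup>n\<^sup>-\<^sup>1\<close> writes \<open>x\<close> as a polynomial in \<open>1 / x\<close>.
\<close>

lemma OS_emb_iff: "\<iota> x \<in> OS \<longleftrightarrow> val_ge v 0 x"
proof
  assume "\<iota> x \<in> OS"
  then obtain n a where n: "n > 0" "\<And>i. i < n \<Longrightarrow> a i \<in> OF" "\<iota> x ^ n = (\<Sum>i<n. a i * \<iota> x ^ i)"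
    using integral_power_reduction[OF ring_set_OF] unfolding OS_eq by blast
  show "val_ge v 0 x"
  proof (rule ccontr)
    assume "\<not> ?thesis"
    then have x: "x \<noteq> 0" "v x < 0" by (auto simp: not_val_ge)
    then have inv: "val_ge v 0 (inverse x)" by (simp add: val_ge_def v_inverse)
    have "\<forall>i. \<exists>b. i < n \<longrightarrow> val_ge v 0 b \<and> a i = \<iota> b" using n(2) by blast
    then obtain b where b: "\<And>i. i < n \<Longrightarrow> val_ge v 0 (b i)" "\<And>i. i < n \<Longrightarrow> a i = \<iota> (b i)"
      by metis
    have "\<iota> (x ^ n) = \<iota> (\<Sum>i<n. b i * x ^ i)"
      using n(3) b(2) hom_sum[OF hom_emb, of "{..<n}" "\<lambda>i. b i * x ^ i"] by (simp add: emb_power emb_mult)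
    then have e: "x ^ n = (\<Sum>i<n. b i * x ^ i)" by (simp add: emb_eq)
    have "x = x ^ n * inverse x ^ (n - 1)"
      using n(1) x(1) by (cases n) (auto simp: field_simps)
    also have "\<dots> = (\<Sum>i<n. b i * (x ^ i * inverse x ^ (n - 1)))"
      by (simp add: e sum_distrib_right mult.assoc)
    also have "\<dots> = (\<Sum>i<n. b i * inverse x ^ (n - 1 - i))"
    proof (intro sum.cong refl)
      fix i assume "i \<in> {..<n}"
      then have "n - 1 = i + (n - 1 - i)" by auto
      then have "inverse x ^ (n - 1) = inverse x ^ i * inverse x ^ (n - 1 - i)"
        by (metis power_add)
      then show "b i * (x ^ i * inverse x ^ (n - 1)) = b i * inverse x ^ (n - 1 - i)"
        using x(1) by (simp add: power_inverse)
    qed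
    finally have "val_ge v 0 x"
      using b(1) inv by (metis (no_types, lifting) lessThan_iff val_ge_mult_left val_ge_power val_ge_sum)
    then show False using x by (simp add: val_ge_def)
  qed
qed (rule OS_emb)

lemma galois_OS:
  assumes "\<sigma> \<in> galois_group \<iota>" "z \<in> OS" shows "\<sigma> z \<in> OS"
proof -
  obtain p where p: "lead_coeff p = 1" "\<forall>i. coeff p i \<in> carrier (valuation_ring v)"
    "poly (map_poly \<iota> p) z = 0" using assms by (auto simp: integral_closure_def)
  note h = galois_hom[OF assms(1)]
  have "map_poly \<sigma> (map_poly \<iota> p) = map_poly \<iota> p"
    by (intro poly_eqI) (simp add: coeff_hom[OF h] coeff_hom[OF hom_emb] galois_emb[OF assms(1)])
  then have "poly (map_poly \<iota> p) (\<sigma> z) = 0"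
    using hom_poly[OF h polys_over_UNIV UNIV_I, of "map_poly \<iota> p" z] p(3) hom_0[OF h] by simp
  then show ?thesis using p by (auto simp: integral_closure_def)
qed

definition piOS :: "'s set" where "piOS = {\<pi> * y | y. y \<in> OS}"

lemma unif_emb_nonzero: "\<pi> \<noteq> 0"
  using unif by (simp add: emb_eq_0)

lemma unif_OS: "\<pi> \<in> OS"
  by (rule OS_emb) (simp add: val_ge_def unif)

lemma piOS_iff: "z \<in> piOS \<longleftrightarrow> z / \<pi> \<in> OS"
  using unif_emb_nonzero by (auto simp: piOS_def intro!: exI[of _ "z / \<pi>"])

lemma piOS_OS: "z \<in> piOS \<Longrightarrow> z \<in> OS"
  by (auto simp: piOS_def OS_mult unif_OS)

lemma piOS_diff: "x \<in> piOS \<Longrightarrow> y \<in> piOS \<Longrightarrow> x - y \<in> piOS"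
  by (simp add: piOS_iff diff_divide_distrib OS_diff)

lemma piOS_add: "x \<in> piOS \<Longrightarrow> y \<in> piOS \<Longrightarrow> x + y \<in> piOS"
  by (simp add: piOS_iff add_divide_distrib OS_add)

lemma piOS_0: "0 \<in> piOS"
  by (simp add: piOS_iff OS_0)

lemma piOS_mult: "x \<in> piOS \<Longrightarrow> y \<in> OS \<Longrightarrow> x * y \<in> piOS"
  using OS_mult[of "x / \<pi>" y] by (simp add: piOS_iff)

lemma piOS_mult2: "x \<in> OS \<Longrightarrow> y \<in> piOS \<Longrightarrow> x * y \<in> piOS"
  using piOS_mult[of y x] by (simp add: mult.commute)

lemma piOS_sum: "(\<And>i. i \<in> A \<Longrightarrow> f i \<in> piOS) \<Longrightarrow> sum f A \<in> piOS"
  by (induction A rule: infinite_finite_induct) (auto simp: piOS_0 piOS_add)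

lemma piOS_emb: "\<iota> x \<in> piOS \<longleftrightarrow> val_ge v 1 x"
  using OS_emb_iff[of "x / unif"] val_ge_unif[of 1 "x / unif"] unif by (simp add: piOS_iff emb_divide)

lemma one_notin_piOS: "1 \<notin> piOS"
  using piOS_emb[of 1] by (simp add: emb_one val_ge_one)

text \<open>
  Multiplying \<open>z\<close> by \<open>\<pi>\<^sup>k\<close> multiplies the coefficient of degree \<open>i\<close> of its monic relation of degree \<open>n\<close>
  by \<open>\<pi>\<^sup>k\<^sup>(\<^sup>n\<^sup>-\<^sup>i\<^sup>)\<close>, which makes all coefficients integral for large \<open>k\<close>.
\<close>

lemma clear_denominator: "\<exists>k. \<pi> ^ k * z \<in> OS"
proof -
  obtain P where P: "P \<noteq> 0" "poly (map_poly \<iota> P) z = 0" using annihilator by metis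
  define n where "n = degree P"
  define c where "c = lead_coeff P"
  have c: "c \<noteq> 0" using P by (simp add: c_def)
  have n: "n > 0"
  proof (rule ccontr)
    assume "\<not> ?thesis"
    then have "P = [:c:]" by (metis c_def degree_eq_zeroE lead_coeff_pCons(2) n_def neq0_conv pCons_0_0)
    then show False using P c by (simp add: map_poly_pCons emb_0 emb_eq_0)
  qed
  define a where "a i = coeff P i / c" for i
  define B where "B = Max (insert 0 ((\<lambda>i. - v (a i)) ` {..<n}))"
  define k where "k = nat B"
  have B0: "B \<ge> 0" unfolding B_def by (intro Max_ge) auto
  have B: "- v (a i) \<le> B" if "i < n" for i unfolding B_def using that by (intro Max_ge) auto
  define q where "q = monom 1 n + (\<Sum>i<n. monom (unif ^ (k * (n - i)) * a i) i)"
  have cq: "coeff q i = (if i = n then 1 else if i < n then unif ^ (k * (n - i)) * a i else 0)" for i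
    by (simp add: q_def coeff_sum)
  have dq: "degree q = n"
    by (rule antisym) (auto intro!: degree_le le_degree simp: cq)
  have int: "val_ge v 0 (coeff q i)" for i
  proof (cases "i < n")
    case True
    then have "int k * 1 \<le> int k * int (n - i)" by (intro mult_left_mono) auto
    then have "- int (k * (n - i)) \<le> v (a i)" using B[OF True] B0 by (simp add: k_def)
    then show ?thesis using True by (simp add: cq val_ge_unif_power del: of_nat_mult) (simp add: val_ge_def)
  qed (auto simp: cq val_ge_one)
  have "z ^ n + (\<Sum>i<n. \<iota> (a i) * z ^ i) = 0"
  proof -
    have "0 = (\<Sum>i\<le>n. \<iota> (coeff P i) * z ^ i)"
    proof -
      have "poly (map_poly \<iota> P) z = (\<Sum>i\<le>n. coeff (map_poly \<iota> P) i * z ^ i)"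
        unfolding poly_altdef n_def using hom_degree_le[OF hom_emb, of P]
        by (intro sum.mono_neutral_left) (auto simp: coeff_eq_0)
      then show ?thesis using P(2) by (simp add: coeff_hom[OF hom_emb])
    qed
    also have "\<dots> = \<iota> c * (\<Sum>i\<le>n. \<iota> (a i) * z ^ i)"
      using c by (simp add: sum_distrib_left a_def emb_divide emb_eq_0)
    finally have "(\<Sum>i\<le>n. \<iota> (a i) * z ^ i) = 0" using c by (simp add: emb_eq_0)
    moreover have "a n = 1" using c by (simp add: a_def n_def c_def)
    ultimately show ?thesis by (simp add: lessThan_Suc_atMost[symmetric] emb_one add.commute)
  qed
  then have "0 = \<pi> ^ (k * n) * (z ^ n + (\<Sum>i<n. \<iota> (a i) * z ^ i))" by simp
  also have "\<dots> = (\<pi> ^ k * z) ^ n + (\<Sum>i<n. \<iota> (unif ^ (k * (n - i)) * a i) * (\<pi> ^ k * z) ^ i)"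
  proof -
    have "\<pi> ^ (k * n) * (\<iota> (a i) * z ^ i) = \<iota> (unif ^ (k * (n - i)) * a i) * (\<pi> ^ k * z) ^ i" if "i < n" for i
    proof -
      have "k * n = k * (n - i) + k * i" using that by (simp flip: add_mult_distrib2)
      then show ?thesis by (simp add: emb_mult emb_power power_add power_mult power_mult_distrib)
    qed
    then have "\<pi> ^ (k * n) * (\<Sum>i<n. \<iota> (a i) * z ^ i)
        = (\<Sum>i<n. \<iota> (unif ^ (k * (n - i)) * a i) * (\<pi> ^ k * z) ^ i)"
      unfolding sum_distrib_left by (intro sum.cong) auto
    moreover have "\<pi> ^ (k * n) * z ^ n = (\<pi> ^ k * z) ^ n" by (simp add: power_mult power_mult_distrib)
    ultimately show ?thesis by (simp only: distrib_left)
  qed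
  also have "\<dots> = (\<Sum>i\<le>n. \<iota> (coeff q i) * (\<pi> ^ k * z) ^ i)"
    by (simp add: cq lessThan_Suc_atMost[symmetric] emb_one add.commute)
  also have "\<dots> = poly (map_poly \<iota> q) (\<pi> ^ k * z)"
    using hom_monic(1)[OF hom_emb, of q] by (simp add: poly_altdef coeff_hom[OF hom_emb] dq cq)
  finally have "\<pi> ^ k * z \<in> OS" using int by (intro OS_poly_root[of q]) (auto simp: dq cq)
  then show ?thesis by blast
qed

text \<open>
  Otherwise the inverse of \<open>z\<close> would not become integral after multiplication by any power of the
  uniformizer.
\<close>

lemma eq_0_if_infinitely_divisible:
  assumes "\<And>k. z / \<pi> ^ k \<in> OS" shows "z = 0"
proof (rule ccontr)
  assume z: "z \<noteq> 0"
  obtain k where "\<pi> ^ k * inverse z \<in> OS" using clear_denominator by blast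
  from OS_mult[OF this assms[of "Suc k"]] have "inverse \<pi> \<in> OS"
    using z unif_emb_nonzero by (simp add: field_simps)
  then have "1 \<in> piOS" by (simp add: piOS_iff divide_inverse)
  then show False using one_notin_piOS by simp
qed

text \<open>
  The separable closure is not complete, but the ring generated over the valuation ring by one
  integral element is, because it is finitely generated as a module (\<open>adjoin_coordinates\<close>).  Limits of
  elements of the separable closure are taken in such rings.
\<close>

definition adjoin :: "'s \<Rightarrow> 's set" where "adjoin z = {poly p z | p. p \<in> polys_over OF}"

lemma ring_set_adjoin: "ring_set (adjoin z)"
proof (rule ring_setI)
  note P = ring_set_polys_over[OF ring_set_OF]
  show "1 \<in> adjoin z" unfolding adjoin_def using rs_1[OF P] by (intro CollectI exI[of _ 1]) simp
  fix x y assume "x \<in> adjoin z" "y \<in> adjoin z"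
  then obtain p q where pq: "p \<in> polys_over OF" "x = poly p z" "q \<in> polys_over OF" "y = poly q z"
    unfolding adjoin_def by blast
  show "x - y \<in> adjoin z" unfolding adjoin_def
    using rs_diff[OF P pq(1,3)] pq by (intro CollectI exI[of _ "p - q"]) simp
  show "x * y \<in> adjoin z" unfolding adjoin_def
    using rs_mult[OF P pq(1,3)] pq by (intro CollectI exI[of _ "p * q"]) simp
qed

lemma adjoin_base: "c \<in> OF \<Longrightarrow> c \<in> adjoin z"
  unfolding adjoin_def using polys_over_const[OF ring_set_OF, of c] by (intro CollectI exI[of _ "[:c:]"]) simp

lemma adjoin_gen: "z \<in> adjoin z"
  unfolding adjoin_def using polys_over_monom[OF ring_set_OF rs_1[OF ring_set_OF], of 1]
  by (intro CollectI exI[of _ "monom 1 1"]) (simp add: poly_monom)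

lemma adjoin_subset: "z \<in> OS \<Longrightarrow> adjoin z \<subseteq> OS"
proof
  fix x assume z: "z \<in> OS" and "x \<in> adjoin z"
  then obtain p where p: "p \<in> polys_over OF" "x = poly p z" unfolding adjoin_def by blast
  have "OF \<subseteq> OS" using OS_emb by auto
  then have "p \<in> polys_over OS" using p(1) by (auto simp: polys_over_def)
  then show "x \<in> OS" using poly_in[OF ring_set_OS _ z] p(2) by simp
qed

lemmas adjoin_OS = subsetD[OF adjoin_subset]

lemma adjoin_coordinates:
  assumes "z \<in> OS"
  obtains n where "\<And>x. x \<in> adjoin z \<Longrightarrow> \<exists>a. (\<forall>i. val_ge v 0 (a i)) \<and> x = (\<Sum>i<n. \<iota> (a i) * z ^ i)"
proof -
  obtain m where m: "m \<in> polys_over OF" "lead_coeff m = 1" "poly m z = 0"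
    using assms by (auto simp: OS_eq integral_over_def)
  have "\<exists>a. (\<forall>i. val_ge v 0 (a i)) \<and> x = (\<Sum>i<degree m. \<iota> (a i) * z ^ i)" if x: "x \<in> adjoin z" for x
  proof -
    obtain p where p: "p \<in> polys_over OF" "x = poly p z" using x by (auto simp: adjoin_def)
    obtain k r where r: "r \<in> polys_over OF" "p = m * k + r" "\<forall>i\<ge>degree m. coeff r i = 0"
      using monic_division[OF ring_set_OF m(1,2) p(1)] by blast
    have "\<forall>i. \<exists>a. val_ge v 0 a \<and> coeff r i = \<iota> a" using r(1) by (auto simp: polys_over_def)
    then obtain a where a: "\<And>i. val_ge v 0 (a i)" "\<And>i. coeff r i = \<iota> (a i)" by metis
    have "x = poly r z" using p r m by simp
    also have "\<dots> = (\<Sum>i<degree m. coeff r i * z ^ i)"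
    proof -
      have "(\<Sum>i\<le>degree r. coeff r i * z ^ i) = (\<Sum>i<max (Suc (degree r)) (degree m). coeff r i * z ^ i)"
        by (intro sum.mono_neutral_left) (auto simp: coeff_eq_0)
      also have "\<dots> = (\<Sum>i<degree m. coeff r i * z ^ i)"
        using r(3) by (intro sum.mono_neutral_right) auto
      finally show ?thesis by (simp add: poly_altdef)
    qed
    finally show ?thesis using a by auto
  qed
  then show ?thesis using that by blast
qed

text \<open>
  The limit is taken coordinatewise with respect to the powers of \<open>z\<close>.
\<close>

lemma adjoin_series:
  assumes z: "z \<in> OS" and y: "\<And>k. y k \<in> adjoin z"
  obtains e where "e \<in> adjoin z" "\<And>K. \<exists>x\<in>adjoin z. e - (\<Sum>k<K. \<pi> ^ k * y k) = \<pi> ^ K * x"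
proof -
  note A = ring_set_adjoin[of z]
  obtain n where n: "\<And>x. x \<in> adjoin z \<Longrightarrow> \<exists>a. (\<forall>i. val_ge v 0 (a i)) \<and> x = (\<Sum>i<n. \<iota> (a i) * z ^ i)"
    using adjoin_coordinates[OF z] by blast
  have "\<forall>k. \<exists>a. (\<forall>i. val_ge v 0 (a i)) \<and> y k = (\<Sum>i<n. \<iota> (a i) * z ^ i)" using n y by blast
  then obtain a where a: "\<And>k i. val_ge v 0 (a k i)" "\<And>k. y k = (\<Sum>i<n. \<iota> (a k i) * z ^ i)" by metis
  have "\<exists>l. \<forall>K. val_ge v (int K) (l - (\<Sum>k<K. unif ^ k * a k i))" for i
    using limit_of_series[of "\<lambda>k. unif ^ k * a k i"] a(1) by (metis val_ge_unif_power diff_self)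
  then obtain l where l: "\<And>i K. val_ge v (int K) (l i - (\<Sum>k<K. unif ^ k * a k i))" by metis
  have base: "\<iota> c * z ^ i \<in> adjoin z" if "val_ge v 0 c" for c i
    using that by (intro rs_mult[OF A adjoin_base rs_power[OF A adjoin_gen]]) auto
  define e where "e = (\<Sum>i<n. \<iota> (l i) * z ^ i)"
  have "val_ge v 0 (l i)" for i using l[of 0 i] by simp
  then have "e \<in> adjoin z" unfolding e_def by (intro rs_sum[OF A] base)
  moreover have "\<exists>x\<in>adjoin z. e - (\<Sum>k<K. \<pi> ^ k * y k) = \<pi> ^ K * x" for K
  proof -
    define r where "r i = (l i - (\<Sum>k<K. unif ^ k * a k i)) / unif ^ K" for i
    have r: "l i - (\<Sum>k<K. unif ^ k * a k i) = unif ^ K * r i" for i using unif by (simp add: r_def)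
    have "val_ge v 0 (r i)" for i using l[of K i] unfolding r val_ge_unif_power by simp
    then have "(\<Sum>i<n. \<iota> (r i) * z ^ i) \<in> adjoin z" by (intro rs_sum[OF A] base)
    moreover have "e - (\<Sum>k<K. \<pi> ^ k * y k) = \<pi> ^ K * (\<Sum>i<n. \<iota> (r i) * z ^ i)"
    proof -
      have "(\<Sum>k<K. \<pi> ^ k * y k) = (\<Sum>i<n. \<iota> (\<Sum>k<K. unif ^ k * a k i) * z ^ i)"
        unfolding a(2) sum_distrib_left
        by (subst sum.swap) (simp add: hom_sum[OF hom_emb] emb_mult emb_power sum_distrib_right mult.assoc)
      then have "e - (\<Sum>k<K. \<pi> ^ k * y k) = (\<Sum>i<n. \<iota> (l i - (\<Sum>k<K. unif ^ k * a k i)) * z ^ i)"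
        by (simp add: e_def sum_subtractf emb_diff left_diff_distrib)
      also have "\<dots> = \<pi> ^ K * (\<Sum>i<n. \<iota> (r i) * z ^ i)"
        unfolding r by (simp add: emb_mult emb_power sum_distrib_left mult.assoc)
      finally show ?thesis .
    qed
    ultimately show ?thesis by blast
  qed
  ultimately show ?thesis using that by blast
qed

text \<open>The geometric series inverts \<open>1 - \<pi> a\<close>.\<close>

lemma unit_if_cong_1:
  assumes "1 - u \<in> piOS" shows "inverse u \<in> OS"
proof -
  obtain a where a: "a \<in> OS" "u = 1 - \<pi> * a" using assms by (auto simp: piOS_def algebra_simps)
  note A = ring_set_adjoin[of a]
  obtain e where e: "e \<in> adjoin a" "\<And>K. \<exists>x\<in>adjoin a. e - (\<Sum>k<K. \<pi> ^ k * a ^ k) = \<pi> ^ K * x"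
    using adjoin_series[OF a(1), of "\<lambda>k. a ^ k"] rs_power[OF A adjoin_gen] by blast
  have "(u * e - 1) / \<pi> ^ K \<in> OS" for K
  proof -
    obtain x where x: "x \<in> adjoin a" "e - (\<Sum>k<K. \<pi> ^ k * a ^ k) = \<pi> ^ K * x" using e(2) by blast
    have "u * (\<Sum>k<K. \<pi> ^ k * a ^ k) = 1 - \<pi> ^ K * a ^ K"
      using one_diff_power_eq[of "\<pi> * a" K] by (simp add: a power_mult_distrib)
    then have "u * e - 1 = \<pi> ^ K * (u * x - a ^ K)"
      using x(2) by (simp add: algebra_simps)
    moreover have "u * x - a ^ K \<in> OS"
      unfolding a(2) using adjoin_OS[OF a(1) x(1)] a(1) OS_1 unif_OS by (intro OS_diff OS_mult OS_power)
    ultimately show ?thesis using unif_emb_nonzero by simp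
  qed
  then have "u * e - 1 = 0" by (rule eq_0_if_infinitely_divisible)
  then have "inverse u = e" by (intro inverse_unique) simp
  then show ?thesis using adjoin_OS[OF a(1) e(1)] by simp
qed

text \<open>
  Newton's iteration \<open>e \<mapsto> 3 e\<^sup>2 - 2 e\<^sup>3\<close> lifts an idempotent modulo \<open>\<pi>\<close> to an idempotent of a field,
  which is \<open>0\<close> or \<open>1\<close>.  This replaces the uniqueness of the extension of the valuation.
\<close>

lemma idempotent_mod_unif:
  assumes z: "z \<in> OS" and e0: "e0 \<in> adjoin z" and y0: "y0 \<in> adjoin z" "e0\<^sup>2 - e0 = \<pi> * y0"
  shows "e0 \<in> piOS \<or> e0 - 1 \<in> piOS"
proof -
  note A = ring_set_adjoin[of z]
  define E where "E k = ((\<lambda>e. 3 * e\<^sup>2 - 2 * e ^ 3) ^^ k) e0" for k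
  have E_Suc: "E (Suc k) = 3 * (E k)\<^sup>2 - 2 * E k ^ 3" for k by (simp add: E_def)
  have pw: "\<pi> ^ k \<in> adjoin z" for k
    using unif by (intro rs_power[OF A] adjoin_base) (auto simp: val_ge_def)
  have EA: "E k \<in> adjoin z" for k
    by (induction k) (auto simp: E_def e0 intro!: rs_diff[OF A] rs_mult[OF A] rs_power[OF A] rs_numeral[OF A])
  have idem: "\<exists>y\<in>adjoin z. (E k)\<^sup>2 - E k = \<pi> ^ Suc k * y" for k
  proof (induction k)
    case 0
    then show ?case using y0 by (auto simp: E_def)
  next
    case (Suc k)
    then obtain y where y: "y \<in> adjoin z" "(E k)\<^sup>2 - E k = \<pi> ^ Suc k * y" by blast
    have "(E (Suc k))\<^sup>2 - E (Suc k) = ((E k)\<^sup>2 - E k)\<^sup>2 * (4 * (E k)\<^sup>2 - 4 * E k - 3)"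
      unfolding E_Suc by (simp add: algebra_simps power2_eq_square power3_eq_cube)
    also have "\<dots> = \<pi> ^ Suc (Suc k) * (\<pi> ^ k * y\<^sup>2 * (4 * (E k)\<^sup>2 - 4 * E k - 3))"
      unfolding y(2) by (simp add: algebra_simps power2_eq_square)
    finally have e: "(E (Suc k))\<^sup>2 - E (Suc k)
      = \<pi> ^ Suc (Suc k) * (\<pi> ^ k * y\<^sup>2 * (4 * (E k)\<^sup>2 - 4 * E k - 3))" .
    have "\<pi> ^ k * y\<^sup>2 * (4 * (E k)\<^sup>2 - 4 * E k - 3) \<in> adjoin z"
      by (intro rs_diff[OF A] rs_mult[OF A] rs_power[OF A y(1)] rs_power[OF A EA] rs_numeral[OF A] EA pw)
    with e show ?case by blast
  qed
  have step: "\<exists>y\<in>adjoin z. E (Suc k) - E k = \<pi> ^ k * y \<and> y / \<pi> \<in> OS" for k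
  proof -
    obtain y where y: "y \<in> adjoin z" "(E k)\<^sup>2 - E k = \<pi> ^ Suc k * y" using idem by blast
    have "E (Suc k) - E k = ((E k)\<^sup>2 - E k) * (1 - 2 * E k)"
      unfolding E_Suc by (simp add: algebra_simps power2_eq_square power3_eq_cube)
    also have "\<dots> = \<pi> ^ k * (\<pi> * (y * (1 - 2 * E k)))" unfolding y(2) by simp
    finally have e: "E (Suc k) - E k = \<pi> ^ k * (\<pi> * (y * (1 - 2 * E k)))" .
    have m: "y * (1 - 2 * E k) \<in> adjoin z"
      using y(1) EA by (intro rs_diff[OF A] rs_mult[OF A] rs_numeral[OF A] rs_1[OF A])
    have "\<pi> * (y * (1 - 2 * E k)) \<in> adjoin z" using rs_mult[OF A pw[of 1] m] by simp
    moreover have "\<pi> * (y * (1 - 2 * E k)) / \<pi> \<in> OS" using adjoin_OS[OF z m] unif_emb_nonzero by simp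
    ultimately show ?thesis using e by blast
  qed
  then obtain y where y: "\<And>k. y k \<in> adjoin z" "\<And>k. E (Suc k) - E k = \<pi> ^ k * y k" "\<And>k. y k / \<pi> \<in> OS"
    by metis
  obtain s where s: "s \<in> adjoin z" "\<And>K. \<exists>x\<in>adjoin z. s - (\<Sum>k<K. \<pi> ^ k * y k) = \<pi> ^ K * x"
    using adjoin_series[OF z, of y] y(1) by blast
  define e where "e = e0 + s"
  have near: "\<exists>x\<in>adjoin z. e - E K = \<pi> ^ K * x" for K
  proof -
    have "E K - e0 = (\<Sum>k<K. E (Suc k) - E k)" unfolding sum_lessThan_telescope by (simp add: E_def)
    then have "E K = e0 + (\<Sum>k<K. \<pi> ^ k * y k)" by (simp add: y(2) algebra_simps)
    then have "e - E K = s - (\<Sum>k<K. \<pi> ^ k * y k)" by (simp add: e_def)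
    then show ?thesis using s(2)[of K] by simp
  qed
  have "(e\<^sup>2 - e) / \<pi> ^ K \<in> OS" for K
  proof -
    obtain x where x: "x \<in> adjoin z" "e - E K = \<pi> ^ K * x" using near by blast
    obtain w where w: "w \<in> adjoin z" "(E K)\<^sup>2 - E K = \<pi> ^ Suc K * w" using idem by blast
    have "e\<^sup>2 - e = ((E K)\<^sup>2 - E K) + (e - E K) * (2 * E K - 1 + (e - E K))"
      by (simp add: algebra_simps power2_eq_square)
    also have "\<dots> = \<pi> ^ K * (\<pi> * w + x * (2 * E K - 1 + \<pi> ^ K * x))"
      unfolding x w by (simp add: algebra_simps)
    finally have "e\<^sup>2 - e = \<pi> ^ K * (\<pi> * w + x * (2 * E K - 1 + \<pi> ^ K * x))" .
    moreover have "\<pi> * w + x * (2 * E K - 1 + \<pi> ^ K * x) \<in> adjoin z"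
      using x w EA pw[of 1] pw
      by (intro rs_add[OF A] rs_diff[OF A] rs_mult[OF A] rs_numeral[OF A] rs_1[OF A]) auto
    ultimately show ?thesis using adjoin_OS[OF z] unif_emb_nonzero by simp
  qed
  then have "e\<^sup>2 - e = 0" by (rule eq_0_if_infinitely_divisible)
  then have "e * (e - 1) = 0" by (simp add: algebra_simps power2_eq_square)
  then have "e = 0 \<or> e = 1" by simp
  moreover obtain x where x: "x \<in> adjoin z" "e - E 1 = \<pi> * x" using near[of 1] by auto
  have "e - e0 = \<pi> * (x + y 0 / \<pi>)"
    using x(2) y(2)[of 0] unif_emb_nonzero by (simp add: E_def algebra_simps)
  moreover have "x + y 0 / \<pi> \<in> OS" using adjoin_OS[OF z x(1)] y(3) by (intro OS_add)
  ultimately have "e - e0 \<in> piOS" by (auto simp: piOS_def)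
  with \<open>e = 0 \<or> e = 1\<close> piOS_diff[OF piOS_0, of "e - e0"] show ?thesis by auto
qed

text \<open>
  By the pigeonhole principle some power of an integral element is idempotent modulo the
  uniformizer, hence congruent to \<open>0\<close> or \<open>1\<close>.
\<close>

lemma power_dichotomy:
  assumes z: "z \<in> OS"
  shows "\<exists>m>0. z ^ m \<in> piOS \<or> z ^ m - 1 \<in> piOS"
proof -
  note A = ring_set_adjoin[of z]
  obtain n where n: "\<And>x. x \<in> adjoin z \<Longrightarrow> \<exists>a. (\<forall>i. val_ge v 0 (a i)) \<and> x = (\<Sum>i<n. \<iota> (a i) * z ^ i)"
    using adjoin_coordinates[OF z] by blast
  have "\<forall>k. \<exists>a. (\<forall>i. val_ge v 0 (a i)) \<and> z ^ k = (\<Sum>i<n. \<iota> (a i) * z ^ i)"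
    using n rs_power[OF A adjoin_gen] by blast
  then obtain g where g: "\<And>k i. val_ge v 0 (g k i)" "\<And>k. z ^ k = (\<Sum>i<n. \<iota> (g k i) * z ^ i)" by metis
  obtain a b where ab: "a < b" "\<And>i. i < n \<Longrightarrow> val_ge v 1 (g a i - g b i)"
    using residue_pigeonhole[of n g] g(1) by blast
  define J where "J = {\<pi> * y | y. y \<in> adjoin z}"
  have J_mult: "x * y \<in> J" if "x \<in> J" "y \<in> adjoin z" for x y
    using that rs_mult[OF A] unfolding J_def by (auto simp: mult.assoc)
  have J_add: "x + y \<in> J" if xy: "x \<in> J" "y \<in> J" for x y
  proof -
    obtain x' y' where "x = \<pi> * x'" "y = \<pi> * y'" "x' \<in> adjoin z" "y' \<in> adjoin z"
      using xy by (auto simp: J_def)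
    then show ?thesis unfolding J_def using rs_add[OF A]
      by (intro CollectI exI[of _ "x' + y'"]) (simp add: distrib_left)
  qed
  define l where "l = b - a"
  have l: "l > 0" "b = a + l" using ab by (auto simp: l_def)
  have base: "z ^ (a + l) - z ^ a \<in> J"
  proof -
    have "\<forall>i. \<exists>c. i < n \<longrightarrow> val_ge v 0 c \<and> g b i - g a i = unif * c"
      using ab(2) val_ge_iff_unif_mult val_ge_diff_swap by blast
    then obtain c where c: "\<And>i. i < n \<Longrightarrow> val_ge v 0 (c i)" "\<And>i. i < n \<Longrightarrow> g b i - g a i = unif * c i"
      by metis
    have "z ^ b - z ^ a = (\<Sum>i<n. \<iota> (g b i - g a i) * z ^ i)"
      by (simp add: g(2)[of a] g(2)[of b] sum_subtractf emb_diff left_diff_distrib)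
    also have "\<dots> = \<pi> * (\<Sum>i<n. \<iota> (c i) * z ^ i)"
      using c(2) by (simp add: sum_distrib_left emb_mult mult.assoc)
    finally have "z ^ (a + l) - z ^ a = \<pi> * (\<Sum>i<n. \<iota> (c i) * z ^ i)" by (simp add: l)
    moreover have "(\<Sum>i<n. \<iota> (c i) * z ^ i) \<in> adjoin z"
      using c(1) by (intro rs_sum[OF A] rs_mult[OF A adjoin_base rs_power[OF A adjoin_gen]]) auto
    ultimately show ?thesis unfolding J_def by blast
  qed
  have shift: "z ^ (a + t + l * j) - z ^ (a + t) \<in> J" for t j
  proof (induction j)
    case 0
    then show ?case unfolding J_def using rs_0[OF A] by (auto intro!: exI[of _ 0])
  next
    case (Suc j)
    have "z ^ (a + t + l * Suc j) - z ^ (a + t + l * j) = (z ^ (a + l) - z ^ a) * z ^ (t + l * j)"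
      by (simp add: algebra_simps power_add)
    then have "z ^ (a + t + l * Suc j) - z ^ (a + t + l * j) \<in> J"
      using J_mult[OF base rs_power[OF A adjoin_gen]] by simp
    from J_add[OF this Suc] show ?case by simp
  qed
  (* A multiple of the period l that is at least a, so that the power with exponent m is idempotent. *)
  define m where "m = l * (a + 1)"
  have m: "m > 0" "a \<le> m" using l(1) by (auto simp: m_def) (metis add_leD1 mult_le_mono1 nat_mult_1 Suc_leI add.commute le_SucI mult_Suc_right)
  have "z ^ (a + (m - a) + l * (a + 1)) - z ^ (a + (m - a)) \<in> J" by (rule shift)
  moreover have "a + (m - a) = m" "l * (a + 1) = m" using m by (simp_all add: m_def)
  ultimately have "(z ^ m)\<^sup>2 - z ^ m \<in> J" by (simp only: power2_eq_square power_add)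
  then obtain y where "y \<in> adjoin z" "(z ^ m)\<^sup>2 - z ^ m = \<pi> * y" by (auto simp: J_def)
  then show ?thesis using idempotent_mod_unif[OF z rs_power[OF A adjoin_gen]] m(1) by blast
qed

text \<open>
  An element with a power congruent to \<open>1\<close> is a unit, so by \<open>power_dichotomy\<close> the non-units are those
  with a power divisible by the uniformizer.  From this the ideal properties of the non-units follow.
\<close>

lemma mS_iff: "z \<in> mS \<longleftrightarrow> z \<in> OS \<and> (\<exists>m>0. z ^ m \<in> piOS)"
proof
  assume "z \<in> mS"
  then have z: "z \<in> OS" "z = 0 \<or> inverse z \<notin> OS" by (auto simp: integral_closure_max_ideal_def)
  obtain m where m: "m > 0" "z ^ m \<in> piOS \<or> z ^ m - 1 \<in> piOS" using power_dichotomy[OF z(1)] by blast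
  have "z ^ m \<in> piOS" if "z ^ m - 1 \<in> piOS"
  proof (cases "z = 0")
    case False
    have "inverse (z ^ m) \<in> OS" using piOS_diff[OF piOS_0 that] by (intro unit_if_cong_1) simp
    then have "z ^ (m - 1) * inverse (z ^ m) \<in> OS" using z(1) by (intro OS_mult OS_power)
    moreover have "z ^ (m - 1) * inverse (z ^ m) = inverse z"
      using False m(1) by (cases m) (auto simp: field_simps)
    ultimately show ?thesis using z(2) False by simp
  qed (use m piOS_0 in \<open>simp add: power_0_left\<close>)
  then show "z \<in> OS \<and> (\<exists>m>0. z ^ m \<in> piOS)" using z m by blast
next
  assume "z \<in> OS \<and> (\<exists>m>0. z ^ m \<in> piOS)"
  then obtain m where z: "z \<in> OS" "m > 0" "z ^ m \<in> piOS" by blast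
  have "inverse z \<notin> OS" if "z \<noteq> 0"
  proof
    assume "inverse z \<in> OS"
    from piOS_mult[OF z(3) OS_power[OF this, of m]] that have "1 \<in> piOS" by (simp add: power_inverse)
    then show False using one_notin_piOS by simp
  qed
  then show "z \<in> mS" using z(1) by (auto simp: integral_closure_max_ideal_def)
qed

lemma mS_OS: "z \<in> mS \<Longrightarrow> z \<in> OS"
  by (simp add: mS_iff)

lemma piOS_mS: "z \<in> piOS \<Longrightarrow> z \<in> mS"
  unfolding mS_iff by (auto simp: piOS_OS intro!: exI[of _ 1])

lemma mS_emb: "\<iota> x \<in> mS \<longleftrightarrow> val_ge v 1 x"
proof
  assume "\<iota> x \<in> mS"
  then obtain m where "m > 0" "\<iota> (x ^ m) \<in> piOS" "val_ge v 0 x"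
    using OS_emb_iff by (auto simp: mS_iff emb_power)
  then have "val_ge v 1 (x ^ m)" "val_ge v 0 x" "m > 0" using piOS_emb by auto
  then show "val_ge v 1 x"
    by (cases "x = 0"; cases "v x = 0") (auto simp: val_ge_def v_power)
qed (simp add: piOS_emb piOS_mS)

lemma one_notin_mS: "1 \<notin> mS"
  using mS_emb[of 1] by (simp add: emb_one val_ge_one)

lemma mS_mult: "x \<in> mS \<Longrightarrow> y \<in> OS \<Longrightarrow> x * y \<in> mS"
  unfolding mS_iff by (auto simp: OS_mult power_mult_distrib intro!: piOS_mult OS_power)

lemma mS_mult2: "x \<in> OS \<Longrightarrow> y \<in> mS \<Longrightarrow> x * y \<in> mS"
  using mS_mult[of y x] by (simp add: mult.commute)

lemma mS_prime: "x \<in> OS \<Longrightarrow> y \<in> OS \<Longrightarrow> x * y \<in> mS \<Longrightarrow> x \<in> mS \<or> y \<in> mS"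
  by (auto simp: integral_closure_max_ideal_def OS_mult)

lemma mS_power: "z \<in> OS \<Longrightarrow> z ^ n \<in> mS \<Longrightarrow> z \<in> mS"
proof (induction n)
  case 0
  then show ?case using one_notin_mS by simp
next
  case (Suc n)
  then show ?case using mS_prime[of z "z ^ n"] OS_power by auto
qed

lemma mS_root: "n > 0 \<Longrightarrow> z ^ n \<in> mS \<Longrightarrow> z \<in> mS"
  using mS_power OS_root mS_OS by blast

lemma mS_unit:
  assumes "z \<in> OS" "z \<notin> mS" shows "z \<noteq> 0" "inverse z \<in> OS"
  using assms by (auto simp: integral_closure_max_ideal_def)

lemma one_minus_mS: "x \<in> mS \<Longrightarrow> 1 - x \<notin> mS"
proof
  assume x: "x \<in> mS" and y: "1 - x \<in> mS"
  obtain m where m: "m > 0" "x ^ m \<in> piOS" using x by (auto simp: mS_iff)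
  have "1 - (1 - x ^ m) \<in> piOS" using m by simp
  then have inv: "inverse (1 - x ^ m) \<in> OS" by (rule unit_if_cong_1)
  have "1 - x ^ m \<noteq> 0" using m(2) one_notin_piOS by auto
  moreover have "1 - x ^ m \<in> mS"
    using one_diff_power_eq[of x m] mS_mult[OF y OS_sum[of "{..<m}" "\<lambda>i. x ^ i"]] OS_power[OF mS_OS[OF x]] by simp
  ultimately show False using mS_mult[OF _ inv, of "1 - x ^ m"] one_notin_mS by simp
qed

lemma mS_diff: "x - y \<in> mS" if x: "x \<in> mS" and y: "y \<in> mS"
proof (rule ccontr)
  assume n: "x - y \<notin> mS"
  have OS: "x - y \<in> OS" using x y by (intro OS_diff mS_OS)
  note u = mS_unit[OF OS n]
  have "x / (x - y) \<in> mS" "- y / (x - y) \<in> mS"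
    using mS_mult[OF x u(2)] mS_mult[OF y OS_minus[OF u(2)]] by (simp_all add: divide_inverse)
  moreover have "1 - x / (x - y) = - y / (x - y)" using u(1) by (simp add: field_simps)
  ultimately show False using one_minus_mS by metis
qed

lemma mS_0: "0 \<in> mS"
  by (simp add: piOS_0 piOS_mS)

lemma mS_minus: "x \<in> mS \<Longrightarrow> - x \<in> mS"
  using mS_diff[OF mS_0] by force

lemma mS_add: "x \<in> mS \<Longrightarrow> y \<in> mS \<Longrightarrow> x + y \<in> mS"
  using mS_diff[of x "- y"] mS_minus by force

lemma galois_mS: "\<sigma> \<in> galois_group \<iota> \<Longrightarrow> z \<in> mS \<Longrightarrow> \<sigma> z \<in> mS"
proof -
  assume s: "\<sigma> \<in> galois_group \<iota>" and z: "z \<in> mS"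
  note h = galois_hom[OF s]
  obtain m y where m: "m > 0" "z ^ m = \<pi> * y" "y \<in> OS" using z by (auto simp: mS_iff piOS_def)
  have "\<sigma> z ^ m = \<pi> * \<sigma> y"
    using m(2) by (metis UNIV_I galois_emb[OF s] hom_mult[OF h] hom_power[OF h])
  then show ?thesis unfolding mS_iff using m galois_OS[OF s] z mS_OS by (auto simp: piOS_def)
qed

end

section \<open>Finite Galois-stable sets and independence of automorphisms\<close>

context separable_closure
begin

lemma galois_inverse:
  assumes "\<sigma> \<in> galois_group \<iota>"
  obtains \<tau> where "\<tau> \<in> galois_group \<iota>" "\<And>x. \<tau> (\<sigma> x) = x" "\<And>x. \<sigma> (\<tau> x) = x"
proof -
  have b: "bij \<sigma>" using assms by (simp add: galois_group_def)
  note h = galois_hom[OF assms]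
  have l: "inv_into UNIV \<sigma> (\<sigma> x) = x" and r: "\<sigma> (inv_into UNIV \<sigma> x) = x" for x
    using b by (auto simp: bij_is_inj surj_f_inv_f[OF bij_is_surj[OF b]])
  have "inv_into UNIV \<sigma> (x + y) = inv_into UNIV \<sigma> x + inv_into UNIV \<sigma> y" for x y
    by (rule inv_f_eq[OF bij_is_inj[OF b]]) (simp add: hom_add[OF h] r)
  moreover have "inv_into UNIV \<sigma> (x * y) = inv_into UNIV \<sigma> x * inv_into UNIV \<sigma> y" for x y
    by (rule inv_f_eq[OF bij_is_inj[OF b]]) (simp add: hom_mult[OF h] r)
  moreover have "inv_into UNIV \<sigma> (\<iota> a) = \<iota> a" for a
    by (rule inv_f_eq[OF bij_is_inj[OF b]]) (rule galois_emb[OF assms])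
  ultimately have "inv_into UNIV \<sigma> \<in> galois_group \<iota>"
    using bij_imp_bij_inv[OF b] by (simp add: galois_group_def)
  then show ?thesis using that l r by blast
qed

lemma galois_inj: "\<sigma> \<in> galois_group \<iota> \<Longrightarrow> \<sigma> x = \<sigma> y \<longleftrightarrow> x = y"
  by (auto simp: galois_group_def bij_def inj_def)

lemma galois_root:
  assumes "\<sigma> \<in> galois_group \<iota>" "poly (map_poly \<iota> P) z = 0"
  shows "poly (map_poly \<iota> P) (\<sigma> z) = 0"
proof -
  note h = galois_hom[OF assms(1)]
  have "map_poly \<sigma> (map_poly \<iota> P) = map_poly \<iota> P"
    by (intro poly_eqI) (simp add: coeff_hom[OF h] coeff_hom[OF hom_emb] galois_emb[OF assms(1)])
  then show ?thesis
    using hom_poly[OF h polys_over_UNIV UNIV_I, of "map_poly \<iota> P" z] assms(2) hom_0[OF h] by simp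
qed

definition galois_stable :: "'s set \<Rightarrow> bool"
  where "galois_stable R \<longleftrightarrow> finite R \<and> (\<forall>\<sigma>\<in>galois_group \<iota>. \<sigma> ` R \<subseteq> R)"

text \<open>
  Adjoin to each element all roots of some polynomial over the base field which it satisfies.
\<close>

lemma galois_stable_superset:
  assumes "finite S" obtains R where "galois_stable R" "S \<subseteq> R"
proof -
  have "\<forall>z. \<exists>P. map_poly \<iota> P \<noteq> 0 \<and> poly (map_poly \<iota> P) z = 0" using annihilator by metis
  then obtain P where P: "\<And>z. map_poly \<iota> (P z) \<noteq> 0" "\<And>z. poly (map_poly \<iota> (P z)) z = 0" by metis
  define R where "R = (\<Union>z\<in>S. {w. poly (map_poly \<iota> (P z)) w = 0})"
  have "finite R" unfolding R_def using assms P(1) by (auto intro: poly_roots_finite)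
  then have "galois_stable R" unfolding galois_stable_def using galois_root by (fastforce simp: R_def)
  moreover have "S \<subseteq> R" using P(2) by (auto simp: R_def)
  ultimately show ?thesis using that by blast
qed

lemma agree_on_fixed:
  assumes "\<sigma> \<in> galois_group \<iota>" "\<tau> \<in> galois_group \<iota>" "\<And>x. x \<in> R \<Longrightarrow> \<sigma> x = \<tau> x"
    and x: "\<And>u. u \<in> fixing_group \<iota> R \<Longrightarrow> u x = x"
  shows "\<sigma> x = \<tau> x"
proof -
  obtain \<rho> where \<rho>: "\<rho> \<in> galois_group \<iota>" "\<And>x. \<rho> (\<tau> x) = x" "\<And>x. \<tau> (\<rho> x) = x"
    using galois_inverse[OF assms(2)] by blast
  have "\<rho> \<circ> \<sigma> \<in> fixing_group \<iota> R"
    using galois_group_comp[OF \<rho>(1) assms(1)] assms(3) \<rho>(2) by (simp add: fixing_group_def)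
  then have "\<rho> (\<sigma> x) = x" using x by fastforce
  then show ?thesis by (metis \<rho>(3))
qed

text \<open>
  Representatives of the Galois group modulo the automorphisms fixing \<open>R\<close>.  There are finitely many
  since each is determined by a permutation of \<open>R\<close>.  Translation permutes the classes, whence the last
  property, which makes sums over \<open>T\<close> usable as traces.
\<close>

lemma transversal:
  assumes R: "galois_stable R"
  obtains T where "finite T" "T \<subseteq> galois_group \<iota>"
    "\<And>\<sigma>. \<sigma> \<in> galois_group \<iota> \<Longrightarrow> \<exists>\<tau>\<in>T. \<forall>x\<in>R. \<tau> x = \<sigma> x"
    "\<And>\<tau> \<tau>'. \<tau> \<in> T \<Longrightarrow> \<tau>' \<in> T \<Longrightarrow> \<forall>x\<in>R. \<tau> x = \<tau>' x \<Longrightarrow> \<tau> = \<tau>'"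
    "\<And>F \<sigma>. (\<And>\<tau> \<tau>'. \<tau> \<in> galois_group \<iota> \<Longrightarrow> \<tau>' \<in> galois_group \<iota> \<Longrightarrow> \<forall>x\<in>R. \<tau> x = \<tau>' x
        \<Longrightarrow> F \<tau> = (F \<tau>' :: 's)) \<Longrightarrow> \<sigma> \<in> galois_group \<iota> \<Longrightarrow> (\<Sum>\<tau>\<in>T. F (\<sigma> \<circ> \<tau>)) = (\<Sum>\<tau>\<in>T. F \<tau>)"
proof -
  define r where "r \<sigma> = (SOME \<tau>. \<tau> \<in> galois_group \<iota> \<and> restrict \<tau> R = restrict \<sigma> R)" for \<sigma>
  have r: "r \<sigma> \<in> galois_group \<iota>" "restrict (r \<sigma>) R = restrict \<sigma> R" if "\<sigma> \<in> galois_group \<iota>" for \<sigma>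
  proof -
    have "\<exists>\<tau>. \<tau> \<in> galois_group \<iota> \<and> restrict \<tau> R = restrict \<sigma> R" using that by blast
    from someI_ex[OF this] show "r \<sigma> \<in> galois_group \<iota>" "restrict (r \<sigma>) R = restrict \<sigma> R"
      by (auto simp: r_def)
  qed
  have r_on: "r \<sigma> x = \<sigma> x" if "\<sigma> \<in> galois_group \<iota>" "x \<in> R" for \<sigma> x
    using fun_cong[OF r(2)[OF that(1)], of x] that(2) by simp
  have r_eq: "r \<sigma> = r \<tau>" if "\<forall>x\<in>R. \<sigma> x = \<tau> x" for \<sigma> \<tau>
  proof -
    have "restrict \<sigma> R = restrict \<tau> R" using that by auto
    then show ?thesis by (simp add: r_def)
  qed
  define T where "T = r ` galois_group \<iota>"
  have TG: "T \<subseteq> galois_group \<iota>" using r by (auto simp: T_def)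
  have T_eq: "\<tau> = \<tau>'" if "\<tau> \<in> T" "\<tau>' \<in> T" "\<forall>x\<in>R. \<tau> x = \<tau>' x" for \<tau> \<tau>'
  proof -
    obtain \<sigma> \<sigma>' where s: "\<sigma> \<in> galois_group \<iota>" "\<tau> = r \<sigma>" "\<sigma>' \<in> galois_group \<iota>" "\<tau>' = r \<sigma>'"
      using \<open>\<tau> \<in> T\<close> \<open>\<tau>' \<in> T\<close> by (auto simp: T_def)
    have "\<forall>x\<in>R. \<sigma> x = \<sigma>' x" using that(3) s r_on by metis
    then show ?thesis using r_eq s by metis
  qed
  have "inj_on (\<lambda>\<tau>. restrict \<tau> R) T"
  proof (rule inj_onI)
    fix x y assume xy: "x \<in> T" "y \<in> T" "restrict x R = restrict y R"
    have "\<forall>z\<in>R. x z = y z"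
    proof
      fix z assume "z \<in> R"
      then show "x z = y z" using fun_cong[OF xy(3), of z] by simp
    qed
    then show "x = y" using T_eq xy by blast
  qed
  moreover have "(\<lambda>\<tau>. restrict \<tau> R) ` T \<subseteq> R \<rightarrow>\<^sub>E R"
    using TG R unfolding galois_stable_def by (fastforce simp: PiE_iff image_subset_iff)
  moreover have "finite (R \<rightarrow>\<^sub>E R)" using R by (auto simp: galois_stable_def intro: finite_PiE)
  ultimately have fin: "finite T" by (meson finite_imageD finite_subset)
  have ex: "\<exists>\<tau>\<in>T. \<forall>x\<in>R. \<tau> x = \<sigma> x" if "\<sigma> \<in> galois_group \<iota>" for \<sigma>
    using r_on[OF that] that by (auto simp: T_def)
  have inv: "(\<Sum>\<tau>\<in>T. F (\<sigma> \<circ> \<tau>)) = (\<Sum>\<tau>\<in>T. F \<tau>)"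
    if F: "\<And>\<tau> \<tau>'. \<tau> \<in> galois_group \<iota> \<Longrightarrow> \<tau>' \<in> galois_group \<iota> \<Longrightarrow> \<forall>x\<in>R. \<tau> x = \<tau>' x \<Longrightarrow> F \<tau> = (F \<tau>' :: 's)"
      and s: "\<sigma> \<in> galois_group \<iota>" for F \<sigma>
  proof -
    have sT: "\<sigma> \<circ> \<tau> \<in> galois_group \<iota>" if "\<tau> \<in> T" for \<tau> using galois_group_comp[OF s] TG that by blast
    have inj: "inj_on (\<lambda>\<tau>. r (\<sigma> \<circ> \<tau>)) T"
    proof (rule inj_onI)
      fix x y assume xy: "x \<in> T" "y \<in> T" "r (\<sigma> \<circ> x) = r (\<sigma> \<circ> y)"
      have "x z = y z" if "z \<in> R" for z
        using r_on[OF sT[OF xy(1)] that] r_on[OF sT[OF xy(2)] that] xy(3) galois_inj[OF s] by simp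
      then show "x = y" using T_eq xy by blast
    qed
    have "(\<lambda>\<tau>. r (\<sigma> \<circ> \<tau>)) ` T \<subseteq> T" using sT by (auto simp: T_def)
    then have im: "(\<lambda>\<tau>. r (\<sigma> \<circ> \<tau>)) ` T = T" by (rule endo_inj_surj[OF fin _ inj])
    have "(\<Sum>\<tau>\<in>T. F \<tau>) = (\<Sum>\<tau>\<in>T. F (r (\<sigma> \<circ> \<tau>)))"
      using sum.reindex[OF inj, of F] im by simp
    also have "\<dots> = (\<Sum>\<tau>\<in>T. F (\<sigma> \<circ> \<tau>))"
      by (intro sum.cong refl F) (use r(1) r_on sT in auto)
    finally show ?thesis by simp
  qed
  show ?thesis by (rule that[OF fin TG ex T_eq inv])
qed

end

text \<open>
  Dedekind's argument, relative to a multiplicatively closed set \<open>E\<close> on which the characters differ: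
  subtracting \<open>\<tau>\<^sub>0(y)\<close> times the relation at \<open>x\<close> from the relation at \<open>x y\<close> removes the character \<open>\<tau>\<^sub>0\<close>.
\<close>

lemma independence_of_characters:
  fixes T :: "('b::monoid_mult \<Rightarrow> 'a::field) set"
  assumes "finite T" and E: "1 \<in> E" "\<And>x y. x \<in> E \<Longrightarrow> y \<in> E \<Longrightarrow> x * y \<in> E"
    and "\<And>\<tau>. \<tau> \<in> T \<Longrightarrow> \<tau> 1 = 1" "\<And>\<tau> x y. \<tau> \<in> T \<Longrightarrow> x \<in> E \<Longrightarrow> y \<in> E \<Longrightarrow> \<tau> (x * y) = \<tau> x * \<tau> y"
    and "\<And>\<tau> \<tau>'. \<tau> \<in> T \<Longrightarrow> \<tau>' \<in> T \<Longrightarrow> \<tau> \<noteq> \<tau>' \<Longrightarrow> \<exists>x\<in>E. \<tau> x \<noteq> \<tau>' x"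
    and "\<And>x. x \<in> E \<Longrightarrow> (\<Sum>\<tau>\<in>T. k \<tau> * \<tau> x) = 0"
    and "\<tau> \<in> T"
  shows "k \<tau> = 0"
  using assms(1,4-)
proof (induction T arbitrary: k \<tau> rule: finite_induct)
  case empty
  then show ?case by simp
next
  case (insert \<tau>0 T)
  have IH: "k \<tau> * (\<tau> y - \<tau>0 y) = 0" if "y \<in> E" "\<tau> \<in> T" for y \<tau>
  proof (rule insert.IH[of "\<lambda>\<tau>. k \<tau> * (\<tau> y - \<tau>0 y)"])
    fix x assume x: "x \<in> E"
    have "k \<tau>0 * \<tau>0 (x * y) + (\<Sum>\<tau>\<in>T. k \<tau> * \<tau> (x * y)) = 0"
      using insert.prems(4)[of "x * y"] insert.hyps E(2)[OF x that(1)] by simp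
    moreover have "(\<Sum>\<tau>\<in>T. k \<tau> * \<tau> (x * y)) = (\<Sum>\<tau>\<in>T. k \<tau> * \<tau> y * \<tau> x)"
    proof (intro sum.cong refl)
      fix \<tau> assume "\<tau> \<in> T"
      then have "\<tau> (x * y) = \<tau> x * \<tau> y" using insert.prems(2) x that(1) by simp
      then show "k \<tau> * \<tau> (x * y) = k \<tau> * \<tau> y * \<tau> x" by simp
    qed
    moreover have "k \<tau>0 * \<tau>0 (x * y) = k \<tau>0 * \<tau>0 x * \<tau>0 y" using insert.prems(2)[of \<tau>0 x y] x that by simp
    moreover have "k \<tau>0 * \<tau>0 x = - (\<Sum>\<tau>\<in>T. k \<tau> * \<tau> x)"
      using insert.prems(4)[OF x] insert.hyps by (simp add: eq_neg_iff_add_eq_0)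
    ultimately have "(\<Sum>\<tau>\<in>T. k \<tau> * \<tau> y * \<tau> x) - (\<Sum>\<tau>\<in>T. k \<tau> * \<tau> x) * \<tau>0 y = 0" by simp
    then show "(\<Sum>\<tau>\<in>T. k \<tau> * (\<tau> y - \<tau>0 y) * \<tau> x) = 0"
      by (simp add: sum_distrib_left algebra_simps sum_subtractf)
  qed (use insert.prems that in auto)
  have T0: "k \<tau> = 0" if "\<tau> \<in> T" for \<tau>
  proof -
    have "\<tau> \<noteq> \<tau>0" using that insert.hyps by auto
    then obtain y where "y \<in> E" "\<tau> y \<noteq> \<tau>0 y" using insert.prems(3)[of \<tau> \<tau>0] \<open>\<tau> \<in> T\<close> by auto
    then show ?thesis using IH[OF _ that] by force
  qed
  moreover have "k \<tau>0 = 0"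
    using insert.prems(4)[OF E(1)] insert.hyps insert.prems(1)[of \<tau>0] T0 by simp
  ultimately show ?case using insert.prems(5) by auto
qed

section \<open>Roots of unity and inertia\<close>

lemma (in separable_closure) separable_splits:
  fixes q :: "'s poly"
  assumes "q \<noteq> 0" "coprime q (pderiv q)"
  shows "\<exists>zs. q = smult (lead_coeff q) (\<Prod>z\<leftarrow>zs. [:-z, 1:])"
  using assms
proof (induction "degree q" arbitrary: q)
  case 0
  then obtain c where "q = [:c:]" by (metis degree_eq_zeroE)
  then show ?case by (intro exI[of _ "[]"]) simp
next
  case (Suc n)
  then obtain z where "poly q z = 0" using separably_closed[of q] by auto
  then obtain q1 where q1: "q = [:-z, 1:] * q1" by (auto simp: poly_eq_0_iff_dvd elim: dvdE)
  have nz: "q1 \<noteq> 0" using Suc.prems q1 by auto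
  have "degree q = degree [:-z, 1:] + degree q1" unfolding q1 using nz by (intro degree_mult_eq) auto
  then have "n = degree q1" using Suc.hyps(2) by simp
  moreover have "coprime q1 (pderiv q1)"
    using Suc.prems(2) separable_factor[of q1 "[:-z, 1:]"] unfolding q1 by (simp only: mult.commute)
  ultimately obtain zs where zs: "q1 = smult (lead_coeff q1) (\<Prod>z\<leftarrow>zs. [:-z, 1:])"
    using Suc.hyps(1)[of q1] nz by auto
  have l: "lead_coeff q = lead_coeff q1" unfolding q1 lead_coeff_mult by simp
  have "q = smult (lead_coeff q) (\<Prod>z\<leftarrow>z # zs. [:-z, 1:])"
    unfolding l by (subst q1, subst zs) (simp del: mult_pCons_left mult_pCons_right add: mult_smult_right)
  then show ?case by blast
qed

context local_closure
begin

text \<open>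
  The residue characteristic, picked as a prime number in the maximal ideal.
\<close>

definition resp :: nat where "resp = (SOME p. prime p \<and> val_ge v 1 (of_nat p))"

lemma resp: "prime resp" "val_ge v 1 (of_nat resp)"
proof -
  have "\<exists>p. prime p \<and> val_ge v 1 (of_nat p)" using residue_prime by blast
  from someI_ex[OF this] show "prime resp" "val_ge v 1 (of_nat resp)" by (auto simp: resp_def)
qed

lemma resp_piOS: "of_nat resp \<in> piOS"
  using piOS_emb[of "of_nat resp"] resp(2) by (simp add: emb_of_nat)

lemma frobenius_additive:
  assumes x: "x \<in> OS" and y: "y \<in> OS"
  shows "(x + y) ^ resp - x ^ resp - y ^ resp \<in> piOS"
proof -
  have p0: "resp > 0" using resp(1) by (simp add: prime_gt_0_nat)
  have "(x + y) ^ resp = (\<Sum>k\<le>resp. of_nat (resp choose k) * x ^ k * y ^ (resp - k))"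
    by (rule binomial_ring)
  also have "\<dots> = (\<Sum>k\<in>insert 0 (insert resp {0<..<resp}). of_nat (resp choose k) * x ^ k * y ^ (resp - k))"
    using p0 by (intro sum.cong) auto
  also have "\<dots> = y ^ resp + (x ^ resp + (\<Sum>k\<in>{0<..<resp}. of_nat (resp choose k) * x ^ k * y ^ (resp - k)))"
    using p0 by simp
  finally have "(x + y) ^ resp - x ^ resp - y ^ resp
      = (\<Sum>k\<in>{0<..<resp}. of_nat (resp choose k) * x ^ k * y ^ (resp - k))" by simp
  also have "\<dots> \<in> piOS"
  proof (rule piOS_sum)
    fix k assume "k \<in> {0<..<resp}"
    then have "resp dvd (resp choose k)" using resp(1) p0 by (intro dvd_choose_prime) auto
    then obtain c where "resp choose k = resp * c" by auto
    then have "of_nat (resp choose k) \<in> piOS" using piOS_mult[OF resp_piOS OS_of_nat[of c]] by simp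
    then show "of_nat (resp choose k) * x ^ k * y ^ (resp - k) \<in> piOS"
      using x y by (intro piOS_mult OS_power)
  qed
  finally show ?thesis .
qed

lemma prime_to_resp_unit:
  assumes "\<not> resp dvd N"
  shows "of_nat N \<noteq> (0::'s)" "inverse (of_nat N) \<in> OS" "(of_nat N :: 'f) \<noteq> 0" "v (of_nat N) = 0"
proof -
  have "coprime N resp" using assms resp(1) prime_imp_coprime[of resp N] by (simp add: coprime_commute)
  then show u: "(of_nat N :: 'f) \<noteq> 0" "v (of_nat N) = 0"
    using unit_of_nat[OF resp, of N] by auto
  then show "of_nat N \<noteq> (0::'s)" using emb_eq_0[of "of_nat N"] by (simp add: emb_of_nat)
  show "inverse (of_nat N) \<in> OS"
    using OS_emb[of "inverse (of_nat N)"] u by (simp add: emb_inverse emb_of_nat val_ge_def v_inverse)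
qed

lemma root_of_unity_OS: "N > 0 \<Longrightarrow> \<zeta> ^ N = 1 \<Longrightarrow> \<zeta> \<in> OS"
  using OS_root[of N \<zeta>] OS_1 by simp

text \<open>
  The polynomial \<open>X\<^sup>N - 1\<close> is separable, so it splits over the separable closure; as the maximal
  ideal is prime, a zero modulo the maximal ideal is congruent to one of its roots.
\<close>

lemma lift_root_of_unity:
  assumes N: "\<not> resp dvd N" and z: "z \<in> OS" "z ^ N - 1 \<in> mS"
  obtains \<zeta> where "\<zeta> ^ N = 1" "z - \<zeta> \<in> mS"
proof -
  have N0: "N > 0" using N by (metis dvd_0_right gr0I)
  define q :: "'s poly" where "q = monom 1 N - 1"
  have deg: "degree q = N"
    unfolding q_def using N0 by (intro antisym degree_le le_degree) (auto simp: coeff_1)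
  have lc: "lead_coeff q = 1" unfolding deg using N0 by (simp add: q_def coeff_1)
  have "smult (inverse (of_nat N)) (monom 1 1) * pderiv q + (- 1) * q = 1"
    using prime_to_resp_unit(1)[OF N] N0
    by (simp add: q_def pderiv_diff pderiv_monom mult_monom smult_monom)
  then have "coprime (pderiv q) q"
    by (intro coprimeI) (use coprime_if_bezout in blast)
  then have "coprime q (pderiv q)" by (simp add: coprime_commute)
  moreover have "q \<noteq> 0" using lc by auto
  ultimately obtain zs where zs: "q = smult (lead_coeff q) (\<Prod>z\<leftarrow>zs. [:-z, 1:])" using separable_splits by blast
  then have q: "q = (\<Prod>z\<leftarrow>zs. [:-z, 1:])" using lc by simp
  have ev: "poly q x = (\<Prod>\<zeta>\<leftarrow>zs. x - \<zeta>)" for x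
    unfolding q by (induction zs) (auto simp: algebra_simps)
  have root: "\<zeta> ^ N = 1" if "\<zeta> \<in> set zs" for \<zeta>
  proof -
    have "poly q \<zeta> = 0" unfolding ev using that by (induction zs) auto
    then show ?thesis by (simp add: q_def poly_monom)
  qed
  have "(\<Prod>\<zeta>\<leftarrow>zs. z - \<zeta>) \<in> mS" using z(2) ev[of z] by (simp add: q_def poly_monom)
  then have "\<exists>\<zeta>\<in>set zs. z - \<zeta> \<in> mS" using root
  proof (induction zs)
    case Nil
    then show ?case using one_notin_mS by simp
  next
    case (Cons w zs)
    have OSp: "(\<Prod>\<zeta>\<leftarrow>zs. z - \<zeta>) \<in> OS"
      using Cons.prems(2) z(1) N0
    proof (induction zs)
      case (Cons w' ws)
      have "z - w' \<in> OS" by (rule OS_diff[OF z(1) root_of_unity_OS[OF N0]]) (simp add: Cons.prems)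
      moreover have "(\<Prod>\<zeta>\<leftarrow>ws. z - \<zeta>) \<in> OS" using Cons by auto
      ultimately show ?case by (simp add: OS_mult)
    qed (simp add: OS_1)
    have "z - w \<in> OS" by (rule OS_diff[OF z(1) root_of_unity_OS[OF N0]]) (simp add: Cons.prems(2))
    from mS_prime[OF this OSp] Cons show ?case by auto
  qed
  then show ?thesis using that root by blast
qed

text \<open>
  Modulo the maximal ideal, \<open>w\<^sup>p - 1\<close> is \<open>(w - 1)\<^sup>p\<close> in residue characteristic \<open>p\<close>, so factors \<open>p\<close> of
  the exponent can be dropped.
\<close>

lemma power_one_prime_to_resp:
  assumes z: "z \<in> OS" "z ^ m - 1 \<in> mS" "m > 0"
  obtains N where "\<not> resp dvd N" "z ^ N - 1 \<in> mS"
proof -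
  obtain N where N: "m = resp ^ multiplicity resp m * N" "\<not> resp dvd N"
    using multiplicity_decompose'[of m resp] z(3) resp(1) by (metis neq0_conv not_prime_unit)
  have red: "w - 1 \<in> mS" if "w \<in> OS" "w ^ (resp ^ e) - 1 \<in> mS" for w e
    using that
  proof (induction e arbitrary: w)
    case (Suc e)
    have "w ^ resp - 1 \<in> mS"
      using Suc.IH[of "w ^ resp"] Suc.prems OS_power by (simp add: power_mult)
    moreover have "w ^ resp - (w - 1) ^ resp - 1 \<in> mS"
      using frobenius_additive[of "w - 1" 1] Suc.prems(1) by (intro piOS_mS) (simp add: OS_diff OS_1)
    ultimately have "(w ^ resp - 1) - (w ^ resp - (w - 1) ^ resp - 1) \<in> mS" by (rule mS_diff)
    then have "(w - 1) ^ resp \<in> mS" by simp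
    then show ?case by (rule mS_power[OF OS_diff[OF Suc.prems(1) OS_1]])
  qed simp
  have "z ^ N - 1 \<in> mS"
    using red[of "z ^ N" "multiplicity resp m"] z(1,2) N(1)
    by (simp add: OS_power mult.commute flip: power_mult)
  then show ?thesis using that N(2) by blast
qed

text \<open>
  The residue field of the separable closure is represented by \<open>0\<close> and the roots of unity of
  order prime to the residue characteristic, so the automorphisms fixing these lie in inertia.
\<close>

lemma inertia_if_fixes_roots_of_unity:
  assumes \<sigma>: "\<sigma> \<in> galois_group \<iota>"
    and fixed: "\<And>N \<zeta>. \<not> resp dvd N \<Longrightarrow> \<zeta> ^ N = 1 \<Longrightarrow> \<sigma> \<zeta> = \<zeta>"
  shows "\<sigma> \<in> inertia_group v \<iota>"
proof -
  note h = galois_hom[OF \<sigma>]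
  have "\<sigma> z - z \<in> mS" if z: "z \<in> OS" for z
  proof (cases "z \<in> mS")
    case True
    then show ?thesis using mS_diff[OF galois_mS[OF \<sigma>]] by blast
  next
    case False
    obtain m where m: "m > 0" "z ^ m \<in> piOS \<or> z ^ m - 1 \<in> piOS" using power_dichotomy[OF z] by blast
    then have "z ^ m - 1 \<in> mS" using False mS_iff[of z] z piOS_mS by blast
    then obtain N where N: "\<not> resp dvd N" "z ^ N - 1 \<in> mS"
      using power_one_prime_to_resp[OF z _ m(1)] by blast
    then obtain \<zeta> where \<zeta>: "\<zeta> ^ N = 1" "z - \<zeta> \<in> mS" using lift_root_of_unity z by blast
    have "\<sigma> (z - \<zeta>) - (z - \<zeta>) \<in> mS" by (rule mS_diff[OF galois_mS[OF \<sigma> \<zeta>(2)] \<zeta>(2)])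
    then show ?thesis using fixed[OF N(1) \<zeta>(1)] by (simp add: hom_diff[OF h])
  qed
  then show ?thesis using \<sigma> by (simp add: inertia_group_def)
qed

lemma inertia_galois: "\<sigma> \<in> inertia_group v \<iota> \<Longrightarrow> \<sigma> \<in> galois_group \<iota>"
  by (simp add: inertia_group_def)

lemma inertia_mS: "\<sigma> \<in> inertia_group v \<iota> \<Longrightarrow> z \<in> OS \<Longrightarrow> \<sigma> z - z \<in> mS"
  by (simp add: inertia_group_def)

lemma frobenius_power_additive:
  assumes "x \<in> OS" "y \<in> OS"
  shows "(x + y) ^ (resp ^ e) - x ^ (resp ^ e) - y ^ (resp ^ e) \<in> piOS"
proof (induction e)
  case 0
  then show ?case by (simp add: piOS_0)
next
  case (Suc e)
  let ?p = "resp" and ?q = "resp ^ e"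
  have cong: "a ^ n - b ^ n \<in> piOS" if "a - b \<in> piOS" "a \<in> OS" "b \<in> OS" for a b n
  proof (cases n)
    case (Suc l)
    have "a ^ n - b ^ n = (a - b) * (\<Sum>p<Suc l. a ^ p * b ^ (l - p))"
      unfolding Suc by (rule diff_power_eq_sum)
    also have "\<dots> \<in> piOS" using that by (intro piOS_mult OS_sum OS_mult OS_power)
    finally show ?thesis .
  qed (simp add: piOS_0)
  have OS: "x ^ ?q \<in> OS" "y ^ ?q \<in> OS" "x ^ ?q + y ^ ?q \<in> OS" "(x + y) ^ ?q \<in> OS"
    using assms by (auto intro: OS_power OS_add)
  have "((x + y) ^ ?q) ^ ?p - (x ^ ?q + y ^ ?q) ^ ?p \<in> piOS"
    using Suc by (intro cong OS) (simp add: diff_diff_eq)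
  from piOS_add[OF this frobenius_additive[OF OS(1,2)]]
  have "((x + y) ^ ?q) ^ ?p - (x ^ ?q) ^ ?p - (y ^ ?q) ^ ?p \<in> piOS" by (simp add: algebra_simps)
  moreover have "z ^ (resp ^ Suc e) = (z ^ ?q) ^ ?p" for z :: 's by (simp add: mult.commute flip: power_mult)
  ultimately show ?case by (simp only:)
qed

text \<open>
  Euler's theorem for an unspecified exponent, by the pigeonhole principle.
\<close>

lemma power_cong_one_mod:
  assumes "coprime p M" "M > 0" obtains f where "f > 0" "M dvd p ^ f - (1::nat)"
proof -
  have "\<not> inj (\<lambda>i. p ^ i mod M)"
  proof
    assume "inj (\<lambda>i. p ^ i mod M)"
    moreover have "finite (range (\<lambda>i. p ^ i mod M))"
      by (rule finite_subset[of _ "{..<M}"]) (use assms in auto)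
    ultimately show False using finite_imageD infinite_UNIV_nat by blast
  qed
  then obtain a b where "a \<noteq> b" "p ^ a mod M = p ^ b mod M" unfolding inj_def by blast
  then have "\<exists>i j. i < j \<and> p ^ i mod M = p ^ j mod M"
    using linorder_neq_iff[of a b] by (metis (no_types))
  then obtain i j where ij: "i < j" "p ^ i mod M = p ^ j mod M" by blast
  have "[p ^ i * p ^ (j - i) = p ^ i * 1] (mod M)"
    using ij by (simp add: cong_def flip: power_add)
  then have "[p ^ (j - i) = 1] (mod M)"
    using assms(1) by (subst (asm) cong_mult_lcancel_nat) auto
  then have "M dvd p ^ (j - i) - 1" by (metis cong_to_1_nat)
  then show ?thesis using that[of "j - i"] ij(1) by simp
qed

text \<open>
  The sum involves finitely many roots of unity and coefficients.  Modulo \<open>\<pi>\<close> each coefficient is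
  \<open>0\<close> or has a power equal to \<open>1\<close> with exponent prime to the residue characteristic, so a power \<open>Q\<close> of
  the residue characteristic that is congruent to \<open>1\<close> modulo all these exponents and \<open>N\<close> fixes every factor;
  and raising to the power \<open>Q\<close> is additive modulo \<open>\<pi>\<close>.
\<close>

lemma frobenius_fixes:
  assumes N: "\<not> resp dvd N" and "finite I" and m: "\<And>i. i \<in> I \<Longrightarrow> m i ^ N = 1"
    and b: "\<And>i. i \<in> I \<Longrightarrow> val_ge v 0 (b i)"
  obtains Q where "Q > 1" "(\<Sum>i\<in>I. m i * \<iota> (b i)) ^ Q - (\<Sum>i\<in>I. m i * \<iota> (b i)) \<in> piOS"
proof -
  have p1: "resp > 1" by (rule prime_gt_1_nat[OF resp(1)])
  have N0: "N > 0" using N by (metis dvd_0_right gr0I)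
  have "\<exists>n. \<not> resp dvd n \<and> (i \<in> I \<longrightarrow> val_ge v 1 (b i) \<or> val_ge v 1 (b i ^ n - 1))" for i
  proof (cases "i \<in> I \<and> \<not> val_ge v 1 (b i)")
    case True
    then have z: "\<iota> (b i) \<in> OS" using b OS_emb by blast
    obtain k where k: "k > 0" "\<iota> (b i) ^ k \<in> piOS \<or> \<iota> (b i) ^ k - 1 \<in> piOS" using power_dichotomy[OF z] by blast
    have "\<iota> (b i) \<notin> mS" using True mS_emb by blast
    then have "\<iota> (b i) ^ k - 1 \<in> mS" using k mS_iff[of "\<iota> (b i)"] z piOS_mS by blast
    then obtain n where "\<not> resp dvd n" "\<iota> (b i) ^ n - 1 \<in> mS"
      using power_one_prime_to_resp[OF z _ k(1)] by blast
    moreover from this have "val_ge v 1 (b i ^ n - 1)"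
      using mS_emb[of "b i ^ n - 1"] by (simp add: emb_diff emb_power emb_one)
    ultimately show ?thesis by blast
  next
    case False
    then show ?thesis using p1 by (intro exI[of _ 1]) auto
  qed
  then obtain n where n: "\<And>i. \<not> resp dvd n i" 
    "\<And>i. i \<in> I \<Longrightarrow> val_ge v 1 (b i) \<or> val_ge v 1 (b i ^ n i - 1)" by metis
  define M where "M = N * (\<Prod>i\<in>I. n i)"
  have "\<not> resp dvd (\<Prod>i\<in>I. n i)" using n(1) resp(1) \<open>finite I\<close> by (simp add: prime_dvd_prod_iff)
  then have "\<not> resp dvd M" using N resp(1) by (simp add: M_def prime_dvd_mult_iff)
  then have "coprime resp M" "M > 0" using resp(1) by (auto intro: prime_imp_coprime gr0I)
  then obtain f where f: "f > 0" "M dvd resp ^ f - 1" using power_cong_one_mod by blast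
  define Q where "Q = resp ^ f"
  have Q1: "Q > 1" unfolding Q_def by (rule one_less_power[OF p1 f(1)])
  define W where "W = {x \<in> OS. x ^ Q - x \<in> piOS}"
  have W_add: "x + y \<in> W" if "x \<in> W" "y \<in> W" for x y
  proof -
    have xy: "x \<in> OS" "y \<in> OS" "x ^ Q - x \<in> piOS" "y ^ Q - y \<in> piOS" using that by (auto simp: W_def)
    have "((x + y) ^ Q - x ^ Q - y ^ Q) + (x ^ Q - x) + (y ^ Q - y) \<in> piOS"
      using frobenius_power_additive[OF xy(1,2)] xy unfolding Q_def by (intro piOS_add)
    moreover have "((x + y) ^ Q - x ^ Q - y ^ Q) + (x ^ Q - x) + (y ^ Q - y) = (x + y) ^ Q - (x + y)" by simp
    ultimately have "(x + y) ^ Q - (x + y) \<in> piOS" by metis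
    then show ?thesis using xy by (simp add: W_def OS_add)
  qed
  have W_mult: "x * y \<in> W" if "x \<in> W" "y \<in> W" for x y
  proof -
    have xy: "x \<in> OS" "y \<in> OS" "x ^ Q - x \<in> piOS" "y ^ Q - y \<in> piOS" using that by (auto simp: W_def)
    have "(x ^ Q - x) * y ^ Q + x * (y ^ Q - y) \<in> piOS"
      using xy by (intro piOS_add piOS_mult piOS_mult2 OS_power)
    then show ?thesis using xy by (simp add: W_def OS_mult algebra_simps power_mult_distrib)
  qed
  have W_m: "m i \<in> W" if "i \<in> I" for i
  proof -
    have "N dvd Q - 1" using f(2) unfolding M_def Q_def by (meson dvd_mult_left)
    then obtain k where k: "Q - 1 = N * k" by auto
    have "m i ^ Q = m i * m i ^ (Q - 1)" using Q1 by (simp flip: power_Suc)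
    also have "m i ^ (Q - 1) = 1" unfolding k by (simp add: power_mult m[OF that])
    finally have "m i ^ Q = m i" by simp
    then show ?thesis using root_of_unity_OS[OF N0 m[OF that]] by (simp add: W_def piOS_0)
  qed
  have W_b: "\<iota> (b i) \<in> W" if i: "i \<in> I" for i
  proof -
    have "val_ge v 1 (b i ^ Q - b i)"
    proof (cases "val_ge v 1 (b i)")
      case True
      then show ?thesis using Q1 by (intro val_ge_diff val_ge_power_pos) auto
    next
      case False
      have "n i dvd M" unfolding M_def using \<open>finite I\<close> i by (intro dvd_mult dvd_prodI)
      then have "n i dvd Q - 1" using f(2) unfolding Q_def by (rule dvd_trans)
      then obtain k where k: "Q - 1 = n i * k" by auto
      have "b i ^ Q - b i = (b i ^ n i - 1) * (\<Sum>j<k. (b i ^ n i) ^ j) * b i"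
      proof -
        have gen: "x * y - x = (y - 1) * x" for x y :: 'f by (simp add: algebra_simps)
        have "b i ^ Q = b i * b i ^ (Q - 1)" using Q1 by (simp flip: power_Suc)
        also have "b i ^ (Q - 1) = (b i ^ n i) ^ k" unfolding k by (rule power_mult)
        finally have "b i ^ Q - b i = b i * (b i ^ n i) ^ k - b i" by (rule arg_cong)
        also have "\<dots> = ((b i ^ n i) ^ k - 1) * b i" by (rule gen)
        finally have "b i ^ Q - b i = ((b i ^ n i) ^ k - 1) * b i" .
        then show ?thesis unfolding power_diff_1_eq[of "b i ^ n i" k] .
      qed
      moreover have "val_ge v 1 (b i ^ n i - 1)" using n(2)[OF i] False by simp
      ultimately show ?thesis using b[OF i]
        by (auto intro!: val_ge_mult_left val_ge_sum val_ge_power)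
    qed
    then have "\<iota> (b i ^ Q - b i) \<in> piOS" using piOS_emb by blast
    then show ?thesis using OS_emb[OF b[OF i]] by (simp add: W_def emb_diff emb_power)
  qed
  have "(\<Sum>i\<in>J. m i * \<iota> (b i)) \<in> W" if "J \<subseteq> I" for J
    using finite_subset[OF that \<open>finite I\<close>] that
  proof (induction J rule: finite_induct)
    case empty
    then show ?case using Q1 by (simp add: W_def OS_0 piOS_0 power_0_left)
  next
    case (insert i J)
    then show ?case by (auto intro!: W_add W_mult W_m W_b)
  qed
  from this[of I] show ?thesis using that[OF Q1] by (simp add: W_def)
qed

lemma finite_roots_of_unity: "N > 0 \<Longrightarrow> finite {\<zeta>::'s. \<zeta> ^ N = 1}"
proof -
  assume "N > 0"
  then have "coeff (monom (1::'s) N - 1) N = 1" by (simp add: coeff_1)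
  then have "monom (1::'s) N - 1 \<noteq> 0" by (metis coeff_0 zero_neq_one)
  from poly_roots_finite[OF this] show ?thesis by (simp add: poly_monom)
qed

text \<open>
  Trace formula for the extension generated by the \<open>N\<close>-th roots of unity: the dual basis of the
  monomials in the roots of unity is, up to the unit \<open>N ^ card \<mu>\<close>, given by their inverses.  So an
  integral element of this extension is a combination of monomials with integral coefficients.
\<close>

lemma unramified_integral_basis:
  assumes N: "\<not> resp dvd N" and u: "u \<in> OS"
    and fixed: "\<And>\<sigma>. \<sigma> \<in> fixing_group \<iota> {\<zeta>. \<zeta> ^ N = 1} \<Longrightarrow> \<sigma> u = u"
  obtains I m b where "finite I" "\<And>i. i \<in> I \<Longrightarrow> m i ^ N = 1" "\<And>i. i \<in> I \<Longrightarrow> val_ge v 0 (b i)"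
    "u = (\<Sum>i\<in>(I::('s \<Rightarrow> nat) set). m i * \<iota> (b i))"
proof -
  define \<mu> where "\<mu> = {\<zeta>::'s. \<zeta> ^ N = 1}"
  have N0: "N > 0" using N by (metis dvd_0_right gr0I)
  have fin: "finite \<mu>" unfolding \<mu>_def by (rule finite_roots_of_unity[OF N0])
  have nz: "\<zeta> \<noteq> 0" if "\<zeta> \<in> \<mu>" for \<zeta> using that N0 by (auto simp: \<mu>_def power_0_left)
  have stable: "galois_stable \<mu>"
    unfolding galois_stable_def
  proof (intro conjI ballI fin subsetI)
    fix \<sigma> w assume s: "\<sigma> \<in> galois_group \<iota>" and "w \<in> \<sigma> ` \<mu>"
    then obtain \<zeta> where "w = \<sigma> \<zeta>" "\<zeta> ^ N = 1" by (auto simp: \<mu>_def)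
    then show "w \<in> \<mu>" using hom_power[OF galois_hom[OF s], of \<zeta> N] hom_1[OF galois_hom[OF s]] by (simp add: \<mu>_def)
  qed
  obtain T where T: "finite T" "T \<subseteq> galois_group \<iota>"
    "\<And>\<sigma>. \<sigma> \<in> galois_group \<iota> \<Longrightarrow> \<exists>\<tau>\<in>T. \<forall>x\<in>\<mu>. \<tau> x = \<sigma> x"
    "\<And>\<tau> \<tau>'. \<tau> \<in> T \<Longrightarrow> \<tau>' \<in> T \<Longrightarrow> \<forall>x\<in>\<mu>. \<tau> x = \<tau>' x \<Longrightarrow> \<tau> = \<tau>'"
    "\<And>F \<sigma>. (\<And>\<tau> \<tau>'. \<tau> \<in> galois_group \<iota> \<Longrightarrow> \<tau>' \<in> galois_group \<iota> \<Longrightarrow> \<forall>x\<in>\<mu>. \<tau> x = \<tau>' x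
        \<Longrightarrow> F \<tau> = (F \<tau>' :: 's)) \<Longrightarrow> \<sigma> \<in> galois_group \<iota> \<Longrightarrow> (\<Sum>\<tau>\<in>T. F (\<sigma> \<circ> \<tau>)) = (\<Sum>\<tau>\<in>T. F \<tau>)"
    using transversal[OF stable] by blast
  define I where "I = \<mu> \<rightarrow>\<^sub>E {..<N}"
  define m where "m i = (\<Prod>\<zeta>\<in>\<mu>. \<zeta> ^ i \<zeta>)" for i :: "'s \<Rightarrow> nat"
  have finI: "finite I" unfolding I_def using fin by (intro finite_PiE) auto
  have m_pow: "m i ^ N = 1" for i
  proof -
    have "m i ^ N = (\<Prod>\<zeta>\<in>\<mu>. (\<zeta> ^ N) ^ i \<zeta>)"
      unfolding m_def prod_power_distrib by (intro prod.cong refl) (simp add: mult.commute flip: power_mult)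
    also have "\<dots> = 1" by (intro prod.neutral) (simp add: \<mu>_def)
    finally show ?thesis .
  qed
  have m_nz: "m i \<noteq> 0" for i using m_pow[of i] N0 by (auto simp: power_0_left)
  define w where "w i = u * inverse (m i)" for i
  have w_OS: "w i \<in> OS" for i
    unfolding w_def by (rule OS_mult[OF u root_of_unity_OS[OF N0]]) (simp add: power_inverse m_pow)
  define t where "t i = (\<Sum>\<tau>\<in>T. \<tau> (w i))" for i
  have m_agree: "\<tau> (m i) = \<tau>' (m i)" if "\<tau> \<in> galois_group \<iota>" "\<tau>' \<in> galois_group \<iota>" "\<forall>x\<in>\<mu>. \<tau> x = \<tau>' x" for \<tau> \<tau>' i
    using that by (simp add: m_def hom_prod[OF galois_hom] hom_power[OF galois_hom])
  have u_agree: "\<tau> u = \<tau>' u" if "\<tau> \<in> galois_group \<iota>" "\<tau>' \<in> galois_group \<iota>" "\<forall>x\<in>\<mu>. \<tau> x = \<tau>' x" for \<tau> \<tau>'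
    using agree_on_fixed[OF that(1,2), of \<mu> u] that(3) fixed unfolding \<mu>_def by blast
  have hinv: "\<tau> (inverse x) = inverse (\<tau> x)" if "\<tau> \<in> galois_group \<iota>" "x \<noteq> 0" for \<tau> x
    using hom_mult[OF galois_hom[OF that(1)], of x "inverse x"] hom_1[OF galois_hom[OF that(1)]] that(2)
    by (intro inverse_unique[symmetric]) simp
  have w_hom: "\<tau> (w i) = \<tau> u * inverse (\<tau> (m i))" if "\<tau> \<in> galois_group \<iota>" for \<tau> i
    unfolding w_def using hom_mult[OF galois_hom[OF that]] hinv[OF that m_nz] by simp
  have "\<sigma> (t i) = t i" if s: "\<sigma> \<in> galois_group \<iota>" for \<sigma> i
  proof -
    have "\<sigma> (t i) = (\<Sum>\<tau>\<in>T. (\<sigma> \<circ> \<tau>) (w i))"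
      by (simp add: t_def hom_sum[OF galois_hom[OF s]])
    also have "\<dots> = t i"
      unfolding t_def
    proof (rule T(5)[OF _ s])
      fix \<tau> \<tau>' assume a: "\<tau> \<in> galois_group \<iota>" "\<tau>' \<in> galois_group \<iota>" "\<forall>x\<in>\<mu>. \<tau> x = \<tau>' x"
      show "\<tau> (w i) = \<tau>' (w i)" using u_agree[OF a] m_agree[OF a] by (simp add: w_hom a)
    qed
    finally show ?thesis .
  qed
  then have "\<exists>c. t i = \<iota> c" for i using galois_fixed[of "t i"] by blast
  then have "\<forall>i. \<exists>c. t i = \<iota> c" ..
  from choice[OF this] obtain c where c: "\<And>i. t i = \<iota> (c i)" by blast
  have "t i \<in> OS" for i unfolding t_def
  proof (rule OS_sum)
    fix \<tau> assume "\<tau> \<in> T"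
    then have "\<tau> \<in> galois_group \<iota>" using T(2) by blast
    then show "\<tau> (w i) \<in> OS" using w_OS by (rule galois_OS)
  qed
  then have c_int: "val_ge v 0 (c i)" for i using OS_emb_iff[of "c i"] unfolding c[symmetric] by simp
  define k where "k = card \<mu>"
  define b where "b i = c i / of_nat N ^ k" for i
  note Nu = prime_to_resp_unit[OF N]
  have b_int: "val_ge v 0 (b i)" for i
    using c_int[of i] val_ge_mult_cancel[of "of_nat N ^ k" 0 "b i"] Nu by (simp add: b_def v_power)
  have orth: "(\<Sum>i\<in>I. m i * inverse (\<tau> (m i))) = (if \<forall>x\<in>\<mu>. \<tau> x = x then of_nat N ^ k else 0)"
    if s: "\<tau> \<in> galois_group \<iota>" for \<tau>
  proof -
    have "m i * inverse (\<tau> (m i)) = (\<Prod>\<zeta>\<in>\<mu>. (\<zeta> * inverse (\<tau> \<zeta>)) ^ i \<zeta>)" for i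
      unfolding m_def hom_prod[OF galois_hom[OF s] UNIV_I]
      by (simp add: hom_power[OF galois_hom[OF s]] prod_inversef[symmetric] power_mult_distrib power_inverse prod.distrib)
    then have "(\<Sum>i\<in>I. m i * inverse (\<tau> (m i))) = (\<Sum>i\<in>I. \<Prod>\<zeta>\<in>\<mu>. (\<zeta> * inverse (\<tau> \<zeta>)) ^ i \<zeta>)" by simp
    also have "\<dots> = (\<Prod>\<zeta>\<in>\<mu>. \<Sum>j<N. (\<zeta> * inverse (\<tau> \<zeta>)) ^ j)"
      unfolding I_def using fin by (subst prod_sum_PiE) auto
    also have "\<dots> = (\<Prod>\<zeta>\<in>\<mu>. if \<tau> \<zeta> = \<zeta> then of_nat N else 0)"
    proof (intro prod.cong refl)
      fix \<zeta> assume z: "\<zeta> \<in> \<mu>"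
      have tz: "\<tau> \<zeta> \<in> \<mu>" using stable s z by (auto simp: galois_stable_def)
      show "(\<Sum>j<N. (\<zeta> * inverse (\<tau> \<zeta>)) ^ j) = (if \<tau> \<zeta> = \<zeta> then of_nat N else 0)"
      proof (cases "\<tau> \<zeta> = \<zeta>")
        case False
        then have "\<zeta> * inverse (\<tau> \<zeta>) \<noteq> 1" using nz[OF tz] by (auto simp: field_simps)
        moreover have "(\<zeta> * inverse (\<tau> \<zeta>)) ^ N = 1" using z tz by (simp add: \<mu>_def power_mult_distrib power_inverse)
        ultimately show ?thesis using False by (simp add: geometric_sum)
      qed (use nz[OF z] in simp)
    qed
    also have "\<dots> = (if \<forall>x\<in>\<mu>. \<tau> x = x then of_nat N ^ k else 0)"
      using fin by (auto simp: k_def prod_zero_iff)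
    finally show ?thesis .
  qed
  obtain \<tau>0 where \<tau>0: "\<tau>0 \<in> T" "\<forall>x\<in>\<mu>. \<tau>0 x = id x" using T(3)[OF galois_id] by blast
  have "(\<Sum>i\<in>I. m i * t i) = (\<Sum>\<tau>\<in>T. \<tau> u * (\<Sum>i\<in>I. m i * inverse (\<tau> (m i))))"
    unfolding t_def sum_distrib_left
    by (subst sum.swap, intro sum.cong refl) (use T(2) w_hom in \<open>auto simp: ac_simps\<close>)
  also have "\<dots> = (\<Sum>\<tau>\<in>T. if \<tau> = \<tau>0 then u * of_nat N ^ k else 0)"
  proof (intro sum.cong refl)
    fix \<tau> assume t: "\<tau> \<in> T"
    then have g: "\<tau> \<in> galois_group \<iota>" "\<tau>0 \<in> galois_group \<iota>" using T(2) \<tau>0 by auto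
    have "(\<forall>x\<in>\<mu>. \<tau> x = x) \<longleftrightarrow> \<tau> = \<tau>0" using T(4)[OF t \<tau>0(1)] \<tau>0(2) by auto
    moreover have "\<tau>0 u = u" using u_agree[OF g(2) galois_id \<tau>0(2)] by simp
    ultimately show "\<tau> u * (\<Sum>i\<in>I. m i * inverse (\<tau> (m i))) = (if \<tau> = \<tau>0 then u * of_nat N ^ k else 0)"
      by (auto simp: orth[OF g(1)])
  qed
  also have "\<dots> = u * of_nat N ^ k" using T(1) \<tau>0(1) by simp
  finally have "u = (\<Sum>i\<in>I. m i * t i) / of_nat N ^ k" using Nu(1) by simp
  also have "\<dots> = (\<Sum>i\<in>I. m i * \<iota> (b i))"
    by (simp add: b_def c emb_divide emb_power emb_of_nat sum_divide_distrib)
  finally have e: "u = (\<Sum>i\<in>I. m i * \<iota> (b i))" .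
  show ?thesis by (rule that[of I m b, OF finI _ _ e]) (simp_all add: m_pow b_int)
qed

text \<open>
  Inertia moves every element \<open>u\<close> of valuation strictly between those of \<open>1\<close> and of the uniformizer.
  By Galois theory it suffices that \<open>u\<close> is not fixed by all automorphisms fixing the roots of unity of
  order prime to the residue characteristic.  If it were, then \<open>u\<^sup>Q \<equiv> u\<close> modulo \<open>\<pi>\<close> for some \<open>Q > 1\<close> by
  \<open>unramified_integral_basis\<close> and \<open>frobenius_fixes\<close>, whence \<open>u\<^sup>Q\<^sup>-\<^sup>1 \<equiv> 1\<close> modulo \<open>\<pi> / u\<close>, although \<open>u\<close> is not a
  unit.
\<close>

theorem inertia_moves:
  assumes u: "u \<in> mS" "u \<noteq> 0" "\<pi> / u \<in> mS"
  obtains \<sigma> where "\<sigma> \<in> inertia_group v \<iota>" "\<sigma> u \<noteq> u"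
proof -
  define \<mu> where "\<mu> N = {\<zeta>::'s. \<zeta> ^ N = 1}" for N
  (* The maximal unramified extension. *)
  define K where "K = {x. \<exists>N. \<not> resp dvd N \<and> (\<forall>\<sigma>\<in>fixing_group \<iota> (\<mu> N). \<sigma> x = x)}"
  have p1: "\<not> resp dvd 1" using resp(1) not_prime_1 by (metis nat_dvd_1_iff_1)
  have KI: "x \<in> K" if "\<not> resp dvd N" "\<And>\<sigma>. \<sigma> \<in> fixing_group \<iota> (\<mu> N) \<Longrightarrow> \<sigma> x = x" for x N
    using that unfolding K_def by blast
  have K2: "\<exists>N. \<not> resp dvd N \<and> (\<forall>\<sigma>\<in>fixing_group \<iota> (\<mu> N). \<sigma> x = x \<and> \<sigma> y = y)" if "x \<in> K" "y \<in> K" for x y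
  proof -
    obtain N where N: "\<not> resp dvd N" "\<forall>\<sigma>\<in>fixing_group \<iota> (\<mu> N). \<sigma> x = x" using \<open>x \<in> K\<close> by (auto simp: K_def)
    obtain M where M: "\<not> resp dvd M" "\<forall>\<sigma>\<in>fixing_group \<iota> (\<mu> M). \<sigma> y = y" using \<open>y \<in> K\<close> by (auto simp: K_def)
    have "\<zeta> ^ (N * M) = 1" if "\<zeta> ^ N = 1 \<or> \<zeta> ^ M = 1" for \<zeta> :: 's
      using that power_mult[of \<zeta> N M] power_mult[of \<zeta> M N] by (auto simp: mult.commute)
    then have "\<mu> N \<subseteq> \<mu> (N * M)" "\<mu> M \<subseteq> \<mu> (N * M)" by (auto simp: \<mu>_def)
    then have sub: "\<sigma> \<in> fixing_group \<iota> (\<mu> N) \<and> \<sigma> \<in> fixing_group \<iota> (\<mu> M)"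
      if "\<sigma> \<in> fixing_group \<iota> (\<mu> (N * M))" for \<sigma>
      using that by (auto simp: fixing_group_def)
    have "\<not> resp dvd N * M" using N(1) M(1) resp(1) by (simp add: prime_dvd_mult_iff)
    then show ?thesis using N(2) M(2) sub by (intro exI[of _ "N * M"]) auto
  qed
  have fg: "\<sigma> \<in> galois_group \<iota>" if "\<sigma> \<in> fixing_group \<iota> S" for \<sigma> S
    using that by (simp add: fixing_group_def)
  have "ring_set K"
  proof (rule ring_setI)
    show "1 \<in> K" using hom_1[OF galois_hom[OF fg]] by (intro KI[OF p1])
    fix x y assume "x \<in> K" "y \<in> K"
    then obtain N where N: "\<not> resp dvd N" "\<And>\<sigma>. \<sigma> \<in> fixing_group \<iota> (\<mu> N) \<Longrightarrow> \<sigma> x = x \<and> \<sigma> y = y"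
      using K2[OF \<open>x \<in> K\<close> \<open>y \<in> K\<close>] by auto
    have "\<sigma> (x - y) = x - y \<and> \<sigma> (x * y) = x * y" if s: "\<sigma> \<in> fixing_group \<iota> (\<mu> N)" for \<sigma>
      using N(2)[OF s] hom_diff[OF galois_hom[OF fg[OF s]], of x y] hom_mult[OF galois_hom[OF fg[OF s]], of x y]
      by simp
    then show "x - y \<in> K" "x * y \<in> K" using KI[OF N(1)] by simp_all
  qed
  moreover have "range \<iota> \<subseteq> K"
  proof
    fix x assume "x \<in> range \<iota>"
    then show "x \<in> K" using galois_emb[OF fg] by (intro KI[OF p1]) auto
  qed
  moreover have "u \<notin> K"
  proof
    assume "u \<in> K"
    then obtain N where N: "\<not> resp dvd N" "\<And>\<sigma>. \<sigma> \<in> fixing_group \<iota> {\<zeta>. \<zeta> ^ N = 1} \<Longrightarrow> \<sigma> u = u"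
      by (auto simp: K_def \<mu>_def)
    obtain Q where Q: "Q > 1" "u ^ Q - u \<in> piOS"
    proof (rule unramified_integral_basis[OF N(1) mS_OS[OF u(1)]])
      show "\<sigma> u = u" if "\<sigma> \<in> fixing_group \<iota> {\<zeta>. \<zeta> ^ N = 1}" for \<sigma> by (rule N(2)[OF that])
      fix I :: "('s \<Rightarrow> nat) set" and m b
      assume I: "finite I" "\<And>i. i \<in> I \<Longrightarrow> m i ^ N = 1" "\<And>i. i \<in> I \<Longrightarrow> val_ge v 0 (b i)"
        "u = (\<Sum>i\<in>I. m i * \<iota> (b i))"
      obtain Q where "Q > 1" "(\<Sum>i\<in>I. m i * \<iota> (b i)) ^ Q - (\<Sum>i\<in>I. m i * \<iota> (b i)) \<in> piOS"
        by (rule frobenius_fixes[OF N(1) I(1), of m b]) (use I(2,3) in auto)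
      then show thesis using that[of Q] unfolding I(4)[symmetric] by simp
    qed
    then obtain y where y: "u ^ Q - u = \<pi> * y" "y \<in> OS" by (auto simp: piOS_def)
    have "u ^ Q = u * u ^ (Q - 1)" using Q(1) by (simp flip: power_Suc)
    then have "u * (u ^ (Q - 1) - 1) = u * (\<pi> / u * y)" using y(1) u(2) by (simp add: algebra_simps)
    then have e: "u ^ (Q - 1) - 1 = \<pi> / u * y" using u(2) by (metis mult_left_cancel)
    have "u ^ (Q - 1) = u * u ^ (Q - 2)" using Q(1) by (simp flip: power_Suc add: Suc_diff_Suc numeral_2_eq_2)
    then have "u ^ (Q - 1) \<in> mS" using mS_mult[OF u(1) OS_power[OF mS_OS[OF u(1)]]] by simp
    from mS_diff[OF this mS_mult[OF u(3) y(2)]] have "1 \<in> mS" using e by (simp add: algebra_simps)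
    then show False using one_notin_mS by simp
  qed
  ultimately obtain \<sigma> where \<sigma>: "\<sigma> \<in> galois_group \<iota>" "\<And>a. a \<in> K \<Longrightarrow> \<sigma> a = a" "\<sigma> u \<noteq> u"
    using fixed_field[of K u] by metis
  have "\<sigma> \<in> inertia_group v \<iota>"
  proof (rule inertia_if_fixes_roots_of_unity[OF \<sigma>(1)])
    fix N \<zeta> assume "\<not> resp dvd N" and z: "\<zeta> ^ N = (1::'s)"
    then have "\<zeta> \<in> K" by (intro KI[of N]) (auto simp: fixing_group_def \<mu>_def)
    then show "\<sigma> \<zeta> = \<zeta>" by (rule \<sigma>(2))
  qed
  with \<sigma>(3) show ?thesis by (intro that[of \<sigma>])
qed

text \<open>
  Multiplied by a suitable power of the uniformizer, the cube root \<open>u\<close> gets valuation \<open>1/3\<close> or \<open>2/3\<close>.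
\<close>

lemma inertia_moves_cube_root:
  assumes t: "t \<noteq> 0" "\<not> 3 dvd v t" "u ^ 3 = \<iota> t"
  obtains \<sigma> where "\<sigma> \<in> inertia_group v \<iota>" "\<sigma> u \<noteq> u"
proof -
  define k where "k = v t div 3"
  define r where "r = v t mod 3"
  have r: "r = 1 \<or> r = 2" "v t = 3 * k + r" using t(2) unfolding r_def k_def by presburger+
  (* A scaling factor bringing the valuation of t into {1, 2}. *)
  define c where "c = unif powi (- k)"
  have c: "c \<noteq> 0" "v c = - k" using unif v_unif_powi by (auto simp: c_def)
  define w where "w = u * \<iota> c"
  have w3: "w ^ 3 = \<iota> (t * c ^ 3)" using t(3) by (simp add: w_def power_mult_distrib emb_mult emb_power)
  have "v (t * c ^ 3) = v t + 3 * v c" "t * c ^ 3 \<noteq> 0" using t(1) c(1) by (simp_all add: val_mult v_power)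
  note vt' = this
  have "v t + 3 * v c = r" using c(2) r(2) by linarith
  with vt' have vt: "v (t * c ^ 3) = r" "t * c ^ 3 \<noteq> 0" by simp_all
  have r12: "1 \<le> r" "r \<le> 2" using r(1) by auto
  have "w ^ 3 \<in> mS" unfolding w3 mS_emb val_ge_def vt(1) using r12(1) by simp
  then have "w \<in> mS" by (rule mS_root[rotated]) simp
  moreover have w0: "w \<noteq> 0"
  proof
    assume "w = 0"
    then have "\<iota> (t * c ^ 3) = 0" unfolding w3[symmetric] by simp
    then show False using vt(2) unfolding emb_eq_0 by simp
  qed
  moreover have "\<pi> / w \<in> mS"
  proof (rule mS_root[of 3])
    have e: "(\<pi> / w) ^ 3 = \<iota> (unif ^ 3 / (t * c ^ 3))" unfolding power_divide w3 by (simp only: emb_divide emb_power)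
    have "v (unif ^ 3 / (t * c ^ 3)) = 3 - r"
      unfolding v_divide[OF power_not_zero[OF unif(1)] vt(2)] vt(1) v_power[OF unif(1)] unif(2) by simp
    then show "(\<pi> / w) ^ 3 \<in> mS" unfolding e mS_emb val_ge_def using r12(2) by simp
  qed simp
  ultimately obtain \<sigma> where s: "\<sigma> \<in> inertia_group v \<iota>" "\<sigma> w \<noteq> w" by (rule inertia_moves)
  have "\<sigma> w = \<sigma> u * \<iota> c"
    by (simp add: w_def hom_mult[OF galois_hom[OF inertia_galois[OF s(1)]]] galois_emb[OF inertia_galois[OF s(1)]])
  then have "\<sigma> u \<noteq> u" using s(2) by (auto simp: w_def)
  with s(1) show ?thesis by (intro that[of \<sigma>])
qed

end

section \<open>Binary cubic forms over a field\<close>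

subsection \<open>Two by two matrices\<close>

definition mat2 :: "'a \<Rightarrow> 'a \<Rightarrow> 'a \<Rightarrow> 'a \<Rightarrow> 'a::zero^2^2"
  where "mat2 p q r s = vector [vector [p, q], vector [r, s]]"

lemma mat2_nth [simp]:
  "mat2 p q r s $ 1 $ 1 = p" "mat2 p q r s $ 1 $ 2 = q" "mat2 p q r s $ 2 $ 1 = r" "mat2 p q r s $ 2 $ 2 = s"
  by (simp_all add: mat2_def vector_2)

lemma mat2_eqI: "(A :: 'a::zero^2^2) $ 1 $ 1 = p \<Longrightarrow> A $ 1 $ 2 = q \<Longrightarrow> A $ 2 $ 1 = r \<Longrightarrow> A $ 2 $ 2 = s \<Longrightarrow> A = mat2 p q r s"
  by (simp add: vec_eq_iff forall_2)

lemma mat2_cases: obtains p q r s where "(A :: 'a::zero^2^2) = mat2 p q r s"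
  by (rule that[OF mat2_eqI]) (rule refl)+

lemma mat2_eq_iff: "mat2 p q r s = mat2 p' q' r' s' \<longleftrightarrow> p = p' \<and> q = q' \<and> r = r' \<and> s = s'"
  by (metis mat2_nth)

lemma mat2_mult: "mat2 p q r s ** mat2 p' q' r' s' =
    mat2 (p * p' + q * r') (p * q' + q * s') (r * p' + s * r') (r * q' + s * (s'::'a::semiring_1))"
  by (rule mat2_eqI) (simp_all add: matrix_matrix_mult_def sum_2)

lemma mat2_one: "mat 1 = mat2 1 0 0 (1::'a::semiring_1)"
  by (rule mat2_eqI) (simp_all add: mat_def)

lemma det_mat2: "det (mat2 p q r s) = p * s - q * (r::'a::comm_ring_1)"
  by (simp add: det_2)

lemma map_mat2: "map_matrix h (mat2 p q r s) = mat2 (h p) (h q) (h r) (h s)"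
  by (rule mat2_eqI) simp_all

lemma act_mat2: "act_form (mat2 p q r s) f = act_coeffs p q r s f"
  by (simp add: act_form_def)

lemma SL2_mat2: "mat2 p q r s \<in> SL2 \<longleftrightarrow> p * s - q * r = (1::'a::field)"
  by (simp add: SL2_def det_mat2)

lemma SL2_one: "mat 1 \<in> (SL2 :: ('a::field^2^2) set)"
  by (simp add: mat2_one SL2_mat2)

lemma SL2_mult: "g \<in> SL2 \<Longrightarrow> h \<in> SL2 \<Longrightarrow> g ** h \<in> (SL2 :: ('a::field^2^2) set)"
  by (simp add: SL2_def det_mul)

lemma SL2_inverse:
  assumes "g \<in> (SL2 :: ('a::field^2^2) set)"
  shows "matrix_inv g \<in> SL2" "matrix_inv g ** g = mat 1" "g ** matrix_inv g = mat 1"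
proof -
  have inv: "invertible g" using assms by (simp add: invertible_det_nz SL2_def)
  then have "\<exists>h. g ** h = mat 1 \<and> h ** g = mat 1" unfolding invertible_def .
  from someI_ex[OF this] show e: "matrix_inv g ** g = mat 1" "g ** matrix_inv g = mat 1"
    by (simp_all add: matrix_inv_def)
  have "det (matrix_inv g) * det g = 1" using e(1) by (metis det_I det_mul)
  then show "matrix_inv g \<in> SL2" using assms by (simp add: SL2_def)
qed

lemma matrix_inv_unique:
  assumes "g \<in> (SL2 :: ('a::field^2^2) set)" "h ** g = mat 1"
  shows "matrix_inv g = h"
  by (metis SL2_inverse(3)[OF assms(1)] assms(2) matrix_mul_assoc matrix_mul_lid matrix_mul_rid)

lemma matrix_inv_mult:
  assumes "g \<in> (SL2 :: ('a::field^2^2) set)" "h \<in> SL2"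
  shows "matrix_inv (g ** h) = matrix_inv h ** matrix_inv g"
proof (rule matrix_inv_unique[OF SL2_mult[OF assms]])
  have "matrix_inv h ** matrix_inv g ** (g ** h) = matrix_inv h ** (matrix_inv g ** g) ** h"
    by (simp add: matrix_mul_assoc)
  then show "matrix_inv h ** matrix_inv g ** (g ** h) = mat 1" using SL2_inverse[OF assms(1)] SL2_inverse[OF assms(2)] by simp
qed

lemma matrix_inv_mat2:
  "p * s - q * r = (1::'a::field) \<Longrightarrow> matrix_inv (mat2 p q r s) = mat2 s (- q) (- r) p"
  by (rule matrix_inv_unique) (simp_all add: SL2_mat2 mat2_mult mat2_one mat2_eq_iff algebra_simps)

lemma act_form_one: "act_form (mat 1) f = (f :: 'a::field cubic_form)"
  by (cases f) (simp add: mat2_one act_mat2)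

lemma act_form_inverse:
  assumes "g \<in> (SL2 :: ('a::field^2^2) set)" "act_form g f = f'"
  shows "f = act_form (matrix_inv g) f'"
  using SL2_inverse[OF assms(1)] by (simp flip: assms(2) act_form_mult add: act_form_one)

lemma map_matrix_mult:
  fixes h :: "'a::field \<Rightarrow> 'b::field" and A B :: "'a^2^2"
  assumes "hom_on UNIV h" shows "map_matrix h (A ** B) = map_matrix h A ** map_matrix h B"
proof -
  obtain p q r s where A: "A = mat2 p q r s" by (rule mat2_cases)
  obtain p' q' r' s' where B: "B = mat2 p' q' r' s'" by (rule mat2_cases)
  show ?thesis using hom_add[OF assms] hom_mult[OF assms] by (simp add: A B mat2_mult map_mat2)
qed

lemma map_matrix_SL2:
  fixes h :: "'a::field \<Rightarrow> 'b::field"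
  assumes "hom_on UNIV h" "A \<in> SL2" shows "map_matrix h A \<in> SL2"
proof -
  obtain p q r s where A: "A = mat2 p q r s" by (rule mat2_cases)
  have "h (p * s - q * r) = 1" using assms hom_1[OF assms(1)] by (simp add: A SL2_mat2)
  then show ?thesis using hom_diff[OF assms(1)] hom_mult[OF assms(1)] by (simp add: A map_mat2 SL2_mat2)
qed

lemma map_matrix_inv:
  fixes h :: "'a::field \<Rightarrow> 'b::field"
  assumes "hom_on UNIV h" "A \<in> SL2" shows "map_matrix h (matrix_inv A) = matrix_inv (map_matrix h A)"
proof (rule matrix_inv_unique[OF map_matrix_SL2[OF assms], symmetric])
  show "map_matrix h (matrix_inv A) ** map_matrix h A = mat 1"
    using SL2_inverse[OF assms(2)] hom_0[OF assms(1)] hom_1[OF assms(1)]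
    by (simp flip: map_matrix_mult[OF assms(1)] add: mat2_one map_mat2)
qed

lemma map_act_form:
  fixes h :: "'a::field \<Rightarrow> 'b::field"
  assumes "hom_on UNIV h"
  shows "map_cubic_form h (act_form A f) = act_form (map_matrix h A) (map_cubic_form h f)"
proof -
  obtain p q r s where A: "A = mat2 p q r s" by (rule mat2_cases)
  show ?thesis
    by (cases f) (simp add: A map_mat2 act_mat2 hom_add[OF assms UNIV_I UNIV_I] hom_mult[OF assms UNIV_I UNIV_I]
      hom_power[OF assms UNIV_I] hom_numeral[OF assms])
qed

subsection \<open>The Hessian\<close>

text \<open>
  The Hessian of \<open>f\<close> is the quadratic covariant \<open>hess_a x\<^sup>2 + hess_b x y + hess_c y\<^sup>2\<close> of
  discriminant \<open>- 3 disc f\<close>.  It is the link between a cubic form and the quadratic algebra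
  \<open>F(\<surd>(- 3 disc f))\<close>.
\<close>

fun hess_a :: "'a::field cubic_form \<Rightarrow> 'a" where "hess_a (Cubic a b c e) = b^2 - 3 * a * c"
fun hess_b :: "'a::field cubic_form \<Rightarrow> 'a" where "hess_b (Cubic a b c e) = b * c - 9 * a * e"
fun hess_c :: "'a::field cubic_form \<Rightarrow> 'a" where "hess_c (Cubic a b c e) = c^2 - 3 * b * e"

lemma hess_disc: "hess_b f ^ 2 - 4 * hess_a f * hess_c f = - 3 * disc f"
  by (cases f) (simp add: algebra_simps power2_eq_square power3_eq_cube)

lemma hess_act:
  assumes "p * s - q * r = (1::'a::field)"
  shows "hess_a (act_coeffs p q r s f) = hess_a f * p^2 + hess_b f * p * q + hess_c f * q^2"
    and "hess_b (act_coeffs p q r s f) = 2 * hess_a f * p * r + hess_b f * (p * s + q * r) + 2 * hess_c f * q * s"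
    and "hess_c (act_coeffs p q r s f) = hess_a f * r^2 + hess_b f * r * s + hess_c f * s^2"
proof -
  have "hess_a (act_coeffs p q r s f) = (hess_a f * p^2 + hess_b f * p * q + hess_c f * q^2) * (p * s - q * r)^2"
    by (cases f) (simp add: algebra_simps power2_eq_square power3_eq_cube)
  then show "hess_a (act_coeffs p q r s f) = hess_a f * p^2 + hess_b f * p * q + hess_c f * q^2"
    by (simp add: assms)
  have "hess_b (act_coeffs p q r s f)
      = (2 * hess_a f * p * r + hess_b f * (p * s + q * r) + 2 * hess_c f * q * s) * (p * s - q * r)^2"
    by (cases f) (simp add: algebra_simps power2_eq_square power3_eq_cube)
  then show "hess_b (act_coeffs p q r s f) = 2 * hess_a f * p * r + hess_b f * (p * s + q * r) + 2 * hess_c f * q * s"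
    by (simp add: assms)
  have "hess_c (act_coeffs p q r s f) = (hess_a f * r^2 + hess_b f * r * s + hess_c f * s^2) * (p * s - q * r)^2"
    by (cases f) (simp add: algebra_simps power2_eq_square power3_eq_cube)
  then show "hess_c (act_coeffs p q r s f) = hess_a f * r^2 + hess_b f * r * s + hess_c f * s^2"
    by (simp add: assms)
qed

lemma disc_act:
  assumes "g \<in> SL2" "(3::'a::field) \<noteq> 0" shows "disc (act_form g f) = disc (f :: 'a cubic_form)"
proof -
  obtain p q r s where g: "g = mat2 p q r s" by (rule mat2_cases)
  then have det: "p * s - q * r = 1" using assms by (simp add: SL2_mat2)
  have id: "(2 * A * p * r + B * (p * s + q * r) + 2 * C * q * s)^2
      - 4 * (A * p^2 + B * p * q + C * q^2) * (A * r^2 + B * r * s + C * s^2)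
      = (B^2 - 4 * A * C) * (p * s - q * r)^2" for A B C :: 'a
    by (simp add: algebra_simps power2_eq_square)
  have "- 3 * disc (act_form g f) = - 3 * disc f"
    unfolding hess_disc[symmetric] g act_mat2 hess_act[OF det] id det by simp
  then show ?thesis using assms(2) by simp
qed

subsection \<open>The normal form of reducible forms\<close>

definition sl_equiv :: "'a::field cubic_form \<Rightarrow> 'a cubic_form \<Rightarrow> bool"
  where "sl_equiv f f' \<longleftrightarrow> (\<exists>g\<in>SL2. f' = act_form g f)"

lemma sl_equiv_sym: "sl_equiv f f' \<Longrightarrow> sl_equiv f' f"
  unfolding sl_equiv_def using act_form_inverse SL2_inverse by blast

lemma sl_equiv_trans: "sl_equiv f f' \<Longrightarrow> sl_equiv f' f'' \<Longrightarrow> sl_equiv f f''"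
  unfolding sl_equiv_def by (metis SL2_mult act_form_mult)

lemma sl_equivI: "p * s - q * r = 1 \<Longrightarrow> f' = act_coeffs p q r s f \<Longrightarrow> sl_equiv f f'"
  unfolding sl_equiv_def by (rule bexI[of _ "mat2 p q r s"]) (simp_all add: act_mat2 SL2_mat2)

lemma sl_equiv_disc: "sl_equiv f f' \<Longrightarrow> (3::'a::field) \<noteq> 0 \<Longrightarrow> disc f' = disc (f :: 'a cubic_form)"
  by (auto simp: sl_equiv_def disc_act)

text \<open>\<open>nform D\<close> is \<open>y (x\<^sup>2 - D y\<^sup>2)\<close>, a reducible form of discriminant \<open>4 D\<close>.\<close>

definition nform :: "'a::field \<Rightarrow> 'a cubic_form" where "nform D = Cubic 0 1 0 (- D)"

text \<open>
  Move the zero to \<open>(1, 0)\<close>, complete the square in the remaining quadratic factor, and scale by a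
  diagonal matrix.
\<close>

lemma sl_equiv_nform_if_zero:
  fixes f :: "'a::field cubic_form"
  assumes char: "(2::'a) \<noteq> 0" "(3::'a) \<noteq> 0" and d: "disc f = d" "d \<noteq> 0"
    and zero: "eval_form f x y = 0" "x \<noteq> 0 \<or> y \<noteq> 0"
  shows "sl_equiv f (nform (d / 4))"
proof -
  have four: "(4::'a) \<noteq> 0" using no_zero_divisors[OF char(1) char(1)] by simp
  obtain r s where rs: "x * s - y * r = 1"
  proof (cases "x = 0")
    case True
    then show ?thesis using that[of "0" "- 1 / y"] that[of 0 "- 1 / y"] zero(2) by (intro that[of 0 "- 1 / y"]) auto
  next
    case False
    then show ?thesis by (intro that[of "1 / x" 0]) auto
  qed
  obtain a0 b c e where f1: "act_coeffs x y r s f = Cubic a0 b c e" by (cases "act_coeffs x y r s f")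
  have "a0 = eval_form f x y" using f1 by (cases f) (auto simp: algebra_simps)
  then have f1: "act_coeffs x y r s f = Cubic 0 b c e" using f1 zero(1) by simp
  have e1: "sl_equiv f (Cubic 0 b c e)" using rs f1 by (intro sl_equivI) auto
  then have d1: "b^2 * c^2 - 4 * b^3 * e = d" using sl_equiv_disc[OF _ char(2)] d(1) by fastforce
  then have b: "b \<noteq> 0" using d(2) by auto
  define k where "k = - c / (2 * b)"
  define e' where "e' = b * k^2 + c * k + e"
  have "2 * b * k + c = 0" using b char by (simp add: k_def)
  then have e2: "sl_equiv (Cubic 0 b c e) (Cubic 0 b 0 e')"
    by (intro sl_equivI[of 1 1 0 k]) (simp_all add: e'_def algebra_simps)
  have e3: "sl_equiv (Cubic 0 b 0 e') (Cubic 0 1 0 (b^3 * e'))"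
    using b by (intro sl_equivI[of "1 / b" b 0 0]) (simp_all add: power2_eq_square)
  have all: "sl_equiv f (Cubic 0 1 0 (b^3 * e'))" by (rule sl_equiv_trans[OF sl_equiv_trans[OF e1 e2] e3])
  then have "- 4 * (b^3 * e') = d" using sl_equiv_disc[OF _ char(2)] d(1) by fastforce
  then have "b^3 * e' = - (d / 4)" using four by (auto simp: field_simps)
  then show ?thesis using all by (simp add: nform_def)
qed

lemma reducible_zero:
  assumes "reducible_form f"
  obtains x y where "eval_form f x y = 0" "x \<noteq> 0 \<or> y \<noteq> 0"
proof -
  obtain l0 l1 q0 q1 q2 where f: "f = Cubic (l0 * q0) (l0 * q1 + l1 * q0) (l0 * q2 + l1 * q1) (l1 * q2)"
    "f \<noteq> Cubic 0 0 0 0" using assms unfolding reducible_form_def by blast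
  have "eval_form f l1 (- l0) = 0" unfolding f by (simp add: algebra_simps power2_eq_square power3_eq_cube)
  moreover have "l1 \<noteq> 0 \<or> - l0 \<noteq> 0" using f by auto
  ultimately show ?thesis by (rule that)
qed

subsection \<open>The norm one torus of the Hessian\<close>

text \<open>
  \<open>tor D p q\<close> is multiplication by \<open>p + q \<surd>(-3 D)\<close>; on elements of norm \<open>1\<close> it preserves
  the Hessian \<open>x\<^sup>2 + 3 D y\<^sup>2\<close> of \<open>nform D\<close>.  The orbit of \<open>nform D\<close> under this torus consists of the
  forms \<open>tform D P Q\<close>, where \<open>P + Q \<surd>(-3 D)\<close> is the cube of \<open>p + q \<surd>(-3 D)\<close>.
\<close>

definition tor :: "'a::field \<Rightarrow> 'a \<Rightarrow> 'a \<Rightarrow> 'a^2^2" where "tor D p q = mat2 p q (- 3 * D * q) p"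

definition tform :: "'a::field \<Rightarrow> 'a \<Rightarrow> 'a \<Rightarrow> 'a cubic_form"
  where "tform D P Q = Cubic (Q / 3) P (- 3 * D * Q) (- D * P)"

lemma tform_1_0: "tform D 1 0 = nform D"
  by (simp add: tform_def nform_def)

lemma tor_SL2: "tor D p q \<in> SL2 \<longleftrightarrow> p^2 + 3 * D * q^2 = 1"
  by (simp add: tor_def SL2_mat2 power2_eq_square algebra_simps)

lemma tor_mult: "tor D p q ** tor D p' q' = tor D (p * p' - 3 * D * q * q') (p * q' + q * p')"
  by (simp add: tor_def mat2_mult mat2_eq_iff algebra_simps)

lemma tor_commute: "tor D p q ** tor D p' q' = tor D p' q' ** tor D p q"
  by (simp add: tor_mult algebra_simps)

lemma tor_1_0: "tor D 1 0 = mat 1"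
  by (simp add: tor_def mat2_one)

lemma tor_act:
  assumes n: "p^2 + 3 * D * q^2 = 1" and char: "(3::'a::field) \<noteq> 0"
  shows "act_form (tor D p q) (nform D) = tform D (4 * p^3 - 3 * p) (q * (4 * p^2 - (1::'a)))"
proof -
  have n': "3 * D * q^2 = 1 - p^2" using n by (simp add: algebra_simps)
  have "act_form (tor D p q) (nform D) = Cubic (q * (p^2 - D * q^2)) (p * (p^2 - 3 * (3 * D * q^2)))
      (- 3 * D * (q * (3 * p^2 - 3 * D * q^2))) (- D * (p * (p^2 - 3 * (3 * D * q^2))))"
    by (simp add: tor_def act_mat2 nform_def algebra_simps power2_eq_square power3_eq_cube)
  moreover have "q * (p^2 - D * q^2) = q * (4 * p^2 - 1) / 3"
  proof -
    have "3 * (q * (p^2 - D * q^2)) = q * (3 * p^2 - 3 * D * q^2)" by (simp add: algebra_simps)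
    also have "\<dots> = q * (4 * p^2 - 1)" unfolding n' by simp
    finally show ?thesis using char by (simp add: eq_divide_eq mult.commute)
  qed
  ultimately show ?thesis unfolding n' tform_def
    by (simp add: algebra_simps power2_eq_square power3_eq_cube)
qed

text \<open>
  The two forms have the same Hessian \<open>x\<^sup>2 + 3 D y\<^sup>2\<close>, which \<open>g\<close> therefore preserves; so \<open>g\<close> lies in its
  special orthogonal group, the torus.
\<close>

lemma nform_to_tform:
  fixes D :: "'a::field"
  assumes g: "g \<in> SL2" "act_form g (nform D) = tform D P Q" and n: "P^2 + 3 * D * Q^2 = 1"
    and char: "(2::'a) \<noteq> 0" "(3::'a) \<noteq> 0"
  obtains p q where "g = tor D p q" "p^2 + 3 * D * q^2 = 1" "P = 4 * p^3 - 3 * p" "Q = q * (4 * p^2 - 1)"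
proof -
  obtain p q r s where m: "g = mat2 p q r s" by (rule mat2_cases)
  have det: "p * s - q * r = 1" using g(1) by (simp add: m SL2_mat2)
  have act: "act_coeffs p q r s (nform D) = tform D P Q" using g(2) by (simp add: m act_mat2)
  have H: "hess_a (nform D) = 1" "hess_b (nform D) = 0" "hess_c (nform D) = 3 * D" by (simp_all add: nform_def)
  have "hess_a (tform D P Q) = P^2 + 3 * D * Q^2" using char by (simp add: tform_def power2_eq_square)
  then have a: "p^2 + 3 * D * q^2 = 1" using hess_act(1)[OF det, of "nform D"] n by (simp add: act H)
  have "hess_b (tform D P Q) = 0" using char by (simp add: tform_def field_simps)
  then have "2 * (p * r + 3 * D * q * s) = 0"
    using hess_act(2)[OF det, of "nform D"] by (simp add: act H algebra_simps)
  then have "p * r + 3 * D * q * s = 0" using char(1) by (metis mult_eq_0_iff)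
  then have b: "p * r = - (3 * D * q * s)" by (simp add: eq_neg_iff_add_eq_0)
  have "r = r * (p^2 + 3 * D * q^2)" by (simp add: a)
  also have "\<dots> = p * (p * r) + 3 * D * q * (q * r)" by (simp add: algebra_simps power2_eq_square)
  also have "\<dots> = - 3 * D * q * (p * s - q * r)" unfolding b by (simp add: algebra_simps)
  finally have r: "r = - 3 * D * q" by (simp add: det)
  have "s = s * (p^2 + 3 * D * q^2)" by (simp add: a)
  also have "\<dots> = p * (p * s) - q * (- (3 * D * q * s))" by (simp add: algebra_simps power2_eq_square)
  also have "\<dots> = p * (p * s - q * r)" unfolding b[symmetric] by (simp add: algebra_simps)
  finally have s: "s = p" by (simp add: det)
  have gt: "g = tor D p q" by (simp add: m r s tor_def)
  have "tform D (4 * p^3 - 3 * p) (q * (4 * p^2 - 1)) = tform D P Q"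
    using tor_act[OF a char(2)] g(2) by (simp add: gt)
  then show ?thesis using char by (intro that[OF gt a]) (auto simp: tform_def)
qed

lemma tform_norm:
  fixes p :: "'a::field"
  assumes "p^2 + 3 * D * q^2 = 1" shows "(4 * p^3 - 3 * p)^2 + 3 * D * (q * (4 * p^2 - 1))^2 = 1"
proof -
  have n': "3 * D * q^2 = 1 - p^2" using assms by (simp add: algebra_simps)
  have "3 * D * (q * (4 * p^2 - 1))^2 = (3 * D * q^2) * (4 * p^2 - 1)^2" by (simp add: power_mult_distrib)
  also have "\<dots> = (1 - p^2) * (4 * p^2 - 1)^2" by (simp only: n')
  finally show ?thesis by (simp add: algebra_simps power2_eq_square power3_eq_cube)
qed

text \<open>
  By \<open>nform_to_tform\<close> the stabilizer lies in the torus, and its elements have cube \<open>1\<close>; here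
  \<open>4 a\<^sup>3 - 3 a - 1 = (a - 1) (2 a + 1)\<^sup>2\<close>.
\<close>

lemma stabilizer_nform:
  fixes D :: "'a::field"
  assumes g: "g \<in> SL2" "act_form g (nform D) = nform D" and char: "(2::'a) \<noteq> 0" "(3::'a) \<noteq> 0"
  obtains a b where "g = tor D a b" "a^2 + 3 * D * b^2 = 1" "2 * a^2 - 1 = a" "2 * a * b = - b"
    "a = 1 \<or> a = - 1 / 2" "a = 1 \<longrightarrow> b = 0"
proof (rule nform_to_tform[OF g(1) _ _ char, of D 1 0])
  show "act_form g (nform D) = tform D 1 0" by (simp add: g(2) tform_1_0)
  fix a b assume t: "g = tor D a b" "a^2 + 3 * D * b^2 = 1" "1 = 4 * a^3 - 3 * a" "0 = b * (4 * a^2 - 1)"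
  have "(a - 1) * (2 * a + 1)^2 = 4 * a^3 - 3 * a - 1"
    by (simp add: algebra_simps power2_eq_square power3_eq_cube)
  then have "a = 1 \<or> 2 * a + 1 = 0" using t(3) by simp
  then show thesis
  proof
    assume a: "a = 1"
    then have "b * 3 = 0" using t(4) by simp
    then have "b = 0" using char by simp
    then show ?thesis using that[OF t(1,2)] a by simp
  next
    assume a: "2 * a + 1 = 0"
    then have 2: "2 * a = - 1" by (simp add: eq_neg_iff_add_eq_0)
    then have h: "a = - 1 / 2" using char by (simp add: field_simps)
    have "2 * a^2 - 1 = 2 * a * a - 1" by (simp add: power2_eq_square)
    also have "\<dots> = - a - 1" unfolding 2 by simp
    also have "\<dots> = a" using 2 by (simp add: algebra_simps eq_neg_iff_add_eq_0)
    finally have "2 * a^2 - 1 = a" .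
    moreover have "a \<noteq> 1" using 2 char by auto
    ultimately show ?thesis using that[OF t(1,2)] h 2 by simp
  qed
qed simp

section \<open>Hilbert 90 for the norm one torus\<close>

context separable_closure
begin

text \<open>
  The pair \<open>(a, b)\<close> stands for the cocycle \<open>a + b s\<close> with \<open>s = \<surd>(-3 D)\<close>, and \<open>(m, n)\<close> for an invertible
  element \<open>w = m + n s\<close> of the quadratic algebra with \<open>\<sigma>(w) = c\<^sub>\<sigma> w\<close>, where \<open>s\<close> is treated as fixed by the Galois
  group.  As in Hilbert's Theorem 90, \<open>w\<close> is a Poincare series \<open>\<Sum> \<tau>(\<alpha>) c\<^sub>\<tau>\<^sup>-\<^sup>1\<close>.  Both factors of its norm must be
  nonzero at once: each is nonzero for some \<open>\<alpha>\<close> by independence of characters, and then one of the two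
  choices of \<open>\<alpha>\<close> or their sum makes both nonzero.
\<close>

lemma torus_hilbert90:
  fixes a b :: "('s \<Rightarrow> 's) \<Rightarrow> 's"
  assumes char: "(2::'s) \<noteq> 0" "(3::'s) \<noteq> 0" and D: "\<iota> D \<noteq> 0"
    and S0: "finite S0" "\<And>u. u \<in> fixing_group \<iota> S0 \<Longrightarrow> a u = 1 \<and> b u = 0"
    and norm: "\<And>\<sigma>. \<sigma> \<in> galois_group \<iota> \<Longrightarrow> a \<sigma> ^ 2 + 3 * \<iota> D * b \<sigma> ^ 2 = 1"
    and cocycle: "\<And>\<sigma> \<tau>. \<sigma> \<in> galois_group \<iota> \<Longrightarrow> \<tau> \<in> galois_group \<iota> \<Longrightarrow>
        a (\<sigma> \<circ> \<tau>) = a \<sigma> * \<sigma> (a \<tau>) - 3 * \<iota> D * b \<sigma> * \<sigma> (b \<tau>)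
      \<and> b (\<sigma> \<circ> \<tau>) = a \<sigma> * \<sigma> (b \<tau>) + b \<sigma> * \<sigma> (a \<tau>)"
  obtains m n where "m ^ 2 + 3 * \<iota> D * n ^ 2 \<noteq> 0"
    "\<And>\<sigma>. \<sigma> \<in> galois_group \<iota> \<Longrightarrow> \<sigma> m = m * a \<sigma> - 3 * \<iota> D * n * b \<sigma> \<and> \<sigma> n = m * b \<sigma> + n * a \<sigma>"
proof -
  obtain R where R: "galois_stable R" "S0 \<subseteq> R" using galois_stable_superset[OF S0(1)] by blast
  obtain T where T: "finite T" "T \<subseteq> galois_group \<iota>"
    "\<And>\<sigma>. \<sigma> \<in> galois_group \<iota> \<Longrightarrow> \<exists>\<tau>\<in>T. \<forall>x\<in>R. \<tau> x = \<sigma> x"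
    "\<And>\<tau> \<tau>'. \<tau> \<in> T \<Longrightarrow> \<tau>' \<in> T \<Longrightarrow> \<forall>x\<in>R. \<tau> x = \<tau>' x \<Longrightarrow> \<tau> = \<tau>'"
    "\<And>F \<sigma>. (\<And>\<tau> \<tau>'. \<tau> \<in> galois_group \<iota> \<Longrightarrow> \<tau>' \<in> galois_group \<iota> \<Longrightarrow> \<forall>x\<in>R. \<tau> x = \<tau>' x
        \<Longrightarrow> F \<tau> = (F \<tau>' :: 's)) \<Longrightarrow> \<sigma> \<in> galois_group \<iota> \<Longrightarrow> (\<Sum>\<tau>\<in>T. F (\<sigma> \<circ> \<tau>)) = (\<Sum>\<tau>\<in>T. F \<tau>)"
    using transversal[OF R(1)] by blast
  have TG: "\<tau> \<in> galois_group \<iota>" if "\<tau> \<in> T" for \<tau> using T(2) that by blast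
  have ab_agree: "a \<sigma> = a \<tau> \<and> b \<sigma> = b \<tau>"
    if st: "\<sigma> \<in> galois_group \<iota>" "\<tau> \<in> galois_group \<iota>" "\<forall>x\<in>R. \<sigma> x = \<tau> x" for \<sigma> \<tau>
  proof -
    obtain \<rho> where \<rho>: "\<rho> \<in> galois_group \<iota>" "\<And>x. \<rho> (\<sigma> x) = x" "\<And>x. \<sigma> (\<rho> x) = x"
      using galois_inverse[OF st(1)] by blast
    have "\<rho> \<circ> \<tau> \<in> fixing_group \<iota> S0"
      unfolding fixing_group_def
    proof (intro CollectI conjI ballI)
      show "\<rho> \<circ> \<tau> \<in> galois_group \<iota>" by (rule galois_group_comp[OF \<rho>(1) st(2)])
      fix x assume "x \<in> S0"
      then have "\<tau> x = \<sigma> x" using st(3) R(2) by auto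
      then show "(\<rho> \<circ> \<tau>) x = x" by (simp add: \<rho>(2))
    qed
    then have 1: "a (\<rho> \<circ> \<tau>) = 1" "b (\<rho> \<circ> \<tau>) = 0" using S0(2) by blast+
    have "\<sigma> \<circ> (\<rho> \<circ> \<tau>) = \<tau>" using \<rho>(3) by (intro ext) simp
    moreover note cocycle[OF st(1) galois_group_comp[OF \<rho>(1) st(2)]]
    ultimately show ?thesis using 1 hom_1[OF galois_hom[OF st(1)]] hom_0[OF galois_hom[OF st(1)]] by simp
  qed
  define E where "E = {x. \<forall>u\<in>fixing_group \<iota> R. u x = x}"
  have fixG: "u \<in> galois_group \<iota>" if "u \<in> fixing_group \<iota> R" for u using that by (simp add: fixing_group_def)
  have E_1: "1 \<in> E" unfolding E_def using hom_1[OF galois_hom[OF fixG]] by blast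
  have E_mult: "x * y \<in> E" if xy: "x \<in> E" "y \<in> E" for x y
    unfolding E_def
  proof (intro CollectI ballI)
    fix u assume u: "u \<in> fixing_group \<iota> R"
    have "u x = x" "u y = y" using xy u by (auto simp: E_def)
    then show "u (x * y) = x * y" by (simp add: hom_mult[OF galois_hom[OF fixG[OF u]]])
  qed
  have E_add: "x + y \<in> E" if xy: "x \<in> E" "y \<in> E" for x y
    unfolding E_def
  proof (intro CollectI ballI)
    fix u assume u: "u \<in> fixing_group \<iota> R"
    have "u x = x" "u y = y" using xy u by (auto simp: E_def)
    then show "u (x + y) = x + y" by (simp add: hom_add[OF galois_hom[OF fixG[OF u]]])
  qed
  have E_agree: "\<sigma> x = \<tau> x"
    if "\<sigma> \<in> galois_group \<iota>" "\<tau> \<in> galois_group \<iota>" "\<forall>x\<in>R. \<sigma> x = \<tau> x" "x \<in> E" for \<sigma> \<tau> x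
    by (rule agree_on_fixed[OF that(1,2), of R]) (use that in \<open>auto simp: E_def\<close>)
  have E_separates: "\<exists>x\<in>E. \<tau> x \<noteq> \<tau>' x" if t: "\<tau> \<in> T" "\<tau>' \<in> T" "\<tau> \<noteq> \<tau>'" for \<tau> \<tau>'
  proof -
    obtain x where x: "x \<in> R" "\<tau> x \<noteq> \<tau>' x" using T(4)[OF t(1,2)] t(3) by blast
    then have "x \<in> E" by (simp add: E_def fixing_group_def)
    then show ?thesis using x by blast
  qed
  define m where "m \<alpha> = (\<Sum>\<tau>\<in>T. \<tau> \<alpha> * a \<tau>)" for \<alpha>
  define n where "n \<alpha> = - (\<Sum>\<tau>\<in>T. \<tau> \<alpha> * b \<tau>)" for \<alpha>
  have equiv: "\<sigma> (m \<alpha>) = m \<alpha> * a \<sigma> - 3 * \<iota> D * n \<alpha> * b \<sigma> \<and> \<sigma> (n \<alpha>) = m \<alpha> * b \<sigma> + n \<alpha> * a \<sigma>"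
    if s: "\<sigma> \<in> galois_group \<iota>" and \<alpha>: "\<alpha> \<in> E" for \<sigma> \<alpha>
  proof -
    note h = galois_hom[OF s]
    have tr: "(\<Sum>\<tau>\<in>T. (\<sigma> \<circ> \<tau>) \<alpha> * a (\<sigma> \<circ> \<tau>)) = m \<alpha>" "(\<Sum>\<tau>\<in>T. (\<sigma> \<circ> \<tau>) \<alpha> * b (\<sigma> \<circ> \<tau>)) = - n \<alpha>"
      unfolding m_def n_def minus_minus
      by (rule T(5)[OF _ s], metis E_agree ab_agree \<alpha>)+
    have inv: "\<sigma> (a \<tau>) = a \<sigma> * a (\<sigma> \<circ> \<tau>) + 3 * \<iota> D * b \<sigma> * b (\<sigma> \<circ> \<tau>)"
      "\<sigma> (b \<tau>) = a \<sigma> * b (\<sigma> \<circ> \<tau>) - b \<sigma> * a (\<sigma> \<circ> \<tau>)" if "\<tau> \<in> T" for \<tau>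
    proof -
      have c: "a (\<sigma> \<circ> \<tau>) = a \<sigma> * \<sigma> (a \<tau>) - 3 * \<iota> D * b \<sigma> * \<sigma> (b \<tau>)"
        "b (\<sigma> \<circ> \<tau>) = a \<sigma> * \<sigma> (b \<tau>) + b \<sigma> * \<sigma> (a \<tau>)" using cocycle[OF s TG[OF that]] by blast+
      have "a \<sigma> * a (\<sigma> \<circ> \<tau>) + 3 * \<iota> D * b \<sigma> * b (\<sigma> \<circ> \<tau>) = (a \<sigma> ^ 2 + 3 * \<iota> D * b \<sigma> ^ 2) * \<sigma> (a \<tau>)"
        unfolding c by (simp add: algebra_simps power2_eq_square)
      then show "\<sigma> (a \<tau>) = a \<sigma> * a (\<sigma> \<circ> \<tau>) + 3 * \<iota> D * b \<sigma> * b (\<sigma> \<circ> \<tau>)" by (simp add: norm[OF s])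
      have "a \<sigma> * b (\<sigma> \<circ> \<tau>) - b \<sigma> * a (\<sigma> \<circ> \<tau>) = (a \<sigma> ^ 2 + 3 * \<iota> D * b \<sigma> ^ 2) * \<sigma> (b \<tau>)"
        unfolding c by (simp add: algebra_simps power2_eq_square)
      then show "\<sigma> (b \<tau>) = a \<sigma> * b (\<sigma> \<circ> \<tau>) - b \<sigma> * a (\<sigma> \<circ> \<tau>)" by (simp add: norm[OF s])
    qed
    have "\<sigma> (m \<alpha>) = (\<Sum>\<tau>\<in>T. (\<sigma> \<circ> \<tau>) \<alpha> * (a \<sigma> * a (\<sigma> \<circ> \<tau>) + 3 * \<iota> D * b \<sigma> * b (\<sigma> \<circ> \<tau>)))"
      unfolding m_def hom_sum[OF h UNIV_I] by (intro sum.cong refl) (simp add: hom_mult[OF h] inv(1))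
    also have "\<dots> = a \<sigma> * (\<Sum>\<tau>\<in>T. (\<sigma> \<circ> \<tau>) \<alpha> * a (\<sigma> \<circ> \<tau>)) + 3 * \<iota> D * b \<sigma> * (\<Sum>\<tau>\<in>T. (\<sigma> \<circ> \<tau>) \<alpha> * b (\<sigma> \<circ> \<tau>))"
      unfolding sum_distrib_left sum.distrib[symmetric] by (intro sum.cong refl) (simp add: algebra_simps)
    finally have 1: "\<sigma> (m \<alpha>) = a \<sigma> * m \<alpha> + 3 * \<iota> D * b \<sigma> * - n \<alpha>" unfolding tr .
    have "\<sigma> (n \<alpha>) = - (\<Sum>\<tau>\<in>T. (\<sigma> \<circ> \<tau>) \<alpha> * (a \<sigma> * b (\<sigma> \<circ> \<tau>) - b \<sigma> * a (\<sigma> \<circ> \<tau>)))"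
      unfolding n_def hom_minus[OF h UNIV_I] hom_sum[OF h UNIV_I]
      by (intro arg_cong[of _ _ uminus] sum.cong refl) (simp add: hom_mult[OF h] inv(2))
    also have "(\<Sum>\<tau>\<in>T. (\<sigma> \<circ> \<tau>) \<alpha> * (a \<sigma> * b (\<sigma> \<circ> \<tau>) - b \<sigma> * a (\<sigma> \<circ> \<tau>)))
        = a \<sigma> * (\<Sum>\<tau>\<in>T. (\<sigma> \<circ> \<tau>) \<alpha> * b (\<sigma> \<circ> \<tau>)) - b \<sigma> * (\<Sum>\<tau>\<in>T. (\<sigma> \<circ> \<tau>) \<alpha> * a (\<sigma> \<circ> \<tau>))"
      unfolding sum_distrib_left sum_subtractf[symmetric] by (intro sum.cong refl) (simp add: algebra_simps)
    finally have 2: "\<sigma> (n \<alpha>) = - (a \<sigma> * - n \<alpha> - b \<sigma> * m \<alpha>)" unfolding tr .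
    show ?thesis using 1 2 by (simp add: algebra_simps)
  qed
  (* Over the separable closure the norm form splits into two linear factors. *)
  have "coprime [:3 * \<iota> D, 0, 1:] (pderiv [:3 * \<iota> D, 0, 1:])"
  proof (rule coprimeI)
    fix c assume c: "c dvd [:3 * \<iota> D, 0, 1:]" "c dvd pderiv [:3 * \<iota> D, 0, 1:]"
    have "[:inverse (3 * \<iota> D):] * [:3 * \<iota> D, 0, 1:] + [:0, - inverse (2 * (3 * \<iota> D)):] * pderiv [:3 * \<iota> D, 0, 1:] = 1"
      using char D no_zero_divisors[OF char] by (simp add: pderiv_pCons one_pCons field_simps)
    then show "is_unit c" using c by (metis dvd_add dvd_mult)
  qed
  then obtain s0 where "poly [:3 * \<iota> D, 0, 1:] s0 = 0" using separably_closed[of "[:3 * \<iota> D, 0, 1:]"] by auto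
  then have s0: "s0 * s0 = - (3 * \<iota> D)" by (simp add: eq_neg_iff_add_eq_0 add.commute)
  have fact: "m \<alpha> ^ 2 + 3 * \<iota> D * n \<alpha> ^ 2 = (m \<alpha> + s0 * n \<alpha>) * (m \<alpha> - s0 * n \<alpha>)" for \<alpha>
  proof -
    have "(m \<alpha> + s0 * n \<alpha>) * (m \<alpha> - s0 * n \<alpha>) = m \<alpha> ^ 2 - (s0 * s0) * n \<alpha> ^ 2"
      by (simp add: algebra_simps power2_eq_square)
    then show ?thesis by (simp add: s0)
  qed
  have nonzero: "\<exists>\<alpha>\<in>E. m \<alpha> + s * n \<alpha> \<noteq> 0" if s: "s * s = - (3 * \<iota> D)" for s
  proof (rule ccontr)
    assume "\<not> ?thesis"
    then have z: "m \<alpha> + s * n \<alpha> = 0" if "\<alpha> \<in> E" for \<alpha> using that by blast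
    obtain \<tau> where \<tau>: "\<tau> \<in> T" using T(3)[OF galois_id] by blast
    have "a \<tau> - s * b \<tau> = 0"
    proof (rule independence_of_characters[OF T(1) E_1 E_mult, where k = "\<lambda>\<tau>. a \<tau> - s * b \<tau>" and \<tau> = \<tau>])
      fix x assume "x \<in> E"
      have "(\<Sum>\<tau>\<in>T. (a \<tau> - s * b \<tau>) * \<tau> x) = m x + s * n x"
        unfolding m_def n_def by (simp add: sum_distrib_left sum_subtractf algebra_simps)
      then show "(\<Sum>\<tau>\<in>T. (a \<tau> - s * b \<tau>) * \<tau> x) = 0" using z[OF \<open>x \<in> E\<close>] by simp
    next
      fix \<tau> assume t: "\<tau> \<in> T"
      show "\<tau> 1 = 1" by (rule hom_1[OF galois_hom[OF TG[OF t]]])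
      show "\<tau> (x * y) = \<tau> x * \<tau> y" for x y by (rule hom_mult[OF galois_hom[OF TG[OF t]] UNIV_I UNIV_I])
    qed (use \<tau> E_separates in auto)
    then have "a \<tau> = s * b \<tau>" by simp
    then have "a \<tau> ^ 2 + 3 * \<iota> D * b \<tau> ^ 2 = (s * s + 3 * \<iota> D) * b \<tau> ^ 2"
      by (simp add: power2_eq_square algebra_simps)
    then show False using norm[OF TG[OF \<tau>]] by (simp add: s)
  qed
  obtain \<alpha> where \<alpha>: "\<alpha> \<in> E" "m \<alpha> + s0 * n \<alpha> \<noteq> 0" using nonzero[OF s0] by blast
  obtain \<beta> where \<beta>: "\<beta> \<in> E" "m \<beta> - s0 * n \<beta> \<noteq> 0" using nonzero[of "- s0"] s0 by auto
  have add: "m (\<alpha> + \<beta>) = m \<alpha> + m \<beta>" "n (\<alpha> + \<beta>) = n \<alpha> + n \<beta>"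
  proof -
    have "(\<Sum>\<tau>\<in>T. \<tau> (\<alpha> + \<beta>) * k \<tau>) = (\<Sum>\<tau>\<in>T. \<tau> \<alpha> * k \<tau>) + (\<Sum>\<tau>\<in>T. \<tau> \<beta> * k \<tau>)" for k
      unfolding sum.distrib[symmetric]
    proof (intro sum.cong refl)
      fix \<tau> assume "\<tau> \<in> T"
      then show "\<tau> (\<alpha> + \<beta>) * k \<tau> = \<tau> \<alpha> * k \<tau> + \<tau> \<beta> * k \<tau>"
        by (simp add: hom_add[OF galois_hom[OF TG]] distrib_right)
    qed
    then show "m (\<alpha> + \<beta>) = m \<alpha> + m \<beta>" "n (\<alpha> + \<beta>) = n \<alpha> + n \<beta>" by (simp_all add: m_def n_def)
  qed
  have "\<exists>\<gamma>\<in>E. m \<gamma> + s0 * n \<gamma> \<noteq> 0 \<and> m \<gamma> - s0 * n \<gamma> \<noteq> 0"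
  proof (cases "m \<alpha> - s0 * n \<alpha> = 0 \<and> m \<beta> + s0 * n \<beta> = 0")
    case True
    have "m (\<alpha> + \<beta>) + s0 * n (\<alpha> + \<beta>) = (m \<alpha> + s0 * n \<alpha>) + (m \<beta> + s0 * n \<beta>)"
      "m (\<alpha> + \<beta>) - s0 * n (\<alpha> + \<beta>) = (m \<alpha> - s0 * n \<alpha>) + (m \<beta> - s0 * n \<beta>)"
      by (simp_all add: add algebra_simps)
    then show ?thesis using True \<alpha> \<beta> by (intro bexI[of _ "\<alpha> + \<beta>"] E_add) auto
  next
    case False
    then show ?thesis using \<alpha> \<beta> by blast
  qed
  then obtain \<gamma> where \<gamma>: "\<gamma> \<in> E" "m \<gamma> ^ 2 + 3 * \<iota> D * n \<gamma> ^ 2 \<noteq> 0" by (auto simp: fact)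
  show ?thesis by (rule that[OF \<gamma>(2) equiv[OF _ \<gamma>(1)]])
qed

text \<open>
  A cocycle \<open>c\<close> of the norm one torus need not be a coboundary there, but one of order \<open>3\<close> is.  If \<open>w\<close>
  trivializes \<open>c\<close> in the multiplicative group of the quadratic algebra, then the conjugate of \<open>w\<close> divided
  by \<open>w\<close> has norm one, and it trivializes \<open>c\<^sup>-\<^sup>2 = c\<close>.
\<close>

lemma torus_cocycle_trivial:
  fixes a b :: "('s \<Rightarrow> 's) \<Rightarrow> 's"
  assumes char: "(2::'s) \<noteq> 0" "(3::'s) \<noteq> 0" and D: "\<iota> D \<noteq> 0"
    and S0: "finite S0" "\<And>u. u \<in> fixing_group \<iota> S0 \<Longrightarrow> a u = 1 \<and> b u = 0"
    and norm: "\<And>\<sigma>. \<sigma> \<in> galois_group \<iota> \<Longrightarrow> a \<sigma> ^ 2 + 3 * \<iota> D * b \<sigma> ^ 2 = 1"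
    and cocycle: "\<And>\<sigma> \<tau>. \<sigma> \<in> galois_group \<iota> \<Longrightarrow> \<tau> \<in> galois_group \<iota> \<Longrightarrow>
        a (\<sigma> \<circ> \<tau>) = a \<sigma> * \<sigma> (a \<tau>) - 3 * \<iota> D * b \<sigma> * \<sigma> (b \<tau>)
      \<and> b (\<sigma> \<circ> \<tau>) = a \<sigma> * \<sigma> (b \<tau>) + b \<sigma> * \<sigma> (a \<tau>)"
    and order3: "\<And>\<sigma>. \<sigma> \<in> galois_group \<iota> \<Longrightarrow> 2 * a \<sigma> ^ 2 - 1 = a \<sigma> \<and> 2 * a \<sigma> * b \<sigma> = - b \<sigma>"
  obtains p q where "p ^ 2 + 3 * \<iota> D * q ^ 2 = 1"
    "\<And>\<sigma>. \<sigma> \<in> galois_group \<iota> \<Longrightarrow> \<sigma> p = p * a \<sigma> - 3 * \<iota> D * q * b \<sigma> \<and> \<sigma> q = p * b \<sigma> + q * a \<sigma>"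
proof -
  obtain m n where N: "m ^ 2 + 3 * \<iota> D * n ^ 2 \<noteq> 0"
    and mn: "\<And>\<sigma>. \<sigma> \<in> galois_group \<iota> \<Longrightarrow> \<sigma> m = m * a \<sigma> - 3 * \<iota> D * n * b \<sigma> \<and> \<sigma> n = m * b \<sigma> + n * a \<sigma>"
    by (rule torus_hilbert90[OF char D S0 norm cocycle]) (assumption | blast)+
  define N where "N = m ^ 2 + 3 * \<iota> D * n ^ 2"
  define p where "p = (m ^ 2 - 3 * \<iota> D * n ^ 2) / N"
  define q where "q = - (2 * m * n) / N"
  have N0: "N \<noteq> 0" using N by (simp add: N_def)
  have pN: "p * N = m ^ 2 - 3 * \<iota> D * n ^ 2" and qN: "q * N = - (2 * m * n)"
    using N0 by (simp_all add: p_def q_def)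
  have "(p ^ 2 + 3 * \<iota> D * q ^ 2) * N ^ 2 = (p * N) ^ 2 + 3 * \<iota> D * (q * N) ^ 2"
    by (simp add: algebra_simps power2_eq_square)
  also have "\<dots> = 1 * N ^ 2"
    unfolding pN qN by (simp add: N_def algebra_simps power2_eq_square)
  finally have "p ^ 2 + 3 * \<iota> D * q ^ 2 = 1" using N0 by simp
  moreover have "\<sigma> p = p * a \<sigma> - 3 * \<iota> D * q * b \<sigma> \<and> \<sigma> q = p * b \<sigma> + q * a \<sigma>"
    if s: "\<sigma> \<in> galois_group \<iota>" for \<sigma>
  proof -
    note h = galois_hom[OF s]
    define A where "A = a \<sigma>"
    define B where "B = b \<sigma>"
    define K where "K = 3 * \<iota> D"
    have nm: "A ^ 2 + K * B ^ 2 = 1" using norm[OF s] by (simp add: A_def B_def K_def)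
    have KB: "K * B ^ 2 = 1 - A ^ 2" using nm by (simp add: algebra_simps)
    have o: "2 * A ^ 2 - 1 = A" "2 * A * B = - B" using order3[OF s] by (simp_all add: A_def B_def)
    have o1: "A ^ 2 - K * B ^ 2 = A" unfolding KB using o(1) by simp
    have sm: "\<sigma> m = m * A - K * n * B" "\<sigma> n = m * B + n * A" using mn[OF s] by (simp_all add: A_def B_def K_def)
    have sK: "\<sigma> K = K" unfolding K_def using hom_mult[OF h] hom_numeral[OF h] galois_emb[OF s] by simp
    have NK: "N = m ^ 2 + K * n ^ 2" "p * N = m ^ 2 - K * n ^ 2" using pN by (simp_all add: N_def K_def)
    have hs: "\<sigma> (x + y) = \<sigma> x + \<sigma> y" "\<sigma> (x - y) = \<sigma> x - \<sigma> y" "\<sigma> (x * y) = \<sigma> x * \<sigma> y"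
      "\<sigma> (x ^ k) = \<sigma> x ^ k" "\<sigma> (- x) = - \<sigma> x" "\<sigma> 2 = 2" for x y k
      using hom_add[OF h] hom_diff[OF h] hom_mult[OF h] hom_power[OF h] hom_minus[OF h] hom_numeral[OF h] by auto
    have "\<sigma> N = (m ^ 2 + K * n ^ 2) * (A ^ 2 + K * B ^ 2)"
      unfolding NK(1) hs sm sK by (simp add: algebra_simps power2_eq_square)
    then have sN: "\<sigma> N = N" by (simp add: nm NK(1))
    have "\<sigma> (p * N) = (m ^ 2 - K * n ^ 2) * (A ^ 2 - K * B ^ 2) - 2 * K * m * n * (2 * A * B)"
      unfolding NK(2) hs sm sK by (simp add: algebra_simps power2_eq_square)
    also have "\<dots> = (p * N) * A - K * (q * N) * B" unfolding o1 o(2) NK(2) qN by (simp add: algebra_simps)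
    also have "\<dots> = (p * A - K * q * B) * N" by (simp add: algebra_simps)
    finally have "\<sigma> p * N = (p * A - K * q * B) * N" by (simp add: hs(3) sN)
    then have 1: "\<sigma> p = p * A - K * q * B" using N0 by simp
    have "\<sigma> (q * N) = - (m * n * (2 * (A ^ 2 - K * B ^ 2)) + (m ^ 2 - K * n ^ 2) * (2 * A * B))"
      unfolding qN hs sm by (simp add: algebra_simps power2_eq_square)
    also have "\<dots> = (p * N) * B + (q * N) * A" unfolding o1 o(2) NK(2) qN by (simp add: algebra_simps)
    also have "\<dots> = (p * B + q * A) * N" by (simp add: algebra_simps)
    finally have "\<sigma> q * N = (p * B + q * A) * N" by (simp add: hs(3) sN)
    then have 2: "\<sigma> q = p * B + q * A" using N0 by simp
    show ?thesis using 1 2 by (simp add: A_def B_def K_def)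
  qed
  ultimately show ?thesis by (rule that)
qed

end

section \<open>Cohomology classes and orbits\<close>

locale cubic_setup = separable_closure \<iota> for \<iota> :: "'f::field \<Rightarrow> 's::field" +
  fixes d :: 'f and f0 :: "'f cubic_form"
  assumes char: "(2::'f) \<noteq> 0" "(3::'f) \<noteq> 0" and d0: "d \<noteq> 0"
    and disc_f0: "disc f0 = d" and reducible_f0: "reducible_form f0"
begin

abbreviation "F0 \<equiv> map_cubic_form \<iota> f0"
abbreviation "A \<equiv> stab \<iota> f0"
abbreviation "C \<equiv> carrier (stab \<iota> f0)"
abbreviation "G \<equiv> galois_group \<iota>"

definition D :: 'f where "D = d / 4"

lemma four: "(4::'f) \<noteq> 0"
  using no_zero_divisors[OF char(1) char(1)] by simp

lemma D0: "D \<noteq> 0"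
  using d0 four by (simp add: D_def)

lemma charS: "(2::'s) \<noteq> 0" "(3::'s) \<noteq> 0"
  using char emb_eq_0[of 2] emb_eq_0[of 3] by (simp_all add: emb_numeral)

lemma emb_nform: "map_cubic_form \<iota> (nform x) = nform (\<iota> x)"
  by (simp add: nform_def emb_0 emb_one emb_minus)

lemma emb_tform: "map_cubic_form \<iota> (tform x y z) = tform (\<iota> x) (\<iota> y) (\<iota> z)"
  by (simp add: tform_def emb_simps)

definition \<delta> :: "'f^2^2" where "\<delta> = (SOME g. g \<in> SL2 \<and> f0 = act_form g (nform D))"

lemma delta: "\<delta> \<in> SL2" "f0 = act_form \<delta> (nform D)"
proof -
  obtain x y where "eval_form f0 x y = 0" "x \<noteq> 0 \<or> y \<noteq> 0" using reducible_zero[OF reducible_f0] by blast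
  then have "sl_equiv f0 (nform D)"
    unfolding D_def by (intro sl_equiv_nform_if_zero char disc_f0 d0)
  then have "\<exists>g. g \<in> SL2 \<and> f0 = act_form g (nform D)" using sl_equiv_sym unfolding sl_equiv_def by blast
  from someI_ex[OF this] show "\<delta> \<in> SL2" "f0 = act_form \<delta> (nform D)" by (auto simp: \<delta>_def)
qed

abbreviation "\<Delta> \<equiv> map_matrix \<iota> \<delta>"

lemma Delta: "\<Delta> \<in> SL2" "F0 = act_form \<Delta> (nform (\<iota> D))"
proof -
  show "\<Delta> \<in> SL2" by (rule map_matrix_SL2[OF hom_emb delta(1)])
  show "F0 = act_form \<Delta> (nform (\<iota> D))"
    by (subst delta(2)) (simp add: map_act_form[OF hom_emb] emb_nform)
qed

lemma C_iff: "g \<in> C \<longleftrightarrow> g \<in> SL2 \<and> act_form g F0 = F0"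
  by (simp add: stab_def)

lemma C_SL2: "g \<in> C \<Longrightarrow> g \<in> SL2"
  by (simp add: C_iff)

lemma stab_mult: "x \<otimes>\<^bsub>A\<^esub> y = x ** y" "\<one>\<^bsub>A\<^esub> = mat 1"
  by (simp_all add: stab_def)

lemma C_conj:
  assumes "g \<in> C"
  obtains a b where "g = \<Delta> ** tor (\<iota> D) a b ** matrix_inv \<Delta>" "a^2 + 3 * \<iota> D * b^2 = 1"
    "2 * a^2 - 1 = a" "2 * a * b = - b" "a = 1 \<or> a = - 1 / 2" "a = 1 \<longrightarrow> b = 0"
proof -
  define k where "k = matrix_inv \<Delta> ** g ** \<Delta>"
  have kS: "k \<in> SL2" unfolding k_def using C_SL2[OF assms] Delta(1) SL2_inverse by (intro SL2_mult) auto
  have "act_form k (nform (\<iota> D)) = act_form (matrix_inv \<Delta>) (act_form g F0)"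
    by (simp add: k_def act_form_mult Delta(2))
  also have "\<dots> = nform (\<iota> D)"
    using assms act_form_inverse[OF Delta(1) Delta(2)[symmetric]] by (simp add: C_iff)
  finally have kN: "act_form k (nform (\<iota> D)) = nform (\<iota> D)" .
  have "g = (\<Delta> ** matrix_inv \<Delta>) ** g ** (\<Delta> ** matrix_inv \<Delta>)" using SL2_inverse(3)[OF Delta(1)] by simp
  then have gk: "g = \<Delta> ** k ** matrix_inv \<Delta>" by (simp add: k_def matrix_mul_assoc)
  show ?thesis
    by (rule stabilizer_nform[OF kS kN charS]) (rule that, use gk in auto)
qed

lemma C_one: "mat 1 \<in> C"
  by (simp add: C_iff SL2_one act_form_one)

lemma C_mult: "g \<in> C \<Longrightarrow> h \<in> C \<Longrightarrow> g ** h \<in> C"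
  by (simp add: C_iff SL2_mult act_form_mult)

lemma C_inv: "g \<in> C \<Longrightarrow> matrix_inv g \<in> C"
  using act_form_inverse SL2_inverse by (metis C_iff)

lemma C_commute: "g \<in> C \<Longrightarrow> h \<in> C \<Longrightarrow> g ** h = h ** g"
proof -
  assume g: "g \<in> C" and h: "h \<in> C"
  obtain a b where ab: "g = \<Delta> ** tor (\<iota> D) a b ** matrix_inv \<Delta>" by (rule C_conj[OF g])
  obtain x y where xy: "h = \<Delta> ** tor (\<iota> D) x y ** matrix_inv \<Delta>" by (rule C_conj[OF h])
  have "\<Delta> ** X ** matrix_inv \<Delta> ** (\<Delta> ** Y ** matrix_inv \<Delta>) = \<Delta> ** (X ** Y) ** matrix_inv \<Delta>" for X Y
  proof -
    have "\<Delta> ** X ** matrix_inv \<Delta> ** (\<Delta> ** Y ** matrix_inv \<Delta>) = \<Delta> ** X ** (matrix_inv \<Delta> ** \<Delta>) ** Y ** matrix_inv \<Delta>"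
      by (simp add: matrix_mul_assoc)
    then show ?thesis using SL2_inverse(2)[OF Delta(1)] by (simp add: matrix_mul_assoc)
  qed
  then show ?thesis by (simp add: ab xy tor_commute)
qed

lemma galois_F0: "\<sigma> \<in> G \<Longrightarrow> map_cubic_form \<sigma> (map_cubic_form \<iota> f) = map_cubic_form \<iota> f"
  by (cases f) (simp add: galois_emb)

lemma galois_C: "\<sigma> \<in> G \<Longrightarrow> g \<in> C \<Longrightarrow> map_matrix \<sigma> g \<in> C"
  using map_act_form[OF galois_hom, of \<sigma> g F0] map_matrix_SL2[OF galois_hom]
  by (simp add: C_iff galois_F0)

lemma stab_inv: "g \<in> C \<Longrightarrow> inv\<^bsub>A\<^esub> g = matrix_inv g"
  unfolding m_inv_def
proof (rule the_equality)
  assume g: "g \<in> C"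
  show "matrix_inv g \<in> C \<and> g \<otimes>\<^bsub>A\<^esub> matrix_inv g = \<one>\<^bsub>A\<^esub> \<and> matrix_inv g \<otimes>\<^bsub>A\<^esub> g = \<one>\<^bsub>A\<^esub>"
    using C_inv[OF g] SL2_inverse[OF C_SL2[OF g]] by (simp add: stab_mult)
  show "y = matrix_inv g" if "y \<in> C \<and> g \<otimes>\<^bsub>A\<^esub> y = \<one>\<^bsub>A\<^esub> \<and> y \<otimes>\<^bsub>A\<^esub> g = \<one>\<^bsub>A\<^esub>" for y
    using matrix_inv_unique[OF C_SL2[OF g], of y] that by (simp add: stab_mult)
qed

subsection \<open>Classes over a group of automorphisms\<close>

text \<open>
  The cocycle \<open>\<sigma> \<mapsto> h\<^sup>-\<^sup>1 \<sigma>(h)\<close> and the class of a cochain, both for an arbitrary set \<open>H\<close> of automorphisms, so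
  that the Galois group and the inertia group are treated alike.
\<close>

definition bnd :: "('s \<Rightarrow> 's) set \<Rightarrow> 's^2^2 \<Rightarrow> ('s \<Rightarrow> 's) \<Rightarrow> 's^2^2"
  where "bnd H h = (\<lambda>\<sigma>\<in>H. matrix_inv h ** map_matrix \<sigma> h)"

definition cls :: "('s \<Rightarrow> 's) set \<Rightarrow> (('s \<Rightarrow> 's) \<Rightarrow> 's^2^2) \<Rightarrow> (('s \<Rightarrow> 's) \<Rightarrow> 's^2^2) set"
  where "cls H c = {\<lambda>\<sigma>\<in>H. bnd H h \<sigma> ** c \<sigma> | h. h \<in> C}"

lemma B1_eq: "B1 T A map_matrix = bnd (topspace T) ` C"
  unfolding B1_def Setcompr_eq_image Collect_mem_eq
  by (intro image_cong refl) (auto simp: bnd_def stab_inv stab_mult)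

lemma cohomology_class_eq: "cohomology_class T A map_matrix c = cls (topspace T) c"
  unfolding cohomology_class_def r_coset_def B1_eq cls_def Z1_def by (auto simp: stab_mult)

lemma bnd_mult:
  assumes "H \<subseteq> G" "h \<in> C" "k \<in> C" "\<sigma> \<in> H"
  shows "bnd H h \<sigma> ** bnd H k \<sigma> = bnd H (h ** k) \<sigma>"
proof -
  have s: "\<sigma> \<in> G" using assms by blast
  have c: "matrix_inv k ** map_matrix \<sigma> k \<in> C" using C_mult C_inv galois_C[OF s] assms(3) by blast
  have ci: "matrix_inv h \<in> C" "matrix_inv k \<in> C" "map_matrix \<sigma> h \<in> C" "map_matrix \<sigma> k \<in> C"
    using C_inv galois_C[OF s] assms by auto
  have "bnd H (h ** k) \<sigma> = matrix_inv k ** (matrix_inv h ** map_matrix \<sigma> h) ** map_matrix \<sigma> k"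
    using assms by (simp add: bnd_def matrix_inv_mult C_SL2 map_matrix_mult[OF galois_hom[OF s]] matrix_mul_assoc)
  also have "matrix_inv k ** (matrix_inv h ** map_matrix \<sigma> h) = matrix_inv h ** map_matrix \<sigma> h ** matrix_inv k"
    by (intro C_commute C_mult ci)
  finally show ?thesis using assms(4) by (simp add: bnd_def matrix_mul_assoc)
qed

lemma cls_shift:
  assumes H: "H \<subseteq> G" and k: "k \<in> C" and c: "\<And>\<sigma>. \<sigma> \<in> H \<Longrightarrow> c' \<sigma> = bnd H k \<sigma> ** c \<sigma>"
  shows "cls H c' = cls H c"
proof -
  have e: "(\<lambda>\<sigma>\<in>H. bnd H h \<sigma> ** c' \<sigma>) = (\<lambda>\<sigma>\<in>H. bnd H (h ** k) \<sigma> ** c \<sigma>)" if "h \<in> C" for h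
    using bnd_mult[OF H that k] c by (auto intro!: restrict_ext simp: matrix_mul_assoc)
  show ?thesis
  proof (intro equalityI subsetI)
    fix x assume "x \<in> cls H c'"
    then show "x \<in> cls H c" unfolding cls_def using e C_mult[OF _ k] by blast
  next
    fix x assume "x \<in> cls H c"
    then obtain h where h: "h \<in> C" "x = (\<lambda>\<sigma>\<in>H. bnd H h \<sigma> ** c \<sigma>)" by (auto simp: cls_def)
    have "h ** matrix_inv k ** k = h" using SL2_inverse(2)[OF C_SL2[OF k]] by (simp flip: matrix_mul_assoc)
    then have "x = (\<lambda>\<sigma>\<in>H. bnd H (h ** matrix_inv k) \<sigma> ** c' \<sigma>)"
      using e[OF C_mult[OF h(1) C_inv[OF k]]] h(2) by simp
    then show "x \<in> cls H c'" unfolding cls_def using C_mult[OF h(1) C_inv[OF k]] by blast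
  qed
qed

lemma bnd_one: "H \<subseteq> G \<Longrightarrow> \<sigma> \<in> H \<Longrightarrow> bnd H (mat 1) \<sigma> = mat 1"
proof -
  assume a: "H \<subseteq> G" "\<sigma> \<in> H"
  then have h: "hom_on UNIV \<sigma>" using galois_hom by blast
  have "map_matrix \<sigma> (mat 1) = (mat 1 :: 's^2^2)" by (simp add: mat2_one map_mat2 hom_0[OF h] hom_1[OF h])
  then show ?thesis using SL2_inverse(2)[OF SL2_one] a by (simp add: bnd_def)
qed

lemma cls_self: "H \<subseteq> G \<Longrightarrow> c \<in> extensional H \<Longrightarrow> c \<in> cls H c"
  unfolding cls_def using C_one bnd_one
  by (intro CollectI exI[of _ "mat 1"] conjI) (auto simp: extensional_def fun_eq_iff)

lemma cls_trivial: "H \<subseteq> G \<Longrightarrow> cls H (\<lambda>\<sigma>\<in>H. mat 1) = bnd H ` C"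
  unfolding cls_def Setcompr_eq_image Collect_mem_eq
  by (intro image_cong refl) (auto simp: bnd_def)

definition coch :: "'s^2^2 \<Rightarrow> ('s \<Rightarrow> 's) \<Rightarrow> 's^2^2"
  where "coch g = (\<lambda>\<sigma>\<in>G. matrix_inv g ** map_matrix \<sigma> g)"

text \<open>
  \<open>rep X g f\<close> says that \<open>X\<close> is the class attached to the orbit of the form \<open>f = g \<cdot> f0\<close>.
\<close>

definition rep :: "(('s \<Rightarrow> 's) \<Rightarrow> 's^2^2) set \<Rightarrow> 's^2^2 \<Rightarrow> 'f cubic_form \<Rightarrow> bool"
  where "rep X g f \<longleftrightarrow> g \<in> SL2 \<and> act_form g F0 = map_cubic_form \<iota> f \<and> X = cls G (coch g)"

lemma carrier_H1: "carrier (H1_stab \<iota> f0) = cls G ` carrier (Z1 (krull_topology \<iota>) A map_matrix)"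
proof -
  have "carrier (H1_stab \<iota> f0)
      = cohomology_class (krull_topology \<iota>) A map_matrix ` carrier (Z1 (krull_topology \<iota>) A map_matrix)"
    by (auto simp: H1_stab_def H1_def FactGroup_def RCOSETS_def cohomology_class_def)
  then show ?thesis by (simp add: cohomology_class_eq topspace_krull_topology)
qed

lemma one_H1: "\<one>\<^bsub>H1_stab \<iota> f0\<^esub> = cls G (\<lambda>\<sigma>\<in>G. mat 1)"
  unfolding cls_trivial[OF order_refl]
  by (simp add: H1_stab_def H1_def FactGroup_def B1_eq topspace_krull_topology)

lemma coch_translate:
  assumes "\<gamma> \<in> SL2" "g \<in> SL2" shows "coch (map_matrix \<iota> \<gamma> ** g) = coch g"
  unfolding coch_def
proof (intro restrict_ext)
  fix \<sigma> assume s: "\<sigma> \<in> G"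
  let ?\<gamma> = "map_matrix \<iota> \<gamma>"
  have \<gamma>: "?\<gamma> \<in> SL2" by (rule map_matrix_SL2[OF hom_emb assms(1)])
  have f: "map_matrix \<sigma> ?\<gamma> = ?\<gamma>" by (simp add: vec_eq_iff galois_emb[OF s])
  have "matrix_inv (?\<gamma> ** g) ** map_matrix \<sigma> (?\<gamma> ** g)
      = matrix_inv g ** (matrix_inv ?\<gamma> ** ?\<gamma>) ** map_matrix \<sigma> g"
    by (simp add: matrix_inv_mult[OF \<gamma> assms(2)] map_matrix_mult[OF galois_hom[OF s]] f matrix_mul_assoc)
  then show "matrix_inv (?\<gamma> ** g) ** map_matrix \<sigma> (?\<gamma> ** g) = matrix_inv g ** map_matrix \<sigma> g"
    using SL2_inverse(2)[OF \<gamma>] by simp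
qed

lemma rep_translate:
  assumes "rep X g f" "\<gamma> \<in> SL2" shows "rep X (map_matrix \<iota> \<gamma> ** g) (act_form \<gamma> f)"
proof -
  have g: "g \<in> SL2" "act_form g F0 = map_cubic_form \<iota> f" "X = cls G (coch g)" using assms(1) by (auto simp: rep_def)
  then show ?thesis
    using coch_translate[OF assms(2) g(1)] SL2_mult[OF map_matrix_SL2[OF hom_emb assms(2)] g(1)]
    by (simp add: rep_def act_form_mult map_act_form[OF hom_emb])
qed

lemma rep_sl_equiv: "rep X g f \<Longrightarrow> sl_equiv f f' \<Longrightarrow> \<exists>g'. rep X g' f'"
  using rep_translate unfolding sl_equiv_def by blast

lemma rep_disc:
  assumes "rep X g f" shows "disc f = d"
proof -
  have e: "disc (map_cubic_form \<iota> h) = \<iota> (disc h)" for h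
    by (cases h) (simp add: emb_simps)
  have "\<iota> (disc f) = \<iota> d"
    using disc_act[of g F0] assms charS disc_f0 e[of f] e[of f0] by (simp add: rep_def)
  then show ?thesis by (simp add: emb_eq)
qed

text \<open>
  If \<open>f = \<gamma> \<cdot> f0\<close> over the base field, then \<open>\<gamma>\<^sup>-\<^sup>1 g\<close> lies in the stabilizer and has the same cocycle
  as \<open>g\<close>.
\<close>

lemma rep_trivial:
  assumes r: "rep X g f" and e: "sl_equiv f0 f" shows "X = \<one>\<^bsub>H1_stab \<iota> f0\<^esub>"
proof -
  obtain \<gamma> where \<gamma>: "\<gamma> \<in> SL2" "f = act_form \<gamma> f0" using e by (auto simp: sl_equiv_def)
  let ?\<gamma> = "map_matrix \<iota> \<gamma>"
  have \<gamma>S: "?\<gamma> \<in> SL2" by (rule map_matrix_SL2[OF hom_emb \<gamma>(1)])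
  define k where "k = matrix_inv ?\<gamma> ** g"
  have g: "g \<in> SL2" "act_form g F0 = act_form ?\<gamma> F0" "X = cls G (coch g)"
    using r \<gamma> by (auto simp: rep_def map_act_form[OF hom_emb])
  have kS: "k \<in> SL2" unfolding k_def by (intro SL2_mult SL2_inverse \<gamma>S g)
  have "act_form k F0 = F0"
    unfolding k_def act_form_mult g(2) by (rule act_form_inverse[OF \<gamma>S refl, symmetric])
  then have kC: "k \<in> C" using kS by (simp add: C_iff)
  have "g = ?\<gamma> ** k" using SL2_inverse(3)[OF \<gamma>S] by (simp add: k_def matrix_mul_assoc)
  then have "coch g = coch k" using coch_translate[OF \<gamma>(1) kS] by simp
  then have "coch g \<sigma> = bnd G k \<sigma> ** (\<lambda>\<sigma>\<in>G. mat 1) \<sigma>" if "\<sigma> \<in> G" for \<sigma>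
    using that by (simp add: coch_def bnd_def)
  then show ?thesis unfolding one_H1 g(3) by (rule cls_shift[OF order_refl kC])
qed

lemma one_carrier: "\<one>\<^bsub>H1_stab \<iota> f0\<^esub> \<in> carrier (H1_stab \<iota> f0)"
proof -
  have "(\<lambda>\<sigma>\<in>G. mat 1) \<in> carrier (Z1 (krull_topology \<iota>) A map_matrix)"
    unfolding Z1_def partial_object.simps topspace_krull_topology stab_mult
  proof (intro CollectI conjI ballI)
    show "(\<lambda>\<sigma>\<in>G. mat 1) \<in> G \<rightarrow>\<^sub>E C" using C_one by auto
    have "continuous_map (krull_topology \<iota>) (discrete_topology C) (\<lambda>_. mat 1)"
      using C_one by (simp add: continuous_map_const)
    then show "continuous_map (krull_topology \<iota>) (discrete_topology C) (\<lambda>\<sigma>\<in>G. mat 1)"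
      by (rule continuous_map_eq) (simp add: topspace_krull_topology)
    fix \<sigma> \<tau> assume s: "\<sigma> \<in> G" "\<tau> \<in> G"
    note h = galois_hom[OF s(1)]
    have "map_matrix \<sigma> (mat 1) = (mat 1 :: 's^2^2)" by (simp add: mat2_one map_mat2 hom_0[OF h] hom_1[OF h])
    then show "(\<lambda>\<sigma>\<in>G. mat 1) (\<sigma> \<circ> \<tau>) = (\<lambda>\<sigma>\<in>G. mat 1) \<sigma> ** map_matrix \<sigma> ((\<lambda>\<sigma>\<in>G. mat 1 :: 's^2^2) \<tau>)"
      using galois_group_comp[OF s] s by simp
  qed
  then show ?thesis unfolding carrier_H1 one_H1 by blast
qed

lemma rep_one: "rep (\<one>\<^bsub>H1_stab \<iota> f0\<^esub>) (mat 1) f0"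
proof -
  have "coch (mat 1) = (\<lambda>\<sigma>\<in>G. mat 1)"
    using bnd_one[OF order_refl] by (auto simp: coch_def bnd_def intro!: restrict_ext)
  then show ?thesis by (simp add: rep_def SL2_one act_form_one one_H1)
qed

definition integral_form :: "('f \<Rightarrow> int) \<Rightarrow> 'f cubic_form \<Rightarrow> bool"
  where "integral_form v f \<longleftrightarrow> set_cubic_form f \<subseteq> carrier (valuation_ring v)"

text \<open>
  The orbit may be represented by the integral form itself, since \<open>rep\<close> can be moved along an orbit.
\<close>

lemma H1_int_iff:
  "X \<in> H1_int v \<iota> d f0 \<longleftrightarrow> X \<in> carrier (H1_stab \<iota> f0) \<and> (\<exists>g f. rep X g f \<and> integral_form v f)"
proof (intro iffI conjI)
  assume X: "X \<in> H1_int v \<iota> d f0"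
  then show "X \<in> carrier (H1_stab \<iota> f0)" by (simp add: H1_int_def)
  obtain \<Omega> f2 where \<Omega>: "\<Omega> \<in> SL2_orbits d" "orbit_corresponds \<iota> f0 \<Omega> X" "f2 \<in> \<Omega>" "integral_form v f2"
    using X by (auto simp: H1_int_def integral_form_def)
  obtain f where f: "\<Omega> = (\<lambda>\<gamma>. act_form \<gamma> f) ` SL2" using \<Omega>(1) by (auto simp: SL2_orbits_def)
  obtain f1 g where f1: "f1 \<in> \<Omega>" "rep X g f1"
    using \<Omega>(2) by (auto simp: orbit_corresponds_def rep_def cohomology_class_eq topspace_krull_topology coch_def)
  have "sl_equiv f f1" "sl_equiv f f2" using f1(1) \<Omega>(3) by (auto simp: f sl_equiv_def)
  then have "sl_equiv f1 f2" by (rule sl_equiv_trans[OF sl_equiv_sym])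
  then show "\<exists>g f. rep X g f \<and> integral_form v f" using rep_sl_equiv[OF f1(2)] \<Omega>(4) by blast
next
  assume X: "X \<in> carrier (H1_stab \<iota> f0) \<and> (\<exists>g f. rep X g f \<and> integral_form v f)"
  then obtain g f where f: "rep X g f" "integral_form v f" by blast
  define \<Omega> where "\<Omega> = (\<lambda>\<gamma>. act_form \<gamma> f) ` SL2"
  have fO: "f \<in> \<Omega>" unfolding \<Omega>_def using SL2_one by (rule rev_image_eqI) (simp add: act_form_one)
  have "\<Omega> \<in> SL2_orbits d" using rep_disc[OF f(1)] by (auto simp: SL2_orbits_def \<Omega>_def forms_disc_def)
  moreover have "orbit_corresponds \<iota> f0 \<Omega> X"
    unfolding orbit_corresponds_def cohomology_class_eq topspace_krull_topology
    using f(1) by (intro bexI[of _ f] bexI[of _ g] fO) (auto simp: rep_def coch_def)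
  ultimately show "X \<in> H1_int v \<iota> d f0"
    using X fO f(2) by (auto simp: H1_int_def integral_form_def)
qed

text \<open>
  An element \<open>h\<close> of the stabilizer whose coboundary agrees on inertia with the cocycle of \<open>g\<close> corrects \<open>g\<close>
  to the element \<open>g h\<^sup>-\<^sup>1\<close> fixed by inertia.  In the statement \<open>f0\<close> is replaced by the normal form, to
  which it is equivalent over the base field.
\<close>

lemma H1_un_iff:
  assumes X: "X \<in> carrier (H1_stab \<iota> f0)" and r: "rep X g f"
  shows "X \<in> H1_un v \<iota> f0 \<longleftrightarrow> (\<exists>g'\<in>SL2. act_form g' (nform (\<iota> D)) = map_cubic_form \<iota> f
    \<and> (\<forall>\<sigma>\<in>inertia_group v \<iota>. map_matrix \<sigma> g' = g'))"
proof -
  define I where "I = inertia_group v \<iota>"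
  have IG: "I \<subseteq> G" by (auto simp: I_def inertia_group_def)
  have top: "topspace (subtopology (krull_topology \<iota>) I) = I"
    using IG by (auto simp: topspace_krull_topology)
  have g: "g \<in> SL2" "act_form g F0 = map_cubic_form \<iota> f" "X = cls G (coch g)" using r by (auto simp: rep_def)
  have X_ext: "coch g \<in> X" unfolding g(3) by (rule cls_self) (auto simp: coch_def)
  have "cls I (restrict c I) = cls I (restrict (coch g) I)" if c: "c \<in> X" for c
  proof -
    obtain h where h: "h \<in> C" "c = (\<lambda>\<sigma>\<in>G. bnd G h \<sigma> ** coch g \<sigma>)" using c by (auto simp: g(3) cls_def)
    show ?thesis using IG by (intro cls_shift[OF IG h(1)]) (auto simp: h(2) bnd_def)
  qed
  then have "res (krull_topology \<iota>) I A map_matrix X = cls I (restrict (coch g) I)"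
    unfolding res_def cohomology_class_eq top using X_ext by blast
  moreover have "\<one>\<^bsub>H1 (subtopology (krull_topology \<iota>) I) A map_matrix\<^esub> = cls I (\<lambda>\<sigma>\<in>I. mat 1)"
  proof -
    have "\<one>\<^bsub>H1 (subtopology (krull_topology \<iota>) I) A map_matrix\<^esub>
        = B1 (subtopology (krull_topology \<iota>) I) A map_matrix" by (simp add: H1_def FactGroup_def)
    then show ?thesis unfolding cls_trivial[OF IG] B1_eq top .
  qed
  ultimately have un: "X \<in> H1_un v \<iota> f0 \<longleftrightarrow> cls I (restrict (coch g) I) = cls I (\<lambda>\<sigma>\<in>I. mat 1)"
    using X by (simp add: H1_un_def kernel_def I_def)
  have D_fix: "map_matrix \<sigma> \<Delta> = \<Delta>" if "\<sigma> \<in> G" for \<sigma> by (simp add: vec_eq_iff galois_emb[OF that])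
  have "cls I (restrict (coch g) I) = cls I (\<lambda>\<sigma>\<in>I. mat 1) \<longleftrightarrow>
      (\<exists>h\<in>C. \<forall>\<sigma>\<in>I. coch g \<sigma> = bnd I h \<sigma>)"
  proof
    assume "cls I (restrict (coch g) I) = cls I (\<lambda>\<sigma>\<in>I. mat 1)"
    moreover have "restrict (coch g) I \<in> cls I (restrict (coch g) I)" by (rule cls_self[OF IG]) simp
    ultimately obtain h where h: "h \<in> C" "restrict (coch g) I = bnd I h" by (auto simp: cls_trivial[OF IG])
    have "coch g \<sigma> = bnd I h \<sigma>" if "\<sigma> \<in> I" for \<sigma> using fun_cong[OF h(2), of \<sigma>] that by simp
    then show "\<exists>h\<in>C. \<forall>\<sigma>\<in>I. coch g \<sigma> = bnd I h \<sigma>" using h(1) by blast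
  next
    assume "\<exists>h\<in>C. \<forall>\<sigma>\<in>I. coch g \<sigma> = bnd I h \<sigma>"
    then obtain h where h: "h \<in> C" "\<forall>\<sigma>\<in>I. coch g \<sigma> = bnd I h \<sigma>" by blast
    show "cls I (restrict (coch g) I) = cls I (\<lambda>\<sigma>\<in>I. mat 1)"
      by (rule cls_shift[OF IG h(1)]) (use h(2) in auto)
  qed
  also have "\<dots> \<longleftrightarrow> (\<exists>g'\<in>SL2. act_form g' (nform (\<iota> D)) = map_cubic_form \<iota> f
      \<and> (\<forall>\<sigma>\<in>I. map_matrix \<sigma> g' = g'))"
  proof
    assume "\<exists>h\<in>C. \<forall>\<sigma>\<in>I. coch g \<sigma> = bnd I h \<sigma>"
    then obtain h where h: "h \<in> C" "\<And>\<sigma>. \<sigma> \<in> I \<Longrightarrow> coch g \<sigma> = bnd I h \<sigma>" by blast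
    have hS: "h \<in> SL2" by (rule C_SL2[OF h(1)])
    define g' where "g' = g ** matrix_inv h ** \<Delta>"
    have "g' \<in> SL2" unfolding g'_def by (intro SL2_mult g SL2_inverse hS Delta)
    moreover have "act_form g' (nform (\<iota> D)) = map_cubic_form \<iota> f"
      using C_inv[OF h(1)] g(2) by (simp add: g'_def act_form_mult Delta(2)[symmetric] C_iff)
    moreover have "map_matrix \<sigma> g' = g'" if s: "\<sigma> \<in> I" for \<sigma>
    proof -
      have sG: "\<sigma> \<in> G" using s IG by blast
      note hm = galois_hom[OF sG]
      have e: "matrix_inv g ** map_matrix \<sigma> g = matrix_inv h ** map_matrix \<sigma> h"
        using h(2)[OF s] s sG by (simp add: coch_def bnd_def)
      have hs: "map_matrix \<sigma> h \<in> SL2" by (rule map_matrix_SL2[OF hm hS])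
      have "map_matrix \<sigma> g = g ** (matrix_inv g ** map_matrix \<sigma> g)"
        using SL2_inverse(3)[OF g(1)] by (simp add: matrix_mul_assoc)
      also have "\<dots> = g ** matrix_inv h ** map_matrix \<sigma> h" unfolding e by (simp add: matrix_mul_assoc)
      finally have "map_matrix \<sigma> g ** matrix_inv (map_matrix \<sigma> h)
          = g ** matrix_inv h ** (map_matrix \<sigma> h ** matrix_inv (map_matrix \<sigma> h))"
        by (simp add: matrix_mul_assoc)
      then have "map_matrix \<sigma> g ** matrix_inv (map_matrix \<sigma> h) = g ** matrix_inv h"
        using SL2_inverse(3)[OF hs] by simp
      then show ?thesis
        by (simp add: g'_def map_matrix_mult[OF hm] map_matrix_inv[OF hm hS] D_fix[OF sG])
    qed
    ultimately show "\<exists>g'\<in>SL2. act_form g' (nform (\<iota> D)) = map_cubic_form \<iota> f \<and> (\<forall>\<sigma>\<in>I. map_matrix \<sigma> g' = g')"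
      by blast
  next
    assume "\<exists>g'\<in>SL2. act_form g' (nform (\<iota> D)) = map_cubic_form \<iota> f \<and> (\<forall>\<sigma>\<in>I. map_matrix \<sigma> g' = g')"
    then obtain g' where g': "g' \<in> SL2" "act_form g' (nform (\<iota> D)) = map_cubic_form \<iota> f"
      "\<And>\<sigma>. \<sigma> \<in> I \<Longrightarrow> map_matrix \<sigma> g' = g'" by blast
    define g1 where "g1 = g' ** matrix_inv \<Delta>"
    have g1: "g1 \<in> SL2" unfolding g1_def by (intro SL2_mult g' SL2_inverse Delta)
    have g1F: "act_form g1 F0 = map_cubic_form \<iota> f"
      using g'(2) act_form_inverse[OF Delta(1) Delta(2)[symmetric]] by (simp add: g1_def act_form_mult)
    define h where "h = matrix_inv g1 ** g"
    have hS: "h \<in> SL2" unfolding h_def by (intro SL2_mult SL2_inverse g1 g)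
    have "act_form h F0 = F0"
      unfolding h_def act_form_mult g(2) by (rule act_form_inverse[OF g1 g1F, symmetric])
    then have hC: "h \<in> C" using hS by (simp add: C_iff)
    have gh: "g = g1 ** h" using SL2_inverse(3)[OF g1] by (simp add: h_def matrix_mul_assoc)
    have "coch g \<sigma> = bnd I h \<sigma>" if s: "\<sigma> \<in> I" for \<sigma>
    proof -
      have sG: "\<sigma> \<in> G" using s IG by blast
      note hm = galois_hom[OF sG]
      have "map_matrix \<sigma> g1 = g1"
        using g'(3)[OF s] by (simp add: g1_def map_matrix_mult[OF hm] map_matrix_inv[OF hm Delta(1)] D_fix[OF sG])
      then have "matrix_inv g ** map_matrix \<sigma> g = matrix_inv h ** (matrix_inv g1 ** g1) ** map_matrix \<sigma> h"
        by (simp add: gh map_matrix_mult[OF hm] matrix_inv_mult[OF g1 hS] matrix_mul_assoc)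
      then show ?thesis using SL2_inverse(2)[OF g1] s sG by (simp add: coch_def bnd_def)
    qed
    then show "\<exists>h\<in>C. \<forall>\<sigma>\<in>I. coch g \<sigma> = bnd I h \<sigma>" using hC by blast
  qed
  finally show ?thesis unfolding un I_def .
qed

text \<open>
  Conjugated by \<open>\<Delta>\<close>, a cocycle of the stabilizer becomes a cocycle of order \<open>3\<close> of the torus, and hence
  the coboundary of some \<open>(p, q)\<close>.  The cube \<open>(P, Q)\<close> of \<open>(p, q)\<close> is Galois invariant, and \<open>(p, q)\<close> carries
  the normal form to \<open>tform D P Q\<close>.
\<close>

theorem class_from_torus:
  assumes X: "X \<in> carrier (H1_stab \<iota> f0)"
  obtains p q P Q where "p^2 + 3 * \<iota> D * q^2 = 1" "\<iota> P = 4 * p^3 - 3 * p" "\<iota> Q = q * (4 * p^2 - 1)"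
    "rep X (tor (\<iota> D) p q ** matrix_inv \<Delta>) (tform D P Q)"
proof -
  obtain c where c: "c \<in> carrier (Z1 (krull_topology \<iota>) A map_matrix)" "X = cls G c"
    using X by (auto simp: carrier_H1)
  have c_ext: "c \<in> extensional G" and cC: "\<And>\<sigma>. \<sigma> \<in> G \<Longrightarrow> c \<sigma> \<in> C"
    and cont: "continuous_map (krull_topology \<iota>) (discrete_topology C) c"
    and coc: "\<And>\<sigma> \<tau>. \<sigma> \<in> G \<Longrightarrow> \<tau> \<in> G \<Longrightarrow> c (\<sigma> \<circ> \<tau>) = c \<sigma> ** map_matrix \<sigma> (c \<tau>)"
    using c(1) by (auto simp: Z1_def topspace_krull_topology stab_mult PiE_iff)
  have c_id: "c id = mat 1"
  proof -
    have "map_matrix id M = M" for M :: "'s^2^2" by (simp add: vec_eq_iff)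
    then have "c id = c id ** c id" using coc[OF galois_id galois_id] by simp
    then have "matrix_inv (c id) ** c id = matrix_inv (c id) ** c id ** c id"
      by (metis matrix_mul_assoc)
    then show ?thesis using SL2_inverse(2)[OF C_SL2[OF cC[OF galois_id]]] by simp
  qed
  have "openin (krull_topology \<iota>) {\<sigma> \<in> topspace (krull_topology \<iota>). c \<sigma> \<in> {mat 1}}"
    using C_one by (intro openin_continuous_map_preimage[OF cont]) simp
  then have "krull_open \<iota> {\<sigma> \<in> G. c \<sigma> = mat 1}"
    by (simp add: openin_krull_topology topspace_krull_topology)
  then obtain S0 where S0: "finite S0" "(\<lambda>\<tau>. id \<circ> \<tau>) ` fixing_group \<iota> S0 \<subseteq> {\<sigma> \<in> G. c \<sigma> = mat 1}"
    using c_id galois_id unfolding krull_open_def by blast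
  define k where "k \<sigma> = matrix_inv \<Delta> ** c \<sigma> ** \<Delta>" for \<sigma>
  define a where "a \<sigma> = k \<sigma> $ 1 $ 1" for \<sigma>
  define b where "b \<sigma> = k \<sigma> $ 1 $ 2" for \<sigma>
  have cancel: "matrix_inv \<Delta> ** (\<Delta> ** Y ** matrix_inv \<Delta>) ** \<Delta> = Y" for Y :: "'s^2^2"
  proof -
    have "matrix_inv \<Delta> ** (\<Delta> ** Y ** matrix_inv \<Delta>) ** \<Delta> = (matrix_inv \<Delta> ** \<Delta>) ** Y ** (matrix_inv \<Delta> ** \<Delta>)"
      by (simp add: matrix_mul_assoc)
    then show ?thesis using SL2_inverse(2)[OF Delta(1)] by simp
  qed
  have k: "k \<sigma> = tor (\<iota> D) (a \<sigma>) (b \<sigma>) \<and> a \<sigma> ^ 2 + 3 * \<iota> D * b \<sigma> ^ 2 = 1 \<and>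
      2 * a \<sigma> ^ 2 - 1 = a \<sigma> \<and> 2 * a \<sigma> * b \<sigma> = - b \<sigma>" if s: "\<sigma> \<in> G" for \<sigma>
  proof (rule C_conj[OF cC[OF s]])
    fix x y assume xy: "c \<sigma> = \<Delta> ** tor (\<iota> D) x y ** matrix_inv \<Delta>" "x^2 + 3 * \<iota> D * y^2 = 1"
      "2 * x^2 - 1 = x" "2 * x * y = - y"
    have ks: "k \<sigma> = tor (\<iota> D) x y" unfolding k_def xy(1) by (rule cancel)
    then have "a \<sigma> = x" "b \<sigma> = y" by (simp_all add: a_def b_def tor_def)
    then show ?thesis using ks xy by simp
  qed
  have ck: "c \<sigma> = \<Delta> ** k \<sigma> ** matrix_inv \<Delta>" for \<sigma>
  proof -
    have "c \<sigma> = (\<Delta> ** matrix_inv \<Delta>) ** c \<sigma> ** (\<Delta> ** matrix_inv \<Delta>)" using SL2_inverse(3)[OF Delta(1)] by simp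
    then show ?thesis by (simp add: k_def matrix_mul_assoc)
  qed
  have D_fix: "map_matrix \<sigma> \<Delta> = \<Delta>" if "\<sigma> \<in> G" for \<sigma> by (simp add: vec_eq_iff galois_emb[OF that])
  have k_coc: "k (\<sigma> \<circ> \<tau>) = k \<sigma> ** map_matrix \<sigma> (k \<tau>)" if st: "\<sigma> \<in> G" "\<tau> \<in> G" for \<sigma> \<tau>
  proof -
    note hm = galois_hom[OF st(1)]
    have "k \<sigma> ** map_matrix \<sigma> (k \<tau>)
        = matrix_inv \<Delta> ** c \<sigma> ** (\<Delta> ** matrix_inv \<Delta>) ** map_matrix \<sigma> (c \<tau>) ** \<Delta>"
      by (simp add: k_def map_matrix_mult[OF hm] map_matrix_inv[OF hm Delta(1)] D_fix[OF st(1)] matrix_mul_assoc)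
    then show ?thesis using SL2_inverse(3)[OF Delta(1)] by (simp add: k_def coc[OF st] matrix_mul_assoc)
  qed
  have ab_coc: "a (\<sigma> \<circ> \<tau>) = a \<sigma> * \<sigma> (a \<tau>) - 3 * \<iota> D * b \<sigma> * \<sigma> (b \<tau>)
      \<and> b (\<sigma> \<circ> \<tau>) = a \<sigma> * \<sigma> (b \<tau>) + b \<sigma> * \<sigma> (a \<tau>)" if st: "\<sigma> \<in> G" "\<tau> \<in> G" for \<sigma> \<tau>
  proof -
    note hm = galois_hom[OF st(1)]
    have kt: "map_matrix \<sigma> (k \<tau>) = tor (\<iota> D) (\<sigma> (a \<tau>)) (\<sigma> (b \<tau>))"
      using k[OF st(2)] by (simp add: tor_def map_mat2 hom_minus[OF hm] hom_mult[OF hm] hom_numeral[OF hm] galois_emb[OF st(1)])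
    have "tor (\<iota> D) (a (\<sigma> \<circ> \<tau>)) (b (\<sigma> \<circ> \<tau>)) = tor (\<iota> D) (a \<sigma>) (b \<sigma>) ** map_matrix \<sigma> (k \<tau>)"
      using k_coc[OF st] k[OF st(1)] k[OF galois_group_comp[OF st]] by simp
    then show ?thesis unfolding kt tor_mult by (simp add: tor_def mat2_eq_iff)
  qed
  have ab_triv: "a u = 1 \<and> b u = 0" if "u \<in> fixing_group \<iota> S0" for u
  proof -
    have "c u = mat 1" using S0(2) that by auto
    then have "k u = mat 1" using SL2_inverse(2)[OF Delta(1)] by (simp add: k_def)
    then show ?thesis by (simp add: a_def b_def mat2_one)
  qed
  have D0S: "\<iota> D \<noteq> 0" using D0 by (simp add: emb_eq_0)
  obtain p q where pq: "p ^ 2 + 3 * \<iota> D * q ^ 2 = 1"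
    "\<And>\<sigma>. \<sigma> \<in> G \<Longrightarrow> \<sigma> p = p * a \<sigma> - 3 * \<iota> D * q * b \<sigma> \<and> \<sigma> q = p * b \<sigma> + q * a \<sigma>"
    by (rule torus_cocycle_trivial[OF charS D0S S0(1) ab_triv _ ab_coc]) (use k in auto)
  define t where "t = tor (\<iota> D) p q"
  have tS: "t \<in> SL2" using pq(1) by (simp add: t_def tor_SL2)
  have st: "map_matrix \<sigma> t = t ** k \<sigma>" if s: "\<sigma> \<in> G" for \<sigma>
  proof -
    note hm = galois_hom[OF s]
    have "map_matrix \<sigma> t = tor (\<iota> D) (\<sigma> p) (\<sigma> q)"
      by (simp add: t_def tor_def map_mat2 hom_minus[OF hm] hom_mult[OF hm] hom_numeral[OF hm] galois_emb[OF s])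
    also have "\<dots> = t ** k \<sigma>" using pq(2)[OF s] k[OF s] by (simp add: t_def tor_mult)
    finally show ?thesis .
  qed
  define g where "g = t ** matrix_inv \<Delta>"
  have gS: "g \<in> SL2" unfolding g_def by (intro SL2_mult tS SL2_inverse Delta)
  have "coch g = c"
  proof
    fix \<sigma>
    show "coch g \<sigma> = c \<sigma>"
    proof (cases "\<sigma> \<in> G")
      case True
      note hm = galois_hom[OF True]
      have iS: "matrix_inv \<Delta> \<in> SL2" by (rule SL2_inverse(1)[OF Delta(1)])
      have ii: "matrix_inv (matrix_inv \<Delta>) = \<Delta>"
        by (rule matrix_inv_unique[OF iS SL2_inverse(3)[OF Delta(1)]])
      have "coch g \<sigma> = \<Delta> ** (matrix_inv t ** t) ** k \<sigma> ** matrix_inv \<Delta>"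
        using True by (simp add: coch_def g_def matrix_inv_mult[OF tS iS] ii map_matrix_mult[OF hm] st[OF True]
          map_matrix_inv[OF hm Delta(1)] D_fix[OF True] matrix_mul_assoc)
      then show ?thesis using SL2_inverse(2)[OF tS] ck[of \<sigma>] by simp
    qed (use c_ext in \<open>simp add: coch_def extensional_def\<close>)
  qed
  then have Xg: "X = cls G (coch g)" using c(2) by simp
  have tN: "act_form t (nform (\<iota> D)) = tform (\<iota> D) (4 * p^3 - 3 * p) (q * (4 * p^2 - 1))"
    unfolding t_def by (rule tor_act[OF pq(1) charS(2)])
  have fixed: "map_cubic_form \<sigma> (act_form t (nform (\<iota> D))) = act_form t (nform (\<iota> D))" if s: "\<sigma> \<in> G" for \<sigma>
  proof -
    have "act_form (k \<sigma>) (nform (\<iota> D)) = act_form (matrix_inv \<Delta>) (act_form (c \<sigma>) F0)"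
      by (simp add: k_def act_form_mult Delta(2))
    also have "\<dots> = nform (\<iota> D)"
      using cC[OF s] act_form_inverse[OF Delta(1) Delta(2)[symmetric]] by (simp add: C_iff)
    finally have kN: "act_form (k \<sigma>) (nform (\<iota> D)) = nform (\<iota> D)" .
    have "map_cubic_form \<sigma> (nform (\<iota> D)) = nform (\<iota> D)" unfolding emb_nform[symmetric] by (rule galois_F0[OF s])
    then show ?thesis using kN by (simp add: map_act_form[OF galois_hom[OF s]] st[OF s] act_form_mult)
  qed
  have "\<sigma> (4 * p^3 - 3 * p) = 4 * p^3 - 3 * p \<and> \<sigma> (q * (4 * p^2 - 1) / 3) = q * (4 * p^2 - 1) / 3" if "\<sigma> \<in> G" for \<sigma>
    using fixed[OF that] unfolding tN tform_def cubic_form.map cubic_form.inject by blast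
  then obtain P Q' where PQ: "4 * p^3 - 3 * p = \<iota> P" "q * (4 * p^2 - 1) / 3 = \<iota> Q'"
    using galois_fixed[of "4 * p^3 - 3 * p"] galois_fixed[of "q * (4 * p^2 - 1) / 3"] by metis
  have Q: "q * (4 * p^2 - 1) = \<iota> (3 * Q')"
    unfolding emb_mult emb_numeral PQ(2)[symmetric] using charS by simp
  have "act_form g F0 = act_form t (nform (\<iota> D))"
    using act_form_inverse[OF Delta(1) Delta(2)[symmetric]] by (simp add: g_def act_form_mult)
  also have "\<dots> = map_cubic_form \<iota> (tform D P (3 * Q'))" unfolding tN emb_tform PQ(1) Q ..
  finally have "rep X g (tform D P (3 * Q'))" using gS Xg by (simp add: rep_def)
  then show ?thesis by (intro that[OF pq(1) PQ(1)[symmetric] Q[symmetric]]) (simp add: g_def t_def)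
qed

end

section \<open>Integral forms over the local field\<close>

locale local_cubic = local_closure v \<iota> + cubic_setup \<iota> d f0
  for v :: "'f::field \<Rightarrow> int" and \<iota> :: "'f \<Rightarrow> 's::field" and d :: 'f and f0 :: "'f cubic_form" +
  assumes d_int: "val_ge v 0 d"
begin

lemma integral_Cubic: "integral_form v (Cubic a b c e) \<longleftrightarrow> val_ge v 0 a \<and> val_ge v 0 b \<and> val_ge v 0 c \<and> val_ge v 0 e"
  by (simp add: integral_form_def valuation_ring_def)

lemma d_eq: "d = 4 * D"
  using four by (simp add: D_def)

lemma emb_d: "\<iota> d = 4 * \<iota> D"
proof -
  have "\<iota> (4 * D) = 4 * \<iota> D" by (simp only: emb_mult emb_numeral)
  then show ?thesis by (simp only: d_eq[symmetric])
qed

lemma v_D: "v D = v d"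
  unfolding D_def using v_divide[OF d0 four] four_nonzero(2) by simp

lemma D_int: "val_ge v 0 D"
  using d_int D0 d0 by (simp add: val_ge_def v_D)

lemma rep_nform:
  assumes "rep X g f" shows "g ** \<Delta> \<in> SL2" "act_form (g ** \<Delta>) (nform (\<iota> D)) = map_cubic_form \<iota> f"
  using assms SL2_mult[OF _ Delta(1)] by (simp_all add: rep_def act_form_mult Delta(2)[symmetric])

lemma sl_equiv_f0: "sl_equiv f0 (nform D)"
  using delta sl_equiv_sym unfolding sl_equiv_def by blast

lemma trivial_if_equiv: "rep X g f \<Longrightarrow> sl_equiv f (nform D) \<Longrightarrow> X = \<one>\<^bsub>H1_stab \<iota> f0\<^esub>"
  using rep_trivial sl_equiv_trans[OF sl_equiv_f0 sl_equiv_sym] by blast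

lemma one_int: "\<one>\<^bsub>H1_stab \<iota> f0\<^esub> \<in> H1_int v \<iota> d f0"
proof -
  have "integral_form v (nform D)" using D_int by (simp add: nform_def integral_Cubic val_ge_one val_ge_minus)
  then show ?thesis
    unfolding H1_int_iff using one_carrier rep_sl_equiv[OF rep_one sl_equiv_f0] by blast
qed

lemma hess_emb: "hess_a (map_cubic_form \<iota> f) = \<iota> (hess_a f)" "hess_c (map_cubic_form \<iota> f) = \<iota> (hess_c f)"
  by (cases f; simp add: emb_simps)+

lemma inertia_hom: "\<sigma> \<in> inertia_group v \<iota> \<Longrightarrow> hom_on UNIV \<sigma>"
  by (rule galois_hom[OF inertia_galois])

text \<open>
  The element \<open>g\<^sup>-\<^sup>1 \<sigma>(g)\<close> of the stabilizer has upper left entry \<open>1\<close> or \<open>-1/2\<close>, and these differ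
  by a unit; so a congruence suffices to recognize the identity.
\<close>

lemma fixed_if_cong:
  assumes g: "mat2 p q r s \<in> SL2" "act_form (mat2 p q r s) (nform (\<iota> D)) = map_cubic_form \<iota> f"
    and s: "\<sigma> \<in> inertia_group v \<iota>" and cong: "s * \<sigma> p - q * \<sigma> r - 1 \<in> mS"
  shows "map_matrix \<sigma> (mat2 p q r s) = mat2 p q r s"
proof -
  let ?g = "mat2 p q r s"
  note sG = inertia_galois[OF s] and h = inertia_hom[OF s]
  have det: "p * s - q * r = 1" using g(1) by (simp add: SL2_mat2)
  have gs: "map_matrix \<sigma> ?g \<in> SL2" by (rule map_matrix_SL2[OF h g(1)])
  define k where "k = matrix_inv ?g ** map_matrix \<sigma> ?g"
  have kS: "k \<in> SL2" unfolding k_def by (intro SL2_mult SL2_inverse g gs)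
  have "act_form (map_matrix \<sigma> ?g) (nform (\<iota> D)) = map_cubic_form \<sigma> (act_form ?g (map_cubic_form \<iota> (nform D)))"
    unfolding map_act_form[OF h] galois_F0[OF sG] by (simp only: emb_nform)
  also have "\<dots> = map_cubic_form \<iota> f" unfolding emb_nform g(2) by (rule galois_F0[OF sG])
  finally have "act_form k (nform (\<iota> D)) = act_form (matrix_inv ?g) (map_cubic_form \<iota> f)"
    by (simp only: k_def act_form_mult)
  also have "\<dots> = nform (\<iota> D)" by (rule act_form_inverse[OF g(1,2), symmetric])
  finally have kN: "act_form k (nform (\<iota> D)) = nform (\<iota> D)" .
  have "k = mat 1"
  proof (rule stabilizer_nform[OF kS kN charS])
    fix a b assume ab: "k = tor (\<iota> D) a b" "a = 1 \<or> a = - 1 / 2" "a = 1 \<longrightarrow> b = 0"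
    have "k $ 1 $ 1 = s * \<sigma> p - q * \<sigma> r"
      unfolding k_def matrix_inv_mat2[OF det] map_mat2 mat2_mult by simp
    then have a: "a - 1 \<in> mS" using ab(1) cong by (simp add: tor_def)
    have "a \<noteq> - 1 / 2"
    proof
      assume "a = - 1 / 2"
      then have "a - 1 = \<iota> (- (3 / 2))" using charS by (simp add: emb_simps field_simps)
      then have "val_ge v 1 (- (3 / 2))" using a mS_emb by metis
      then have "val_ge v 1 3" unfolding val_ge_minus val_ge_div2 .
      then show False using small_units by (simp add: val_ge_def)
    qed
    then show "k = mat 1" using ab by (simp add: tor_1_0)
  qed
  then have "?g ** (matrix_inv ?g ** map_matrix \<sigma> ?g) = ?g" by (simp add: k_def)
  then show ?thesis using SL2_inverse(3)[OF g(1)] by (simp add: matrix_mul_assoc)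
qed

subsection \<open>Unit discriminant\<close>

text \<open>
  If \<open>(p, q)\<close> is the first row of an element carrying \<open>nform D\<close> to \<open>f\<close>, then \<open>q\<close> is a root of
  \<open>d X\<^sup>3 - A X + a\<close>, where \<open>A\<close> and \<open>a\<close> are the leading coefficients of the Hessian of \<open>f\<close> and
  of \<open>f\<close>.
\<close>

lemma row_integral:
  assumes d: "v d = 0" and h_int: "val_ge v 0 \<alpha>" and a: "val_ge v 0 a"
    and h_eq: "p^2 + 3 * \<iota> D * q^2 = \<iota> \<alpha>" and a_eq: "p^2 * q - \<iota> D * q^3 = \<iota> a"
  shows "p \<in> OS" "q \<in> OS"
proof -
  have res: "\<iota> d * q^3 - \<iota> \<alpha> * q + \<iota> a = 0"
    unfolding h_eq[symmetric] a_eq[symmetric] emb_d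
    by (simp add: algebra_simps power2_eq_square power3_eq_cube)
  have dn: "\<iota> d \<noteq> 0" using d0 by (simp add: emb_eq_0)
  have div: "val_ge v 0 (x / d)" if "val_ge v 0 x" for x
    using that val_ge_mult_cancel[OF d0, of 0 "x / d"] d d0 by simp
  have "poly (map_poly \<iota> [:a / d, - \<alpha> / d, 0, 1:]) q = (\<iota> d * q^3 - \<iota> \<alpha> * q + \<iota> a) / \<iota> d"
    using dn by (simp add: map_poly_pCons emb_simps field_simps power3_eq_cube)
  then have root: "poly (map_poly \<iota> [:a / d, - \<alpha> / d, 0, 1:]) q = 0" by (simp add: res)
  show q: "q \<in> OS"
  proof (rule OS_poly_root[OF _ _ root])
    show "val_ge v 0 (coeff [:a / d, - \<alpha> / d, 0, 1:] i)" for i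
      using div[OF a] div[of "- \<alpha>"] h_int
      by (auto simp: coeff_pCons val_ge_minus val_ge_one split: nat.split)
  qed simp
  have "p^2 = \<iota> \<alpha> - \<iota> (3 * D) * q^2" unfolding h_eq[symmetric] by (simp add: emb_simps)
  also have "\<dots> \<in> OS"
    using h_int D_int q by (intro OS_diff OS_mult OS_power OS_emb) (auto simp: val_ge_times3)
  finally show "p \<in> OS" by (rule OS_root[rotated]) simp
qed

text \<open>
  Both rows of \<open>g\<close> are integral by \<open>row_integral\<close>, so inertia changes them only modulo the maximal
  ideal.
\<close>

lemma integral_unramified:
  assumes d: "v d = 0" and f: "integral_form v f"
    and g: "g \<in> SL2" "act_form g (nform (\<iota> D)) = map_cubic_form \<iota> f" and s: "\<sigma> \<in> inertia_group v \<iota>"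
  shows "map_matrix \<sigma> g = g"
proof -
  obtain p q r s where m: "g = mat2 p q r s" by (rule mat2_cases)
  have det: "p * s - q * r = 1" using g(1) by (simp add: m SL2_mat2)
  obtain a b c e where fc: "f = Cubic a b c e" by (cases f)
  have int: "val_ge v 0 a" "val_ge v 0 b" "val_ge v 0 c" "val_ge v 0 e" using f by (auto simp: fc integral_Cubic)
  have act: "act_coeffs p q r s (nform (\<iota> D)) = map_cubic_form \<iota> f" using g(2) by (simp add: m act_mat2)
  have H: "hess_a (nform (\<iota> D)) = 1" "hess_b (nform (\<iota> D)) = 0" "hess_c (nform (\<iota> D)) = 3 * \<iota> D"
    by (simp_all add: nform_def)
  have A: "p^2 + 3 * \<iota> D * q^2 = \<iota> (hess_a f)" and C: "r^2 + 3 * \<iota> D * s^2 = \<iota> (hess_c f)"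
    using hess_act(1)[OF det, of "nform (\<iota> D)"] hess_act(3)[OF det, of "nform (\<iota> D)"]
    by (simp_all add: act H hess_emb)
  have ae: "p^2 * q - \<iota> D * q^3 = \<iota> a" "r^2 * s - \<iota> D * s^3 = \<iota> e" using act by (auto simp: fc nform_def)
  have ints: "val_ge v 0 (hess_a f)" "val_ge v 0 (hess_c f)"
    using int by (auto simp: fc intro!: val_ge_diff val_ge_mult_left val_ge_power val_ge_numeral)
  note pq = row_integral[OF d ints(1) int(1) A ae(1)] and rs = row_integral[OF d ints(2) int(4) C ae(2)]
  have "s * (\<sigma> p - p) - q * (\<sigma> r - r) \<in> mS"
    by (rule mS_diff[OF mS_mult2[OF rs(2) inertia_mS[OF s pq(1)]] mS_mult2[OF pq(2) inertia_mS[OF s rs(1)]]])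
  moreover have "s * (\<sigma> p - p) - q * (\<sigma> r - r) = s * \<sigma> p - q * \<sigma> r - (p * s - q * r)" by (simp add: algebra_simps)
  ultimately have "s * \<sigma> p - q * \<sigma> r - 1 \<in> mS" by (simp add: det)
  then show ?thesis using fixed_if_cong[OF g[unfolded m] s] by (simp add: m)
qed

subsection \<open>Points of the torus\<close>

text \<open>
  If \<open>P\<close> is not integral, then \<open>- 3 D Q\<^sup>2 / P\<^sup>2 = 1 - 1 / P\<^sup>2\<close> is congruent to \<open>1\<close> and hence a square; so is
  \<open>- 3 D\<close>, which means that the torus splits.
\<close>

lemma split_if_not_integral:
  assumes n: "P^2 + 3 * D * Q^2 = 1" and P: "\<not> val_ge v 0 P"
  obtains s where "s^2 = - 3 * D" "s \<noteq> 0" "2 * v s = v D"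
proof -
  have P0: "P \<noteq> 0" "v P < 0" using P by (auto simp: not_val_ge)
  have Q0: "Q \<noteq> 0"
  proof
    assume "Q = 0"
    then have "v (P^2) = 0" using n v_one by simp
    then show False using P0 by (simp add: v_power)
  qed
  have "val_ge v 1 ((1 - 1 / P^2) - 1)"
    using P0 by (simp add: val_ge_def v_minus v_divide v_power v_one)
  then obtain y where y: "y^2 = 1 - 1 / P^2" by (rule hensel_square_root)
  define s where "s = y * P / Q"
  have "(1 - 1 / P^2) * P^2 = P^2 - 1" using P0 by (simp add: left_diff_distrib)
  then have "s^2 = (P^2 - 1) / Q^2" by (simp add: s_def power_divide power_mult_distrib y)
  also have "P^2 - 1 = - 3 * D * Q^2" unfolding n[symmetric] by simp
  finally have s2: "s^2 = - 3 * D" using Q0 by simp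
  moreover have D3: "- 3 * D \<noteq> 0" using D0 small_units by simp
  ultimately have s0: "s \<noteq> 0" by auto
  have "2 * v s = v (s^2)" using s0 by (simp add: v_power)
  also have "\<dots> = v D" unfolding s2 using D0 small_units by (simp add: v_minus val_mult)
  finally show ?thesis by (rule that[OF s2 s0])
qed

lemma split_unit:
  assumes n: "P^2 + 3 * D * Q^2 = 1" and s: "s^2 = - 3 * D"
  shows "(P + Q * s) * (P - Q * s) = 1" "P + Q * s \<noteq> 0" "P - Q * s \<noteq> 0" "v (P - Q * s) = - v (P + Q * s)"
proof -
  have "(P + Q * s) * (P - Q * s) = P^2 - Q^2 * s^2" by (simp add: algebra_simps power2_eq_square)
  also have "\<dots> = 1" unfolding s using n by (simp add: algebra_simps)
  finally show e: "(P + Q * s) * (P - Q * s) = 1" .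
  then show nz: "P + Q * s \<noteq> 0" "P - Q * s \<noteq> 0" by auto
  have "v (P + Q * s) + v (P - Q * s) = 0" using val_mult[OF nz] e v_one by simp
  then show "v (P - Q * s) = - v (P + Q * s)" by simp
qed

text \<open>
  When \<open>s\<^sup>2 = - 3 D\<close>, the linear forms \<open>x \<plusminus> s y\<close> diagonalize \<open>tform D P Q\<close>, which becomes
  \<open>\<alpha> x\<^sup>3 + \<beta> y\<^sup>3\<close> with \<open>v \<alpha> + v \<beta> = v s\<close>.  Scaling the variables by \<open>unif\<^sup>l\<close> moves a multiple of \<open>3\<close> between the
  two valuations, and the bounds on \<open>l\<close> say that both become nonnegative.
\<close>

lemma split_integral:
  assumes n: "P^2 + 3 * D * Q^2 = 1" and s: "s^2 = - 3 * D" "s \<noteq> 0"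
    and l: "v (P + Q * s) - 2 * v s \<le> 3 * l" "3 * l \<le> v (P + Q * s) - v s"
  obtains f where "sl_equiv (tform D P Q) f" "integral_form v f"
proof -
  note t = split_unit[OF n s(1)]
  define \<mu> where "\<mu> = unif powi l"
  have \<mu>: "\<mu> \<noteq> 0" "v \<mu> = l" using unif v_unif_powi by (auto simp: \<mu>_def)
  define q where "q = 1 / (2 * s * \<mu>)"
  have q: "q \<noteq> 0" "2 * q * s * \<mu> = 1" using small_units s(2) \<mu> by (simp_all add: q_def)
  have "v (2 * q * s * \<mu>) = 0" unfolding q(2) by (rule v_one)
  then have vq: "v q = - v s - l" using q(1) s(2) \<mu> small_units by (simp add: val_mult)
  have tf: "tform D P Q = Cubic (Q / 3) P (s^2 * Q) (s^2 * P / 3)"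
    using small_units unfolding tform_def s(1) by simp
  define \<alpha> where "\<alpha> = 4 / 3 * q^3 * s^2 * (P + Q * s)"
  define \<beta> where "\<beta> = 4 / 3 * \<mu>^3 * s^2 * (P - Q * s)"
  have "act_coeffs (q * s) q (- \<mu> * s) \<mu> (tform D P Q) = Cubic \<alpha> 0 0 \<beta>"
    unfolding tf \<alpha>_def \<beta>_def using small_units
    by (simp add: field_simps power2_eq_square power3_eq_cube)
  then have "sl_equiv (tform D P Q) (Cubic \<alpha> 0 0 \<beta>)"
    using q(2) by (intro sl_equivI[of "q * s" \<mu> q "- \<mu> * s"]) (simp_all add: algebra_simps)
  moreover have "v \<alpha> = v (P + Q * s) - v s - 3 * l" "v \<beta> = 3 * l + 2 * v s - v (P + Q * s)"
    using q(1) \<mu> s(2) t(2-4) small_units four_nonzero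
    by (simp_all add: \<alpha>_def \<beta>_def val_mult v_divide v_power vq)
  then have "integral_form v (Cubic \<alpha> 0 0 \<beta>)" using l by (auto simp: integral_Cubic val_ge_def)
  ultimately show ?thesis by (rule that)
qed

lemma torus_coordinate_bound:
  assumes n: "P^2 + 3 * D * Q^2 = 1" and P: "val_ge v 0 P" and k: "v D = 2 * k"
  shows "val_ge v (- k) Q"
proof (cases "Q = 0")
  case False
  have e: "3 * (D * Q^2) = 1 - P^2" using n by (simp add: algebra_simps)
  have "val_ge v 0 (3 * (D * Q^2))"
    unfolding e by (intro val_ge_diff val_ge_power P) (simp add: val_ge_one)
  then have "val_ge v 0 (D * Q^2)" by (simp only: val_ge_times3)
  then show ?thesis using False D0 by (simp add: val_ge_def val_mult v_power k)
qed simp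

text \<open>
  For integral \<open>P\<close> the second coordinate has valuation at least \<open>- k\<close>, so the coefficients of
  \<open>tform D P Q\<close> have valuations at least \<open>- k, 0, k, 2 k\<close>.  The diagonal matrix with entry \<open>unif\<^sup>j\<close> changes
  these by \<open>3 j, j, - j, - 3 j\<close>.
\<close>

lemma integral_torus_point:
  assumes n: "P^2 + 3 * D * Q^2 = 1" and P: "val_ge v 0 P" and k: "v D = 2 * k"
    and j: "k \<le> 3 * j" "3 * j \<le> 2 * k"
  obtains f where "sl_equiv (tform D P Q) f" "integral_form v f"
proof -
  have k0: "k \<ge> 0" using val_geD[OF D_int D0] k by simp
  have Q: "val_ge v (- k) Q" by (rule torus_coordinate_bound[OF n P k])
  define \<mu> where "\<mu> = unif powi j"
  have \<mu>: "\<mu> \<noteq> 0" "v \<mu> = j" using unif v_unif_powi by (auto simp: \<mu>_def)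
  have eq: "sl_equiv (tform D P Q) (Cubic (\<mu>^3 * (Q / 3)) (\<mu> * P) (- 3 * D * Q / \<mu>) (- D * P / \<mu>^3))"
    using \<mu>(1) unfolding tform_def
    by (intro sl_equivI[of \<mu> "1 / \<mu>" 0 0]) (simp_all add: field_simps power2_eq_square power3_eq_cube)
  have "val_ge v 0 (\<mu>^3 * (Q / 3))"
    using val_ge_mult_cancel[of "\<mu>^3" 0 "Q / 3"] \<mu> val_ge_mono[OF Q, of "- (3 * j)"] j
    by (simp add: v_power val_ge_div3)
  moreover have "val_ge v 0 (\<mu> * P)"
    using val_ge_mult_cancel[of \<mu> 0 P] \<mu> val_ge_mono[OF P, of "- j"] j k0 by simp
  moreover have "val_ge v 0 (- 3 * D * Q / \<mu>)"
  proof -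
    have "val_ge v k (- D * Q)" using val_ge_mult[OF _ Q, of "2 * k" "- D"] D0 k by (simp add: val_ge_def v_minus)
    then have "val_ge v j (3 * (- D * Q))" using j k0 by (simp only: val_ge_times3) (auto intro: val_ge_mono)
    moreover have e: "\<mu> * (- 3 * D * Q / \<mu>) = 3 * (- D * Q)" using \<mu> by (simp add: mult.assoc)
    ultimately have "val_ge v j (\<mu> * (- 3 * D * Q / \<mu>))" by (simp only: e)
    from iffD1[OF val_ge_mult_cancel[OF \<mu>(1)] this] show ?thesis unfolding \<mu>(2) diff_self .
  qed
  moreover have "val_ge v 0 (- D * P / \<mu>^3)"
  proof -
    have "val_ge v (2 * k) (- D * P)" using val_ge_mult[OF _ P, of "2 * k" "- D"] D0 k by (simp add: val_ge_def v_minus)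
    then have "val_ge v (3 * j) (- D * P)" using j by (auto intro: val_ge_mono)
    then show ?thesis using val_ge_mult_cancel[of "\<mu>^3" "3 * j" "- D * P / \<mu>^3"] \<mu> by (simp add: v_power)
  qed
  ultimately have "integral_form v (Cubic (\<mu>^3 * (Q / 3)) (\<mu> * P) (- 3 * D * Q / \<mu>) (- D * P / \<mu>^3))"
    by (simp only: integral_Cubic)
  then show ?thesis by (rule that[OF eq])
qed

text \<open>
  Hensel's lemma solves \<open>4 p\<^sup>3 - 3 p = P\<close> for \<open>P\<close> congruent to \<open>1\<close>; the opposite sign is covered because
  \<open>(- P, - Q)\<close> is the cube of \<open>(- p, - q)\<close>.
\<close>

lemma cube_if_cong:
  assumes n: "P^2 + 3 * D * Q^2 = 1" and P: "val_ge v 1 (P - 1) \<or> val_ge v 1 (P + 1)"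
  shows "sl_equiv (nform D) (tform D P Q)"
proof -
  have main: "\<exists>p q. p^2 + 3 * D * q^2 = 1 \<and> P = 4 * p^3 - 3 * p \<and> Q = q * (4 * p^2 - 1)"
    if n: "P^2 + 3 * D * Q^2 = 1" and P: "val_ge v 1 (P - 1)" for P Q
  proof -
    obtain p where p: "4 * p^3 - 3 * p = P" "val_ge v 1 (p - 1)" using hensel_cube_root[OF P] by blast
    define w where "w = 4 * p^2 - 1"
    have p0: "val_ge v 0 p" using val_ge_add[of 0 "p - 1" 1] val_ge_mono[OF p(2), of 0] by (simp add: val_ge_one)
    have "val_ge v 1 ((p - 1) * (4 * p + 4))"
      by (intro val_ge_mult_left p val_ge_add val_ge_mult_right val_ge_numeral p0)
    moreover have "w = 3 + (p - 1) * (4 * p + 4)" by (simp add: w_def algebra_simps power2_eq_square)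
    ultimately have w: "w \<noteq> 0" using v_add_dominant(1)[of 3] small_units by simp
    define q where "q = Q / w"
    have Q: "Q = q * w" using w by (simp add: q_def)
    have "3 * D * q^2 * w^2 = 3 * D * Q^2" by (simp add: Q power_mult_distrib)
    also have "\<dots> = 1 - P^2" using n by (simp add: algebra_simps)
    also have "\<dots> = (1 - p^2) * w^2"
      unfolding p(1)[symmetric] w_def by (simp add: algebra_simps power2_eq_square power3_eq_cube)
    finally have "3 * D * q^2 = 1 - p^2" using w by simp
    then show ?thesis using p(1) Q unfolding w_def by (intro exI[of _ p] exI[of _ q]) simp
  qed
  have fin: "sl_equiv (nform D) (tform D P Q)"
    if "p^2 + 3 * D * q^2 = 1" "P = 4 * p^3 - 3 * p" "Q = q * (4 * p^2 - 1)" for p q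
    using tor_act[OF that(1) char(2)] that tor_SL2[of D p q] unfolding sl_equiv_def by metis
  show ?thesis
    using P
  proof
    assume "val_ge v 1 (P - 1)"
    then show ?thesis using main[OF n] fin by blast
  next
    assume "val_ge v 1 (P + 1)"
    then have "val_ge v 1 (- P - 1)" using val_ge_minus[of 1 "P + 1"] by simp
    moreover have "(- P)^2 + 3 * D * (- Q)^2 = 1" using n by simp
    ultimately obtain p q where pq: "p^2 + 3 * D * q^2 = 1" "- P = 4 * p^3 - 3 * p" "- Q = q * (4 * p^2 - 1)"
      using main by blast
    have "P = 4 * (- p)^3 - 3 * (- p)" using pq(2) by (simp add: minus_equation_iff[of P])
    moreover have "Q = (- q) * (4 * (- p)^2 - 1)" using pq(3) by (simp add: minus_equation_iff[of Q])
    moreover have "(- p)^2 + 3 * D * (- q)^2 = 1" using pq(1) by simp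
    ultimately show ?thesis using fin by blast
  qed
qed

subsection \<open>Unramified torus points\<close>

text \<open>
  The first coordinate \<open>p\<close> of the cube root is integral, and \<open>q\<close> is after scaling by \<open>unif\<^sup>k\<close>; so inertia
  changes the torus element only modulo the maximal ideal.
\<close>

lemma integral_point_unramified:
  assumes pq: "p^2 + 3 * \<iota> D * q^2 = 1" and P: "\<iota> P = 4 * p^3 - 3 * p" "val_ge v 0 P" and k: "v D = 2 * k"
    and act: "act_form (tor (\<iota> D) p q) (nform (\<iota> D)) = map_cubic_form \<iota> f"
    and s: "\<sigma> \<in> inertia_group v \<iota>"
  shows "map_matrix \<sigma> (tor (\<iota> D) p q) = tor (\<iota> D) p q"
proof -
  note sG = inertia_galois[OF s] and h = inertia_hom[OF s]
  have k0: "k \<ge> 0" using val_geD[OF D_int D0] k by simp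
  have root: "poly (map_poly \<iota> [:- P / 4, - 3 / 4, 0, 1:]) p = 0"
  proof -
    have 4: "(4::'s) \<noteq> 0" using four emb_eq_0[of 4] by (simp add: emb_numeral)
    have "4 * poly (map_poly \<iota> [:- P / 4, - 3 / 4, 0, 1:]) p = 4 * p^3 - 3 * p - \<iota> P"
      using 4 by (simp add: map_poly_pCons emb_simps algebra_simps power3_eq_cube)
    then show ?thesis using 4 by (simp add: P(1))
  qed
  have div4: "val_ge v 0 (x / 4)" if "val_ge v 0 x" for x
    using that val_ge_mult_cancel[of 4 0 "x / 4"] four_nonzero by simp
  have p: "p \<in> OS"
  proof (rule OS_poly_root[OF _ _ root])
    show "val_ge v 0 (coeff [:- P / 4, - 3 / 4, 0, 1:] i)" for i
      using div4[of "- P"] div4[of "- 3"] P(2) val_ge_numeral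
      by (auto simp: coeff_pCons val_ge_minus val_ge_one split: nat.split)
  qed simp
  (* The square of w cancels the valuation of D. *)
  define w where "w = unif powi k"
  have w: "w \<noteq> 0" "v w = k" using unif v_unif_powi by (auto simp: w_def)
  define c where "c = 3 * D / w^2"
  have c: "c \<noteq> 0" "v c = 0" using w D0 small_units k by (simp_all add: c_def v_divide val_mult v_power)
  have Dc: "3 * D = c * w^2" using w by (simp add: c_def)
  define y where "y = q * \<iota> w"
  have Dw: "3 * \<iota> D = \<iota> c * \<iota> w ^ 2" using arg_cong[OF Dc, of \<iota>] by (simp add: emb_simps)
  have cy: "\<iota> c * y^2 = 1 - p^2" using pq unfolding Dw by (simp add: y_def power2_eq_square algebra_simps)
  have "y^2 = \<iota> (inverse c) * (1 - p^2)" unfolding cy[symmetric] using c(1) by (simp add: emb_inverse emb_eq_0)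
  also have "\<dots> \<in> OS" using c p by (intro OS_mult OS_diff OS_1 OS_power OS_emb) (simp_all add: val_ge_def v_inverse)
  finally have y: "y \<in> OS" by (rule OS_root[rotated]) simp
  have sy: "\<sigma> y = \<sigma> q * \<iota> w" by (simp add: y_def hom_mult[OF h] galois_emb[OF sG])
  have "p * (\<sigma> p - p) + \<iota> c * y * (\<sigma> y - y) \<in> mS"
    using c p y inertia_mS[OF s] by (intro mS_add mS_mult2 OS_mult OS_emb) (simp_all add: val_ge_def)
  also have "p * (\<sigma> p - p) + \<iota> c * y * (\<sigma> y - y) = p * \<sigma> p + 3 * \<iota> D * q * \<sigma> q - (p^2 + 3 * \<iota> D * q^2)"
    unfolding sy Dw by (simp add: y_def algebra_simps power2_eq_square)
  finally have "p * \<sigma> p + 3 * \<iota> D * q * \<sigma> q - 1 \<in> mS" by (simp add: pq)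
  then have "p * \<sigma> p - q * \<sigma> (- 3 * \<iota> D * q) - 1 \<in> mS"
    by (simp add: hom_mult[OF h] hom_minus[OF h] hom_numeral[OF h] galois_emb[OF sG] algebra_simps)
  then show ?thesis
    using fixed_if_cong[of p q "- 3 * \<iota> D * q" p f \<sigma>] tor_SL2[of "\<iota> D" p q] pq act s unfolding tor_def by simp
qed

text \<open>
  In the split case a point \<open>(p, q)\<close> of the torus is the unit \<open>p + q s\<close>, with inverse \<open>p - q s\<close>, and
  cubing is the usual one.
\<close>

lemma cube_in_split_torus:
  assumes pq: "p^2 + 3 * \<iota> D * q^2 = 1" and P: "\<iota> P = 4 * p^3 - 3 * p" and Q: "\<iota> Q = q * (4 * p^2 - 1)"
    and s: "s^2 = - 3 * D"
  shows "(p + q * \<iota> s)^3 = \<iota> (P + Q * s)" "(p + q * \<iota> s) * (p - q * \<iota> s) = 1"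
proof -
  define S where "S = \<iota> s"
  have S2: "S * S = - (3 * \<iota> D)" using arg_cong[OF s, of \<iota>] by (simp add: S_def emb_simps power2_eq_square)
  have n': "3 * \<iota> D * q^2 = 1 - p^2" using pq by (simp add: algebra_simps)
  have "(p + q * S)^3 = p^3 + 3 * p^2 * q * S + 3 * p * q^2 * (S * S) + q^3 * S * (S * S)"
    by (simp add: algebra_simps power2_eq_square power3_eq_cube)
  also have "\<dots> = p^3 - 3 * p * (3 * \<iota> D * q^2) + q * (3 * p^2 - 3 * \<iota> D * q^2) * S"
    unfolding S2 by (simp add: algebra_simps power2_eq_square power3_eq_cube)
  also have "\<dots> = \<iota> P + \<iota> Q * S"
    unfolding n' P Q by (simp add: algebra_simps power2_eq_square power3_eq_cube)
  finally show "(p + q * \<iota> s)^3 = \<iota> (P + Q * s)" by (simp add: S_def emb_add emb_mult)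
  have "(p + q * S) * (p - q * S) = p^2 - (S * S) * q^2" by (simp add: algebra_simps power2_eq_square)
  also have "\<dots> = 1" unfolding S2 using pq by simp
  finally show "(p + q * \<iota> s) * (p - q * \<iota> s) = 1" by (simp add: S_def)
qed

text \<open>
  Scaled by a power of the uniformizer, \<open>u = p + q s\<close> is a unit \<open>w\<close>, and
  \<open>\<sigma>(u) / u = \<sigma>(w) / w\<close> is congruent to \<open>1\<close>.  The entry of \<open>g\<^sup>-\<^sup>1 \<sigma>(g)\<close> to be compared with \<open>1\<close> is the half
  sum of \<open>\<sigma>(u) / u\<close> and its inverse.
\<close>

lemma split_point_unramified:
  assumes pq: "p^2 + 3 * \<iota> D * q^2 = 1" and P: "\<iota> P = 4 * p^3 - 3 * p" and Q: "\<iota> Q = q * (4 * p^2 - 1)"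
    and n: "P^2 + 3 * D * Q^2 = 1" and s2: "s^2 = - 3 * D" and l: "v (P + Q * s) = 3 * l"
    and act: "act_form (tor (\<iota> D) p q) (nform (\<iota> D)) = map_cubic_form \<iota> f"
    and s: "\<sigma> \<in> inertia_group v \<iota>"
  shows "map_matrix \<sigma> (tor (\<iota> D) p q) = tor (\<iota> D) p q"
proof -
  note sG = inertia_galois[OF s] and h = inertia_hom[OF s]
  define S where "S = \<iota> s"
  have S2: "S * S = - (3 * \<iota> D)" using arg_cong[OF s2, of \<iota>] by (simp add: S_def emb_simps power2_eq_square)
  have sS: "\<sigma> S = S" by (simp add: S_def galois_emb[OF sG])
  define u where "u = p + q * S"
  define u' where "u' = p - q * S"
  have u3: "u^3 = \<iota> (P + Q * s)" and uu: "u * u' = 1"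
    using cube_in_split_torus[OF pq P Q s2] by (simp_all add: u_def u'_def S_def)
  have u0: "u \<noteq> 0" using uu by auto
  (* A scaling factor making the cube root a unit. *)
  define c where "c = unif powi (- l)"
  have c: "c \<noteq> 0" "v c = - l" using unif v_unif_powi by (auto simp: c_def)
  define w where "w = u * \<iota> c"
  have w0: "w \<noteq> 0" using u0 c by (simp add: w_def emb_eq_0)
  note t = split_unit[OF n s2]
  have w3: "w^3 = \<iota> ((P + Q * s) * c^3)" by (simp add: w_def power_mult_distrib u3 emb_mult emb_power)
  have v3: "v ((P + Q * s) * c^3) = 0" "(P + Q * s) * c^3 \<noteq> 0"
    using t(2) c by (simp_all add: val_mult v_power l)
  have w: "w \<in> OS" "inverse w \<in> OS"
  proof -
    have "w^3 \<in> OS" unfolding w3 using v3 by (intro OS_emb) (simp add: val_ge_def)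
    then show "w \<in> OS" by (rule OS_root[rotated]) simp
    have "inverse w ^ 3 = \<iota> (inverse ((P + Q * s) * c^3))" by (simp only: power_inverse w3 emb_inverse)
    also have "\<dots> \<in> OS" by (rule OS_emb) (simp only: val_ge_def v_inverse[OF v3(2)] v3(1), simp)
    finally show "inverse w \<in> OS" by (rule OS_root[rotated]) simp
  qed
  have sw: "\<sigma> w = \<sigma> u * \<iota> c" by (simp add: w_def hom_mult[OF h] galois_emb[OF sG])
  have sw0: "\<sigma> w \<noteq> 0" using w0 galois_inj[OF sG, of w 0] hom_0[OF h] by simp
  have su: "\<sigma> u * \<sigma> u' = 1" using uu hom_mult[OF h, of u u'] hom_1[OF h] by simp
  have isw: "inverse (\<sigma> w) \<in> OS"
  proof -
    have "\<sigma> w * \<sigma> (inverse w) = 1" using hom_mult[OF h, of w "inverse w"] w0 hom_1[OF h] by simp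
    then have "inverse (\<sigma> w) = \<sigma> (inverse w)" by (rule inverse_unique)
    then show ?thesis using galois_OS[OF sG w(2)] by simp
  qed
  have ms: "(\<sigma> w - w) * ((\<sigma> w - w) * inverse w * inverse (\<sigma> w)) * \<iota> (1 / 2) \<in> mS"
    using inertia_mS[OF s w(1)] w isw
    by (intro mS_mult OS_mult OS_emb) (auto simp: val_ge_div2 val_ge_one intro: mS_OS)
  have "u * \<sigma> u' + u' * \<sigma> u = 2 * (p * \<sigma> p - (S * S) * q * \<sigma> q)"
    by (simp add: u_def u'_def hom_add[OF h] hom_diff[OF h] hom_mult[OF h] sS algebra_simps)
  then have a: "u * \<sigma> u' + u' * \<sigma> u = 2 * (p * \<sigma> p + 3 * \<iota> D * q * \<sigma> q)" by (simp add: S2)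
  have su0: "\<sigma> u \<noteq> 0" using su by auto
  have "u' = inverse u" "\<sigma> u' = inverse (\<sigma> u)"
    using inverse_unique[OF uu] inverse_unique[OF su] by simp_all
  then have "u * \<sigma> u' + u' * \<sigma> u - 2 = (\<sigma> u - u) * (\<sigma> u - u) * inverse u * inverse (\<sigma> u)"
    using u0 su0 by (simp add: field_simps)
  also have "\<dots> = (\<sigma> w - w) * (\<sigma> w - w) * inverse w * inverse (\<sigma> w)"
    unfolding sw unfolding w_def using u0 su0 c(1) by (simp add: field_simps emb_eq_0)
  finally have "2 * (p * \<sigma> p + 3 * \<iota> D * q * \<sigma> q) - 2 = (\<sigma> w - w) * (\<sigma> w - w) * inverse w * inverse (\<sigma> w)"
    unfolding a .
  moreover have gen: "x - 1 = y * \<iota> (1 / 2)" if "2 * x - 2 = y" for x y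
    unfolding that[symmetric] using charS by (simp add: emb_simps field_simps)
  ultimately have "p * \<sigma> p + 3 * \<iota> D * q * \<sigma> q - 1 = (\<sigma> w - w) * ((\<sigma> w - w) * inverse w * inverse (\<sigma> w)) * \<iota> (1 / 2)"
    using gen by (simp add: mult.assoc)
  then have "p * \<sigma> p + 3 * \<iota> D * q * \<sigma> q - 1 \<in> mS" using ms by metis
  then have "p * \<sigma> p - q * \<sigma> (- 3 * \<iota> D * q) - 1 \<in> mS"
    by (simp add: hom_mult[OF h] hom_minus[OF h] hom_numeral[OF h] galois_emb[OF sG] algebra_simps)
  then show ?thesis
    using fixed_if_cong[of p q "- 3 * \<iota> D * q" p f \<sigma>] tor_SL2[of "\<iota> D" p q] pq act s unfolding tor_def by simp
qed

text \<open>
  An element carrying the normal form to \<open>tform D P Q\<close> is a torus point, and \<open>p + q s\<close> is a cube root of an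
  element whose valuation is not divisible by \<open>3\<close>; inertia moves it.
\<close>

lemma split_point_ramified:
  assumes n: "P^2 + 3 * D * Q^2 = 1" and s2: "s^2 = - 3 * D" and l: "\<not> 3 dvd v (P + Q * s)"
    and g: "g \<in> SL2" "act_form g (nform (\<iota> D)) = map_cubic_form \<iota> (tform D P Q)"
    and fixed: "\<And>\<sigma>. \<sigma> \<in> inertia_group v \<iota> \<Longrightarrow> map_matrix \<sigma> g = g"
  shows False
proof (rule nform_to_tform[OF g(1) g(2)[unfolded emb_tform] _ charS])
  show "(\<iota> P)^2 + 3 * \<iota> D * (\<iota> Q)^2 = 1" using arg_cong[OF n, of \<iota>] by (simp add: emb_simps)
  fix p q assume pq: "g = tor (\<iota> D) p q" "p^2 + 3 * \<iota> D * q^2 = 1" "\<iota> P = 4 * p^3 - 3 * p" "\<iota> Q = q * (4 * p^2 - 1)"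
  have "(p + q * \<iota> s)^3 = \<iota> (P + Q * s)" by (rule cube_in_split_torus(1)[OF pq(2-4) s2])
  then obtain \<sigma> where \<sigma>: "\<sigma> \<in> inertia_group v \<iota>" "\<sigma> (p + q * \<iota> s) \<noteq> p + q * \<iota> s"
    by (rule inertia_moves_cube_root[OF split_unit(2)[OF n s2] l])
  have "\<sigma> p = p" "\<sigma> q = q" using fixed[OF \<sigma>(1)] by (simp_all add: pq(1) tor_def map_mat2 mat2_eq_iff)
  then show False
    using \<sigma>(2) by (simp add: hom_add[OF inertia_hom[OF \<sigma>(1)]] hom_mult[OF inertia_hom[OF \<sigma>(1)]] galois_emb[OF inertia_galois[OF \<sigma>(1)]])
qed

subsection \<open>Integral forms of positive discriminant valuation\<close>

text \<open>
  Modulo the maximal ideal the form has a double root and a simple root.  The shift which makes the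
  middle coefficient of the Hessian vanish moves the double root to the reduction of \<open>(0, 1)\<close>, and the simple root lifts
  by Hensel's lemma.
\<close>

lemma reducible_if_hessian_unit:
  assumes f: "integral_form v f" "disc f = d" and d1: "v d \<ge> 1" and ha: "hess_a f \<noteq> 0" "v (hess_a f) = 0"
  shows "sl_equiv f (nform D)"
proof -
  define \<alpha> where "\<alpha> = hess_a f"
  have \<alpha>: "\<alpha> \<noteq> 0" "v \<alpha> = 0" using ha by (simp_all add: \<alpha>_def)
  have div: "val_ge v n (x / \<alpha>) \<longleftrightarrow> val_ge v n x" for n x
    using val_ge_mult_cancel[OF \<alpha>(1), of n "x / \<alpha>"] \<alpha> by simp
  obtain a0 b0 c0 e0 where fc: "f = Cubic a0 b0 c0 e0" by (cases f)
  have int0: "val_ge v 0 a0" "val_ge v 0 b0" "val_ge v 0 c0" "val_ge v 0 e0" using f by (auto simp: fc integral_Cubic)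
  (* The shift that makes the middle coefficient of the Hessian vanish. *)
  define r where "r = - hess_b f / (2 * \<alpha>)"
  have hb: "val_ge v 0 (hess_b f)"
    using int0 by (auto simp: fc intro!: val_ge_diff val_ge_mult_left val_ge_numeral)
  have "val_ge v 0 (- hess_b f / 2 / \<alpha>)" using hb by (simp only: div val_ge_div2 val_ge_minus)
  then have r: "val_ge v 0 r" by (simp add: r_def)
  have det: "1 * 1 - 0 * r = 1" by simp
  obtain a b c e where f1: "act_coeffs 1 0 r 1 f = Cubic a b c e" by (cases "act_coeffs 1 0 r 1 f")
  have eq: "sl_equiv f (Cubic a b c e)" using f1 by (intro sl_equivI[of 1 1 0 r]) simp_all
  have d: "disc (Cubic a b c e) = d" using sl_equiv_disc[OF eq char(2)] f(2) by simp
  have int: "val_ge v 0 a" "val_ge v 0 b"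
    using f1 int0 r by (auto simp: fc intro!: val_ge_add val_ge_mult_left val_ge_numeral)
  have h1: "hess_a (Cubic a b c e) = \<alpha>" using hess_act(1)[OF det, of f] by (simp add: f1 \<alpha>_def)
  have "hess_b (Cubic a b c e) = 2 * \<alpha> * r + hess_b f" using hess_act(2)[OF det, of f] by (simp add: f1 \<alpha>_def)
  also have "\<dots> = 0" using \<alpha> char by (simp add: r_def)
  finally have h2: "hess_b (Cubic a b c e) = 0" .
  define \<epsilon> where "\<epsilon> = hess_c (Cubic a b c e) / \<alpha>"
  have h3: "hess_c (Cubic a b c e) = \<epsilon> * \<alpha>" using \<alpha> by (simp add: \<epsilon>_def)
  have "4 * \<alpha> * (\<epsilon> * \<alpha>) = 3 * d"
    using hess_disc[of "Cubic a b c e"] unfolding h1 h2 h3 d by simp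
  then have "val_ge v 1 (4 * \<alpha> * (\<epsilon> * \<alpha>))" using d1 d0 val_ge_times3[of 1 d] by (simp add: val_ge_def)
  then have \<epsilon>: "val_ge v 1 \<epsilon>"
    using val_ge_mult_cancel[of "4 * \<alpha> * \<alpha>" 1 \<epsilon>] \<alpha> four_nonzero by (simp add: val_mult ac_simps)
  have A: "b^2 - 3 * a * c = \<alpha>" and B: "b * c - 9 * a * e = 0" and C': "c^2 - 3 * b * e = \<epsilon> * \<alpha>"
    using h1 h2 h3 by simp_all
  have "\<alpha> * c = - (3 * a * (c^2 - 3 * b * e)) + b * (b * c - 9 * a * e)"
    unfolding A[symmetric] by (simp add: algebra_simps power2_eq_square)
  also have "\<dots> = \<alpha> * (- 3 * a * \<epsilon>)" unfolding B C' by simp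
  finally have c: "c = - 3 * a * \<epsilon>" using \<alpha> by (simp only: mult_cancel_left) simp
  have "3 * (\<alpha> * e) = - (b * (c^2 - 3 * b * e)) + c * (b * c - 9 * a * e)"
    unfolding A[symmetric] by (simp add: algebra_simps power2_eq_square)
  also have "\<dots> = \<alpha> * (- b * \<epsilon>)" unfolding B C' by simp
  finally have "\<alpha> * (3 * e) = \<alpha> * (- b * \<epsilon>)" by (simp add: ac_simps)
  then have "3 * e = - b * \<epsilon>" using \<alpha> by (simp only: mult_cancel_left) simp
  then have e: "e = - (b * \<epsilon> / 3)" using char by (simp add: field_simps)
  have "b^2 = \<alpha> + 3 * a * c" using A by (simp add: algebra_simps)
  moreover have "val_ge v 1 (3 * a * c)"
    unfolding c using int \<epsilon> by (intro val_ge_mult_right val_ge_numeral) (simp_all add: val_ge_minus val_ge_times3 val_ge_numeral val_ge_mult_right)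
  ultimately have "b^2 \<noteq> 0" "v (b^2) = 0" using v_add_dominant[of \<alpha> "3 * a * c"] \<alpha> by simp_all
  then have b: "b \<noteq> 0" "v b = 0" by (auto simp: v_power)
  obtain y where y: "a + b * y - 3 * a * \<epsilon> * y ^ 2 - b * \<epsilon> / 3 * y ^ 3 = 0"
    by (rule hensel_cubic_root[OF int(1) b \<epsilon>])
  have "eval_form (Cubic a b c e) 1 y = 0" unfolding c e using y by (simp add: algebra_simps)
  then have "sl_equiv (Cubic a b c e) (nform (d / 4))"
    by (intro sl_equiv_nform_if_zero[OF char d d0, of 1 y]) simp_all
  then show ?thesis using sl_equiv_trans[OF eq] by (simp add: D_def)
qed

text \<open>
  Modulo the maximal ideal the form is a unit times the cube of a linear form.  Completing the cube
  turns it into \<open>a x\<^sup>3 + c' x y\<^sup>2 + e' y\<^sup>3\<close>, and discriminant valuation \<open>2\<close> forces \<open>v e' = 1\<close>: the form is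
  Eisenstein, its roots have valuation \<open>1/3\<close>, and inertia moves them.  But \<open>g\<close> carries the root \<open>(1, 0)\<close> of
  the normal form to such a root.
\<close>

lemma ramified_if_triple_root:
  assumes f: "integral_form v (Cubic a b c e)" "disc (Cubic a b c e) = d" and d2: "v d = 2"
    and a: "a \<noteq> 0" "v a = 0" and ha: "val_ge v 1 (hess_a (Cubic a b c e))"
    and g: "g \<in> SL2" "act_form g (nform (\<iota> D)) = map_cubic_form \<iota> (Cubic a b c e)"
    and fixed: "\<And>\<sigma>. \<sigma> \<in> inertia_group v \<iota> \<Longrightarrow> map_matrix \<sigma> g = g"
  shows False
proof -
  have int: "val_ge v 0 a" "val_ge v 0 b" "val_ge v 0 c" "val_ge v 0 e" using f by (auto simp: integral_Cubic)
  define r where "r = - b / (3 * a)"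
  have "val_ge v 0 (- b / 3 / a)"
    using val_ge_mult_cancel[OF a(1), of 0 "- b / 3 / a"] a int(2) by (simp add: val_ge_div3 val_ge_minus)
  then have r: "val_ge v 0 r" by (simp add: r_def)
  define c' where "c' = 3 * a * r^2 + 2 * b * r + c"
  define e' where "e' = a * r^3 + b * r^2 + c * r + e"
  have f1: "act_coeffs 1 0 r 1 (Cubic a b c e) = Cubic a 0 c' e'"
    using a char by (simp add: c'_def e'_def r_def algebra_simps)
  have det: "1 * 1 - 0 * r = 1" by simp
  have eq: "sl_equiv (Cubic a b c e) (Cubic a 0 c' e')" using f1 by (intro sl_equivI[of 1 1 0 r]) simp_all
  have d: "disc (Cubic a 0 c' e') = d" using sl_equiv_disc[OF eq char(2)] f(2) by simp
  have int': "val_ge v 0 c'" "val_ge v 0 e'"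
    using int r unfolding c'_def e'_def by (auto intro!: val_ge_add val_ge_mult_left val_ge_numeral val_ge_power)
  have "hess_a (Cubic a 0 c' e') = hess_a (Cubic a b c e)" using hess_act(1)[OF det, of "Cubic a b c e"] by (simp only: f1) simp
  then have "val_ge v 1 (- (3 * (a * c')))" using ha by (simp only: hess_a.simps) (simp add: mult.assoc)
  then have "val_ge v 1 (3 * (a * c'))" by (simp only: val_ge_minus)
  then have ac: "val_ge v 1 (a * c')" by (simp only: val_ge_times3)
  then have c1: "val_ge v 1 c'" using val_ge_mult_cancel[OF a(1), of 1 c'] a by simp
  have disc: "- (4 * a * c'^3) - 27 * a^2 * e'^2 = d" using d by (simp add: algebra_simps)
  have c3: "val_ge v 3 (4 * a * c'^3)"
    using val_ge_mult_right[OF val_ge_mult_right[OF val_ge_numeral int(1)], of 3 "c' * c' * c'"]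
      val_ge_mult[OF val_ge_mult[OF c1 c1] c1] by (simp add: power3_eq_cube)
  have e27: "27 * a^2 * e'^2 = - d + - (4 * a * c'^3)" unfolding disc[symmetric] by simp
  have dm: "- d \<noteq> 0" "v (- d) = 2" using d0 d2 by (simp_all add: v_minus)
  have c3': "val_ge v (v (- d) + 1) (- (4 * a * c'^3))" using c3 by (simp add: dm(2) val_ge_minus)
  have ve: "v (27 * a^2 * e'^2) = 2" "27 * a^2 * e'^2 \<noteq> 0"
    unfolding e27 using v_add_dominant[OF dm(1) c3'] dm(2) by simp_all
  have 27: "v (27::'f) = 0" using val_mult[of 9 3] small_units nine_nonzero by simp
  have e0: "e' \<noteq> 0" and n27: "(27::'f) \<noteq> 0" using ve(2) by auto
  then have e1: "v e' = 1" using ve(1) a 27 by (simp add: val_mult v_power)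
  (* The transformation from the normal form to the Eisenstein form is still fixed by inertia. *)
  define h where "h = map_matrix \<iota> (mat2 1 0 r 1) ** g"
  have gS: "map_matrix \<iota> (mat2 1 0 r 1) \<in> SL2" by (rule map_matrix_SL2[OF hom_emb]) (simp add: SL2_mat2)
  have hN: "act_form h (nform (\<iota> D)) = map_cubic_form \<iota> (Cubic a 0 c' e')"
    unfolding h_def act_form_mult g(2) map_act_form[OF hom_emb, symmetric] by (simp only: act_mat2 f1)
  have hS: "h \<in> SL2" unfolding h_def by (intro SL2_mult gS g)
  have hfix: "map_matrix \<sigma> h = h" if s: "\<sigma> \<in> inertia_group v \<iota>" for \<sigma>
  proof -
    have "map_matrix \<sigma> (map_matrix \<iota> (mat2 1 0 r 1)) = map_matrix \<iota> (mat2 1 0 r 1)"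
      by (simp add: vec_eq_iff galois_emb[OF inertia_galois[OF s]])
    then show ?thesis unfolding h_def by (simp add: map_matrix_mult[OF inertia_hom[OF s]] fixed[OF s])
  qed
  obtain p q r' s where m: "h = mat2 p q r' s" by (rule mat2_cases)
  have "act_coeffs p q r' s (nform (\<iota> D)) = map_cubic_form \<iota> (Cubic a 0 c' e')" using hN by (simp add: m act_mat2)
  then have "\<iota> a = p^2 * q - \<iota> D * q^3" by (simp add: nform_def)
  then have q0: "q \<noteq> 0" using a emb_eq_0[of a] by auto
  (* The image of the root (1, 0) of the normal form under h, in the coordinate x / y. *)
  define \<theta> where "\<theta> = - s / q"
  have "eval_form (map_cubic_form \<iota> (Cubic a 0 c' e')) (- s) q = 0"
    unfolding hN[symmetric] eval_act_form m by (simp add: nform_def algebra_simps)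
  then have "\<iota> a * (- s)^3 + \<iota> c' * (- s) * q^2 + \<iota> e' * q^3 = 0" by (simp add: emb_0)
  then have "q^3 * (\<iota> a * \<theta>^3 + \<iota> c' * \<theta> + \<iota> e') = 0"
    using q0 by (simp add: \<theta>_def field_simps power2_eq_square power3_eq_cube)
  then have root: "\<iota> a * \<theta>^3 + \<iota> c' * \<theta> + \<iota> e' = 0" using q0 by simp
  have an: "\<iota> a \<noteq> 0" using a by (simp add: emb_eq_0)
  have diva: "val_ge v n (x / a) \<longleftrightarrow> val_ge v n x" for n x
    using val_ge_mult_cancel[OF a(1), of n "x / a"] a by simp
  have "poly (map_poly \<iota> [:e' / a, c' / a, 0, 1:]) \<theta> = (\<iota> a * \<theta>^3 + \<iota> c' * \<theta> + \<iota> e') / \<iota> a"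
    using an by (simp add: map_poly_pCons emb_simps field_simps power3_eq_cube)
  then have rt: "poly (map_poly \<iota> [:e' / a, c' / a, 0, 1:]) \<theta> = 0" by (simp add: root)
  have \<theta>: "\<theta> \<in> OS"
  proof (rule OS_poly_root[OF _ _ rt])
    show "val_ge v 0 (coeff [:e' / a, c' / a, 0, 1:] i)" for i
      using int' by (auto simp: coeff_pCons diva val_ge_one split: nat.split)
  qed simp
  have "\<theta>^3 = - \<iota> (c' / a) * \<theta> - \<iota> (e' / a)"
    using rt by (simp add: map_poly_pCons emb_simps algebra_simps power3_eq_cube eq_neg_iff_add_eq_0)
  also have "\<dots> \<in> mS"
    using e1 by (intro mS_diff mS_mult mS_minus \<theta>) (simp_all add: mS_emb diva c1, simp add: val_ge_def)
  finally have \<theta>m: "\<theta> \<in> mS" by (rule mS_root[rotated]) simp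
  have \<theta>0: "\<theta> \<noteq> 0"
  proof
    assume "\<theta> = 0"
    then have "\<iota> e' = 0" using root by simp
    then show False using e0 by (simp add: emb_eq_0)
  qed
  have "\<pi> / \<theta> = - (\<iota> (unif / e') * (\<iota> a * \<theta>^2 + \<iota> c'))"
  proof -
    have en: "\<iota> e' \<noteq> 0" using e0 by (simp add: emb_eq_0)
    have "\<theta> * (\<iota> a * \<theta>^2 + \<iota> c') = - \<iota> e'"
      using root by (simp add: algebra_simps power2_eq_square power3_eq_cube eq_neg_iff_add_eq_0)
    then have "\<iota> a * \<theta>^2 + \<iota> c' = - \<iota> e' / \<theta>" using \<theta>0 by (simp add: field_simps)
    then show ?thesis using en \<theta>0 by (simp add: emb_divide)
  qed
  also have "\<dots> \<in> mS"
  proof (intro mS_minus mS_mult2 mS_add)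
    show "\<iota> (unif / e') \<in> OS" using e0 e1 unif by (intro OS_emb) (simp add: val_ge_def v_divide)
    show "\<iota> c' \<in> mS" using c1 by (simp add: mS_emb)
    show "\<iota> a \<in> OS" by (rule OS_emb[OF int(1)])
    show "\<theta>^2 \<in> mS" using mS_mult[OF \<theta>m \<theta>] by (simp add: power2_eq_square)
  qed
  finally obtain \<sigma> where \<sigma>: "\<sigma> \<in> inertia_group v \<iota>" "\<sigma> \<theta> \<noteq> \<theta>" by (rule inertia_moves[OF \<theta>m \<theta>0])
  note hm = inertia_hom[OF \<sigma>(1)]
  have "\<sigma> q = q" "\<sigma> s = s" using hfix[OF \<sigma>(1)] by (simp_all add: m map_mat2 mat2_eq_iff)
  moreover have "\<sigma> \<theta> * \<sigma> q = - \<sigma> s"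
    using hom_mult[OF hm, of \<theta> q] hom_minus[OF hm, of s] q0 by (simp add: \<theta>_def)
  ultimately have "\<sigma> \<theta> = \<theta>" using q0 by (simp add: \<theta>_def field_simps)
  then show False using \<sigma>(2) by simp
qed

text \<open>
  If the Hessian vanishes modulo the maximal ideal, the reduction of \<open>f\<close> is a multiple of a cube,
  \<open>ramified_if_triple_root\<close> excludes that it is nonzero, and \<open>v d = 2\<close> excludes that it vanishes.
  Otherwise \<open>f\<close> is reducible.
\<close>

lemma reducible_if_integral_unramified:
  assumes f: "integral_form v f" "disc f = d" and d2: "v d = 2"
    and g: "g \<in> SL2" "act_form g (nform (\<iota> D)) = map_cubic_form \<iota> f"
    and fixed: "\<And>\<sigma>. \<sigma> \<in> inertia_group v \<iota> \<Longrightarrow> map_matrix \<sigma> g = g"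
  shows "sl_equiv f (nform D)"
proof -
  obtain a b c e where fc: "f = Cubic a b c e" by (cases f)
  have int: "val_ge v 0 a" "val_ge v 0 b" "val_ge v 0 c" "val_ge v 0 e" using f by (auto simp: fc integral_Cubic)
  have unit: "x \<noteq> 0 \<and> v x = 0" if "val_ge v 0 x" "\<not> val_ge v 1 x" for x using that by (auto simp: val_ge_def)
  have ints: "val_ge v 0 (hess_a f)" "val_ge v 0 (hess_c f)"
    using int by (auto simp: fc intro!: val_ge_diff val_ge_mult_left val_ge_power val_ge_numeral)
  (* Exchanging the variables exchanges the outer coefficients of the form and of the Hessian. *)
  define f' where "f' = Cubic e (- c) b (- a)"
  have act: "act_coeffs 0 1 (- 1) 0 f = f'" by (simp add: fc f'_def)
  have eq: "sl_equiv f f'" using act by (intro sl_equivI[of 0 0 1 "- 1"]) simp_all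
  have f': "integral_form v f'" "disc f' = d"
    using int sl_equiv_disc[OF eq char(2)] f(2) by (simp_all add: f'_def integral_Cubic val_ge_minus)
  have h': "hess_a f' = hess_c f" by (simp add: fc f'_def)
  consider "\<not> val_ge v 1 (hess_a f)" | "\<not> val_ge v 1 (hess_c f)"
    | "val_ge v 1 (hess_a f)" "val_ge v 1 (hess_c f)" by blast
  then show ?thesis
  proof cases
    case 1
    then show ?thesis using unit[OF ints(1)] d2 by (intro reducible_if_hessian_unit f) auto
  next
    case 2
    then have "sl_equiv f' (nform D)"
      using unit[OF ints(2)] d2 by (intro reducible_if_hessian_unit f') (auto simp: h')
    then show ?thesis by (rule sl_equiv_trans[OF eq])
  next
    case 3
    have False
    proof (cases "val_ge v 1 a")
      case False
      from unit[OF int(1) False] have a: "a \<noteq> 0" "v a = 0" by blast+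
      show False
        by (rule ramified_if_triple_root[OF f[unfolded fc] d2 a 3(1)[unfolded fc] g(1) g(2)[unfolded fc]])
          (rule fixed)
    next
      case a1: True
      show False
      proof (cases "val_ge v 1 e")
        case False
        define h where "h = map_matrix \<iota> (mat2 0 1 (- 1) 0) ** g"
        have gS: "map_matrix \<iota> (mat2 0 1 (- 1) 0) \<in> SL2" by (rule map_matrix_SL2[OF hom_emb]) (simp add: SL2_mat2)
        have hN: "act_form h (nform (\<iota> D)) = map_cubic_form \<iota> f'"
          unfolding h_def act_form_mult g(2) map_act_form[OF hom_emb, symmetric] by (simp only: act_mat2 act)
        have hS: "h \<in> SL2" unfolding h_def by (intro SL2_mult gS g)
        have hfix: "map_matrix \<sigma> h = h" if s: "\<sigma> \<in> inertia_group v \<iota>" for \<sigma>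
        proof -
          have "map_matrix \<sigma> (map_matrix \<iota> (mat2 0 1 (- 1) 0)) = map_matrix \<iota> (mat2 0 1 (- 1) 0)"
            by (simp add: vec_eq_iff galois_emb[OF inertia_galois[OF s]])
          then show ?thesis unfolding h_def by (simp add: map_matrix_mult[OF inertia_hom[OF s]] fixed[OF s])
        qed
        from unit[OF int(4) False] have e: "e \<noteq> 0" "v e = 0" by blast+
        have ha: "val_ge v 1 (hess_a f')" unfolding h' by (rule 3(2))
        show False
          by (rule ramified_if_triple_root[OF f'[unfolded f'_def] d2 e ha[unfolded f'_def] hS hN[unfolded f'_def]])
            (rule hfix)
      next
        case e1: True
        have "val_ge v 1 (3 * a * c)" "val_ge v 1 (3 * b * e)"
          using val_ge_mult_left[OF val_ge_mult_right[OF val_ge_numeral a1] int(3)]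
            val_ge_mult_right[OF val_ge_mult_right[OF val_ge_numeral int(2)] e1] by simp_all
        then have "val_ge v 1 (b^2)" "val_ge v 1 (c^2)"
          using 3 val_ge_add[of 1 "hess_a f" "3 * a * c"] val_ge_add[of 1 "hess_c f" "3 * b * e"] by (simp_all add: fc)
        moreover have root: "val_ge v 1 x" if "val_ge v 1 (x^2)" for x
          using that by (cases "x = 0") (simp_all add: val_ge_def v_power)
        ultimately have b1: "val_ge v 1 b" and c1: "val_ge v 1 c" by (simp_all only: root)
        have three: "val_ge v 3 (x * y * z)" if "val_ge v 1 x" "val_ge v 1 y" "val_ge v 1 z" for x y z
          using val_ge_mult[OF val_ge_mult[OF that(1,2)] that(3)] by simp
        have eq3: "disc f = (b * b * c) * c - (a * c * c) * (4 * c) - (b * b * b) * (4 * e)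
            - (a * a * e) * (27 * e) + (a * b * c) * (18 * e)"
          by (simp add: fc algebra_simps power2_eq_square power3_eq_cube)
        have num: "val_ge v 0 (numeral n * x)" if "val_ge v 0 x" for n x
          by (rule val_ge_mult_right[OF val_ge_numeral that])
        have "val_ge v 3 ((b * b * c) * c)" by (rule val_ge_mult_left[OF three[OF b1 b1 c1] int(3)])
        moreover have "val_ge v 3 ((a * c * c) * (4 * c))" by (rule val_ge_mult_left[OF three[OF a1 c1 c1] num[OF int(3)]])
        moreover have "val_ge v 3 ((b * b * b) * (4 * e))" by (rule val_ge_mult_left[OF three[OF b1 b1 b1] num[OF int(4)]])
        moreover have "val_ge v 3 ((a * a * e) * (27 * e))" by (rule val_ge_mult_left[OF three[OF a1 a1 e1] num[OF int(4)]])
        moreover have "val_ge v 3 ((a * b * c) * (18 * e))" by (rule val_ge_mult_left[OF three[OF a1 b1 c1] num[OF int(4)]])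
        ultimately have "val_ge v 3 (disc f)" unfolding eq3 by (intro val_ge_add val_ge_diff)
        then have "val_ge v 3 d" unfolding f(2) .
        then show False using d2 d0 by (simp add: val_ge_def)
      qed
    qed
    then show ?thesis ..
  qed
qed

section \<open>Integral and unramified classes\<close>

text \<open>
  The point \<open>(P, Q)\<close> itself lies on the torus, because its embedding is the cube of \<open>(p, q)\<close>.
\<close>

lemma class_torus_point:
  assumes X: "X \<in> carrier (H1_stab \<iota> f0)"
  obtains g p q P Q where "p^2 + 3 * \<iota> D * q^2 = 1" "\<iota> P = 4 * p^3 - 3 * p" "\<iota> Q = q * (4 * p^2 - 1)"
    "P^2 + 3 * D * Q^2 = 1" "rep X g (tform D P Q)"
    "tor (\<iota> D) p q \<in> SL2" "act_form (tor (\<iota> D) p q) (nform (\<iota> D)) = map_cubic_form \<iota> (tform D P Q)"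
proof (rule class_from_torus[OF X])
  fix p q P Q assume pq: "p^2 + 3 * \<iota> D * q^2 = 1" "\<iota> P = 4 * p^3 - 3 * p" "\<iota> Q = q * (4 * p^2 - 1)"
    and r: "rep X (tor (\<iota> D) p q ** matrix_inv \<Delta>) (tform D P Q)"
  have "\<iota> (P^2 + 3 * D * Q^2) = \<iota> 1"
    using tform_norm[OF pq(1)] by (simp add: emb_simps pq(2,3))
  then have n: "P^2 + 3 * D * Q^2 = 1" by (simp only: emb_eq)
  have act: "act_form (tor (\<iota> D) p q) (nform (\<iota> D)) = map_cubic_form \<iota> (tform D P Q)"
    unfolding tor_act[OF pq(1) charS(2)] emb_tform pq(2,3) ..
  show thesis by (rule that[OF pq n r _ act]) (simp add: tor_SL2 pq(1))
qed

lemma int_if_equiv: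
  assumes "X \<in> carrier (H1_stab \<iota> f0)" "rep X g f" "sl_equiv f f'" "integral_form v f'"
  shows "X \<in> H1_int v \<iota> d f0"
  unfolding H1_int_iff using rep_sl_equiv[OF assms(2,3)] assms(1,4) by blast

lemma un_if_fixed:
  assumes "X \<in> carrier (H1_stab \<iota> f0)" "rep X g f" "h \<in> SL2" "act_form h (nform (\<iota> D)) = map_cubic_form \<iota> f"
    "\<And>\<sigma>. \<sigma> \<in> inertia_group v \<iota> \<Longrightarrow> map_matrix \<sigma> h = h"
  shows "X \<in> H1_un v \<iota> f0"
  unfolding H1_un_iff[OF assms(1,2)] using assms(3-5) by blast

lemma H1_un_carrier: "X \<in> H1_un v \<iota> f0 \<Longrightarrow> X \<in> carrier (H1_stab \<iota> f0)"
  by (simp add: H1_un_def kernel_def)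

lemma H1_int_carrier: "X \<in> H1_int v \<iota> d f0 \<Longrightarrow> X \<in> carrier (H1_stab \<iota> f0)"
  by (simp add: H1_int_iff)

text \<open>
  A class with an integral form is unramified by \<open>integral_unramified\<close>.  Conversely, a torus point \<open>(P, Q)\<close>
  with integral \<open>P\<close> gives an integral form; a point with non-integral \<open>P\<close> lives in a split torus, where
  being unramified makes the valuation of \<open>P + Q s\<close> divisible by \<open>3\<close>, so that it can be scaled away.
\<close>

theorem int_eq_un:
  assumes d: "v d = 0" shows "H1_int v \<iota> d f0 = H1_un v \<iota> f0"
proof (intro equalityI subsetI)
  fix X assume X: "X \<in> H1_int v \<iota> d f0"
  then obtain g f where f: "rep X g f" "integral_form v f" by (auto simp: H1_int_iff)
  note r = rep_nform[OF f(1)]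
  show "X \<in> H1_un v \<iota> f0"
    by (rule un_if_fixed[OF H1_int_carrier[OF X] f(1) r]) (rule integral_unramified[OF d f(2) r])
next
  fix X assume un: "X \<in> H1_un v \<iota> f0"
  note X = H1_un_carrier[OF un]
  have vD: "v D = 2 * 0" using d by (simp add: v_D)
  show "X \<in> H1_int v \<iota> d f0"
  proof (rule class_torus_point[OF X])
    fix g p q P Q assume n: "P^2 + 3 * D * Q^2 = 1" and r: "rep X g (tform D P Q)"
    show ?thesis
    proof (cases "val_ge v 0 P")
      case True
      obtain f where "sl_equiv (tform D P Q) f" "integral_form v f"
        by (rule integral_torus_point[OF n True vD, of 0]) simp_all
      then show ?thesis by (rule int_if_equiv[OF X r])
    next
      case False
      then obtain s where s: "s^2 = - 3 * D" "s \<noteq> 0" "2 * v s = v D" by (rule split_if_not_integral[OF n])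
      obtain h where h: "h \<in> SL2" "act_form h (nform (\<iota> D)) = map_cubic_form \<iota> (tform D P Q)"
        "\<And>\<sigma>. \<sigma> \<in> inertia_group v \<iota> \<Longrightarrow> map_matrix \<sigma> h = h"
        using un unfolding H1_un_iff[OF X r] by blast
      have "3 dvd v (P + Q * s)" using split_point_ramified[OF n s(1) _ h] by blast
      then obtain l where l: "v (P + Q * s) = 3 * l" by (elim dvdE)
      obtain f where "sl_equiv (tform D P Q) f" "integral_form v f"
        by (rule split_integral[OF n s(1,2), of l]) (use s(3) vD l in auto)
      then show ?thesis by (rule int_if_equiv[OF X r])
    qed
  qed
qed

text \<open>
  The torus does not split, so \<open>P\<close> is integral, and \<open>(P - 1) (P + 1) = - 3 D Q\<^sup>2\<close> has odd, hence positive
  valuation.  So \<open>P\<close> is congruent to \<open>1\<close> or \<open>- 1\<close>, and the point is a cube.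
\<close>

theorem trivial_if_odd:
  assumes d: "odd (v d)" and X: "X \<in> carrier (H1_stab \<iota> f0)" shows "X = \<one>\<^bsub>H1_stab \<iota> f0\<^esub>"
proof (rule class_torus_point[OF X])
  fix g p q P Q assume n: "P^2 + 3 * D * Q^2 = 1" and r: "rep X g (tform D P Q)"
  have P: "val_ge v 0 P"
  proof (rule ccontr)
    assume "\<not> val_ge v 0 P"
    then obtain s where "2 * v s = v D" by (rule split_if_not_integral[OF n])
    then show False using d by (metis v_D dvd_triv_left)
  qed
  have e: "(P - 1) * (P + 1) = - (3 * (D * Q^2))" using n by (simp add: algebra_simps power2_eq_square)
  have "val_ge v 1 (D * Q^2)"
  proof (cases "Q = 0")
    case False
    have "3 * (D * Q^2) = 1 - P^2" using n by (simp add: algebra_simps)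
    then have "val_ge v 0 (3 * (D * Q^2))" using val_ge_diff[of 0 1 "P^2"] val_ge_power[OF P] by (simp add: val_ge_one)
    then have "val_ge v 0 (D * Q^2)" by (simp only: val_ge_times3)
    moreover have "odd (v (D * Q^2))" using d D0 False by (simp add: val_mult v_power v_D)
    ultimately show ?thesis using False D0 by (auto simp: val_ge_def elim!: oddE)
  qed simp
  then have "val_ge v 1 ((P - 1) * (P + 1))" unfolding e val_ge_minus val_ge_times3 .
  moreover have "val_ge v 0 (P - 1)" "val_ge v 0 (P + 1)"
    using P by (auto intro!: val_ge_diff val_ge_add simp: val_ge_one)
  ultimately have "val_ge v 1 (P - 1) \<or> val_ge v 1 (P + 1)"
    by (cases "P - 1 = 0"; cases "P + 1 = 0") (auto simp: val_ge_def val_mult)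
  from cube_if_cong[OF n this] have "sl_equiv (tform D P Q) (nform D)" by (rule sl_equiv_sym)
  then show ?thesis by (rule trivial_if_equiv[OF r])
qed

text \<open>
  Torus points with integral \<open>P\<close>, and split ones with \<open>v (P + Q s)\<close> divisible by \<open>3\<close>, give unramified classes;
  the remaining split ones have an integral diagonal form with valuations \<open>0\<close> and \<open>1\<close>.  Conversely, an
  integral form in an unramified class is reducible by \<open>reducible_if_integral_unramified\<close>.
\<close>

theorem nonintegral_eq:
  assumes d: "v d = 2"
  shows "carrier (H1_stab \<iota> f0) - H1_int v \<iota> d f0 = H1_un v \<iota> f0 - {\<one>\<^bsub>H1_stab \<iota> f0\<^esub>}"
proof (intro equalityI subsetI)
  fix X assume "X \<in> carrier (H1_stab \<iota> f0) - H1_int v \<iota> d f0"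
  then have X: "X \<in> carrier (H1_stab \<iota> f0)" "X \<notin> H1_int v \<iota> d f0" by auto
  have vD: "v D = 2 * 1" using d by (simp add: v_D)
  have "X \<in> H1_un v \<iota> f0"
  proof (rule class_torus_point[OF X(1)])
    fix g p q P Q assume pq: "p^2 + 3 * \<iota> D * q^2 = 1" "\<iota> P = 4 * p^3 - 3 * p" "\<iota> Q = q * (4 * p^2 - 1)"
      and n: "P^2 + 3 * D * Q^2 = 1" and r: "rep X g (tform D P Q)"
      and t: "tor (\<iota> D) p q \<in> SL2" "act_form (tor (\<iota> D) p q) (nform (\<iota> D)) = map_cubic_form \<iota> (tform D P Q)"
    show ?thesis
    proof (cases "val_ge v 0 P")
      case True
      show ?thesis
        by (rule un_if_fixed[OF X(1) r t]) (rule integral_point_unramified[OF pq(1,2) True vD t(2)])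
    next
      case False
      then obtain s where s: "s^2 = - 3 * D" "s \<noteq> 0" "2 * v s = v D" by (rule split_if_not_integral[OF n])
      define m where "m = v (P + Q * s)"
      have vs: "v s = 1" using s(3) vD by simp
      show ?thesis
      proof (cases "3 dvd m")
        case True
        then obtain l where "v (P + Q * s) = 3 * l" by (auto simp: m_def elim: dvdE)
        then show ?thesis
          by (intro un_if_fixed[OF X(1) r t]) (rule split_point_unramified[OF pq n s(1) _ t(2)])
      next
        case F: False
        have l: "m - 2 \<le> 3 * (m div 3)" "3 * (m div 3) \<le> m - 1" using F by presburger+
        obtain f where "sl_equiv (tform D P Q) f" "integral_form v f"
          by (rule split_integral[OF n s(1,2), of "m div 3"]) (use l in \<open>simp_all add: m_def vs\<close>)
        then show ?thesis using int_if_equiv[OF X(1) r] X(2) by blast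
      qed
    qed
  qed
  moreover have "X \<noteq> \<one>\<^bsub>H1_stab \<iota> f0\<^esub>" using X(2) one_int by auto
  ultimately show "X \<in> H1_un v \<iota> f0 - {\<one>\<^bsub>H1_stab \<iota> f0\<^esub>}" by blast
next
  fix X assume "X \<in> H1_un v \<iota> f0 - {\<one>\<^bsub>H1_stab \<iota> f0\<^esub>}"
  then have un: "X \<in> H1_un v \<iota> f0" and ne: "X \<noteq> \<one>\<^bsub>H1_stab \<iota> f0\<^esub>" by auto
  note X = H1_un_carrier[OF un]
  have "X \<notin> H1_int v \<iota> d f0"
  proof
    assume "X \<in> H1_int v \<iota> d f0"
    then obtain g f where f: "rep X g f" "integral_form v f" by (auto simp: H1_int_iff)
    obtain h where h: "h \<in> SL2" "act_form h (nform (\<iota> D)) = map_cubic_form \<iota> f"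
      "\<And>\<sigma>. \<sigma> \<in> inertia_group v \<iota> \<Longrightarrow> map_matrix \<sigma> h = h"
      using un unfolding H1_un_iff[OF X f(1)] by blast
    have "sl_equiv f (nform D)" by (rule reducible_if_integral_unramified[OF f(2) rep_disc[OF f(1)] d h])
    then show False using trivial_if_equiv[OF f(1)] ne by blast
  qed
  then show "X \<in> carrier (H1_stab \<iota> f0) - H1_int v \<iota> d f0" using X by blast
qed

text \<open>
  For \<open>v d = 2 k\<close> with \<open>k \<ge> 2\<close>, the intervals for the exponents in \<open>integral_torus_point\<close> and
  \<open>split_integral\<close> have length \<open>k\<close>, so they contain a multiple of \<open>3\<close>.
\<close>

theorem all_integral:
  assumes d: "v d > 2" and X: "X \<in> carrier (H1_stab \<iota> f0)" shows "X \<in> H1_int v \<iota> d f0"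
proof (cases "odd (v d)")
  case True
  then show ?thesis using trivial_if_odd[OF True X] one_int by simp
next
  case False
  then have "even (v d)" by simp
  then obtain k where k: "v d = 2 * k" by (rule evenE)
  have vD: "v D = 2 * k" and k2: "k \<ge> 2" using k d by (simp_all add: v_D)
  show ?thesis
  proof (rule class_torus_point[OF X])
    fix g p q P Q assume n: "P^2 + 3 * D * Q^2 = 1" and r: "rep X g (tform D P Q)"
    show ?thesis
    proof (cases "val_ge v 0 P")
      case True
      have l: "k \<le> 3 * ((k + 2) div 3)" "3 * ((k + 2) div 3) \<le> 2 * k" using k2 by presburger+
      obtain f where "sl_equiv (tform D P Q) f" "integral_form v f"
        by (rule integral_torus_point[OF n True vD l])
      then show ?thesis by (rule int_if_equiv[OF X r])
    next
      case False
      then obtain s where s: "s^2 = - 3 * D" "s \<noteq> 0" "2 * v s = v D" by (rule split_if_not_integral[OF n])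
      define m where "m = v (P + Q * s)"
      have vs: "v s = k" using s(3) vD by simp
      have l: "m - 2 * k \<le> 3 * ((m - k) div 3)" "3 * ((m - k) div 3) \<le> m - k" using k2 by presburger+
      obtain f where "sl_equiv (tform D P Q) f" "integral_form v f"
        by (rule split_integral[OF n s(1,2), of "(m - k) div 3"]) (use l in \<open>simp_all add: m_def vs\<close>)
      then show ?thesis by (rule int_if_equiv[OF X r])
    qed
  qed
qed

end

theorem theorem3p9:
  fixes v :: "'f::field \<Rightarrow> int" and \<iota> :: "'f \<Rightarrow> 's::field"
    and d :: 'f and f0 :: "'f cubic_form"
  assumes "local_field v" and "residue_char v > 3"
    and "separable_closure \<iota>"
    and "d \<in> carrier (valuation_ring v)" and "d \<noteq> 0"
    and "f0 \<in> forms_disc d" and "reducible_form f0"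
  shows "(v d = 0 \<longrightarrow> H1_int v \<iota> d f0 = H1_un v \<iota> f0)
    \<and> (odd (v d) \<longrightarrow> H1_int v \<iota> d f0 = carrier (H1_stab \<iota> f0)
        \<and> carrier (H1_stab \<iota> f0) = {\<one>\<^bsub>H1_stab \<iota> f0\<^esub>})
    \<and> (v d = 2 \<longrightarrow> carrier (H1_stab \<iota> f0) - H1_int v \<iota> d f0
        = H1_un v \<iota> f0 - {\<one>\<^bsub>H1_stab \<iota> f0\<^esub>})
    \<and> (v d > 2 \<longrightarrow> H1_int v \<iota> d f0 = carrier (H1_stab \<iota> f0))"
proof -
  interpret local_field_char_gt3 v
    using assms by (simp add: local_field_char_gt3_def local_field_char_gt3_axioms_def)
  interpret separable_closure \<iota> by fact
  interpret cubic_setup \<iota> d f0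
    by unfold_locales (use assms small_units in \<open>auto simp: forms_disc_def\<close>)
  interpret local_cubic v \<iota> d f0
    by unfold_locales (use assms in \<open>simp add: valuation_ring_def\<close>)
  have sub: "H1_int v \<iota> d f0 \<subseteq> carrier (H1_stab \<iota> f0)" using H1_int_carrier by blast
  show ?thesis
  proof (intro conjI impI)
    assume odd: "odd (v d)"
    show "carrier (H1_stab \<iota> f0) = {\<one>\<^bsub>H1_stab \<iota> f0\<^esub>}"
    proof (intro equalityI subsetI)
      fix X assume "X \<in> carrier (H1_stab \<iota> f0)"
      then show "X \<in> {\<one>\<^bsub>H1_stab \<iota> f0\<^esub>}" using trivial_if_odd[OF odd] by simp
    qed (use one_carrier in simp)
    show "H1_int v \<iota> d f0 = carrier (H1_stab \<iota> f0)"
    proof (rule equalityI[OF sub subsetI])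
      fix X assume "X \<in> carrier (H1_stab \<iota> f0)"
      then have "X = \<one>\<^bsub>H1_stab \<iota> f0\<^esub>" by (rule trivial_if_odd[OF odd])
      then show "X \<in> H1_int v \<iota> d f0" using one_int by (rule ssubst)
    qed
  next
    assume d2: "v d > 2"
    show "H1_int v \<iota> d f0 = carrier (H1_stab \<iota> f0)"
      by (rule equalityI[OF sub subsetI]) (rule all_integral[OF d2])
  next
    assume "v d = 0"
    then show "H1_int v \<iota> d f0 = H1_un v \<iota> f0" by (rule int_eq_un)
  next
    assume "v d = 2"
    then show "carrier (H1_stab \<iota> f0) - H1_int v \<iota> d f0 = H1_un v \<iota> f0 - {\<one>\<^bsub>H1_stab \<iota> f0\<^esub>}"
      by (rule nonintegral_eq)
  qed
qed

end
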